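(* Let $(k_n)_n$, $(l_n)_n$ be sequences of positive integers with $k_n\to\infty$ and $l_n\to\infty$. Let $\varphi:\mathrm{M}^{\mathrm{HS}}_\infty[(k_n)_n]\to\mathrm{M}^{\mathrm{HS}}_\infty[(l_n)_n]$ be a unital $*$-isomorphism of product form. Then $k_n/l_n\to1$ and there exist unitaries $w_n\in\mathrm{U}(l_n)$ such that for all $[a_n]_n\in\mathrm{M}^{\mathrm{HS}}_\infty[(k_n)_n]$, if $[b_n]_n=[a_n]_n\updownarrow\mathrm{M}^{\mathrm{HS}}_\infty[(l_n)_n]$, then $\varphi([a_n]_n)=[w_n^*b_nw_n]_n$.
   Context: For $k\ge 1$ and $x\in\mathrm{M}_k(\mathbb C)$, $\|x\|_{2,k}=(\frac1k\mathrm{tr}(x^*x))^{1/2}$. For a sequence $(k_n)_n$ of positive integers with $k_n\to\infty$, $\mathrm{M}^{\mathrm{HS}}_\infty[(k_n)_n]$ is the unital $*$-algebra of operator-norm bounded sequences $(a_n)_n\in\prod_n\mathrm{M}_{k_n}(\mathbb C)$ with coordinatewise operations, modulo the ideal of sequences with $\|a_n\|_{2,k_n}\to0$; $[a_n]_n$ denotes the class of $(a_n)_n$. A map $\varphi:\mathrm{M}^{\mathrm{HS}}_\infty[(k_n)_n]\to\mathrm{M}^{\mathrm{HS}}_\infty[(l_n)_n]$ is of product form if there are maps (of sets) $h_n:\mathrm{M}_{k_n}(\mathbb C)\to\mathrm{M}_{l_n}(\mathbb C)$ such that $\varphi([a_n]_n)=[h_n(a_n)]_n$ for every operator-norm bounded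 sequence $(a_n)_n$ with $a_n\in\mathrm{M}_{k_n}(\mathbb C)$. If $k_n/l_n\to1$ and $[a_n]_n\in\mathrm{M}^{\mathrm{HS}}_\infty[(k_n)_n]$, then $[a_n]_n\updownarrow\mathrm{M}^{\mathrm{HS}}_\infty[(l_n)_n]$ denotes the unique $[b_n]_n\in\mathrm{M}^{\mathrm{HS}}_\infty[(l_n)_n]$ with $\lim_n\|a_n\oplus0_{k_n\vee l_n-k_n}-b_n\oplus0_{k_n\vee l_n-l_n}\|_{2,k_n\vee l_n}=0$, where $k\vee l=\max(k,l)$. *)

theory Defs
  imports
    "HOL-Algebra.QuotRing"
    "HOL-Algebra.Module"
    "Jordan_Normal_Form.Schur_Decomposition"
begin

hide_const (open) Multiset.mult Polynomial.smult

section \<open>Norms on complex matrices\<close>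

definition mat_trace :: "complex mat \<Rightarrow> complex" where
  "mat_trace A = (\<Sum>i<dim_row A. A $$ (i, i))"

definition hs_norm :: "nat \<Rightarrow> complex mat \<Rightarrow> real" where
  "hs_norm k A = sqrt (Re (mat_trace (mat_adjoint A * A)) / real k)"

definition cvec_norm :: "complex vec \<Rightarrow> real" where
  "cvec_norm v = sqrt (Re (v \<bullet>c v))"

definition op_norm :: "complex mat \<Rightarrow> real" where
  "op_norm A = (SUP v \<in> {v \<in> carrier_vec (dim_col A). cvec_norm v \<le> 1}. cvec_norm (A *\<^sub>v v))"

definition unitary_mats :: "nat \<Rightarrow> complex mat set" where
  "unitary_mats n = {w \<in> carrier_mat n n.
     mat_adjoint w * w = 1\<^sub>m n \<and> w * mat_adjoint w = 1\<^sub>m n}"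


section \<open>Star-algebras and their quotients\<close>

record ('a, 'b) star_algebra = "('a, 'b) module" +
  star :: "'b \<Rightarrow> 'b"

text \<open>
  Scalar multiplication and star of a coset are given as a union over all representatives, in the
  style of \<^const>\<open>rcoset_mult\<close>. If \<open>I\<close> is a two-sided ideal closed under scalars and star, all the
  cosets in such a union coincide.
\<close>

definition quot_star_algebra ::
    "('a, 'b) star_algebra \<Rightarrow> 'b set \<Rightarrow> ('a, 'b set) star_algebra" where
  "quot_star_algebra A I =
     \<lparr>carrier = carrier (A Quot I),
      mult = mult (A Quot I),
      one = one (A Quot I),
      zero = zero (A Quot I),
      add = add (A Quot I),
      smult = (\<lambda>c X. \<Union>x\<in>X. I +>\<^bsub>A\<^esub> (c \<odot>\<^bsub>A\<^esub> x)),
      star = (\<lambda>X. \<Union>x\<in>X. I +>\<^bsub>A\<^esub> star A x)\<rparr>"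

text \<open>Preservation of the unit is part of \<^const>\<open>ring_hom\<close>, hence of \<^const>\<open>ring_iso\<close>.\<close>

definition unital_star_iso ::
    "(complex, 'b) star_algebra \<Rightarrow> (complex, 'c) star_algebra \<Rightarrow> ('b \<Rightarrow> 'c) set" where
  "unital_star_iso A B = {\<phi> \<in> ring_iso A B.
     (\<forall>c. \<forall>x\<in>carrier A. \<phi> (c \<odot>\<^bsub>A\<^esub> x) = c \<odot>\<^bsub>B\<^esub> \<phi> x) \<and>
     (\<forall>x\<in>carrier A. \<phi> (star A x) = star B (\<phi> x))}"


section \<open>Bounded matrix sequences modulo Hilbert--Schmidt null sequences\<close>

definition bdd_seqs :: "(nat \<Rightarrow> nat) \<Rightarrow> (nat \<Rightarrow> complex mat) set" where
  "bdd_seqs k = {a. (\<forall>n. a n \<in> carrier_mat (k n) (k n)) \<and> (\<exists>C. \<forall>n. op_norm (a n) \<le> C)}"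

definition bdd_seq_algebra :: "(nat \<Rightarrow> nat) \<Rightarrow> (complex, nat \<Rightarrow> complex mat) star_algebra" where
  "bdd_seq_algebra k =
     \<lparr>carrier = bdd_seqs k,
      mult = (\<lambda>a b n. a n * b n),
      one = (\<lambda>n. 1\<^sub>m (k n)),
      zero = (\<lambda>n. 0\<^sub>m (k n) (k n)),
      add = (\<lambda>a b n. a n + b n),
      smult = (\<lambda>c a n. c \<cdot>\<^sub>m a n),
      star = (\<lambda>a n. mat_adjoint (a n))\<rparr>"

definition hs_null :: "(nat \<Rightarrow> nat) \<Rightarrow> (nat \<Rightarrow> complex mat) set" where
  "hs_null k = {a \<in> bdd_seqs k. (\<lambda>n. hs_norm (k n) (a n)) \<longlonglongrightarrow> 0}"

definition M_HS :: "(nat \<Rightarrow> nat) \<Rightarrow> (complex, (nat \<Rightarrow> complex mat) set) star_algebra" where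
  "M_HS k = quot_star_algebra (bdd_seq_algebra k) (hs_null k)"

definition hs_class :: "(nat \<Rightarrow> nat) \<Rightarrow> (nat \<Rightarrow> complex mat) \<Rightarrow> (nat \<Rightarrow> complex mat) set" where
  "hs_class k a = hs_null k +>\<^bsub>bdd_seq_algebra k\<^esub> a"

text \<open>
  The requirement that \<open>(h\<^sub>n(a\<^sub>n))\<^sub>n\<close> be bounded is what makes its class an element of the target.
\<close>

definition product_form ::
    "(nat \<Rightarrow> nat) \<Rightarrow> (nat \<Rightarrow> nat) \<Rightarrow> ((nat \<Rightarrow> complex mat) set \<Rightarrow> (nat \<Rightarrow> complex mat) set) \<Rightarrow> bool"
  where
  "product_form k l \<phi> \<longleftrightarrow>
     (\<exists>h :: nat \<Rightarrow> complex mat \<Rightarrow> complex mat.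
        (\<forall>n. h n \<in> carrier_mat (k n) (k n) \<rightarrow> carrier_mat (l n) (l n)) \<and>
        (\<forall>a\<in>bdd_seqs k. (\<lambda>n. h n (a n)) \<in> bdd_seqs l \<and>
           \<phi> (hs_class k a) = hs_class l (\<lambda>n. h n (a n))))"

definition pad_zero :: "complex mat \<Rightarrow> nat \<Rightarrow> complex mat" where
  "pad_zero A m = four_block_mat A (0\<^sub>m (dim_row A) m) (0\<^sub>m m (dim_col A)) (0\<^sub>m m m)"

text \<open>
  Meaningful when \<open>k\<^sub>n / l\<^sub>n \<longlonglongrightarrow> 1\<close>: then the class described exists, is unique and does not
  depend on the chosen representatives.
\<close>

definition updown ::
    "(nat \<Rightarrow> nat) \<Rightarrow> (nat \<Rightarrow> nat) \<Rightarrow> (nat \<Rightarrow> complex mat) set \<Rightarrow> (nat \<Rightarrow> complex mat) set" where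
  "updown k l X = (THE Y. \<exists>a\<in>bdd_seqs k. \<exists>b\<in>bdd_seqs l. X = hs_class k a \<and> Y = hs_class l b \<and>
     (\<lambda>n. hs_norm (max (k n) (l n))
        (pad_zero (a n) (max (k n) (l n) - k n) - pad_zero (b n) (max (k n) (l n) - l n)))
     \<longlonglongrightarrow> 0)"

end

(*
  A unital *-isomorphism of product form is given by maps h_n for which all algebraic identities
  hold up to errors tending to 0 uniformly on operator-norm balls (pick the worst matrices for each
  n). The h_n asymptotically preserve the normalized trace: averaging a traceless matrix with a
  suitable unitary conjugate shrinks its Hilbert-Schmidt norm without changing the trace of its image
  much. Hence the h_n are nearly isometric for the normalized Hilbert-Schmidt norms.

  They are only defined on bounded matrices and only nearly linear there. Evaluating h_n on truncated
  random matrices with independent signs, which become Gaussian in the limit, and keeping the degree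
  one part of the Hermite expansion produces an exactly linear map L with L(u x) close to h_n(u) L(x)
  on average over the matrix units x. Averaging once more, some X with entries read off from L
  satisfies X u = h_n(u) X approximately, for a given unitary u and for most elements of a finite group
  of unitaries acting irreducibly. Irreducibility forces X* X to be nearly scalar, so that X is nearly
  isometric and k_n <= (1 + o(1)) l_n; it also forces the X for different u to agree up to a phase, so
  that one unitary w_n serves for all u. Every contraction is the mean of two unitaries, which extends
  the result from unitaries to all bounded matrices. The inverse isomorphism lifts to maps with
  the same properties and yields the opposite inequality between k_n and l_n.
*)
theory Submission
  imports Defs "HOL-Analysis.Weierstrass_Theorems" "Jordan_Normal_Form.Spectral_Radius" "HOL-Real_Asymp.Real_Asymp"
begin

section \<open>Finitely supported infinite matrices\<close>

text \<open>Product form allows worst cases to be picked for each n, but says nothing linear about a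
  single h_n: its errors are small only in normalized Hilbert-Schmidt norm. On a matrix unit, of
  normalized norm k^(-1/2), such an error hides everything. A random matrix with all entries active
  has normalized norm about 1, so matrix units become visible on average. Degree one is forced by
  inner products: at inputs of correlation \<rho> the values of h_n have correlation about \<rho>,
  whereas a degree d part contributes \<rho>^d times its squared norm. One linear map must serve the
  samples x and u x for all unitaries u; sign vectors are not invariant under u, their Gaussian
  limit is. Trigonometric polynomials have explicit averages over signs with explicit limits, so no
  Gaussian measure occurs. Since X is controlled in Hilbert-Schmidt norm only, the quadratic
  expression X* X is compared with 1 in trace norm. As k and l may differ, unitaries are compared in
  size max(k, l), filled up by an identity block.\<close>

text \<open>
  Matrices of all sizes live in one type, so that padding by zeros is the identity and truncation
  is multiplication by the diagonal projections \<open>unitm k\<close>; the inner product is the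
  (unnormalized) Frobenius one.
\<close>

typedef fmat = "{f :: nat \<Rightarrow> nat \<Rightarrow> complex. \<exists>n. \<forall>i j. n \<le> i \<or> n \<le> j \<longrightarrow> f i j = 0}"
  morphisms ent Fmat
  by (rule exI[of _ "\<lambda>_ _. 0"]) auto

definition rect :: "nat \<Rightarrow> nat \<Rightarrow> fmat set" where
  "rect r c = {A. \<forall>i j. r \<le> i \<or> c \<le> j \<longrightarrow> ent A i j = 0}"

definition mk :: "nat \<Rightarrow> nat \<Rightarrow> (nat \<Rightarrow> nat \<Rightarrow> complex) \<Rightarrow> fmat" where
  "mk r c f = Fmat (\<lambda>i j. if i < r \<and> j < c then f i j else 0)"

lemma fmat_eqI: "(\<And>i j. ent A i j = ent B i j) \<Longrightarrow> A = B"
  by (metis ent_inject ext)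

lemma ent_mk [simp]: "ent (mk r c f) i j = (if i < r \<and> j < c then f i j else 0)"
  unfolding mk_def
  by (subst Fmat_inverse) (auto intro!: exI[of _ "max r c"])

lemma mk_rect [simp]: "mk r c f \<in> rect r c"
  by (auto simp: rect_def)

lemma rectD: "A \<in> rect r c \<Longrightarrow> r \<le> i \<or> c \<le> j \<Longrightarrow> ent A i j = 0"
  by (auto simp: rect_def)

lemma rect_mono: "A \<in> rect r c \<Longrightarrow> r \<le> r' \<Longrightarrow> c \<le> c' \<Longrightarrow> A \<in> rect r' c'"
  by (auto simp: rect_def)

lemma rect_ex: "\<exists>n. A \<in> rect n n"
  using ent[of A] by (auto simp: rect_def)

lemma rect_eqI:
  assumes "A \<in> rect r c" "B \<in> rect r c" "\<And>i j. i < r \<Longrightarrow> j < c \<Longrightarrow> ent A i j = ent B i j"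
  shows "A = B"
  using assms by (intro fmat_eqI) (metis not_less rectD)

lemma rect_ex2: "\<exists>n. A \<in> rect n n \<and> B \<in> rect n n"
proof -
  obtain a b where "A \<in> rect a a" "B \<in> rect b b" using rect_ex by blast
  then show ?thesis by (intro exI[of _ "max a b"]) (auto elim: rect_mono)
qed

lemma rect_ex3: "\<exists>n. A \<in> rect n n \<and> B \<in> rect n n \<and> C \<in> rect n n"
proof -
  obtain a c where "A \<in> rect a a" "B \<in> rect a a" "C \<in> rect c c" using rect_ex2 rect_ex by blast
  then show ?thesis by (intro exI[of _ "max a c"]) (auto elim: rect_mono)
qed

text \<open>An arbitrarily chosen bound on both indices, by which the operations below become finite
  sums. Results do not depend on the choice, since a larger range only adds zeros
  (\<open>sum_support\<close>, \<open>sum2_support\<close>).\<close>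

definition supp :: "fmat \<Rightarrow> nat" where "supp A = (SOME n. A \<in> rect n n)"

lemma supp: "A \<in> rect (supp A) (supp A)"
  unfolding supp_def by (rule someI_ex[OF rect_ex])

definition cs :: "complex \<Rightarrow> fmat \<Rightarrow> fmat" where
  "cs c A = mk (supp A) (supp A) (\<lambda>i j. c * ent A i j)"

definition adj :: "fmat \<Rightarrow> fmat" where
  "adj A = mk (supp A) (supp A) (\<lambda>i j. cnj (ent A j i))"

text \<open>The complex Frobenius form, antilinear in the first argument. Its real part is the
  \<open>inner\<close> of the type class, so that the real Hilbert space lemmas apply, while
  \<open>cip\<close> itself retains traces and phases.\<close>

definition cip :: "fmat \<Rightarrow> fmat \<Rightarrow> complex" where
  "cip A B = (\<Sum>i<supp A. \<Sum>j<supp A. cnj (ent A i j) * ent B i j)"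

lemma sum2_support:
  fixes f :: "nat \<Rightarrow> nat \<Rightarrow> 'a::comm_monoid_add"
  assumes "\<And>i j. r \<le> i \<or> c \<le> j \<Longrightarrow> f i j = 0" "\<And>i j. r' \<le> i \<or> c' \<le> j \<Longrightarrow> f i j = 0"
  shows "(\<Sum>i<r. \<Sum>j<c. f i j) = (\<Sum>i<r'. \<Sum>j<c'. f i j)"
proof -
  have *: "(\<Sum>i<r. \<Sum>j<c. f i j) = (\<Sum>p\<in>{..<max r r'}\<times>{..<max c c'}. f (fst p) (snd p))"
    if that: "\<forall>i j. r \<le> i \<or> c \<le> j \<longrightarrow> f i j = 0" for r c r' c'
  proof -
    have "(\<Sum>i<r. \<Sum>j<c. f i j) = (\<Sum>p\<in>{..<r}\<times>{..<c}. f (fst p) (snd p))"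
      by (simp add: sum.cartesian_product case_prod_beta)
    also have "\<dots> = (\<Sum>p\<in>{..<max r r'}\<times>{..<max c c'}. f (fst p) (snd p))"
      by (rule sum.mono_neutral_left) (use that in \<open>auto, (metis not_less)+\<close>)
    finally show ?thesis .
  qed
  show ?thesis using *[of r c r' c'] *[of r' c' r c] assms by (simp add: max.commute)
qed

lemma sum_support:
  fixes f :: "nat \<Rightarrow> 'a::comm_monoid_add"
  assumes "\<forall>i\<ge>a. f i = 0" "\<forall>i\<ge>b. f i = 0"
  shows "(\<Sum>i<a. f i) = (\<Sum>i<b. f i)"
proof -
  have "(\<Sum>i<c. f i) = (\<Sum>i<max a b. f i)" if "\<forall>i\<ge>c. f i = 0" "c \<le> max a b" for c
    by (rule sum.mono_neutral_left) (use that in auto)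
  then show ?thesis using assms by (metis max.cobounded1 max.cobounded2)
qed

lemma cip_rect:
  assumes "A \<in> rect r c \<or> B \<in> rect r c"
  shows "cip A B = (\<Sum>i<r. \<Sum>j<c. cnj (ent A i j) * ent B i j)"
proof -
  have "(\<Sum>i<supp A. \<Sum>j<supp A. cnj (ent A i j) * ent B i j)
     = (\<Sum>i<r. \<Sum>j<c. cnj (ent A i j) * ent B i j)"
    by (rule sum2_support) (use assms in \<open>auto simp: rectD[OF supp] rectD\<close>)
  then show ?thesis by (simp add: cip_def)
qed

instantiation fmat :: real_inner
begin

definition "0 = mk 0 0 (\<lambda>_ _. 0)"
definition "A + B = mk (max (supp A) (supp B)) (max (supp A) (supp B)) (\<lambda>i j. ent A i j + ent B i j)"
definition "A - B = mk (max (supp A) (supp B)) (max (supp A) (supp B)) (\<lambda>i j. ent A i j - ent B i j)"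
definition "- A = mk (supp A) (supp A) (\<lambda>i j. - ent A i j)"
definition "scaleR r A = mk (supp A) (supp A) (\<lambda>i j. r *\<^sub>R ent A i j)"
definition "inner A B = Re (cip A B)"
definition "norm (A :: fmat) = sqrt (inner A A)"
definition "dist (A :: fmat) B = norm (A - B)"
definition "sgn (A :: fmat) = scaleR (inverse (norm A)) A"
definition [code del]:
  "(uniformity :: (fmat \<times> fmat) filter) = (INF e\<in>{0 <..}. principal {(x, y). dist x y < e})"
definition [code del]:
  "open (U :: fmat set) \<longleftrightarrow> (\<forall>x\<in>U. \<forall>\<^sub>F (x', y) in uniformity. x' = x \<longrightarrow> y \<in> U)"

lemma ent_zero [simp]: "ent 0 i j = 0" by (simp add: zero_fmat_def)
lemma ent_add [simp]: "ent (A + B) i j = ent A i j + ent B i j"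
  by (auto simp: plus_fmat_def rectD[OF supp] not_less)
lemma ent_diff [simp]: "ent (A - B) i j = ent A i j - ent B i j"
  by (auto simp: minus_fmat_def rectD[OF supp] not_less)
lemma ent_minus [simp]: "ent (- A) i j = - ent A i j"
  by (auto simp: uminus_fmat_def rectD[OF supp] not_less)
lemma ent_scaleR [simp]: "ent (r *\<^sub>R A) i j = r *\<^sub>R ent A i j"
  by (auto simp: scaleR_fmat_def rectD[OF supp] not_less)

lemma cip_add_right: "cip A (B + C) = cip A B + cip A C"
  by (simp add: cip_def ring_distribs sum.distrib)

lemma cip_sym: "cip A B = cnj (cip B A)"
proof -
  obtain n where n: "A \<in> rect n n" "B \<in> rect n n" using rect_ex2 by blast
  show ?thesis by (simp add: cip_rect[of _ n n] n mult.commute)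
qed

lemma cip_self: "A \<in> rect r c \<Longrightarrow> cip A A = of_real (\<Sum>i<r. \<Sum>j<c. (cmod (ent A i j))\<^sup>2)"
  by (simp add: cip_rect[of _ r c] complex_norm_square mult.commute del: of_real_power)

lemma inner_self_rect: "A \<in> rect r c \<Longrightarrow> inner A A = (\<Sum>i<r. \<Sum>j<c. (cmod (ent A i j))\<^sup>2)"
  by (simp add: inner_fmat_def cip_self)

instance
proof
  fix A B C :: fmat and r s :: real
  show "A + B + C = A + (B + C)" "A + B = B + A" "0 + A = A" "- A + A = 0" "A - B = A + - B"
    "r *\<^sub>R (A + B) = r *\<^sub>R A + r *\<^sub>R B" "(r + s) *\<^sub>R A = r *\<^sub>R A + s *\<^sub>R A"
    "r *\<^sub>R s *\<^sub>R A = (r * s) *\<^sub>R A" "1 *\<^sub>R A = A"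
    by (auto intro!: fmat_eqI simp: algebra_simps)
  show "dist A B = norm (A - B)" by (simp add: dist_fmat_def)
  show "sgn A = scaleR (inverse (norm A)) A" by (simp add: sgn_fmat_def)
  show "(uniformity :: (fmat \<times> fmat) filter) = (INF e\<in>{0 <..}. principal {(x, y). dist x y < e})"
    by (rule uniformity_fmat_def)
  show "open U \<longleftrightarrow> (\<forall>x\<in>U. \<forall>\<^sub>F (x', y) in uniformity. x' = x \<longrightarrow> y \<in> U)" for U :: "fmat set"
    by (rule open_fmat_def)
  show "inner A B = inner B A"
    unfolding inner_fmat_def by (metis cip_sym complex_cnj_cnj cnj.sel(1))
  have "inner C (A + B) = inner C A + inner C B" for A B C :: fmat
    by (simp add: inner_fmat_def cip_add_right)
  then show "inner (A + B) C = inner A C + inner B C"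
    by (metis (no_types, lifting) cip_sym cnj.sel(1) inner_fmat_def)
  have "ent (r *\<^sub>R A) = (\<lambda>i j. r *\<^sub>R ent A i j)" by (intro ext) simp
  moreover have "r *\<^sub>R A \<in> rect (supp A) (supp A)"
    using supp[of A] by (auto simp: rect_def)
  ultimately show "inner (r *\<^sub>R A) B = r * inner A B"
    by (simp add: inner_fmat_def cip_rect[of _ "supp A" "supp A"] supp sum_distrib_left algebra_simps sum.distrib)
  show "0 \<le> inner A A" by (subst inner_self_rect[OF supp]) (intro sum_nonneg, simp)
  show "inner A A = 0 \<longleftrightarrow> A = 0"
  proof
    assume "inner A A = 0"
    then have "\<forall>i<supp A. \<forall>j<supp A. ent A i j = 0"
      by (subst (asm) inner_self_rect[OF supp]) (auto simp: sum_nonneg_eq_0_iff sum_nonneg)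
    then show "A = 0" by (intro rect_eqI[OF supp]) (auto simp: rect_def)
  qed (simp add: inner_fmat_def cip_def)
  show "norm A = sqrt (inner A A)" by (rule norm_fmat_def)
qed

end

lemma ent_sum: "ent (\<Sum>x\<in>S. f x) i j = (\<Sum>x\<in>S. ent (f x) i j)"
  by (induction S rule: infinite_finite_induct) auto

lemma ent_cs [simp]: "ent (cs c A) i j = c * ent A i j"
  by (auto simp: cs_def rectD[OF supp] not_less)
lemma ent_adj [simp]: "ent (adj A) i j = cnj (ent A j i)"
  by (auto simp: adj_def rectD[OF supp] not_less)

text \<open>A ring without unit, as the identity of infinite size is not finitely supported. The
  projections \<open>unitm k\<close> act as local units.\<close>

instantiation fmat :: ring
begin

definition "A * B = mk (supp A) (supp B) (\<lambda>i j. \<Sum>p<supp A. ent A i p * ent B p j)"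

lemma ent_mult:
  assumes "A \<in> rect r c \<or> B \<in> rect c d"
  shows "ent (A * B) i j = (\<Sum>p<c. ent A i p * ent B p j)"
proof -
  have "(\<Sum>p<supp A. ent A i p * ent B p j) = (\<Sum>p<c. ent A i p * ent B p j)"
    by (rule sum_support) (use assms in \<open>auto simp: rectD[OF supp] rectD\<close>)
  moreover have "ent (A * B) i j = (\<Sum>p<supp A. ent A i p * ent B p j)"
    by (auto simp: times_fmat_def rectD[OF supp] not_less)
  ultimately show ?thesis by simp
qed

instance
proof
  fix A B C :: fmat
  obtain n where n: "A \<in> rect n n" "B \<in> rect n n" "C \<in> rect n n" using rect_ex3 by blast
  have AB: "A * B \<in> rect n n" using n
    by (auto simp: rect_def ent_mult[of A n n B n])
  show "A * B * C = A * (B * C)"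
  proof (rule fmat_eqI)
    fix i j
    show "ent (A * B * C) i j = ent (A * (B * C)) i j"
      by (simp add: ent_mult[of _ n n _ n] n AB sum_distrib_left sum_distrib_right mult.assoc)
        (rule sum.swap)
  qed
  obtain m where m: "A \<in> rect m m" "B \<in> rect m m" "A + B \<in> rect m m"
    using rect_ex3 by blast
  show "(A + B) * C = A * C + B * C"
    by (intro fmat_eqI) (simp add: ent_mult[of _ m m _ m] m algebra_simps sum.distrib)
  show "A * (B + C) = A * B + A * C"
    by (intro fmat_eqI) (simp add: ent_mult[of _ n n _ n] n algebra_simps sum.distrib)
qed

end

abbreviation sq :: "nat \<Rightarrow> fmat set" where "sq k \<equiv> rect k k"

lemma rect_mult [simp, intro]: "A \<in> rect r c \<Longrightarrow> B \<in> rect d e \<Longrightarrow> A * B \<in> rect r e"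
  by (auto simp: rect_def times_fmat_def intro!: sum.neutral)
lemma rect_mult_left [simp]: "A \<in> sq r \<Longrightarrow> B \<in> rect r c \<Longrightarrow> A * B \<in> rect r c"
  by (rule rect_mult)
lemma rect_mult_right [simp]: "A \<in> rect r c \<Longrightarrow> B \<in> sq c \<Longrightarrow> A * B \<in> rect r c"
  by (rule rect_mult)
lemma rect_add [simp, intro]: "A \<in> rect r c \<Longrightarrow> B \<in> rect r c \<Longrightarrow> A + B \<in> rect r c"
  by (auto simp: rect_def)
lemma rect_diff [simp, intro]: "A \<in> rect r c \<Longrightarrow> B \<in> rect r c \<Longrightarrow> A - B \<in> rect r c"
  by (auto simp: rect_def)
lemma rect_minus [simp, intro]: "A \<in> rect r c \<Longrightarrow> - A \<in> rect r c"
  by (auto simp: rect_def)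
lemma rect_zero [simp, intro]: "0 \<in> rect r c"
  by (auto simp: rect_def)
lemma rect_scaleR [simp, intro]: "A \<in> rect r c \<Longrightarrow> x *\<^sub>R A \<in> rect r c"
  by (auto simp: rect_def)
lemma rect_cs [simp, intro]: "A \<in> rect r c \<Longrightarrow> cs x A \<in> rect r c"
  by (auto simp: rect_def)
lemma rect_adj [simp, intro]: "A \<in> rect r c \<Longrightarrow> adj A \<in> rect c r"
  by (auto simp: rect_def)
lemma rect_sum [simp, intro]: "(\<And>x. x \<in> S \<Longrightarrow> f x \<in> rect r c) \<Longrightarrow> (\<Sum>x\<in>S. f x) \<in> rect r c"
  by (auto simp: rect_def ent_sum)

lemma scaleR_eq_cs: "r *\<^sub>R A = cs (of_real r) A"
  by (intro fmat_eqI) (simp add: scaleR_conv_of_real)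

instance fmat :: real_algebra
proof
  fix A B :: fmat and r :: real
  show "r *\<^sub>R A * B = r *\<^sub>R (A * B)"
    by (intro fmat_eqI) (simp add: ent_mult[OF disjI1, of _ "supp A" "supp A"] supp scaleR_right.sum)
  show "A * r *\<^sub>R B = r *\<^sub>R (A * B)"
    by (intro fmat_eqI) (simp add: ent_mult[OF disjI1, OF supp] scaleR_right.sum)
qed

lemma cs_simps [simp]: "cs 0 A = 0" "cs 1 A = A" "cs c 0 = 0" "cs c (cs d A) = cs (c * d) A"
  by (auto intro!: fmat_eqI)
lemma cs_minus: "cs (- c) A = - cs c A" "cs c (- A) = - cs c A"
  by (auto intro!: fmat_eqI)
lemma cs_add: "cs (c + d) A = cs c A + cs d A" "cs c (A + B) = cs c A + cs c B"
  by (auto intro!: fmat_eqI simp: algebra_simps)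
lemma cs_diff: "cs (c - d) A = cs c A - cs d A" "cs c (A - B) = cs c A - cs c B"
  by (auto intro!: fmat_eqI simp: algebra_simps)
lemma cs_mult [simp]: "cs c A * B = cs c (A * B)" "A * cs c B = cs c (A * B)"
  by (auto intro!: fmat_eqI simp: ent_mult[OF disjI1, of _ "supp A" "supp A"] supp sum_distrib_left algebra_simps)
lemma cs_scaleR: "cs c (r *\<^sub>R A) = r *\<^sub>R cs c A"
  by (intro fmat_eqI) simp

lemma adj_adj [simp]: "adj (adj A) = A" by (intro fmat_eqI) simp
lemma adj_zero [simp]: "adj 0 = 0" by (intro fmat_eqI) simp
lemma adj_add: "adj (A + B) = adj A + adj B" by (intro fmat_eqI) simp
lemma adj_diff: "adj (A - B) = adj A - adj B" by (intro fmat_eqI) simp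
lemma adj_cs: "adj (cs c A) = cs (cnj c) (adj A)" by (intro fmat_eqI) simp
lemma adj_scaleR: "adj (r *\<^sub>R A) = r *\<^sub>R adj A" by (intro fmat_eqI) simp
lemma adj_mult: "adj (A * B) = adj B * adj A"
proof -
  obtain n where n: "A \<in> sq n" "B \<in> sq n" using rect_ex2 by blast
  then have "adj A \<in> sq n" "adj B \<in> sq n" by auto
  then show ?thesis
    using n by (intro fmat_eqI) (simp add: ent_mult[of _ n n _ n] mult.commute)
qed

lemma cip_diff_right: "cip A (B - C) = cip A B - cip A C"
  by (simp add: cip_def ring_distribs sum_subtractf)
lemma cip_cs_right: "cip A (cs c B) = c * cip A B"
  by (simp add: cip_def sum_distrib_left algebra_simps)
lemma cip_cs_left: "cip (cs c A) B = cnj c * cip A B"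
  by (subst (1 2) cip_sym) (simp add: cip_cs_right)
lemma cip_diff_left: "cip (A - B) C = cip A C - cip B C"
  by (metis cip_diff_right cip_sym complex_cnj_diff)
lemma cip_zero [simp]: "cip A 0 = 0" "cip 0 A = 0"
  by (simp_all add: cip_rect[of _ 0 0])
lemma cip_norm: "cip A A = of_real ((norm A)\<^sup>2)"
  using cip_self[OF supp, of A] inner_self_rect[OF supp, of A] by (simp add: power2_norm_eq_inner)

lemma sum3_reverse:
  fixes g :: "nat \<Rightarrow> nat \<Rightarrow> nat \<Rightarrow> 'a::comm_monoid_add"
  shows "(\<Sum>i<n. \<Sum>j<n. \<Sum>p<n. g i j p) = (\<Sum>p<n. \<Sum>j<n. \<Sum>i<n. g i j p)"
proof -
  have "(\<Sum>i<n. \<Sum>j<n. \<Sum>p<n. g i j p) = (\<Sum>j<n. \<Sum>i<n. \<Sum>p<n. g i j p)" by (rule sum.swap)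
  also have "\<dots> = (\<Sum>j<n. \<Sum>p<n. \<Sum>i<n. g i j p)" by (intro sum.cong sum.swap refl)
  also have "\<dots> = (\<Sum>p<n. \<Sum>j<n. \<Sum>i<n. g i j p)" by (rule sum.swap)
  finally show ?thesis .
qed

lemma cip_mult_left: "cip (A * B) C = cip B (adj A * C)"
proof -
  obtain n where n: "A \<in> sq n" "B \<in> sq n" "C \<in> sq n" using rect_ex3 by blast
  then have n': "adj A \<in> sq n" "A * B \<in> sq n" by auto
  show ?thesis
    by (simp add: cip_rect[of _ n n] ent_mult[of _ n n _ n] n n' sum_distrib_left sum_distrib_right)
      (subst sum3_reverse, simp add: ac_simps)
qed

lemma cip_adj: "cip (adj A) (adj B) = cip B A"
proof -
  obtain n where n: "A \<in> sq n" "B \<in> sq n" using rect_ex2 by blast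
  then have n': "adj A \<in> sq n" "adj B \<in> sq n" by auto
  show ?thesis
    apply (simp add: cip_rect[of _ n n] n n')
    apply (subst sum.swap)
    apply (auto intro!: sum.cong simp: algebra_simps)
    done
qed

lemma cip_mult_right: "cip (A * B) C = cip A (C * adj B)"
  by (metis adj_adj adj_mult cip_adj cip_mult_left cip_sym)

lemma inner_mult_left: "inner (A * B) C = inner B (adj A * C)"
  by (simp add: inner_fmat_def cip_mult_left)
lemma inner_mult_right: "inner (A * B) C = inner A (C * adj B)"
  by (simp add: inner_fmat_def cip_mult_right)
lemma inner_adj: "inner (adj A) (adj B) = inner B A"
  by (simp add: inner_fmat_def cip_adj)
lemma norm_adj [simp]: "norm (adj A) = norm A"
  by (simp add: norm_eq_sqrt_inner inner_adj)
lemma inner_cs_cs: "inner (cs c A) (cs c B) = (cmod c)\<^sup>2 * inner A B"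
  by (simp add: inner_fmat_def cip_cs_left cip_cs_right cmod_power2)
    (simp add: power2_eq_square algebra_simps)
lemma norm_cs [simp]: "norm (cs c A) = cmod c * norm A"
  by (simp add: norm_eq_sqrt_inner inner_cs_cs real_sqrt_mult)

text \<open>Multiplying \<open>B\<close> by the conjugate phase of \<open>cip A B\<close> makes the
  form real and reduces the claim to the real Cauchy-Schwarz inequality.\<close>

lemma cmod_cip_le: "cmod (cip A B) \<le> norm A * norm B"
proof -
  define c where "c = cnj (sgn (cip A B))"
  have "cnj z * z = of_real (cmod z) * of_real (cmod z)" for z
    by (metis complex_norm_square mult.commute of_real_mult power2_eq_square)
  then have "cmod (cip A B) = Re (c * cip A B)"
    by (simp add: c_def sgn_eq)
  also have "\<dots> = inner A (cs c B)" by (simp add: inner_fmat_def cip_cs_right)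
  also have "\<dots> \<le> norm A * norm (cs c B)" by (rule norm_cauchy_schwarz)
  also have "\<dots> \<le> norm A * norm B"
    by (auto simp: c_def norm_sgn intro!: mult_left_mono mult_left_le_one_le)
  finally show ?thesis .
qed

lemma norm_sq_rect: "A \<in> rect r c \<Longrightarrow> (norm A)\<^sup>2 = (\<Sum>i<r. \<Sum>j<c. (cmod (ent A i j))\<^sup>2)"
  by (simp add: power2_norm_eq_inner inner_self_rect)

section \<open>Local units and matrix units\<close>

definition unitm :: "nat \<Rightarrow> fmat" where "unitm k = mk k k (\<lambda>i j. if i = j then 1 else 0)"

definition eu :: "nat \<Rightarrow> nat \<Rightarrow> fmat" where
  "eu i j = mk (Suc i) (Suc j) (\<lambda>p q. if p = i \<and> q = j then 1 else 0)"

lemma ent_unitm [simp]: "ent (unitm k) i j = (if i = j \<and> i < k then 1 else 0)"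
  by (auto simp: unitm_def)
lemma ent_eu [simp]: "ent (eu i j) p q = (if p = i \<and> q = j then 1 else 0)"
  by (auto simp: eu_def)
lemma unitm_rect [simp, intro]: "unitm k \<in> sq k" by (simp add: unitm_def)
lemma eu_rect [simp, intro]: "i < r \<Longrightarrow> j < c \<Longrightarrow> eu i j \<in> rect r c" by (auto simp: rect_def)
lemma adj_unitm [simp]: "adj (unitm k) = unitm k" by (intro fmat_eqI) auto
lemma adj_eu [simp]: "adj (eu i j) = eu j i" by (intro fmat_eqI) auto

lemma ent_unitm_mult: "ent (unitm k * A) i j = (if i < k then ent A i j else 0)"
  by (auto simp: ent_mult[OF disjI1, OF unitm_rect] if_distrib[of "\<lambda>x. x * _"] cong: if_cong)
lemma ent_mult_unitm: "ent (A * unitm k) i j = (if j < k then ent A i j else 0)"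
  by (auto simp: ent_mult[OF disjI2, OF unitm_rect] if_distrib[of "\<lambda>x. _ * x"] cong: if_cong)

lemma unitm_left [simp]: "A \<in> rect r c \<Longrightarrow> unitm r * A = A"
  by (intro fmat_eqI) (auto simp: ent_unitm_mult rectD not_less)
lemma unitm_right [simp]: "A \<in> rect r c \<Longrightarrow> A * unitm c = A"
  by (intro fmat_eqI) (auto simp: ent_mult_unitm rectD not_less)
lemma unitm_left_sq [simp]: "A \<in> sq r \<Longrightarrow> unitm r * A = A"
  by (rule unitm_left)
lemma unitm_right_sq [simp]: "A \<in> sq c \<Longrightarrow> A * unitm c = A"
  by (rule unitm_right)
lemma unitm_left_rect: "A \<in> rect r c \<Longrightarrow> unitm k * A \<in> rect k c"
  by (auto simp: rect_def ent_unitm_mult)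
lemma unitm_right_rect: "A \<in> rect r c \<Longrightarrow> A * unitm k \<in> rect r k"
  by (auto simp: rect_def ent_mult_unitm)
lemma unitm_unitm: "unitm k * unitm l = unitm (min k l)"
  by (intro fmat_eqI) (auto simp: ent_unitm_mult)

lemma ent_eu_mult: "ent (eu i j * A) p q = (if p = i then ent A j q else 0)"
  by (auto simp: ent_mult[OF disjI1, OF eu_rect[of i "Suc i" j "Suc j"]] if_distrib[of "\<lambda>x. x * _"] cong: if_cong)
lemma ent_mult_eu: "ent (A * eu i j) p q = (if q = j then ent A p i else 0)"
  by (auto simp: ent_mult[OF disjI2, OF eu_rect[of i "Suc i" j "Suc j"]] if_distrib[of "\<lambda>x. _ * x"] cong: if_cong)
lemma eu_eu: "eu i j * eu p q = (if j = p then eu i q else 0)"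
  by (intro fmat_eqI) (auto simp: ent_eu_mult)
lemma cip_eu: "cip (eu i j) A = ent A i j"
  by (simp add: cip_rect[of _ "Suc i" "Suc j"] if_distrib[of "\<lambda>x. cnj x * _"] cong: if_cong)
lemma norm_eu [simp]: "norm (eu i j) = 1"
  by (simp add: norm_eq_sqrt_inner inner_fmat_def cip_eu)
lemma norm_sq_unitm: "(norm (unitm k))\<^sup>2 = real k"
proof -
  have "(\<Sum>j<k. (cmod (ent (unitm k) i j))\<^sup>2) = 1" if "i < k" for i
    using that by (simp add: if_distrib[of "\<lambda>x. (cmod x)\<^sup>2"] sum.delta cong: if_cong)
  then show ?thesis by (simp add: norm_sq_rect[OF unitm_rect])
qed

subsection \<open>Operator bounds and unitaries\<close>

text \<open>Left multiplication acts on each column separately, so its norm for the Frobenius norm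
  is the operator norm of \<open>A\<close>. A predicate on the bound avoids suprema and passes
  easily through sums and products; the link to \<open>op_norm\<close> is made in
  \<open>op_norm_le\<close> and \<open>opb_op_norm\<close>.\<close>

definition opb :: "real \<Rightarrow> fmat \<Rightarrow> bool" where
  "opb C A \<longleftrightarrow> 0 \<le> C \<and> (\<forall>B. norm (A * B) \<le> C * norm B)"

lemma opb_nonneg: "opb C A \<Longrightarrow> 0 \<le> C" by (simp add: opb_def)
lemma opb_left: "opb C A \<Longrightarrow> norm (A * B) \<le> C * norm B" by (simp add: opb_def)

text \<open>The square of |A* B| is the inner product of \<open>B\<close> with A A* B, at most |B| C
  |A* B| by the bound for \<open>A\<close>; one factor |A* B| cancels.\<close>

lemma opb_adj: "opb C A \<Longrightarrow> opb C (adj A)"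
  unfolding opb_def
proof (intro conjI allI; (elim conjE)?)
  fix B assume C: "0 \<le> C" and A: "\<forall>B. norm (A * B) \<le> C * norm B"
  have "(norm (adj A * B))\<^sup>2 = inner B (A * (adj A * B))"
    by (simp add: power2_norm_eq_inner inner_mult_left)
  also have "\<dots> \<le> norm B * (C * norm (adj A * B))"
    by (meson A mult_left_mono norm_cauchy_schwarz norm_ge_zero order_trans)
  finally have "norm (adj A * B) * norm (adj A * B) \<le> norm (adj A * B) * (C * norm B)"
    by (simp add: power2_eq_square algebra_simps)
  then show "norm (adj A * B) \<le> C * norm B"
    using C by (cases "norm (adj A * B) = 0") (auto simp: mult_le_cancel_left)
qed

lemma opb_right: "opb C A \<Longrightarrow> norm (B * A) \<le> C * norm B"
  by (metis adj_adj adj_mult norm_adj opb_adj opb_left)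
lemma opb_mono: "opb C A \<Longrightarrow> C \<le> D \<Longrightarrow> opb D A"
  unfolding opb_def by (meson mult_right_mono norm_ge_zero order_trans)
lemma opb_mult: "opb C A \<Longrightarrow> opb D B \<Longrightarrow> opb (C * D) (A * B)"
  unfolding opb_def by (auto simp: mult.assoc) (meson mult_left_mono order_trans)
lemma opb_add: "opb C A \<Longrightarrow> opb D B \<Longrightarrow> opb (C + D) (A + B)"
  unfolding opb_def by (auto simp: ring_distribs intro: norm_triangle_le add_mono)
lemma opb_cs: "opb C A \<Longrightarrow> opb (cmod c * C) (cs c A)"
  unfolding opb_def by (auto simp: mult.assoc intro: mult_left_mono)
lemma opb_scaleR: "opb C A \<Longrightarrow> opb (\<bar>r\<bar> * C) (r *\<^sub>R A)"
  using opb_cs[of C A "of_real r"] by (simp add: scaleR_eq_cs)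
lemma opb_minus: "opb C A \<Longrightarrow> opb C (- A)"
  unfolding opb_def by simp
lemma opb_diff: "opb C A \<Longrightarrow> opb D B \<Longrightarrow> opb (C + D) (A - B)"
  using opb_add[of C A D "- B"] by (simp add: opb_minus)
lemma opb_zero [simp]: "0 \<le> C \<Longrightarrow> opb C 0" by (simp add: opb_def)
lemma opb_unitm [simp]: "opb 1 (unitm k)"
proof -
  have "norm (unitm k * B) \<le> norm B" for B
  proof -
    have "(norm (unitm k * B))\<^sup>2 = inner B (unitm k * B)"
      by (simp add: power2_norm_eq_inner inner_mult_left unitm_unitm flip: mult.assoc)
    also have "\<dots> \<le> norm B * norm (unitm k * B)" by (rule norm_cauchy_schwarz)
    finally show ?thesis
      by (metis (no_types, opaque_lifting) mult_le_cancel_right norm_ge_zero not_less order_le_less power2_eq_square)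
  qed
  then show ?thesis by (simp add: opb_def)
qed
lemma opb_norm_le: "opb C A \<Longrightarrow> A \<in> rect r c \<Longrightarrow> norm A \<le> C * sqrt c"
  using opb_left[of C A "unitm c"] by (simp add: norm_sq_unitm flip: real_sqrt_abs)
    (metis norm_sq_unitm abs_norm_cancel real_sqrt_abs)

lemma norm_mult_fmat: "norm (A * B) \<le> norm A * norm (B :: fmat)"
proof -
  obtain n where n: "A \<in> sq n" "B \<in> sq n" using rect_ex2 by blast
  have "(norm (A * B))\<^sup>2 \<le> (\<Sum>i<n. \<Sum>j<n. (\<Sum>p<n. (cmod (ent A i p))\<^sup>2) * (\<Sum>p<n. (cmod (ent B p j))\<^sup>2))"
    unfolding norm_sq_rect[OF rect_mult[OF n]]
  proof (intro sum_mono)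
    fix i j
    have "(cmod (ent (A * B) i j))\<^sup>2 \<le> (\<Sum>p<n. cmod (ent A i p) * cmod (ent B p j))\<^sup>2"
      unfolding ent_mult[OF disjI1, OF n(1)]
      by (intro power_mono) (auto intro!: sum_norm_le simp: norm_mult)
    also have "\<dots> \<le> (\<Sum>p<n. (cmod (ent A i p))\<^sup>2) * (\<Sum>p<n. (cmod (ent B p j))\<^sup>2)"
      by (rule Cauchy_Schwarz_ineq_sum)
    finally show "(cmod (ent (A * B) i j))\<^sup>2 \<le> \<dots>" .
  qed
  also have "\<dots> = (\<Sum>i<n. (\<Sum>p<n. (cmod (ent A i p))\<^sup>2)) * (\<Sum>j<n. (\<Sum>p<n. (cmod (ent B p j))\<^sup>2))"
    by (simp add: sum_product)
  also have "\<dots> = (norm A * norm B)\<^sup>2"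
    by (subst (2) sum.swap) (simp add: norm_sq_rect[OF n(1)] norm_sq_rect[OF n(2)] power_mult_distrib)
  finally show ?thesis by (rule power2_le_imp_le) simp
qed

definition umat :: "nat \<Rightarrow> fmat set" where
  "umat k = {u \<in> sq k. adj u * u = unitm k \<and> u * adj u = unitm k}"

lemma umat_rect: "u \<in> umat k \<Longrightarrow> u \<in> sq k" by (simp add: umat_def)
lemma umat_adj: "u \<in> umat k \<Longrightarrow> adj u \<in> umat k" by (auto simp: umat_def)
lemma umat_unitm [simp, intro]: "unitm k \<in> umat k" by (simp add: umat_def unitm_unitm)
lemma umat_mult: "u \<in> umat k \<Longrightarrow> v \<in> umat k \<Longrightarrow> u * v \<in> umat k"
proof -
  assume "u \<in> umat k" "v \<in> umat k"
  then have r: "u \<in> sq k" "v \<in> sq k" and uv: "adj u * u = unitm k" "u * adj u = unitm k"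
     "adj v * v = unitm k" "v * adj v = unitm k" by (auto simp: umat_def)
  have "adj (u * v) * (u * v) = adj v * (adj u * u) * v" by (simp add: adj_mult mult.assoc)
  moreover have "(u * v) * adj (u * v) = u * (v * adj v) * adj u" by (simp add: adj_mult mult.assoc)
  ultimately show ?thesis using r by (simp add: umat_def uv unitm_right[of _ k k])
qed
lemma umat_norm_left: "u \<in> umat k \<Longrightarrow> A \<in> rect k c \<Longrightarrow> norm (u * A) = norm A"
  by (simp add: norm_eq_sqrt_inner inner_mult_left umat_def flip: mult.assoc)
lemma umat_norm_right: "u \<in> umat k \<Longrightarrow> A \<in> rect r k \<Longrightarrow> norm (A * u) = norm A"
  by (metis adj_mult norm_adj rect_adj umat_adj umat_norm_left)
lemma umat_opb: "u \<in> umat k \<Longrightarrow> opb 1 u"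
  unfolding opb_def
proof (intro conjI allI)
  fix B assume u: "u \<in> umat k"
  have "u * B = u * (unitm k * B)" using u by (metis mult.assoc umat_rect unitm_right)
  also have "norm \<dots> = norm (unitm k * B)"
    using u by (intro umat_norm_left[of _ k _ "supp B"] unitm_left_rect[OF supp]) 
  also have "\<dots> \<le> 1 * norm B" by (rule opb_left) simp
  finally show "norm (u * B) \<le> 1 * norm B" .
qed simp
lemma umat_cs: "u \<in> umat k \<Longrightarrow> cmod c = 1 \<Longrightarrow> cs c u \<in> umat k"
  by (auto simp: umat_def adj_cs complex_norm_square[symmetric] mult.commute)
lemma umat_cancel_left: "u \<in> umat k \<Longrightarrow> A \<in> rect k c \<Longrightarrow> adj u * (u * A) = A"
  by (simp add: umat_def flip: mult.assoc)

section \<open>Singular value decomposition and its consequences\<close>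

text \<open>The spectrum of a complex matrix of positive size is nonempty; \<open>Suc m\<close>
  keeps the size positive. Column vectors are the elements of \<open>rect (Suc m) 1\<close>.\<close>

lemma exists_eigenvector:
  assumes "A \<in> sq (Suc m)"
  shows "\<exists>e \<mu>. e \<in> rect (Suc m) 1 \<and> norm e = 1 \<and> A * e = cs \<mu> e"
proof -
  let ?n = "Suc m"
  define B where "B = Matrix.mat ?n ?n (\<lambda>(i, j). ent A i j)"
  have B: "B \<in> carrier_mat ?n ?n" by (simp add: B_def)
  obtain \<mu> where "eigenvalue B \<mu>" using spectrum_non_empty[OF B] by (auto simp: spectrum_def)
  then obtain v where v: "v \<in> carrier_vec ?n" "v \<noteq> 0\<^sub>v ?n" "B *\<^sub>v v = \<mu> \<cdot>\<^sub>v v"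
    using B by (auto simp: eigenvalue_def eigenvector_def)
  define e where "e = mk ?n 1 (\<lambda>i j. vec_index v i)"
  have e: "e \<in> rect ?n 1" by (simp add: e_def)
  have "e \<noteq> 0"
  proof
    assume "e = 0"
    then have "\<forall>i<?n. ent e i 0 = 0" by simp
    then have "v = 0\<^sub>v ?n" using v(1) by (intro eq_vecI) (auto simp: e_def)
    then show False using v by simp
  qed
  have Ae: "A * e = cs \<mu> e"
  proof (rule rect_eqI[OF rect_mult[OF assms e] rect_cs[OF e]])
    fix i j :: nat assume ij: "i < ?n" "j < 1"
    have "ent (A * e) i j = (\<Sum>p<?n. ent A i p * vec_index v p)"
      using ij by (simp add: ent_mult[OF disjI1, OF assms] e_def)
    also have "\<dots> = vec_index (B *\<^sub>v v) i"
      using ij v(1) by (simp add: B_def scalar_prod_def atLeast0LessThan)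
    also have "\<dots> = ent (cs \<mu> e) i j" using ij v by (simp add: e_def)
    finally show "ent (A * e) i j = ent (cs \<mu> e) i j" .
  qed
  have "(1 / norm e) *\<^sub>R e \<in> rect ?n 1 \<and> norm ((1 / norm e) *\<^sub>R e) = 1
      \<and> A * ((1 / norm e) *\<^sub>R e) = cs \<mu> ((1 / norm e) *\<^sub>R e)"
    using e \<open>e \<noteq> 0\<close> by (simp add: Ae cs_scaleR)
  then show ?thesis by blast
qed

lemma column_adj_mult: "v \<in> rect n 1 \<Longrightarrow> w \<in> rect n 1 \<Longrightarrow> adj v * w = cs (cip v w) (eu 0 0)"
  by (rule rect_eqI[of _ 1 1]) (auto simp: ent_mult[of _ 1 n _ 1] cip_rect[of _ n 1])

text \<open>The reflection in v = e - x takes x to e as soon as the unit vectors x and e have a real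
  inner product; the phase \<open>c\<close> in x = c e_m arranges this. For x = e the scalar
  \<open>c\<close> already does it. The last basis vector is used so that the induction in the
  singular value decomposition can split off the last row and column.\<close>

lemma householder:
  assumes e: "e \<in> rect (Suc m) 1" "norm e = 1"
  shows "\<exists>W\<in>umat (Suc m). W * eu m 0 = e"
proof -
  let ?n = "Suc m"
  define \<alpha> where "\<alpha> = ent e m 0"
  define c where "c = (if \<alpha> = 0 then 1 else sgn \<alpha>)"
  have c: "cmod c = 1" by (simp add: c_def norm_sgn)
  define x where "x = cs c (eu m 0)"
  have x: "x \<in> rect ?n 1" "norm x = 1" using c by (auto simp: x_def)
  have "cnj z * z = of_real (cmod z) * of_real (cmod z)" for z
    by (metis complex_norm_square mult.commute of_real_mult power2_eq_square)
  then have "cnj c * \<alpha> = of_real (cmod \<alpha>)" by (simp add: c_def sgn_eq)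
  then have xe: "cip x e = of_real (cmod \<alpha>)" by (simp add: x_def cip_cs_left cip_eu \<alpha>_def)
  then have ex: "cip e x = of_real (cmod \<alpha>)" by (metis cip_sym complex_cnj_complex_of_real)
  show ?thesis
  proof (cases "x = e")
    case True
    then show ?thesis using c
      by (intro bexI[of _ "cs c (unitm ?n)"]) (auto simp: x_def unitm_left[of _ ?n 1] intro: umat_cs)
  next
    case False
    define v where "v = e - x"
    have v: "v \<in> rect ?n 1" using e x by (auto simp: v_def)
    have v0: "norm v \<noteq> 0" using False by (simp add: v_def)
    have vv: "cip v v = of_real (2 - 2 * cmod \<alpha>)"
    proof -
      have "cip v v = cip e e - cip e x - (cip x e - cip x x)"
        by (simp only: v_def cip_diff_left cip_diff_right) simp
      also have "\<dots> = of_real (2 - 2 * cmod \<alpha>)"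
        using xe ex e(2) x(2) by (simp add: cip_norm)
      finally show ?thesis .
    qed
    define r where "r = 2 - 2 * cmod \<alpha>"
    have "(norm v)\<^sup>2 = r" using vv unfolding cip_norm r_def of_real_eq_iff .
    then have r: "r \<noteq> 0" using v0 by auto
    define H where "H = unitm ?n - cs (2 / r) (v * adj v)"
    have v1: "v * eu 0 0 = v" using v by (intro fmat_eqI) (auto simp: ent_mult_eu rectD)
    have vvvv: "v * adj v * (v * adj v) = cs r (v * adj v)"
      using column_adj_mult[OF v v] vv v1
      by (simp add: mult.assoc r_def flip: mult.assoc[of "adj v"])
        (simp add: r_def flip: mult.assoc)
    have Hr: "H \<in> sq ?n" "adj H = H" using v
      by (auto simp: H_def adj_diff adj_cs adj_mult)
    have "H * H = unitm ?n"
    proof -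
      define T where "T = v * adj v"
      have T: "T \<in> sq ?n" "T * T = cs r T" using v vvvv by (auto simp: T_def)
      have "H * H = unitm ?n - cs (2 / r) T - (cs (2 / r) T - cs (2 / r) (cs (2 / r) (cs r T)))"
        unfolding H_def T_def[symmetric]
        by (simp only: left_diff_distrib right_diff_distrib cs_mult T unitm_left_sq unitm_right_sq unitm_rect) (simp add: cs_diff)
      also have "\<dots> = unitm ?n" using r by (intro fmat_eqI) (simp add: field_simps power2_eq_square)
      finally show ?thesis .
    qed
    then have H: "H \<in> umat ?n" using Hr by (simp add: umat_def)
    have "cip v x = of_real (- r / 2)"
      using ex x(2) by (simp add: v_def cip_diff_left cip_norm r_def)
    then have "H * x = x + v"
      using x v r column_adj_mult[OF v x(1)] v1
      by (simp add: H_def algebra_simps mult.assoc)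
        (intro fmat_eqI, simp)
    then have "H * x = e" by (simp add: v_def)
    then have "cs c H * eu m 0 = e" by (simp add: x_def)
    then show ?thesis using H c by (intro bexI[of _ "cs c H"]) (auto intro: umat_cs)
  qed
qed

text \<open>An eigenvector e of A* A with A e nonzero gives the pair with f = A e / |A e|. If A e =
  0, the same argument is tried for the adjoint and an eigenvector f of A A*; if this fails too,
  then e and f form a pair with s = 0.\<close>

lemma singular_pair:
  assumes A: "A \<in> sq (Suc m)"
  shows "\<exists>e f s. e \<in> rect (Suc m) 1 \<and> f \<in> rect (Suc m) 1 \<and> norm e = 1 \<and> norm f = 1 \<and> 0 \<le> s
    \<and> A * e = s *\<^sub>R f \<and> adj A * f = s *\<^sub>R e"
proof -
  have *: "\<exists>f s. f \<in> rect (Suc m) 1 \<and> norm f = 1 \<and> 0 \<le> s \<and> A * e = s *\<^sub>R f \<and> adj A * f = s *\<^sub>R e"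
    if A: "A \<in> sq (Suc m)" and e: "e \<in> rect (Suc m) 1" "norm e = 1" "adj A * A * e = cs \<mu> e"
      and 0: "A * e \<noteq> 0" for A e \<mu>
  proof -
    have "\<mu> = cip e (cs \<mu> e)" by (simp add: cip_cs_right cip_norm e)
    also have "\<dots> = of_real ((norm (A * e))\<^sup>2)"
      unfolding e(3)[symmetric] by (metis adj_adj cip_mult_left cip_norm mult.assoc)
    finally have mu: "\<mu> = of_real ((norm (A * e))\<^sup>2)" .
    have "adj A * ((1 / norm (A * e)) *\<^sub>R (A * e)) = norm (A * e) *\<^sub>R e"
      using e(3) 0 unfolding mu scaleR_eq_cs[symmetric] by (simp add: mult.assoc power2_eq_square)
    then show ?thesis using A e 0
      by (intro exI[of _ "(1 / norm (A * e)) *\<^sub>R (A * e)"] exI[of _ "norm (A * e)"]) auto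
  qed
  obtain e \<mu> where e: "e \<in> rect (Suc m) 1" "norm e = 1" "adj A * A * e = cs \<mu> e"
    using exists_eigenvector[of "adj A * A" m] A by blast
  obtain f \<nu> where f: "f \<in> rect (Suc m) 1" "norm f = 1" "A * adj A * f = cs \<nu> f"
    using exists_eigenvector[of "A * adj A" m] A by blast
  show ?thesis
  proof (cases "A * e = 0")
    case False
    then show ?thesis using *[OF A e] e by blast
  next
    case e0: True
    show ?thesis
    proof (cases "adj A * f = 0")
      case False
      have "adj A \<in> sq (Suc m)" using A by auto
      from *[OF this f(1,2), of \<nu>] f(3) False f show ?thesis by auto
    next
      case True
      then show ?thesis using e f e0 by (intro exI[of _ e] exI[of _ f] exI[of _ 0]) auto
    qed
  qed
qed

definition dg :: "nat \<Rightarrow> (nat \<Rightarrow> complex) \<Rightarrow> fmat" where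
  "dg m f = mk m m (\<lambda>i j. if i = j then f i else 0)"

lemma ent_dg [simp]: "ent (dg m f) i j = (if i = j \<and> i < m then f i else 0)"
  by (auto simp: dg_def)
lemma dg_rect [simp, intro]: "dg m f \<in> sq m" by (simp add: dg_def)
lemma adj_dg [simp]: "adj (dg m f) = dg m (\<lambda>i. cnj (f i))" by (intro fmat_eqI) auto
lemma ent_dg_mult: "ent (dg m f * A) i j = (if i < m then f i * ent A i j else 0)"
  by (auto simp: ent_mult[OF disjI1, OF dg_rect] if_distrib[of "\<lambda>x. x * _"] cong: if_cong)
lemma dg_dg: "dg m f * dg m g = dg m (\<lambda>i. f i * g i)"
  by (intro fmat_eqI) (auto simp: ent_dg_mult)
lemma dg_one: "dg m (\<lambda>i. 1) = unitm m" by (intro fmat_eqI) auto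
lemma norm_sq_dg: "(norm (dg m f))\<^sup>2 = (\<Sum>i<m. (cmod (f i))\<^sup>2)"
proof -
  have "(\<Sum>j<m. (cmod (ent (dg m f) i j))\<^sup>2) = (cmod (f i))\<^sup>2" if "i < m" for i
    using that by (simp add: if_distrib[of "\<lambda>x. (cmod x)\<^sup>2"] sum.delta cong: if_cong)
  then show ?thesis by (simp add: norm_sq_rect[OF dg_rect])
qed
lemma cip_dg: "cip (dg m f) (dg m g) = (\<Sum>i<m. cnj (f i) * g i)"
proof -
  have "(\<Sum>j<m. cnj (ent (dg m f) i j) * ent (dg m g) i j) = cnj (f i) * g i" if "i < m" for i
    using that by (simp add: if_distrib[of "\<lambda>x. x * _"] if_distrib[of cnj] cong: if_cong)
  then show ?thesis by (simp add: cip_rect[OF disjI1, OF dg_rect])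
qed
lemma opb_dg:
  assumes "0 \<le> C" "\<And>i. i < m \<Longrightarrow> cmod (f i) \<le> C"
  shows "opb C (dg m f)"
  unfolding opb_def
proof (intro conjI allI assms(1))
  fix B
  define n where "n = max m (supp B)"
  have B: "B \<in> sq n" "dg m f \<in> sq n"
    by (auto simp: n_def intro: rect_mono[OF supp] rect_mono[OF dg_rect])
  have "(norm (dg m f * B))\<^sup>2 \<le> (\<Sum>i<n. \<Sum>j<n. C\<^sup>2 * (cmod (ent B i j))\<^sup>2)"
    unfolding norm_sq_rect[OF rect_mult[OF B(2,1)]]
    using assms by (intro sum_mono) (auto simp: ent_dg_mult norm_mult power_mult_distrib intro!: mult_right_mono power_mono)
  also have "\<dots> = (C * norm B)\<^sup>2"
    by (simp add: norm_sq_rect[OF B(1)] power_mult_distrib sum_distrib_left)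
  finally show "norm (dg m f * B) \<le> C * norm B"
    using assms(1) by (auto intro: power2_le_imp_le)
qed
lemma umat_dg: "(\<And>i. i < m \<Longrightarrow> cmod (f i) = 1) \<Longrightarrow> dg m f \<in> umat m"
proof -
  assume f: "\<And>i. i < m \<Longrightarrow> cmod (f i) = 1"
  have "cnj (f i) * f i = 1 \<and> f i * cnj (f i) = 1" if "i < m" for i
    using f[OF that] by (metis complex_norm_square mult.commute of_real_1 power_one)
  then show ?thesis by (auto simp: umat_def dg_dg intro!: fmat_eqI)
qed

lemma rect_mult_eu_0: "A \<in> rect r c \<Longrightarrow> c \<le> i \<Longrightarrow> A * eu i j = 0"
  by (intro fmat_eqI) (simp add: ent_mult_eu rectD)
lemma eu_mult_rect_0: "A \<in> rect r c \<Longrightarrow> r \<le> j \<Longrightarrow> eu i j * A = 0"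
  by (intro fmat_eqI) (simp add: ent_eu_mult rectD)

lemma unitm_Suc: "unitm m + eu m m = unitm (Suc m)"
  by (intro fmat_eqI) auto

lemma umat_Suc: "u \<in> umat m \<Longrightarrow> u + eu m m \<in> umat (Suc m)"
proof -
  assume "u \<in> umat m"
  then have u: "u \<in> sq m" "adj u \<in> sq m" "adj u * u = unitm m" "u * adj u = unitm m"
    by (auto simp: umat_def)
  note u
  moreover have "u + eu m m \<in> sq (Suc m)"
    by (intro rect_add rect_mono[OF u(1)] eu_rect) auto
  ultimately show ?thesis
    by (auto simp: umat_def adj_add algebra_simps rect_mult_eu_0[of _ m m] eu_mult_rect_0[of _ m m]
        eu_eu unitm_Suc add.commute[of "eu m m"])
qed

text \<open>Deflation: unitaries taking the last basis vector to e and to f turn \<open>A\<close>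
  into \<open>B\<close>. Since both A e = t f and A* f = t e hold, the last row and the last column
  of \<open>B\<close> vanish off the diagonal, and the induction hypothesis applies to the remaining
  corner.\<close>

theorem singular_value_decomposition:
  "A \<in> sq m \<Longrightarrow> \<exists>U\<in>umat m. \<exists>V\<in>umat m. \<exists>s::nat \<Rightarrow> real. (\<forall>i. 0 \<le> s i) \<and>
     A = U * dg m (\<lambda>i. of_real (s i)) * adj V"
proof (induction m arbitrary: A)
  case 0
  then have "A = unitm 0 * dg 0 (\<lambda>i. of_real 0) * adj (unitm 0)"
    by (intro rect_eqI[of _ 0 0]) auto
  then show ?case by (intro bexI[of _ "unitm 0"] exI[of _ "\<lambda>_. 0"]) auto
next
  case (Suc m)
  obtain e f t where ef: "e \<in> rect (Suc m) 1" "f \<in> rect (Suc m) 1" "norm e = 1" "norm f = 1" "0 \<le> t"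
    "A * e = t *\<^sub>R f" "adj A * f = t *\<^sub>R e"
    using singular_pair[OF Suc.prems] by blast
  obtain W where W: "W \<in> umat (Suc m)" "W * eu m 0 = e" using householder ef by blast
  obtain W' where W': "W' \<in> umat (Suc m)" "W' * eu m 0 = f" using householder ef by blast
  define B where "B = adj W' * A * W"
  have r: "W \<in> sq (Suc m)" "W' \<in> sq (Suc m)" using W W' by (auto simp: umat_def)
  have B: "B \<in> sq (Suc m)" using r Suc.prems by (auto simp: B_def)
  have eu: "eu m 0 \<in> rect (Suc m) 1" by auto
  have "B * eu m 0 = t *\<^sub>R eu m 0"
  proof -
    have "B * eu m 0 = adj W' * (A * (W * eu m 0))" by (simp add: B_def mult.assoc)
    also have "\<dots> = t *\<^sub>R (adj W' * (W' * eu m 0))" by (simp only: W(2) W'(2) ef(6) mult_scaleR_right)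
    finally show ?thesis by (simp only: umat_cancel_left[OF W'(1) eu])
  qed
  then have "ent (B * eu m 0) i 0 = ent (t *\<^sub>R eu m 0) i 0" for i by simp
  then have Bm: "ent B i m = (if i = m then t else 0)" for i
    by (simp add: ent_mult_eu scaleR_conv_of_real)
  have "adj B * eu m 0 = t *\<^sub>R eu m 0"
  proof -
    have "adj B * eu m 0 = adj W * (adj A * (W' * eu m 0))" by (simp add: B_def adj_mult mult.assoc)
    also have "\<dots> = t *\<^sub>R (adj W * (W * eu m 0))" by (simp only: W(2) W'(2) ef(7) mult_scaleR_right)
    finally show ?thesis by (simp only: umat_cancel_left[OF W(1) eu])
  qed
  then have "ent (adj B * eu m 0) i 0 = ent (t *\<^sub>R eu m 0) i 0" for i by simp
  then have "cnj (ent B m i) = (if i = m then t else 0)" for i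
    by (simp add: ent_mult_eu scaleR_conv_of_real)
  then have mB: "ent B m i = (if i = m then t else 0)" for i
    by (metis complex_cnj_cnj complex_cnj_complex_of_real)
  define A' where "A' = unitm m * B * unitm m"
  have A': "A' \<in> sq m" using B unitm_left_rect unitm_right_rect unfolding A'_def by blast
  obtain U V s where UV: "U \<in> umat m" "V \<in> umat m" "\<forall>i. (0::real) \<le> s i" "A' = U * dg m (\<lambda>i. of_real (s i)) * adj V"
    using Suc.IH[OF A'] by blast
  define s' where "s' = s(m := t)"
  have BA: "B = A' + cs (of_real t) (eu m m)"
  proof (rule fmat_eqI)
    fix i j
    have B0: "ent B i j = 0" if "m < i \<or> m < j" using rectD[OF B, of i j] that by auto
    consider "i < m" "j < m" | "i = m" | "j = m" | "i > m" | "j > m" by linarith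
    then show "ent B i j = ent (A' + cs (of_real t) (eu m m)) i j"
      by cases (auto simp: A'_def ent_unitm_mult ent_mult_unitm Bm mB B0)
  qed
  have D: "dg (Suc m) (\<lambda>i. of_real (s' i)) = dg m (\<lambda>i. of_real (s i)) + cs (of_real t) (eu m m)"
    by (intro fmat_eqI) (auto simp: s'_def)
  have UVr: "U \<in> sq m" "adj V \<in> sq m" "adj V \<in> sq m" using UV by (auto simp: umat_def)
  have "(U + eu m m) * dg (Suc m) (\<lambda>i. of_real (s' i)) * adj (V + eu m m)
     = U * dg m (\<lambda>i. of_real (s i)) * adj V + cs (of_real t) (eu m m)"
    unfolding D using UVr
    by (simp add: adj_add algebra_simps rect_mult_eu_0[of _ m m] eu_mult_rect_0[of _ m m] eu_eu mult.assoc)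
  then have BU: "B = (U + eu m m) * dg (Suc m) (\<lambda>i. of_real (s' i)) * adj (V + eu m m)"
    using BA UV(4) by simp
  have "A = W' * B * adj W"
    using W(1) W'(1) Suc.prems umat_cancel_left[OF umat_adj[OF W'(1)], of A "Suc m"]
    by (simp add: B_def mult.assoc umat_def unitm_right[of _ "Suc m" "Suc m"])
  also have "\<dots> = (W' * (U + eu m m)) * dg (Suc m) (\<lambda>i. of_real (s' i)) * adj (W * (V + eu m m))"
    by (simp add: BU adj_mult mult.assoc)
  finally have "A = (W' * (U + eu m m)) * dg (Suc m) (\<lambda>i. of_real (s' i)) * adj (W * (V + eu m m))" .
  moreover have "W' * (U + eu m m) \<in> umat (Suc m)" "W * (V + eu m m) \<in> umat (Suc m)"
    using W W' UV by (auto intro: umat_mult umat_Suc)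
  moreover have "\<forall>i. 0 \<le> s' i" using UV ef by (simp add: s'_def)
  ultimately show ?case by blast
qed

lemma umat_conj_inner:
  assumes "V \<in> umat m" "A \<in> sq m"
  shows "cip (V * A * adj V) (V * B * adj V) = cip A B"
proof -
  have V: "V \<in> sq m" "adj V * V = unitm m" using assms by (auto simp: umat_def)
  have "cip (V * A * adj V) (V * B * adj V) = cip (V * A) (V * B * (adj V * V))"
    unfolding cip_mult_right[of "V * A" "adj V"] adj_adj by (simp only: mult.assoc)
  also have "\<dots> = cip A (adj V * V * (B * unitm m))"
    unfolding V(2) cip_mult_left[of V A] by (simp only: mult.assoc V(2)[symmetric])
  also have "\<dots> = cip (unitm m * A) (B * unitm m)"
    unfolding V(2) cip_mult_left[of "unitm m" A] adj_unitm ..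
  also have "\<dots> = cip (unitm m * A * unitm m) B"
    unfolding cip_mult_right[of "unitm m * A" "unitm m"] adj_unitm ..
  finally show ?thesis using assms by simp
qed

text \<open>
  The partial isometry of a polar decomposition, completed to a unitary; \<open>S\<close> is the sign of
  \<open>adj A * A - 1\<close>, so that the second bound is a trace norm bound.
\<close>

lemma near_unitary:
  assumes "A \<in> sq m"
  shows "\<exists>w\<in>umat m. norm (A - w) \<le> norm (adj A * A - unitm m) \<and>
    (\<exists>S\<in>sq m. opb 1 S \<and> (norm (A - w))\<^sup>2 \<le> inner S (adj A * A - unitm m))"
proof -
  obtain U V s where U: "U \<in> umat m" and V: "V \<in> umat m" and s: "\<forall>i. (0::real) \<le> s i"
    and A: "A = U * dg m (\<lambda>i. of_real (s i)) * adj V"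
    using singular_value_decomposition[OF assms] by blast
  have r: "U \<in> sq m" "V \<in> sq m" "adj V \<in> sq m" and UV: "adj U * U = unitm m" "V * adj V = unitm m"
    using U V by (auto simp: umat_def)
  let ?w = "U * adj V"
  have "A - ?w = U * dg m (\<lambda>i. of_real (s i) - 1) * adj V"
  proof -
    have D: "dg m (\<lambda>i. of_real (s i)) = unitm m + dg m (\<lambda>i. of_real (s i) - 1)"
      by (intro fmat_eqI) auto
    show ?thesis unfolding A D using r by (simp add: ring_distribs)
  qed
  then have "norm (A - ?w) = norm (U * dg m (\<lambda>i. of_real (s i) - 1))"
    using r umat_norm_right[OF umat_adj[OF V]] by (metis dg_rect rect_mult)
  also have "\<dots> = norm (dg m (\<lambda>i. of_real (s i) - 1))" by (rule umat_norm_left[OF U dg_rect])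
  finally have n: "(norm (A - ?w))\<^sup>2 = (\<Sum>i<m. (cmod (of_real (s i) - 1))\<^sup>2)" by (simp add: norm_sq_dg)
  let ?D = "\<lambda>i. complex_of_real ((s i)\<^sup>2 - 1)"
  have AA: "adj A * A - unitm m = V * dg m ?D * adj V"
  proof -
    have "adj A * A = V * dg m (\<lambda>i. of_real (s i)) * (adj U * U) * dg m (\<lambda>i. of_real (s i)) * adj V"
      by (simp add: A adj_mult mult.assoc)
    also have "\<dots> = V * (dg m (\<lambda>i. of_real (s i)) * dg m (\<lambda>i. of_real (s i))) * adj V"
    proof -
      have "V * dg m (\<lambda>i. of_real (s i)) * unitm m = V * dg m (\<lambda>i. of_real (s i))" using r by simp
      then show ?thesis unfolding UV by (simp add: mult.assoc)
    qed
    also have "\<dots> - unitm m = V * (dg m (\<lambda>i. of_real (s i)) * dg m (\<lambda>i. of_real (s i)) - unitm m) * adj V"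
      using r by (simp add: algebra_simps UV)
    also have "dg m (\<lambda>i. of_real (s i)) * dg m (\<lambda>i. of_real (s i)) - unitm m = dg m ?D"
      by (intro fmat_eqI) (auto simp: dg_dg power2_eq_square)
    finally show ?thesis .
  qed
  have dgD: "norm (V * dg m ?D * adj V) = norm (dg m ?D)"
    using umat_conj_inner[OF V dg_rect, of ?D "dg m ?D"] by (simp add: norm_eq_sqrt_inner inner_fmat_def)
  have c1: "cmod (of_real t - 1) = \<bar>t - 1\<bar>" for t by (metis norm_of_real of_real_1 of_real_diff)
  have f: "\<bar>t\<^sup>2 - 1\<bar> = \<bar>t - 1\<bar> * (t + 1)" if "0 \<le> t" for t :: real
    using that by (simp add: power2_eq_square square_diff_one_factored abs_mult mult.commute)
  have "(norm (A - ?w))\<^sup>2 \<le> (norm (adj A * A - unitm m))\<^sup>2"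
    unfolding n AA dgD norm_sq_dg norm_of_real
  proof (intro sum_mono)
    fix i
    \<comment> \<open>Since s + 1 is at least 1, the factorization of s^2 - 1 gives this for each
      singular value.\<close>
    have "\<bar>s i - 1\<bar> \<le> \<bar>(s i)\<^sup>2 - 1\<bar>" using s f[of "s i"] by (simp add: mult_le_cancel_left1)
    then show "(cmod (of_real (s i) - 1))\<^sup>2 \<le> \<bar>(s i)\<^sup>2 - 1\<bar>\<^sup>2" unfolding c1 by (intro power_mono) auto
  qed
  then have 1: "norm (A - ?w) \<le> norm (adj A * A - unitm m)" by (rule power2_le_imp_le) simp
  let ?S = "V * dg m (\<lambda>i. of_real (sgn ((s i)\<^sup>2 - 1))) * adj V"
  have "inner ?S (adj A * A - unitm m) = (\<Sum>i<m. \<bar>(s i)\<^sup>2 - 1\<bar>)"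
    unfolding AA inner_fmat_def umat_conj_inner[OF V dg_rect] cip_dg
    by (simp flip: of_real_mult of_real_sum add: abs_sgn mult.commute del: of_real_diff)
  \<comment> \<open>The other bound |s - 1| <= s + 1 gives (s - 1)^2 <= |s^2 - 1|: a squared
    Frobenius distance against a trace norm, the form needed when \<open>adj A * A\<close> is close
    to 1 in trace norm only.\<close>
  moreover have "(norm (A - ?w))\<^sup>2 \<le> (\<Sum>i<m. \<bar>(s i)\<^sup>2 - 1\<bar>)"
    unfolding n
  proof (intro sum_mono)
    fix i
    have "\<bar>s i - 1\<bar> * \<bar>s i - 1\<bar> \<le> \<bar>s i - 1\<bar> * (s i + 1)" using s[rule_format, of i] by (intro mult_left_mono) auto
    then show "(cmod (of_real (s i) - 1))\<^sup>2 \<le> \<bar>(s i)\<^sup>2 - 1\<bar>" using s f[of "s i"] unfolding c1 power2_eq_square by simp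
  qed
  moreover have "opb (1 * 1 * 1) ?S"
    by (intro opb_mult umat_opb[OF V] umat_opb[OF umat_adj[OF V]] opb_dg) (auto simp: norm_sgn sgn_if)
  ultimately show ?thesis using 1 r U V
    by (intro bexI[of _ ?w] conjI bexI[of _ ?S]) (auto intro: umat_mult umat_adj)
qed

text \<open>Each singular value is at most C, hence of the form C cos t, which is C / 2 times the
  sum of the two unit numbers exp(i t) and exp(- i t).\<close>

lemma average_two_unitaries:
  assumes A: "A \<in> sq m" and C: "opb C A" "0 < C"
  shows "\<exists>u\<in>umat m. \<exists>v\<in>umat m. A = (C / 2) *\<^sub>R (u + v)"
proof -
  obtain U V s where U: "U \<in> umat m" and V: "V \<in> umat m" and s: "\<forall>i. (0::real) \<le> s i"
    and A': "A = U * dg m (\<lambda>i. of_real (s i)) * adj V"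
    using singular_value_decomposition[OF A] by blast
  have r: "U \<in> sq m" "V \<in> sq m" "adj V \<in> sq m" "adj V * V = unitm m" using U V by (auto simp: umat_def)
  have sC: "s i \<le> C" if i: "i < m" for i
  proof -
    have e: "eu i 0 \<in> rect m 1" using i by auto
    have "A * (V * eu i 0) = U * dg m (\<lambda>i. of_real (s i)) * (adj V * V) * eu i 0"
      by (simp add: A' mult.assoc)
    also have "\<dots> = U * (dg m (\<lambda>i. of_real (s i)) * eu i 0)"
    proof -
      have "U * dg m (\<lambda>i. of_real (s i)) * unitm m = U * dg m (\<lambda>i. of_real (s i))" using r by simp
      then show ?thesis unfolding r(4) by (simp add: mult.assoc)
    qed
    also have "dg m (\<lambda>i. of_real (s i)) * eu i 0 = s i *\<^sub>R eu i 0"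
      using i by (intro fmat_eqI) (auto simp: ent_dg_mult scaleR_conv_of_real)
    finally have "norm (A * (V * eu i 0)) = s i"
      using umat_norm_left[OF U rect_scaleR[OF e]] s by simp
    moreover have "norm (V * eu i 0) = 1" using umat_norm_left[OF V e] by simp
    ultimately show ?thesis using opb_left[OF C(1), of "V * eu i 0"] by simp
  qed
  define t where "t i = arccos (s i / C)" for i
  have t: "cos (t i) = s i / C" if "i < m" for i
    unfolding t_def using sC[OF that] s C(2) by (intro cos_arccos) (auto simp: field_simps intro: order_trans[of _ 0])
  let ?u = "U * dg m (\<lambda>i. cis (t i)) * adj V" and ?v = "U * dg m (\<lambda>i. cis (- t i)) * adj V"
  have D: "dg m (\<lambda>i. of_real (s i)) = (C / 2) *\<^sub>R (dg m (\<lambda>i. cis (t i)) + dg m (\<lambda>i. cis (- t i)))"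
    using t C(2) by (intro fmat_eqI) (auto simp: complex_eq_iff)
  have "A = (C / 2) *\<^sub>R (?u + ?v)" unfolding A' D by (simp add: algebra_simps)
  moreover have "?u \<in> umat m" "?v \<in> umat m"
    using U V by (auto intro!: umat_mult umat_adj umat_dg)
  ultimately show ?thesis by blast
qed

subsection \<open>Truncation by the resolvent\<close>

text \<open>The inverse of 1 + y* y inside \<open>sq k\<close>. The choice is governed by
  \<open>adj y * y\<close> alone, so that \<open>res k (u * y)\<close> and \<open>res k y\<close>
  are literally the same term after rewriting when u is unitary, see
  \<open>chi_unitary\<close>.\<close>

definition res :: "nat \<Rightarrow> fmat \<Rightarrow> fmat" where
  "res k y = (SOME b. b \<in> sq k \<and> (unitm k + adj y * y) * b = unitm k \<and> b * (unitm k + adj y * y) = unitm k)"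

text \<open>In the coordinates of a singular value decomposition the last three bounds are 1 / (1 +
  s^2) <= 1, s / (1 + s^2) <= 1/2 and s^2 / (1 + s^2) <= 1.\<close>

lemma res_props:
  assumes y: "y \<in> sq k"
  defines "b \<equiv> res k y"
  shows "b \<in> sq k" "(unitm k + adj y * y) * b = unitm k" "b * (unitm k + adj y * y) = unitm k"
    "opb 1 b" "opb (1/2) (y * b)" "opb 1 (y * b * adj y)"
proof -
  obtain U V s where U: "U \<in> umat k" and V: "V \<in> umat k" and s: "\<forall>i. (0::real) \<le> s i"
    and A: "y = U * dg k (\<lambda>i. of_real (s i)) * adj V"
    using singular_value_decomposition[OF y] by blast
  have r: "U \<in> sq k" "V \<in> sq k" "adj U \<in> sq k" "adj V \<in> sq k" and UV: "adj U * U = unitm k" "V * adj V = unitm k" "adj V * V = unitm k"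
    using U V by (auto simp: umat_def)
  let ?c = "V * dg k (\<lambda>i. of_real (1 / (1 + (s i)\<^sup>2))) * adj V"
  have red1: "X * adj V * (V * Y) = X * Y" if "Y \<in> rect k c" for X Y and c :: nat
    using that by (simp add: mult.assoc UV flip: mult.assoc[of "adj V"])
  have red2: "X * adj U * (U * Y) = X * Y" if "Y \<in> rect k c" for X Y and c :: nat
    using that by (simp add: mult.assoc UV flip: mult.assoc[of "adj U"])
  have yy: "adj y * y = V * dg k (\<lambda>i. of_real ((s i)\<^sup>2)) * adj V"
  proof -
    have "adj y * y = (V * dg k (\<lambda>i. of_real (s i)) * adj U) * (U * (dg k (\<lambda>i. of_real (s i)) * adj V))"
      by (simp add: A adj_mult mult.assoc)
    also have "\<dots> = V * dg k (\<lambda>i. of_real (s i)) * (dg k (\<lambda>i. of_real (s i)) * adj V)"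
      by (rule red2) (use r in auto)
    also have "\<dots> = V * (dg k (\<lambda>i. of_real (s i)) * dg k (\<lambda>i. of_real (s i))) * adj V" by (simp add: mult.assoc)
    finally show ?thesis by (simp add: dg_dg power2_eq_square)
  qed
  have one: "unitm k + adj y * y = V * dg k (\<lambda>i. of_real (1 + (s i)\<^sup>2)) * adj V"
  proof -
    have "dg k (\<lambda>i. of_real (1 + (s i)\<^sup>2)) = unitm k + dg k (\<lambda>i. of_real ((s i)\<^sup>2))"
      by (intro fmat_eqI) auto
    then show ?thesis using r by (simp add: yy algebra_simps UV)
  qed
  have pos: "1 + (s i)\<^sup>2 > 0" for i by (simp add: add_pos_nonneg)
  have pos': "1 + complex_of_real ((s i)\<^sup>2) \<noteq> 0" for i
    using pos[of i] by (metis of_real_0 of_real_1 of_real_add of_real_eq_iff less_irrefl)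
  have conj: "(V * dg k f * adj V) * (V * dg k g * adj V) = V * dg k (\<lambda>i. f i * g i) * adj V" for f g
    using red1[of "dg k g * adj V" k "V * dg k f"] r by (simp add: mult.assoc flip: dg_dg)
  have c: "?c \<in> sq k" "(unitm k + adj y * y) * ?c = unitm k" "?c * (unitm k + adj y * y) = unitm k"
    using r pos' unfolding one conj by (auto simp: UV dg_one)
  have b: "b \<in> sq k \<and> (unitm k + adj y * y) * b = unitm k \<and> b * (unitm k + adj y * y) = unitm k"
    unfolding b_def res_def by (rule someI[where x = ?c]) (intro conjI c)
  then show "b \<in> sq k" "(unitm k + adj y * y) * b = unitm k" "b * (unitm k + adj y * y) = unitm k" by auto
  have "b = (?c * (unitm k + adj y * y)) * b" unfolding c(3) using b by simp
  also have "\<dots> = ?c * ((unitm k + adj y * y) * b)" by (simp only: mult.assoc)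
  also have "\<dots> = ?c" using b c(1) by (simp only: unitm_right_sq)
  finally have bc: "b = ?c" .
  have bnd: "cmod (complex_of_real x) \<le> C" if "0 \<le> x" "x \<le> C" for x C using that by simp
  have "opb (1 * 1 * 1) b" unfolding bc
    by (intro opb_mult umat_opb[OF V] umat_opb[OF umat_adj[OF V]] opb_dg bnd) (auto simp: divide_le_eq_1_pos[OF pos])
  then show "opb 1 b" by simp
  have yb: "y * b = U * dg k (\<lambda>i. of_real (s i / (1 + (s i)\<^sup>2))) * adj V"
  proof -
    let ?D = "dg k (\<lambda>i. of_real (s i))" and ?E = "dg k (\<lambda>i. of_real (1 / (1 + (s i)\<^sup>2)))"
    have "y * b = U * ?D * adj V * (V * (?E * adj V))"
      unfolding bc by (subst A) (simp only: mult.assoc)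
    also have "\<dots> = U * ?D * (?E * adj V)" by (rule red1[of _ k]) (use r in simp)
    also have "\<dots> = U * (?D * ?E) * adj V" by (simp only: mult.assoc)
    finally show ?thesis by (simp add: dg_dg)
  qed
  have "s i / (1 + (s i)\<^sup>2) \<le> 1/2" for i
    using pos[of i] sum_squares_ge_zero[of "s i - 1" 0] by (simp add: field_simps power2_eq_square)
  then have "opb (1 * (1/2) * 1) (y * b)" unfolding yb
    by (intro opb_mult umat_opb[OF U] umat_opb[OF umat_adj[OF V]] opb_dg bnd) (use s in auto)
  then show "opb (1/2) (y * b)" by simp
  have yby: "y * b * adj y = U * dg k (\<lambda>i. of_real ((s i)\<^sup>2 / (1 + (s i)\<^sup>2))) * adj U"
  proof -
    let ?D = "dg k (\<lambda>i. of_real (s i))" and ?E = "dg k (\<lambda>i. of_real (s i / (1 + (s i)\<^sup>2)))"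
    have "adj y = V * (?D * adj U)" by (simp add: A adj_mult mult.assoc)
    then have "y * b * adj y = U * ?E * adj V * (V * (?D * adj U))" by (simp only: yb)
    also have "\<dots> = U * ?E * (?D * adj U)" by (rule red1[of _ k]) (use r in simp)
    also have "\<dots> = U * (?E * ?D) * adj U" by (simp only: mult.assoc)
    finally show ?thesis by (simp add: dg_dg power2_eq_square)
  qed
  have "(s i)\<^sup>2 / (1 + (s i)\<^sup>2) \<le> 1" for i
    using pos[of i] by (simp add: field_simps)
  then have "opb (1 * 1 * 1) (y * b * adj y)" unfolding yby
    by (intro opb_mult umat_opb[OF U] umat_opb[OF umat_adj[OF U]] opb_dg bnd) auto
  then show "opb 1 (y * b * adj y)" by simp
qed

text \<open>The smooth truncation y (1 + y* y / R^2)^(-1). It bounds the operator norm in terms of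
  \<open>R\<close>, is Lipschitz for the Frobenius norm with a constant independent of
  \<open>R\<close> and of the size, and commutes with left multiplication by unitaries.\<close>

definition chi :: "nat \<Rightarrow> real \<Rightarrow> fmat \<Rightarrow> fmat" where
  "chi k R y = y * res k ((1 / R) *\<^sub>R y)"

lemma chi_scale: "R \<noteq> 0 \<Longrightarrow> chi k R y = R *\<^sub>R (((1 / R) *\<^sub>R y) * res k ((1 / R) *\<^sub>R y))"
  by (simp add: chi_def)

lemma chi_rect [simp, intro]: "y \<in> sq k \<Longrightarrow> chi k R y \<in> sq k"
  by (auto simp: chi_def intro: res_props)

lemma chi_opb: "y \<in> sq k \<Longrightarrow> 0 < R \<Longrightarrow> opb R (chi k R y)"
  using opb_scaleR[OF res_props(5)[of "(1 / R) *\<^sub>R y" k], of R]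
  by (subst chi_scale) (auto intro: opb_mono)

lemma chi_unitary:
  assumes "u \<in> umat k" "y \<in> sq k"
  shows "chi k R (u * y) = u * chi k R y"
proof -
  have "adj (u * y) * (u * y) = adj y * y"
    using umat_cancel_left[OF assms] by (simp add: adj_mult mult.assoc)
  then show ?thesis by (simp add: chi_def res_def adj_scaleR mult.assoc)
qed

text \<open>Scaling reduces to R = 1. The resolvent identity b - c = b (z* z - y* y) c splits the
  difference into three terms, each containing y - z once between factors such as
  \<open>y * b\<close>, \<open>z * c\<close> or \<open>y * b * adj y\<close>, whose operator bounds
  are uniform in y and z.\<close>

lemma chi_lipschitz:
  assumes "y \<in> sq k" "z \<in> sq k" "0 < R"
  shows "norm (chi k R y - chi k R z) \<le> 3 * norm (y - z)"
proof -
  have *: "norm (y * res k y - z * res k z) \<le> 3 * norm (y - z)" if yz: "y \<in> sq k" "z \<in> sq k" for y z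
  proof -
    define b c where "b = res k y" and "c = res k z"
    note b = res_props[OF yz(1), folded b_def] and c = res_props[OF yz(2), folded c_def]
    have "b - c = b * ((unitm k + adj z * z) * c) - (b * (unitm k + adj y * y)) * c"
      using b c by simp
    also have "\<dots> = b * (adj z * z - adj y * y) * c"
      by (simp add: algebra_simps)
    also have "\<dots> = b * (adj y * (z - y) + adj (z - y) * z) * c"
      by (simp add: algebra_simps adj_diff)
    finally have bc: "b - c = b * (adj y * (z - y) + adj (z - y) * z) * c" .
    have "y * b - z * c = (y - z) * c + y * (b - c)" by (simp add: algebra_simps)
    also have "\<dots> = (y - z) * c + ((y * b * adj y) * (z - y)) * c + y * b * (adj (z - y) * (z * c))"
      unfolding bc by (simp add: ring_distribs mult.assoc)
    finally have eq: "y * b - z * c = \<dots>" .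
    have "norm ((y - z) * c) \<le> norm (y - z)" using opb_right[OF c(4)] by simp
    moreover have "norm (((y * b * adj y) * (z - y)) * c) \<le> norm (y - z)"
      using opb_right[OF c(4)] opb_left[OF b(6), of "z - y"] by (metis mult_1 norm_minus_commute order_trans)
    moreover have "norm (y * b * (adj (z - y) * (z * c))) \<le> norm (y - z)"
    proof -
      have "norm (y * b * (adj (z - y) * (z * c))) \<le> 1/2 * norm (adj (z - y) * (z * c))"
        by (rule opb_left[OF b(5)])
      also have "\<dots> \<le> 1/2 * (1/2 * norm (adj (z - y)))"
        using opb_right[OF c(5), of "adj (z - y)"] by (intro mult_left_mono) auto
      finally have "norm (y * b * (adj (z - y) * (z * c))) \<le> 1/4 * norm (y - z)"
        by (simp add: norm_minus_commute)
      then show ?thesis using norm_ge_zero[of "y - z"] by linarith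
    qed
    ultimately have "norm (y * b - z * c) \<le> norm (y - z) + norm (y - z) + norm (y - z)"
      unfolding eq by (intro norm_triangle_le add_mono) 
    then show ?thesis by (simp add: b_def c_def)
  qed
  have "norm (chi k R y - chi k R z) = R * norm ((1/R) *\<^sub>R y * res k ((1/R) *\<^sub>R y) - (1/R) *\<^sub>R z * res k ((1/R) *\<^sub>R z))"
    using assms(3) by (simp add: chi_scale flip: scaleR_diff_right)
  also have "\<dots> \<le> R * (3 * norm ((1/R) *\<^sub>R y - (1/R) *\<^sub>R z))"
    using assms by (intro mult_left_mono *) auto
  also have "\<dots> = 3 * norm (y - z)" using assms(3) by (simp flip: scaleR_diff_right)
  finally show ?thesis .
qed

text \<open>With z = y / R and b its resolvent, y - y b = y z* (z b). The error is quadratic in y,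
  so a fourth moment of the random matrix controls its mean square.\<close>

lemma chi_approx:
  assumes "y \<in> sq k" "0 < R"
  shows "norm (y - chi k R y) \<le> norm (y * adj y) / (2 * R)"
proof -
  define z b where "z = (1/R) *\<^sub>R y" and "b = res k z"
  have z: "z \<in> sq k" using assms by (auto simp: z_def)
  note b = res_props[OF z, folded b_def]
  have "y - chi k R y = y * ((unitm k + adj z * z) * b) - y * b"
    using assms b by (simp add: chi_def z_def b_def)
  also have "\<dots> = y * adj z * (z * b)" using b(1) by (simp add: algebra_simps)
  also have "norm \<dots> \<le> 1/2 * norm (y * adj z)" by (rule opb_right[OF b(5)])
  finally show ?thesis using assms by (simp add: z_def adj_scaleR)
qed

section \<open>Random signs\<close>

text \<open>The mean of \<open>F (\<Sum>\<^sub>i \<epsilon>\<^sub>i v\<^sub>i)\<close> over independent uniform signs \<open>\<epsilon>\<^sub>i\<close>.\<close>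

primrec avg :: "'v::real_vector list \<Rightarrow> ('v \<Rightarrow> 'w::real_vector) \<Rightarrow> 'w" where
  "avg [] F = F 0"
| "avg (v # vs) F = (1/2) *\<^sub>R (avg vs (\<lambda>z. F (z + v)) + avg vs (\<lambda>z. F (z - v)))"

lemma avg_add: "avg vs (\<lambda>z. F z + G z) = avg vs F + avg vs G"
  by (induction vs arbitrary: F G) (simp_all add: algebra_simps)
lemma avg_scaleR: "avg vs (\<lambda>z. c *\<^sub>R F z) = c *\<^sub>R avg vs F"
  by (induction vs arbitrary: F) (simp_all add: algebra_simps)
lemma avg_cmult: "avg vs (\<lambda>z. (c::real) * F z) = c * avg vs F"
  using avg_scaleR[of vs c F] by simp
lemma avg_minus: "avg vs (\<lambda>z. - F z) = - avg vs F"
  using avg_scaleR[of vs "-1" F] by simp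
lemma avg_diff: "avg vs (\<lambda>z. F z - G z) = avg vs F - avg vs G"
  using avg_add[of vs F "\<lambda>z. - G z"] by (simp add: avg_minus)
lemma avg_const [simp]: "avg vs (\<lambda>z. c) = c"
  by (induction vs) (simp_all flip: scaleR_left_distrib add: scaleR_2[symmetric])
lemma avg_sum: "avg vs (\<lambda>z. \<Sum>i\<in>I. F i z) = (\<Sum>i\<in>I. avg vs (F i))"
  by (induction I rule: infinite_finite_induct) (simp_all add: avg_add)
lemma avg_mono: "(\<And>z. F z \<le> (G z :: real)) \<Longrightarrow> avg vs F \<le> avg vs G"
  by (induction vs arbitrary: F G) (simp_all add: add_mono)
lemma avg_mono_span:
  assumes "subspace V" "set vs \<subseteq> V" "\<And>z. z \<in> V \<Longrightarrow> F z \<le> (G z :: real)"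
  shows "avg vs F \<le> avg vs G"
  using assms
proof (induction vs arbitrary: F G)
  case (Cons v vs)
  have "avg vs (\<lambda>z. F (z + v)) \<le> avg vs (\<lambda>z. G (z + v))" "avg vs (\<lambda>z. F (z - v)) \<le> avg vs (\<lambda>z. G (z - v))"
    using Cons.prems by (auto intro!: Cons.IH Cons.prems(3) subspace_add[of V] subspace_diff[of V])
  then show ?case by simp
qed (auto intro: subspace_0)
lemma avg_cong_span:
  assumes "subspace V" "set vs \<subseteq> V" "\<And>z. z \<in> V \<Longrightarrow> F z = G z"
  shows "avg vs F = avg vs G"
  using assms
proof (induction vs arbitrary: F G)
  case (Cons v vs)
  have "avg vs (\<lambda>z. F (z + v)) = avg vs (\<lambda>z. G (z + v))" "avg vs (\<lambda>z. F (z - v)) = avg vs (\<lambda>z. G (z - v))"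
    using Cons.prems by (auto intro!: Cons.IH Cons.prems(3) subspace_add[of V] subspace_diff[of V])
  then show ?case by simp
qed (auto intro: subspace_0)
lemma avg_abs: "\<bar>avg vs F\<bar> \<le> avg vs (\<lambda>z. \<bar>F z :: real\<bar>)"
proof -
  have "avg vs F \<le> avg vs (\<lambda>z. \<bar>F z\<bar>)" "avg vs (\<lambda>z. - F z) \<le> avg vs (\<lambda>z. \<bar>F z\<bar>)" by (intro avg_mono; simp)+
  then show ?thesis by (simp add: avg_minus abs_le_iff)
qed
lemma avg_append: "avg (xs @ ys) F = avg xs (\<lambda>x. avg ys (\<lambda>y. F (x + y)))"
proof (induction xs arbitrary: F)
  case (Cons v xs)
  show ?case
    by (simp only: append_Cons avg.simps Cons.IH avg_add[symmetric] avg_scaleR[symmetric])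
      (simp add: algebra_simps)
qed simp
lemma avg_map: "linear h \<Longrightarrow> avg (map h xs) F = avg xs (\<lambda>x. F (h x))"
  by (induction xs arbitrary: F) (simp_all add: linear_0 linear_add linear_diff)

text \<open>Real and imaginary part of the characteristic function: by independence of the signs,
  the mean of exp(i <v, z>) is the product of the numbers cos <v, w>.\<close>

lemma avg_cos_sin:
  "avg vs (\<lambda>z. cos (inner v z + \<theta>)) = cos \<theta> * (\<Prod>w\<leftarrow>vs. cos (inner v w))"
  "avg vs (\<lambda>z. sin (inner v z + \<theta>)) = sin \<theta> * (\<Prod>w\<leftarrow>vs. cos (inner v w))"
proof (induction vs arbitrary: \<theta>)
  case (Cons w vs)
  { case 1
    have "avg (w # vs) (\<lambda>z. cos (inner v z + \<theta>)) = (1/2) * (avg vs (\<lambda>z. cos (inner v z + (\<theta> + inner v w)))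
      + avg vs (\<lambda>z. cos (inner v z + (\<theta> - inner v w))))"
      by (simp add: inner_simps algebra_simps)
    also have "\<dots> = cos \<theta> * (\<Prod>w\<leftarrow>w # vs. cos (inner v w))"
      unfolding Cons by (simp add: cos_add cos_diff algebra_simps)
    finally show ?case . }
  { case 2
    have "avg (w # vs) (\<lambda>z. sin (inner v z + \<theta>)) = (1/2) * (avg vs (\<lambda>z. sin (inner v z + (\<theta> + inner v w)))
      + avg vs (\<lambda>z. sin (inner v z + (\<theta> - inner v w))))"
      by (simp add: inner_simps algebra_simps)
    also have "\<dots> = sin \<theta> * (\<Prod>w\<leftarrow>w # vs. cos (inner v w))"
      unfolding Cons by (simp add: sin_add sin_diff algebra_simps)
    finally show ?case . }
qed simp_all

text \<open>Differentiate the product formula for cos in the direction \<open>x\<close>: each factor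
  cos <v, w> contributes its logarithmic derivative, hence the tangents. This is the discrete form
  of Gaussian integration by parts.\<close>

lemma avg_inner_sin:
  assumes "\<forall>w\<in>set vs. cos (inner v w) \<noteq> 0"
  shows "avg vs (\<lambda>z. inner x z * sin (inner v z + \<theta>))
    = cos \<theta> * (\<Prod>w\<leftarrow>vs. cos (inner v w)) * (\<Sum>w\<leftarrow>vs. inner x w * tan (inner v w))"
  using assms
proof (induction vs arbitrary: \<theta>)
  case (Cons w vs)
  let ?a = "inner v w" and ?x = "inner x w"
  have "avg (w # vs) (\<lambda>z. inner x z * sin (inner v z + \<theta>)) =
     (1/2) * ((avg vs (\<lambda>z. inner x z * sin (inner v z + (\<theta> + ?a))) + ?x * avg vs (\<lambda>z. sin (inner v z + (\<theta> + ?a))))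
     + (avg vs (\<lambda>z. inner x z * sin (inner v z + (\<theta> - ?a))) - ?x * avg vs (\<lambda>z. sin (inner v z + (\<theta> - ?a)))))"
  proof -
    have e: "inner x (z + w) * sin (inner v (z + w) + \<theta>)
         = inner x z * sin (inner v z + (\<theta> + ?a)) + ?x * sin (inner v z + (\<theta> + ?a))"
       "inner x (z - w) * sin (inner v (z - w) + \<theta>)
         = inner x z * sin (inner v z + (\<theta> - ?a)) - ?x * sin (inner v z + (\<theta> - ?a))" for z
      by (simp_all add: inner_simps algebra_simps)
    show ?thesis
      unfolding avg.simps e avg_add avg_diff avg_cmult by simp
  qed
  also have "\<dots> = cos \<theta> * (\<Prod>w\<leftarrow>vs. cos (inner v w)) * (cos ?a * (\<Sum>w\<leftarrow>vs. inner x w * tan (inner v w)) + ?x * sin ?a)"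
  proof -
    have IH: "avg vs (\<lambda>z. inner x z * sin (inner v z + \<theta>))
       = cos \<theta> * (\<Prod>w\<leftarrow>vs. cos (inner v w)) * (\<Sum>w\<leftarrow>vs. inner x w * tan (inner v w))" for \<theta>
      by (rule Cons.IH) (use Cons.prems in auto)
    show ?thesis unfolding IH avg_cos_sin(2)
      by (simp add: cos_add cos_diff sin_add sin_diff algebra_simps)
  qed
  also have "sin ?a = cos ?a * tan ?a" using Cons.prems by (simp add: tan_def)
  finally show ?case by (simp add: algebra_simps)
qed simp

lemma avg_inner_zero: "avg vs (\<lambda>z. inner v z) = 0"
  by (induction vs) (simp_all add: inner_simps avg_add avg_diff)

text \<open>Distinct signs are uncorrelated, so cross terms average out. The induction needs an
  arbitrary offset \<open>y\<close>, because removing one sign shifts the argument.\<close>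

lemma avg_linear_sq:
  fixes h :: "'v::real_vector \<Rightarrow> 'w::real_inner"
  assumes "linear h"
  shows "avg vs (\<lambda>z. (norm (h z))\<^sup>2) = (\<Sum>w\<leftarrow>vs. (norm (h w))\<^sup>2)"
proof -
  have *: "avg vs (\<lambda>z. (norm (h z + y))\<^sup>2) = (norm y)\<^sup>2 + (\<Sum>w\<leftarrow>vs. (norm (h w))\<^sup>2)" for y
  proof (induction vs arbitrary: y)
    case Nil then show ?case by (simp add: linear_0 assms)
  next
    case (Cons w vs)
    have "h (z + w) + y = h z + (h w + y)" "h (z - w) + y = h z + (y - h w)" for z
      by (simp_all add: linear_add linear_diff assms)
    then have "avg (w # vs) (\<lambda>z. (norm (h z + y))\<^sup>2) = (1/2) * ((norm (h w + y))\<^sup>2 + (norm (y - h w))\<^sup>2)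
        + (\<Sum>w\<leftarrow>vs. (norm (h w))\<^sup>2)"
      by (simp only: avg.simps Cons.IH real_scaleR_def) simp
    also have "(norm (h w + y))\<^sup>2 + (norm (y - h w))\<^sup>2 = 2 * ((norm (h w))\<^sup>2 + (norm y)\<^sup>2)"
      by (simp add: power2_norm_eq_inner inner_simps inner_commute)
    finally show ?case by simp
  qed
  show ?thesis using *[of 0] by simp
qed

lemma avg_inner_inner: "avg vs (\<lambda>z. inner x z * inner y z) = (\<Sum>w\<leftarrow>vs. inner x w * inner y w)"
proof (induction vs)
  case (Cons w vs)
  have "inner x (z + w) * inner y (z + w) + inner x (z - w) * inner y (z - w)
     = 2 * (inner x z * inner y z) + 2 * (inner x w * inner y w)" for z
    by (simp add: inner_simps algebra_simps)
  then have "avg (w # vs) (\<lambda>z. inner x z * inner y z) = (1/2) * avg vs (\<lambda>z. 2 * (inner x z * inner y z) + 2 * (inner x w * inner y w))"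
    by (simp add: avg_add[symmetric])
  also have "\<dots> = avg vs (\<lambda>z. inner x z * inner y z) + inner x w * inner y w"
    unfolding avg_add avg_cmult by simp
  finally show ?case using Cons by simp
qed simp

text \<open>The constant 3 is the Gaussian one. Conditioning on one sign adds 6 a^2 S + a^4 to the
  fourth moment, and the square of S + a^2, taken three times, absorbs it.\<close>

lemma avg_inner_fourth: "avg vs (\<lambda>z. (inner x z)^4) \<le> 3 * (\<Sum>w\<leftarrow>vs. (inner x w)\<^sup>2)\<^sup>2"
proof (induction vs)
  case (Cons w vs)
  let ?a = "inner x w" and ?S = "\<Sum>w\<leftarrow>vs. (inner x w)\<^sup>2"
  have "(inner x (z + w))^4 + (inner x (z - w))^4 = 2 * (inner x z)^4 + (12 * ?a\<^sup>2) * (inner x z * inner x z) + 2 * ?a^4" for z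
    by (simp add: inner_simps power4_eq_xxxx power2_eq_square algebra_simps)
  then have "avg (w # vs) (\<lambda>z. (inner x z)^4) = (1/2) * avg vs (\<lambda>z. 2 * (inner x z)^4 + (12 * ?a\<^sup>2) * (inner x z * inner x z) + 2 * ?a^4)"
    by (simp add: avg_add[symmetric])
  also have "\<dots> = avg vs (\<lambda>z. (inner x z)^4) + 6 * ?a\<^sup>2 * ?S + ?a^4"
    unfolding avg_add avg_cmult avg_inner_inner by (simp add: power2_eq_square)
  also have "\<dots> \<le> 3 * ?S\<^sup>2 + 6 * ?a\<^sup>2 * ?S + 3 * ?a^4"
  proof -
    have "0 \<le> ?a^4" by simp
    then show ?thesis using Cons by linarith
  qed
  also have "\<dots> = 3 * (?a\<^sup>2 + ?S)\<^sup>2" by (simp add: power2_sum algebra_simps flip: power_mult)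
  finally show ?case by simp
qed simp

section \<open>Gaussian limits of trigonometric polynomials\<close>

text \<open>By the central limit theorem, signed sums over this list approach a centred Gaussian
  variable, with covariance s^2 times the identity when \<open>bs\<close> is a Parseval frame. Only
  explicit limits are used: \<open>cos_power_limit\<close> for the characteristic function and
  \<open>tan_limit\<close> for its derivative.\<close>

definition smp :: "real \<Rightarrow> 'v::real_vector list \<Rightarrow> nat \<Rightarrow> 'v list" where
  "smp s bs N = concat (replicate N (map (\<lambda>b. (s / sqrt N) *\<^sub>R b) bs))"

lemma smp_sum_list:
  fixes g :: "'v::real_vector \<Rightarrow> real"
  shows "(\<Sum>w\<leftarrow>smp s bs N. g w) = real N * (\<Sum>b\<leftarrow>bs. g ((s / sqrt N) *\<^sub>R b))"
proof -
  have "(\<Sum>w\<leftarrow>concat (replicate M (map h bs)). g w) = real M * (\<Sum>b\<leftarrow>bs. g (h b))" for M and h :: "'v \<Rightarrow> 'v"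
    by (induction M) (simp_all add: algebra_simps comp_def)
  then show ?thesis by (simp add: smp_def)
qed

lemma smp_prod_list:
  fixes g :: "'v::real_vector \<Rightarrow> real"
  shows "(\<Prod>w\<leftarrow>smp s bs N. g w) = (\<Prod>b\<leftarrow>bs. g ((s / sqrt N) *\<^sub>R b) ^ N)"
proof -
  have P: "(\<Prod>b\<leftarrow>bs. f b) * (\<Prod>b\<leftarrow>bs. h b) = (\<Prod>b\<leftarrow>bs. f b * h b)" for f h :: "'v \<Rightarrow> real"
    by (induction bs) (simp_all add: algebra_simps)
  have "(\<Prod>w\<leftarrow>concat (replicate M (map h bs)). g w) = (\<Prod>b\<leftarrow>bs. g (h b) ^ M)" for M and h :: "'v \<Rightarrow> 'v"
  proof (induction M)
    case 0 then show ?case by (induction bs) auto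
  next
    case (Suc M) then show ?case by (simp add: comp_def P)
  qed
  then show ?thesis by (simp add: smp_def)
qed

lemma set_smp: "set bs \<subseteq> V \<Longrightarrow> subspace V \<Longrightarrow> set (smp s bs N) \<subseteq> V"
  by (auto simp: smp_def subspace_scale)

lemma cos_power_limit: "(\<lambda>N. cos (t / sqrt (real N)) ^ N) \<longlonglongrightarrow> exp (- t\<^sup>2 / 2)"
proof (cases "t = 0")
  case False
  then have "t > 0 \<or> t < 0" by auto
  then show ?thesis
  proof
    assume "t > 0" then show ?thesis by real_asymp (simp add: power2_eq_square)
  next
    assume "t < 0" then show ?thesis by real_asymp (simp add: power2_eq_square)
  qed
qed simp

lemma tan_limit: "(\<lambda>N. real N * (x / sqrt (real N) * tan (t / sqrt (real N)))) \<longlonglongrightarrow> x * t"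
proof (cases "t = 0")
  case False
  then have "t > 0 \<or> t < 0" by auto
  then have "(\<lambda>N. real N * (1 / sqrt (real N) * tan (t / sqrt (real N)))) \<longlonglongrightarrow> t"
  proof
    assume "t > 0" then show ?thesis unfolding tan_def by real_asymp
  next
    assume "t < 0" then show ?thesis unfolding tan_def by real_asymp
  qed
  from tendsto_mult_left[OF this, of x] show ?thesis by (simp add: field_simps)
qed simp

text \<open>Schur's product theorem for powers of a Gram matrix. One factor <v_i, v_j> is expanded
  over \<open>bs\<close> and absorbed into the vectors \<open>e\<close>, which leaves a sum of
  expressions of lower power.\<close>

lemma gram_power_nonneg:
  fixes v :: "nat \<Rightarrow> 'v::real_inner" and e :: "nat \<Rightarrow> 'w::real_inner"
  assumes "\<And>i j. i < n \<Longrightarrow> j < n \<Longrightarrow> inner (v i) (v j) = (\<Sum>b\<leftarrow>bs. inner (v i) b * inner (v j) b)"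
  shows "0 \<le> (\<Sum>i<n. \<Sum>j<n. inner (e i) (e j) * inner (v i) (v j) ^ d)"
proof (induction d arbitrary: e)
  case 0
  have "(\<Sum>i<n. \<Sum>j<n. inner (e i) (e j)) = inner (\<Sum>i<n. e i) (\<Sum>i<n. e i)"
    by (simp add: inner_sum_left inner_sum_right) (rule sum.swap)
  then show ?case by simp
next
  case (Suc d)
  have "(\<Sum>i<n. \<Sum>j<n. inner (e i) (e j) * inner (v i) (v j) ^ Suc d)
     = (\<Sum>i<n. \<Sum>j<n. \<Sum>b\<leftarrow>bs. inner (inner (v i) b *\<^sub>R e i) (inner (v j) b *\<^sub>R e j) * inner (v i) (v j) ^ d)"
  proof (intro sum.cong refl)
    fix i j assume "i \<in> {..<n}" "j \<in> {..<n}"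
    then have ij: "i < n" "j < n" by auto
    let ?c = "inner (e i) (e j) * inner (v i) (v j) ^ d"
    have "(\<Sum>b\<leftarrow>bs. inner (inner (v i) b *\<^sub>R e i) (inner (v j) b *\<^sub>R e j) * inner (v i) (v j) ^ d)
        = (\<Sum>b\<leftarrow>bs. inner (v i) b * inner (v j) b * ?c)" by (simp add: ac_simps)
    also have "\<dots> = (\<Sum>b\<leftarrow>bs. inner (v i) b * inner (v j) b) * ?c" by (rule sum_list_mult_const)
    also have "\<dots> = inner (v i) (v j) * ?c" by (simp only: assms[OF ij])
    finally show "inner (e i) (e j) * inner (v i) (v j) ^ Suc d
        = (\<Sum>b\<leftarrow>bs. inner (inner (v i) b *\<^sub>R e i) (inner (v j) b *\<^sub>R e j) * inner (v i) (v j) ^ d)" by simp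
  qed
  also have "\<dots> = (\<Sum>b\<leftarrow>bs. \<Sum>i<n. \<Sum>j<n. inner (inner (v i) b *\<^sub>R e i) (inner (v j) b *\<^sub>R e j) * inner (v i) (v j) ^ d)"
    by (induction bs) (simp_all add: sum.distrib)
  also have "\<dots> \<ge> 0" 
    by (rule sum_list_nonneg) (use Suc.IH in \<open>auto simp del: inner_scaleR_left inner_scaleR_right\<close>)
  finally show ?case .
qed

text \<open>\<open>parseval\<close> makes \<open>bs\<close> a Parseval frame of \<open>V\<close>.
  The subspace is kept apart from the type because \<open>fmat\<close> has infinite dimension; in
  the application \<open>V\<close> is \<open>sq k\<close>, and \<open>bs\<close> consists of the
  matrix units and their multiples by \<i>.\<close>

locale sign_frame =
  fixes V :: "'v::real_inner set" and bs :: "'v list" and s :: real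
  assumes sub: "subspace V" and bs: "set bs \<subseteq> V"
    and parseval: "\<And>v w. v \<in> V \<Longrightarrow> w \<in> V \<Longrightarrow> inner v w = (\<Sum>b\<leftarrow>bs. inner v b * inner w b)"
begin

abbreviation S :: "nat \<Rightarrow> 'v list" where "S N \<equiv> smp s bs N"

lemma S_V: "set (S N) \<subseteq> V"
  by (rule set_smp[OF bs sub])

lemma parseval_norm: "v \<in> V \<Longrightarrow> (norm v)\<^sup>2 = (\<Sum>b\<leftarrow>bs. (inner v b)\<^sup>2)"
  by (subst power2_norm_eq_inner, subst parseval[of v v]) (simp_all add: power2_eq_square)

lemma cos_prod_limit:
  assumes "v \<in> V"
  shows "(\<lambda>N. \<Prod>w\<leftarrow>S N. cos (inner v w)) \<longlonglongrightarrow> exp (- (s\<^sup>2 * (norm v)\<^sup>2 / 2))"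
proof -
  have "(\<lambda>N. \<Prod>b\<leftarrow>xs. cos (s * inner v b / sqrt N) ^ N) \<longlonglongrightarrow> exp (- (s\<^sup>2 * (\<Sum>b\<leftarrow>xs. (inner v b)\<^sup>2) / 2))" for xs
  proof (induction xs)
    case (Cons b xs)
    from tendsto_mult[OF cos_power_limit Cons, of "s * inner v b"]
    show ?case by (simp add: exp_add[symmetric] power_mult_distrib algebra_simps add_divide_distrib diff_divide_distrib)
  qed simp
  from this[of bs] show ?thesis by (simp add: smp_prod_list parseval_norm[OF assms])
qed

lemma tan_sum_limit:
  assumes "v \<in> V" "x \<in> V"
  shows "(\<lambda>N. \<Sum>w\<leftarrow>S N. inner x w * tan (inner v w)) \<longlonglongrightarrow> s\<^sup>2 * inner x v"
proof -
  have "(\<lambda>N. real N * (\<Sum>b\<leftarrow>xs. (s * inner x b) / sqrt N * tan (s * inner v b / sqrt N)))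
     \<longlonglongrightarrow> s\<^sup>2 * (\<Sum>b\<leftarrow>xs. inner x b * inner v b)" for xs
  proof (induction xs)
    case (Cons b xs)
    from tendsto_add[OF tan_limit Cons, of "s * inner x b" "s * inner v b"]
    show ?case by (simp add: algebra_simps power2_eq_square)
  qed simp
  from this[of bs] show ?thesis
    by (simp add: smp_sum_list parseval[OF assms(2,1)])
qed

lemma cos_nonzero_eventually: "\<forall>\<^sub>F N in sequentially. \<forall>w\<in>set (S N). cos (inner v w) \<noteq> 0"
proof -
  have "\<forall>\<^sub>F N in sequentially. \<forall>b\<in>set bs. cos (s * inner v b / sqrt (real N)) \<noteq> 0"
  proof (intro eventually_ball_finite ballI)
    fix b
    have "(\<lambda>N. s * inner v b / sqrt (real N)) \<longlonglongrightarrow> 0"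
      by (intro tendsto_divide_0[OF tendsto_const] filterlim_at_top_imp_at_infinity
          filterlim_compose[OF sqrt_at_top] filterlim_real_sequentially)
    from tendsto_cos[OF this] have "(\<lambda>N. cos (s * inner v b / sqrt (real N))) \<longlonglongrightarrow> 1" by simp
    then show "\<forall>\<^sub>F N in sequentially. cos (s * inner v b / sqrt (real N)) \<noteq> 0"
      by (rule tendsto_imp_eventually_ne) simp
  qed simp
  then show ?thesis by eventually_elim (auto simp: smp_def)
qed

lemma second_moment:
  assumes "N \<ge> 1" "x \<in> V" "y \<in> V"
  shows "(\<Sum>w\<leftarrow>S N. inner x w * inner y w) = s\<^sup>2 * inner x y"
proof -
  have e: "inner x ((s / sqrt N) *\<^sub>R b) * inner y ((s / sqrt N) *\<^sub>R b) = (s\<^sup>2 / N) * (inner x b * inner y b)" for b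
    using assms(1) by (simp add: power2_eq_square)
  show ?thesis using assms(1)
    by (simp only: smp_sum_list e sum_list_const_mult parseval[OF assms(2,3)]) simp
qed

section \<open>Noise correlation and Hermite expansion of trigonometric polynomials\<close>

definition tp :: "nat \<Rightarrow> (nat \<Rightarrow> 'v) \<Rightarrow> (nat \<Rightarrow> real) \<Rightarrow> (nat \<Rightarrow> 'w::real_inner) \<Rightarrow> 'v \<Rightarrow> 'w" where
  "tp n v \<theta> c z = (\<Sum>i<n. cos (inner (v i) z + \<theta> i) *\<^sub>R c i)"

text \<open>The characteristic function at \<open>v\<close> of the limiting Gaussian
  variable.\<close>

definition gw :: "'v \<Rightarrow> real" where "gw v = exp (- (s\<^sup>2 * (norm v)\<^sup>2 / 2))"

text \<open>The correlation of \<open>tp n v \<theta> c\<close> at two Gaussian inputs of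
  correlation \<rho>, see \<open>noise_limit\<close>; cosh and sinh are the even and the odd part in
  Mehler's formula.\<close>

definition kern :: "nat \<Rightarrow> (nat \<Rightarrow> 'v) \<Rightarrow> (nat \<Rightarrow> real) \<Rightarrow> (nat \<Rightarrow> 'w::real_inner) \<Rightarrow> real \<Rightarrow> real" where
  "kern n v \<theta> c \<rho> = (\<Sum>i<n. \<Sum>j<n. inner (c i) (c j) * (gw (v i) * gw (v j) *
     (cos (\<theta> i) * cos (\<theta> j) * cosh (\<rho> * (s\<^sup>2 * inner (v i) (v j)))
      + sin (\<theta> i) * sin (\<theta> j) * sinh (\<rho> * (s\<^sup>2 * inner (v i) (v j))))))"

text \<open>The squared Gaussian norm of the part of \<open>tp n v \<theta> c\<close> of degree \<open>d\<close> in the Hermite expansion.\<close>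

definition chaos :: "nat \<Rightarrow> (nat \<Rightarrow> 'v) \<Rightarrow> (nat \<Rightarrow> real) \<Rightarrow> (nat \<Rightarrow> 'w::real_inner) \<Rightarrow> nat \<Rightarrow> real" where
  "chaos n v \<theta> c d = (\<Sum>i<n. \<Sum>j<n. inner (c i) (c j) * (gw (v i) * gw (v j) *
     (if even d then cos (\<theta> i) * cos (\<theta> j) else sin (\<theta> i) * sin (\<theta> j)))
      * (s\<^sup>2 * inner (v i) (v j)) ^ d / fact d)"

text \<open>The orthogonal projection of \<open>tp n v \<theta> c\<close> onto linear maps under the
  Gaussian limit law: by integration by parts, cos(<v, z> + \<theta>) projects to - gw v sin
  \<theta> <v, z>.\<close>

definition lin :: "nat \<Rightarrow> (nat \<Rightarrow> 'v) \<Rightarrow> (nat \<Rightarrow> real) \<Rightarrow> (nat \<Rightarrow> 'w::real_inner) \<Rightarrow> 'v \<Rightarrow> 'w" where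
  "lin n v \<theta> c z = (\<Sum>i<n. (- (gw (v i) * sin (\<theta> i)) * inner (v i) z) *\<^sub>R c i)"

lemma linear_lin: "linear (lin n v \<theta> c)"
proof (rule linearI)
  show "lin n v \<theta> c (x + y) = lin n v \<theta> c x + lin n v \<theta> c y" for x y
    by (simp only: lin_def inner_add_right distrib_left scaleR_left_distrib sum.distrib)
  show "lin n v \<theta> c (r *\<^sub>R x) = r *\<^sub>R lin n v \<theta> c x" for r x
    by (simp only: lin_def inner_scaleR_right scaleR_sum_right scaleR_scaleR mult.left_commute)
qed

text \<open>Products of cosines become cosines of linear forms in x and y, whose averages factor
  into characteristic functions. The relation \<rho>^2 + \<sigma>^2 = 1 cancels the surplus in the
  Gaussian exponents and leaves gw(v_i) gw(v_j) exp(t) or exp(-t) with t = \<rho> s^2 <v_i,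
  v_j>.\<close>

lemma noise_limit:
  assumes v: "\<And>i. i < n \<Longrightarrow> v i \<in> V" and \<rho>\<sigma>: "\<rho>\<^sup>2 + \<sigma>\<^sup>2 = 1"
  shows "(\<lambda>N. avg (S N) (\<lambda>x. avg (S N) (\<lambda>y. inner (tp n v \<theta> c (\<rho> *\<^sub>R y + \<sigma> *\<^sub>R x)) (tp n v \<theta> c y))))
     \<longlonglongrightarrow> kern n v \<theta> c \<rho>"
proof -
  define C where "C N w = (\<Prod>x\<leftarrow>S N. cos (inner w x))" for N w
  have M: "avg (S N) (\<lambda>x. avg (S N) (\<lambda>y. cos (inner (v i) (\<rho> *\<^sub>R y + \<sigma> *\<^sub>R x) + \<theta> i) * cos (inner (v j) y + \<theta> j)))
    = (1/2) * (cos (\<theta> i - \<theta> j) * C N (\<sigma> *\<^sub>R v i) * C N (\<rho> *\<^sub>R v i - v j)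
       + cos (\<theta> i + \<theta> j) * C N (\<sigma> *\<^sub>R v i) * C N (\<rho> *\<^sub>R v i + v j))" for N i j
  proof -
    have "cos (inner (v i) (\<rho> *\<^sub>R y + \<sigma> *\<^sub>R x) + \<theta> i) * cos (inner (v j) y + \<theta> j)
      = (1/2) * (cos (inner (\<rho> *\<^sub>R v i - v j) y + (inner (\<sigma> *\<^sub>R v i) x + (\<theta> i - \<theta> j)))
        + cos (inner (\<rho> *\<^sub>R v i + v j) y + (inner (\<sigma> *\<^sub>R v i) x + (\<theta> i + \<theta> j))))" for x y
      by (subst cos_times_cos) (simp add: inner_simps algebra_simps)
    note prod = this
    have "avg (S N) (\<lambda>y. cos (inner (v i) (\<rho> *\<^sub>R y + \<sigma> *\<^sub>R x) + \<theta> i) * cos (inner (v j) y + \<theta> j))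
      = (1/2) * (C N (\<rho> *\<^sub>R v i - v j) * cos (inner (\<sigma> *\<^sub>R v i) x + (\<theta> i - \<theta> j))
        + C N (\<rho> *\<^sub>R v i + v j) * cos (inner (\<sigma> *\<^sub>R v i) x + (\<theta> i + \<theta> j)))" for x
      unfolding prod avg_cmult avg_add avg_cos_sin C_def by (simp add: mult.commute)
    note inner_avg = this
    show ?thesis
      by (simp only: inner_avg avg_cmult avg_add avg_cos_sin(1)) (simp add: C_def mult_ac)
  qed
  have lim: "(\<lambda>N. avg (S N) (\<lambda>x. avg (S N) (\<lambda>y. cos (inner (v i) (\<rho> *\<^sub>R y + \<sigma> *\<^sub>R x) + \<theta> i) * cos (inner (v j) y + \<theta> j))))
    \<longlonglongrightarrow> gw (v i) * gw (v j) * (cos (\<theta> i) * cos (\<theta> j) * cosh (\<rho> * (s\<^sup>2 * inner (v i) (v j)))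
      + sin (\<theta> i) * sin (\<theta> j) * sinh (\<rho> * (s\<^sup>2 * inner (v i) (v j))))" if "i < n" "j < n" for i j
  proof -
    let ?t = "\<rho> * (s\<^sup>2 * inner (v i) (v j))"
    have CV: "(\<lambda>N. C N w) \<longlonglongrightarrow> gw w" if "w \<in> V" for w
      unfolding C_def gw_def by (rule cos_prod_limit[OF that])
    have V: "\<sigma> *\<^sub>R v i \<in> V" "\<rho> *\<^sub>R v i - v j \<in> V" "\<rho> *\<^sub>R v i + v j \<in> V"
      using v[OF that(1)] v[OF that(2)] sub by (simp_all add: subspace_scale subspace_add subspace_diff)
    have \<sigma>: "\<sigma>\<^sup>2 = 1 - \<rho>\<^sup>2" using \<rho>\<sigma> by simp
    have n1: "(norm (\<sigma> *\<^sub>R v i))\<^sup>2 = (1 - \<rho>\<^sup>2) * (norm (v i))\<^sup>2"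
      by (simp add: power_mult_distrib \<sigma>)
    have n2: "(norm (\<rho> *\<^sub>R v i - v j))\<^sup>2 = \<rho>\<^sup>2 * (norm (v i))\<^sup>2 - 2 * \<rho> * inner (v i) (v j) + (norm (v j))\<^sup>2"
      "(norm (\<rho> *\<^sub>R v i + v j))\<^sup>2 = \<rho>\<^sup>2 * (norm (v i))\<^sup>2 + 2 * \<rho> * inner (v i) (v j) + (norm (v j))\<^sup>2"
      by (simp_all only: power2_norm_eq_inner)
        (simp_all add: inner_simps inner_commute[of "v j" "v i"] power2_eq_square algebra_simps)
    have g1: "gw (\<sigma> *\<^sub>R v i) * gw (\<rho> *\<^sub>R v i - v j) = gw (v i) * gw (v j) * exp ?t"
      unfolding gw_def exp_add[symmetric] exp_inj_iff n1 n2 by (simp add: field_simps)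
    have g2: "gw (\<sigma> *\<^sub>R v i) * gw (\<rho> *\<^sub>R v i + v j) = gw (v i) * gw (v j) * exp (- ?t)"
      unfolding gw_def exp_add[symmetric] exp_inj_iff n1 n2 by (simp add: field_simps)
    have "(\<lambda>N. (1/2) * (cos (\<theta> i - \<theta> j) * C N (\<sigma> *\<^sub>R v i) * C N (\<rho> *\<^sub>R v i - v j)
       + cos (\<theta> i + \<theta> j) * C N (\<sigma> *\<^sub>R v i) * C N (\<rho> *\<^sub>R v i + v j)))
      \<longlonglongrightarrow> (1/2) * (cos (\<theta> i - \<theta> j) * gw (\<sigma> *\<^sub>R v i) * gw (\<rho> *\<^sub>R v i - v j)
       + cos (\<theta> i + \<theta> j) * gw (\<sigma> *\<^sub>R v i) * gw (\<rho> *\<^sub>R v i + v j))"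
      by (intro tendsto_intros CV V)
    also have "(1/2) * (cos (\<theta> i - \<theta> j) * gw (\<sigma> *\<^sub>R v i) * gw (\<rho> *\<^sub>R v i - v j)
       + cos (\<theta> i + \<theta> j) * gw (\<sigma> *\<^sub>R v i) * gw (\<rho> *\<^sub>R v i + v j))
     = gw (v i) * gw (v j) * (cos (\<theta> i) * cos (\<theta> j) * cosh ?t + sin (\<theta> i) * sin (\<theta> j) * sinh ?t)"
      unfolding mult.assoc g1 g2
      by (simp add: cosh_field_def sinh_field_def cos_add cos_diff field_simps)
    finally show ?thesis unfolding M .
  qed
  have "avg (S N) (\<lambda>x. avg (S N) (\<lambda>y. inner (tp n v \<theta> c (\<rho> *\<^sub>R y + \<sigma> *\<^sub>R x)) (tp n v \<theta> c y)))
     = (\<Sum>i<n. \<Sum>j<n. inner (c i) (c j) * avg (S N) (\<lambda>x. avg (S N) (\<lambda>y. cos (inner (v i) (\<rho> *\<^sub>R y + \<sigma> *\<^sub>R x) + \<theta> i) * cos (inner (v j) y + \<theta> j))))" for N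
  proof -
    have "inner (tp n v \<theta> c x) (tp n v \<theta> c y)
      = (\<Sum>i<n. \<Sum>j<n. inner (c i) (c j) * (cos (inner (v i) x + \<theta> i) * cos (inner (v j) y + \<theta> j)))" for x y
      unfolding tp_def[of n v \<theta> c x] inner_sum_left unfolding tp_def inner_sum_right
      by (intro sum.cong refl) (simp add: algebra_simps)
    then show ?thesis by (simp only: avg_sum avg_cmult)
  qed
  then show ?thesis unfolding kern_def by (simp only:) (intro tendsto_sum tendsto_mult_left lim; simp)
qed

text \<open>The limit equals the squared norm of \<open>lin\<close> in \<open>lin_moment\<close>, as
  it must for an orthogonal projection. The cosine is written as a shifted sine to apply
  \<open>avg_inner_sin\<close>.\<close>

lemma cross_limit:
  assumes v: "\<And>i. i < n \<Longrightarrow> v i \<in> V"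
  shows "(\<lambda>N. avg (S N) (\<lambda>y. inner (tp n v \<theta> c y) (lin n v \<theta> c y))) \<longlonglongrightarrow> chaos n v \<theta> c 1"
proof -
  have lim: "(\<lambda>N. avg (S N) (\<lambda>y. inner (v j) y * cos (inner (v i) y + \<theta> i)))
     \<longlonglongrightarrow> - sin (\<theta> i) * gw (v i) * (s\<^sup>2 * inner (v j) (v i))" if "i < n" "j < n" for i j
  proof -
    have "\<forall>\<^sub>F N in sequentially. avg (S N) (\<lambda>y. inner (v j) y * cos (inner (v i) y + \<theta> i))
      = - sin (\<theta> i) * (\<Prod>w\<leftarrow>S N. cos (inner (v i) w)) * (\<Sum>w\<leftarrow>S N. inner (v j) w * tan (inner (v i) w))"
      using cos_nonzero_eventually[of "v i"]
    proof eventually_elim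
      case (elim N)
      have "cos (t + \<theta> i) = sin (t + (\<theta> i + pi / 2))" for t
        by (simp add: sin_add cos_add)
      then show ?case using avg_inner_sin[OF elim, of "v j" "\<theta> i + pi / 2"] by (simp add: cos_add)
    qed
    moreover have "(\<lambda>N. - sin (\<theta> i) * (\<Prod>w\<leftarrow>S N. cos (inner (v i) w)) * (\<Sum>w\<leftarrow>S N. inner (v j) w * tan (inner (v i) w)))
      \<longlonglongrightarrow> - sin (\<theta> i) * gw (v i) * (s\<^sup>2 * inner (v j) (v i))"
      unfolding gw_def using v that by (intro tendsto_intros cos_prod_limit tan_sum_limit) auto
    ultimately show ?thesis by (simp add: tendsto_cong)
  qed
  have eq: "avg (S N) (\<lambda>y. inner (tp n v \<theta> c y) (lin n v \<theta> c y))
    = (\<Sum>i<n. \<Sum>j<n. (inner (c i) (c j) * - (gw (v j) * sin (\<theta> j))) * avg (S N) (\<lambda>y. inner (v j) y * cos (inner (v i) y + \<theta> i)))" for N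
  proof -
    have "inner (tp n v \<theta> c y) (lin n v \<theta> c y)
      = (\<Sum>i<n. \<Sum>j<n. (inner (c i) (c j) * - (gw (v j) * sin (\<theta> j))) * (inner (v j) y * cos (inner (v i) y + \<theta> i)))" for y
      unfolding tp_def inner_sum_left unfolding lin_def inner_sum_right
      by (intro sum.cong refl) (simp add: algebra_simps)
    then show ?thesis by (simp only: avg_sum avg_cmult)
  qed
  let ?X = "\<Sum>i<n. \<Sum>j<n. (inner (c i) (c j) * - (gw (v j) * sin (\<theta> j))) * (- sin (\<theta> i) * gw (v i) * (s\<^sup>2 * inner (v j) (v i)))"
  have "?X = chaos n v \<theta> c 1"
    unfolding chaos_def by (intro sum.cong refl) (simp add: inner_commute algebra_simps)
  moreover have "(\<lambda>N. avg (S N) (\<lambda>y. inner (tp n v \<theta> c y) (lin n v \<theta> c y)))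
    \<longlonglongrightarrow> (\<Sum>i<n. \<Sum>j<n. (inner (c i) (c j) * - (gw (v j) * sin (\<theta> j))) * (- sin (\<theta> i) * gw (v i) * (s\<^sup>2 * inner (v j) (v i))))"
    unfolding eq by (intro tendsto_sum tendsto_mult_left lim) auto
  ultimately show ?thesis by simp
qed

lemma lin_moment:
  assumes v: "\<And>i. i < n \<Longrightarrow> v i \<in> V" and "N \<ge> 1"
  shows "avg (S N) (\<lambda>y. (norm (lin n v \<theta> c y))\<^sup>2) = chaos n v \<theta> c 1"
proof -
  have "(norm (lin n v \<theta> c y))\<^sup>2
    = (\<Sum>i<n. \<Sum>j<n. (inner (c i) (c j) * (gw (v i) * sin (\<theta> i) * gw (v j) * sin (\<theta> j))) * (inner (v i) y * inner (v j) y))" for y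
    unfolding power2_norm_eq_inner lin_def inner_sum_left
    by (intro sum.cong refl) (simp add: inner_sum_right sum_distrib_left algebra_simps)
  then have "avg (S N) (\<lambda>y. (norm (lin n v \<theta> c y))\<^sup>2)
    = (\<Sum>i<n. \<Sum>j<n. (inner (c i) (c j) * (gw (v i) * sin (\<theta> i) * gw (v j) * sin (\<theta> j))) * (\<Sum>w\<leftarrow>S N. inner (v i) w * inner (v j) w))"
    by (simp only: avg_sum avg_cmult avg_inner_inner)
  also have "\<dots> = chaos n v \<theta> c 1"
    unfolding chaos_def using assms by (intro sum.cong refl) (simp add: second_moment)
  finally show ?thesis .
qed

lemma degree_one_distance:
  assumes v: "\<And>i. i < n \<Longrightarrow> v i \<in> V"
  shows "(\<lambda>N. avg (S N) (\<lambda>y. (norm (tp n v \<theta> c y - lin n v \<theta> c y))\<^sup>2)) \<longlonglongrightarrow> kern n v \<theta> c 1 - chaos n v \<theta> c 1"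
proof -
  let ?f = "tp n v \<theta> c" and ?g = "lin n v \<theta> c"
  have eq: "(norm (?f y - ?g y))\<^sup>2 = inner (?f y) (?f y) - 2 * inner (?f y) (?g y) + (norm (?g y))\<^sup>2" for y
    by (simp add: power2_norm_eq_inner inner_simps inner_commute)
  have "(\<lambda>N. avg (S N) (\<lambda>y. inner (?f y) (?f y))) \<longlonglongrightarrow> kern n v \<theta> c 1"
    using noise_limit[of n v 1 0 \<theta> c] v by simp
  moreover have "(\<lambda>N. avg (S N) (\<lambda>y. (norm (?g y))\<^sup>2)) \<longlonglongrightarrow> chaos n v \<theta> c 1"
    by (rule tendsto_eventually, rule eventually_sequentiallyI[of 1]) (simp add: lin_moment v)
  ultimately have "(\<lambda>N. avg (S N) (\<lambda>y. inner (?f y) (?f y)) - 2 * avg (S N) (\<lambda>y. inner (?f y) (?g y)) + avg (S N) (\<lambda>y. (norm (?g y))\<^sup>2))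
    \<longlonglongrightarrow> kern n v \<theta> c 1 - 2 * chaos n v \<theta> c 1 + chaos n v \<theta> c 1"
    by (intro tendsto_intros cross_limit v)
  then show ?thesis unfolding eq avg_add avg_diff avg_cmult by simp
qed

lemma chaos_nonneg:
  assumes v: "\<And>i. i < n \<Longrightarrow> v i \<in> V"
  shows "0 \<le> chaos n v \<theta> c d"
proof -
  define e where "e i = (gw (v i) * (if even d then cos (\<theta> i) else sin (\<theta> i))) *\<^sub>R c i" for i
  have "0 \<le> (\<Sum>i<n. \<Sum>j<n. inner (e i) (e j) * inner (v i) (v j) ^ d)"
    by (rule gram_power_nonneg) (auto intro: parseval v)
  then have "0 \<le> (s\<^sup>2) ^ d / fact d * (\<Sum>i<n. \<Sum>j<n. inner (e i) (e j) * inner (v i) (v j) ^ d)"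
    by (intro mult_nonneg_nonneg) auto
  also have "\<dots> = chaos n v \<theta> c d"
    unfolding chaos_def sum_distrib_left e_def by (intro sum.cong refl) (simp add: power_mult_distrib algebra_simps)
  finally show ?thesis .
qed

text \<open>The power series of cosh and sinh: noise of correlation \<rho> damps the part of degree
  d by \<rho>^d.\<close>

lemma kern_sums: "(\<lambda>d. \<rho> ^ d * chaos n v \<theta> c d) sums kern n v \<theta> c \<rho>"
proof -
  have *: "(\<lambda>d. (if even d then a else b) * (\<rho> * t) ^ d / fact d) sums (a * cosh (\<rho> * t) + b * sinh (\<rho> * t))" for a b t :: real
  proof -
    have "(\<lambda>d. a * (if even d then (\<rho> * t) ^ d /\<^sub>R fact d else 0) + b * (if even d then 0 else (\<rho> * t) ^ d /\<^sub>R fact d))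
      sums (a * cosh (\<rho> * t) + b * sinh (\<rho> * t))"
      by (intro sums_add sums_mult cosh_converges sinh_converges)
    moreover have "a * (if even d then (\<rho> * t) ^ d /\<^sub>R fact d else 0) + b * (if even d then 0 else (\<rho> * t) ^ d /\<^sub>R fact d)
      = (if even d then a else b) * (\<rho> * t) ^ d / fact d" for d
      by (simp add: field_simps)
    ultimately show ?thesis by simp
  qed
  have "(\<lambda>d. \<Sum>i<n. \<Sum>j<n. inner (c i) (c j) * (gw (v i) * gw (v j) *
     ((if even d then cos (\<theta> i) * cos (\<theta> j) else sin (\<theta> i) * sin (\<theta> j)) * (\<rho> * (s\<^sup>2 * inner (v i) (v j))) ^ d / fact d)))
    sums kern n v \<theta> c \<rho>"
    unfolding kern_def by (intro sums_sum sums_mult *)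
  moreover have "(\<Sum>i<n. \<Sum>j<n. inner (c i) (c j) * (gw (v i) * gw (v j) *
     ((if even d then cos (\<theta> i) * cos (\<theta> j) else sin (\<theta> i) * sin (\<theta> j)) * (\<rho> * (s\<^sup>2 * inner (v i) (v j))) ^ d / fact d)))
    = \<rho> ^ d * chaos n v \<theta> c d" for d
    unfolding chaos_def sum_distrib_left
    by (intro sum.cong refl) (simp add: power_mult_distrib)
  ultimately show ?thesis by simp
qed

text \<open>With q_d the squared norm in degree d, the hypotheses say that the sum of \<rho>^d q_d
  is about \<rho> at 0, 3/5 and 1. In the combination with weights (3/5)^2 - (3/5)^d all terms with
  d >= 2 are nonnegative, which bounds q_1 from below. The point 3/5 is taken because \<sigma> = 4/5
  is then rational; the computation gives 28/3, rounded up to 10.\<close>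

lemma degree_one_dominates:
  assumes v: "\<And>i. i < n \<Longrightarrow> v i \<in> V"
    and "\<bar>kern n v \<theta> c 0\<bar> \<le> \<eta>" "\<bar>kern n v \<theta> c (3/5) - 3/5\<bar> \<le> \<eta>" "\<bar>kern n v \<theta> c 1 - 1\<bar> \<le> \<eta>"
  shows "kern n v \<theta> c 1 - chaos n v \<theta> c 1 \<le> 10 * \<eta>"
proof -
  let ?K = "kern n v \<theta> c" and ?q = "chaos n v \<theta> c"
  have q0: "?K 0 = ?q 0" using sums_unique2[OF kern_sums[of 0 n v \<theta> c], of "?q 0"] sums_If_finite_set[of "{0}" ?q]
    by (simp add: power_0_left if_distrib[of "\<lambda>x. x * _"] cong: if_cong)
  have "(\<lambda>d. (9/25) * (1 ^ d * ?q d) - (3/5) ^ d * ?q d) sums ((9/25) * ?K 1 - ?K (3/5))"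
    by (intro sums_diff sums_mult kern_sums)
  then have S: "(\<lambda>d. ((3/5)^2 - (3/5) ^ d) * ?q d) sums ((9/25) * ?K 1 - ?K (3/5))"
    by (simp add: algebra_simps power2_eq_square)
  have "(\<Sum>d\<in>{0,1}. ((3/5)^2 - (3/5) ^ d) * ?q d) \<le> (\<Sum>d. ((3/5)^2 - (3/5) ^ d) * ?q d)"
  proof (rule sum_le_suminf)
    fix d :: nat assume "d \<in> - {0, 1}"
    then show "0 \<le> ((3/5)^2 - (3/5) ^ d) * ?q d"
    proof -
      assume "d \<in> - {0, 1}"
      then have "(3/5::real) ^ d \<le> (3/5) ^ 2" by (intro power_decreasing) auto
      then show "0 \<le> ((3/5)^2 - (3/5) ^ d) * ?q d" using chaos_nonneg[of n v \<theta> c d, OF v] by simp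
    qed
  qed (use S in \<open>auto simp: sums_iff\<close>)
  also have "\<dots> = (9/25) * ?K 1 - ?K (3/5)" using S by (simp add: sums_iff)
  finally have "- (16/25) * ?q 0 - (6/25) * ?q 1 \<le> (9/25) * ?K 1 - ?K (3/5)"
    by (simp add: power2_eq_square)
  then show ?thesis using assms(2-4) unfolding q0 by linarith
qed

end

section \<open>Approximation of Lipschitz maps by trigonometric polynomials\<close>

lemma bernstein_variance:
  assumes "M \<ge> 1" "0 \<le> x" "x \<le> 1"
  shows "(\<Sum>j\<le>M. Bernstein M j x * (real j / real M - x)\<^sup>2) \<le> 1 / real M"
proof -
  have "(\<Sum>j\<le>M. Bernstein M j x * (real j / real M - x)\<^sup>2)
    = (\<Sum>j\<le>M. (real j * (real j - 1) * Bernstein M j x) / (real M)\<^sup>2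
        + (1 - 2 * real M * x) / (real M)\<^sup>2 * (real j * Bernstein M j x) + x\<^sup>2 * Bernstein M j x)"
    using assms by (intro sum.cong refl) (simp add: field_simps power2_eq_square)
  also have "\<dots> = (real M * (real M - 1) * x\<^sup>2) / (real M)\<^sup>2 + (1 - 2 * real M * x) / (real M)\<^sup>2 * (real M * x) + x\<^sup>2"
    by (simp only: sum.distrib sum_divide_distrib[symmetric] sum_distrib_left[symmetric] sum_k_Bernstein sum_kk_Bernstein sum_Bernstein mult_1_right)
  also have "\<dots> = x * (1 - x) / real M" using assms by (simp add: field_simps power2_eq_square)
  also have "\<dots> \<le> 1 / real M" using assms by (intro divide_right_mono) (auto intro: mult_le_one)
  finally show ?thesis .
qed

context sign_frame
begin

definition trig :: "('v \<Rightarrow> 'w::real_inner) \<Rightarrow> bool" where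
  "trig f \<longleftrightarrow> (\<exists>n v \<theta> c. (\<forall>i<n. v i \<in> V) \<and> f = tp n v \<theta> c)"

lemma trig_single: "v \<in> V \<Longrightarrow> trig (\<lambda>z. cos (inner v z + \<theta>) *\<^sub>R c)"
  unfolding trig_def by (rule exI[of _ 1], rule exI[of _ "\<lambda>_. v"]) (force simp: tp_def)

lemma trig_zero: "trig (\<lambda>z. 0)"
  unfolding trig_def by (rule exI[of _ 0], (rule exI)+) (auto simp: tp_def)

lemma trig_add:
  assumes "trig f" "trig g" shows "trig (\<lambda>z. f z + g z)"
proof -
  obtain n v \<theta> c m w \<eta> d where f: "\<forall>i<n. v i \<in> V" "f = tp n v \<theta> c" and g: "\<forall>i<m. w i \<in> V" "g = tp m w \<eta> d"
    using assms unfolding trig_def by blast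
  define v' where "v' i = (if i < n then v i else w (i - n))" for i
  define \<theta>' where "\<theta>' i = (if i < n then \<theta> i else \<eta> (i - n))" for i
  define c' where "c' i = (if i < n then c i else d (i - n))" for i
  have "(\<Sum>i<n + m. cos (inner (v' i) z + \<theta>' i) *\<^sub>R c' i)
     = (\<Sum>i<n. cos (inner (v' i) z + \<theta>' i) *\<^sub>R c' i) + (\<Sum>i<m. cos (inner (v' (n + i)) z + \<theta>' (n + i)) *\<^sub>R c' (n + i))" for z
    by (induction m) (simp_all add: add.assoc)
  then have "(\<lambda>z. f z + g z) = tp (n + m) v' \<theta>' c'"
    by (auto simp: f g tp_def v'_def \<theta>'_def c'_def)
  moreover have "\<forall>i<n + m. v' i \<in> V" using f g by (auto simp: v'_def)
  ultimately show ?thesis unfolding trig_def by blast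
qed

lemma trig_sum: "(\<And>i. i \<in> I \<Longrightarrow> trig (f i)) \<Longrightarrow> trig (\<lambda>z. \<Sum>i\<in>I. f i z)"
  by (induction I rule: infinite_finite_induct) (auto intro: trig_zero trig_add)

lemma trig_const: "trig (\<lambda>z. c)"
  using trig_single[OF subspace_0[OF sub], of 0 c] by simp

lemma trig_scaleR:
  fixes f :: "'v \<Rightarrow> real"
  assumes "trig f" shows "trig (\<lambda>z. f z *\<^sub>R c)"
proof -
  obtain n v \<theta> d where f: "\<forall>i<n. v i \<in> V" "f = tp n v \<theta> d"
    using assms unfolding trig_def by blast
  have "trig (\<lambda>z. \<Sum>i<n. cos (inner (v i) z + \<theta> i) *\<^sub>R (d i *\<^sub>R c))"
    by (intro trig_sum trig_single) (use f in auto)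
  then show ?thesis by (simp add: f tp_def scaleR_left.sum)
qed

lemma trig_mult:
  fixes f g :: "'v \<Rightarrow> real"
  assumes "trig f" "trig g" shows "trig (\<lambda>z. f z * g z)"
proof -
  obtain n v \<theta> c m w \<eta> d where f: "\<forall>i<n. v i \<in> V" "f = tp n v \<theta> c" and g: "\<forall>i<m. w i \<in> V" "g = tp m w \<eta> d"
    using assms unfolding trig_def by blast
  have "f z * g z = (\<Sum>i<n. \<Sum>j<m. cos (inner (v i - w j) z + (\<theta> i - \<eta> j)) *\<^sub>R (c i * d j / 2)
      + cos (inner (v i + w j) z + (\<theta> i + \<eta> j)) *\<^sub>R (c i * d j / 2))" for z
  proof -
    have "f z * g z = (\<Sum>i<n. \<Sum>j<m. (cos (inner (v i) z + \<theta> i) * c i) * (cos (inner (w j) z + \<eta> j) * d j))"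
      by (simp add: f g tp_def sum_product)
    also have "\<dots> = (\<Sum>i<n. \<Sum>j<m. cos (inner (v i - w j) z + (\<theta> i - \<eta> j)) *\<^sub>R (c i * d j / 2)
      + cos (inner (v i + w j) z + (\<theta> i + \<eta> j)) *\<^sub>R (c i * d j / 2))"
    proof (intro sum.cong refl)
      fix i j
      have "cos (inner (v i) z + \<theta> i) * cos (inner (w j) z + \<eta> j)
        = (cos (inner (v i - w j) z + (\<theta> i - \<eta> j)) + cos (inner (v i + w j) z + (\<theta> i + \<eta> j))) / 2"
        by (subst cos_times_cos) (simp add: inner_simps algebra_simps)
      then show "(cos (inner (v i) z + \<theta> i) * c i) * (cos (inner (w j) z + \<eta> j) * d j)
        = cos (inner (v i - w j) z + (\<theta> i - \<eta> j)) *\<^sub>R (c i * d j / 2)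
      + cos (inner (v i + w j) z + (\<theta> i + \<eta> j)) *\<^sub>R (c i * d j / 2)"
        by (simp add: field_simps)
    qed
    finally show ?thesis .
  qed
  moreover have "trig (\<lambda>z. \<Sum>i<n. \<Sum>j<m. cos (inner (v i - w j) z + (\<theta> i - \<eta> j)) *\<^sub>R (c i * d j / 2)
      + cos (inner (v i + w j) z + (\<theta> i + \<eta> j)) *\<^sub>R (c i * d j / 2))"
    by (intro trig_sum trig_add trig_single) (use f g sub in \<open>auto intro: subspace_add subspace_diff\<close>)
  ultimately show ?thesis by simp
qed

lemma trig_power: "trig (f :: 'v \<Rightarrow> real) \<Longrightarrow> trig (\<lambda>z. f z ^ n)"
  by (induction n) (auto intro: trig_const trig_mult)
lemma trig_prod: "finite I \<Longrightarrow> (\<And>i. i \<in> I \<Longrightarrow> trig (f i :: 'v \<Rightarrow> real)) \<Longrightarrow> trig (\<lambda>z. \<Prod>i\<in>I. f i z)"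
  by (induction I rule: finite_induct) (auto intro: trig_const trig_mult)

lemma trig_bernstein:
  assumes "b \<in> V"
  shows "trig (\<lambda>z. Bernstein M j ((1 + sin (inner b z / B)) / 2))"
proof -
  have "sin (inner b z / B) = cos (inner ((1 / B) *\<^sub>R b) z + - (pi / 2)) *\<^sub>R 1" for z
    by (simp add: cos_diff)
  moreover have "trig (\<lambda>z. cos (inner ((1 / B) *\<^sub>R b) z + - (pi / 2)) *\<^sub>R (1::real))"
    by (intro trig_single subspace_scale[OF sub] assms)
  ultimately have s: "trig (\<lambda>z. sin (inner b z / B))" by simp
  have t: "trig (\<lambda>z. (1 + sin (inner b z / B)) * (1/2))" "trig (\<lambda>z. 1 + (-1) * ((1 + sin (inner b z / B)) * (1/2)))"
    by (intro trig_mult trig_add trig_const s)+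
  have "trig (\<lambda>z. real (M choose j) * ((1 + sin (inner b z / B)) * (1/2)) ^ j * (1 + (-1) * ((1 + sin (inner b z / B)) * (1/2))) ^ (M - j))"
    by (rule trig_mult[OF trig_mult[OF trig_const trig_power[OF t(1)]] trig_power[OF t(2)]])
  moreover have "1 + (-1) * ((1 + t) * (1/2)) = 1 - (1 + t) / 2" "(1 + t) * (1/2) = (1 + t) / 2" for t :: real
    by (simp_all add: field_simps)
  ultimately show ?thesis unfolding Bernstein_def by (simp only:)
qed

lemma expand_frame:
  assumes "z \<in> V"
  shows "z = (\<Sum>p<length bs. inner (bs ! p) z *\<^sub>R (bs ! p))"
proof -
  let ?z = "\<Sum>p<length bs. inner (bs ! p) z *\<^sub>R (bs ! p)"
  have b: "bs ! p \<in> V" if "p < length bs" for p using bs that by auto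
  have zV: "?z \<in> V" by (intro subspace_sum[OF sub] subspace_scale[OF sub]) (use b in auto)
  have d: "z - ?z \<in> V" using zV assms sub by (simp add: subspace_diff)
  have "inner ?z (z - ?z) = inner z (z - ?z)"
    using parseval[OF assms d]
    by (simp add: inner_sum_left sum_list_sum_nth atLeast0LessThan inner_commute)
  then have "inner (z - ?z) (z - ?z) = 0" by (simp add: inner_diff_left)
  then show ?thesis by simp
qed

text \<open>A Bernstein operator in the variables (1 + sin(<b, z> / B)) / 2, which lie in [0, 1]. It
  averages \<open>F\<close> over grid points near the vector with coordinates B sin(<b, z> / B), and
  these approximate <b, z> up to a quadratic error. The growth of the bound in z is harmless because
  fourth moments of the samples are finite.\<close>

lemma trig_approx:
  fixes F :: "'v \<Rightarrow> 'w::real_inner"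
  assumes Lip: "\<And>x y. x \<in> V \<Longrightarrow> y \<in> V \<Longrightarrow> norm (F x - F y) \<le> L * norm (x - y) + \<delta>"
    and L: "0 \<le> L" and \<kappa>: "0 < \<kappa>"
  shows "\<exists>f. trig f \<and> (\<forall>z\<in>V. norm (f z - F z) \<le> \<delta> + \<kappa> + \<kappa> * (\<Sum>b\<leftarrow>bs. (inner b z)\<^sup>2))"
proof -
  let ?m = "length bs" and ?b = "\<lambda>p. bs ! p"
  have b: "?b p \<in> V" if "p < ?m" for p using bs that by auto
  define A where "A = L * (\<Sum>p<?m. norm (?b p)) + 1"
  have A: "A > 0" using L by (auto simp: A_def intro!: add_nonneg_pos mult_nonneg_nonneg sum_nonneg)
  \<comment> \<open>\<open>A\<close> dominates L times the total length of the frame. The grid error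
    \<eta> is to cost half of \<kappa>, and a large \<open>B\<close> makes the sine error at most
    \<kappa> times the squared coordinate.\<close>
  define \<eta> B where "\<eta> = \<kappa> / (2 * A)" and "B = A / \<kappa>"
  have \<eta>: "\<eta> > 0" and B: "B > 0" using A \<kappa> by (auto simp: \<eta>_def B_def)
  \<comment> \<open>So many grid points that the Bernstein variance 1 / M, weighted by B^2 / \<eta>,
    costs the other half of \<kappa>.\<close>
  obtain M :: nat where M: "real M > 2 * B\<^sup>2 * A / (\<eta> * \<kappa>)" using reals_Archimedean2 by blast
  have "0 \<le> 2 * B\<^sup>2 * A / (\<eta> * \<kappa>)" using A B \<eta> \<kappa> by simp
  then have M1: "M \<ge> 1" using M by linarith
  define x where "x p z = (1 + sin (inner (?b p) z / B)) / 2" for p z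
  have x: "0 \<le> x p z" "x p z \<le> 1" for p z
  proof -
    have "0 \<le> (1 + t) / 2 \<and> (1 + t) / 2 \<le> 1" if "-1 \<le> t" "t \<le> 1" for t :: real using that by simp
    then show "0 \<le> x p z" "x p z \<le> 1" unfolding x_def using sin_ge_minus_one sin_le_one by blast+
  qed
  define I where "I = PiE {..<?m} (\<lambda>_. {..M})"
  have I: "finite I" unfolding I_def by (intro finite_PiE) auto
  define T where "T c = (\<Sum>p<?m. (B * (2 * real (c p) / real M - 1)) *\<^sub>R ?b p)" for c
  have TV: "T c \<in> V" for c unfolding T_def by (intro subspace_sum[OF sub] subspace_scale[OF sub]) (use b in auto)
  \<comment> \<open>For each z the products of Bernstein weights form a probability distribution on
    the grid \<open>I\<close>, with independent coordinates; hence \<open>W1\<close> and the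
    marginals \<open>marg\<close>.\<close>
  define W where "W c z = (\<Prod>p<?m. Bernstein M (c p) (x p z))" for c z
  have W0: "0 \<le> W c z" for c z unfolding W_def by (intro prod_nonneg ballI Bernstein_nonneg x)
  have W1: "(\<Sum>c\<in>I. W c z) = 1" for z
    unfolding W_def I_def by (subst prod_sum_PiE[symmetric]) auto
  have marg: "(\<Sum>c\<in>I. W c z * g (c q)) = (\<Sum>j\<le>M. Bernstein M j (x q z) * g j)" if q: "q < ?m" for q g z
  proof -
    have "W c z * g (c q) = (\<Prod>p<?m. Bernstein M (c p) (x p z) * (if p = q then g (c p) else 1))" for c
      unfolding prod.distrib W_def using q by (simp add: prod.delta)
    then have "(\<Sum>c\<in>I. W c z * g (c q)) = (\<Prod>p<?m. \<Sum>j\<le>M. Bernstein M j (x p z) * (if p = q then g j else 1))"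
      unfolding I_def by (subst prod_sum_PiE) auto
    also have "\<dots> = (\<Prod>p<?m. if p = q then (\<Sum>j\<le>M. Bernstein M j (x p z) * g j) else 1)"
      by (intro prod.cong refl) auto
    also have "\<dots> = (\<Sum>j\<le>M. Bernstein M j (x q z) * g j)" using q by (simp add: prod.delta)
    finally show ?thesis .
  qed
  define f where "f z = (\<Sum>c\<in>I. W c z *\<^sub>R F (T c))" for z
  have "trig f"
    unfolding f_def W_def x_def
    by (intro trig_sum trig_scaleR trig_prod trig_bernstein) (use b in auto)
  moreover have "norm (f z - F z) \<le> \<delta> + \<kappa> + \<kappa> * (\<Sum>b\<leftarrow>bs. (inner b z)\<^sup>2)" if z: "z \<in> V" for z
  proof -
    let ?z = "\<lambda>p. inner (?b p) z"
    define t where "t c p = (real (c p) / real M - x p z)\<^sup>2" for c p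
    have TZ: "norm (F (T c) - F z) \<le> \<delta> + (\<Sum>p<?m. L * norm (?b p) * (\<eta> + B\<^sup>2 / \<eta> * t c p + (?z p)\<^sup>2 / (2 * B)))" for c
    proof -
      have "norm (T c - z) \<le> (\<Sum>p<?m. norm (?b p) * (\<eta> + B\<^sup>2 / \<eta> * t c p + (?z p)\<^sup>2 / (2 * B)))"
      proof -
        have "T c - z = (\<Sum>p<?m. (B * (2 * real (c p) / real M - 1) - ?z p) *\<^sub>R ?b p)"
          by (subst expand_frame[OF z]) (simp add: T_def sum_subtractf[symmetric] scaleR_left_diff_distrib)
        also have "norm \<dots> \<le> (\<Sum>p<?m. norm (?b p) * (\<eta> + B\<^sup>2 / \<eta> * t c p + (?z p)\<^sup>2 / (2 * B)))"
        proof (rule sum_norm_le)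
          fix p
          let ?a = "real (c p) / real M - x p z"
          have e: "B * (2 * real (c p) / real M - 1) - ?z p = 2 * B * ?a + (B * sin (?z p / B) - ?z p)"
            by (simp add: x_def field_simps)
          have "\<bar>sin (?z p / B) - ?z p / B\<bar> \<le> (?z p / B)\<^sup>2 / 2"
            using Maclaurin_sin_bound[of "?z p / B" 2]
            by (simp add: lessThan_Suc numeral_2_eq_2 sin_coeff_def)
          then have "B * \<bar>sin (?z p / B) - ?z p / B\<bar> \<le> B * ((?z p / B)\<^sup>2 / 2)"
            using B by (intro mult_left_mono) auto
          moreover have "B * \<bar>sin (?z p / B) - ?z p / B\<bar> = \<bar>B * sin (?z p / B) - ?z p\<bar>"
          proof -
            have "B * sin (?z p / B) - ?z p = B * (sin (?z p / B) - ?z p / B)" using B by (simp add: field_simps)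
            then show ?thesis using B by (simp add: abs_mult)
          qed
          ultimately have 1: "\<bar>B * sin (?z p / B) - ?z p\<bar> \<le> (?z p)\<^sup>2 / (2 * B)"
            using B by (simp add: power2_eq_square field_simps)
          \<comment> \<open>The first absolute moment of the grid displacement is traded for its
            variance, which \<open>bernstein_variance\<close> bounds.\<close>
          have 2: "\<bar>2 * B * a\<bar> \<le> \<eta> + B\<^sup>2 / \<eta> * a\<^sup>2" for a
          proof -
            have "0 \<le> (\<eta> - B * \<bar>a\<bar>)\<^sup>2" by simp
            then have "2 * \<eta> * (B * \<bar>a\<bar>) \<le> \<eta>\<^sup>2 + B\<^sup>2 * a\<^sup>2"
              by (simp add: power2_diff power_mult_distrib)
            then show ?thesis using \<eta> B by (simp add: field_simps power2_eq_square abs_mult)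
          qed
          show "norm ((B * (2 * real (c p) / real M - 1) - ?z p) *\<^sub>R ?b p) \<le> norm (?b p) * (\<eta> + B\<^sup>2 / \<eta> * t c p + (?z p)\<^sup>2 / (2 * B))"
            unfolding e norm_scaleR t_def mult.commute[of "\<bar>_\<bar>"] using 1 2[of ?a]
            by (intro mult_left_mono) auto
        qed
        finally show ?thesis .
      qed
      from mult_left_mono[OF this L] have "L * norm (T c - z) \<le> (\<Sum>p<?m. L * norm (?b p) * (\<eta> + B\<^sup>2 / \<eta> * t c p + (?z p)\<^sup>2 / (2 * B)))"
        by (simp add: sum_distrib_left mult.assoc)
      then show ?thesis using Lip[OF TV[of c] z] by linarith
    qed
    have "f z - F z = (\<Sum>c\<in>I. W c z *\<^sub>R (F (T c) - F z))"
      by (simp add: f_def scaleR_right_diff_distrib sum_subtractf scaleR_left.sum[symmetric] W1)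
    also have "norm \<dots> \<le> (\<Sum>c\<in>I. W c z * norm (F (T c) - F z))"
      by (rule sum_norm_le) (simp add: W0)
    also have "\<dots> \<le> (\<Sum>c\<in>I. W c z * (\<delta> + (\<Sum>p<?m. L * norm (?b p) * (\<eta> + B\<^sup>2 / \<eta> * t c p + (?z p)\<^sup>2 / (2 * B)))))"
      by (intro sum_mono mult_left_mono TZ W0)
    also have "\<dots> = \<delta> + (\<Sum>p<?m. L * norm (?b p) * (\<eta> + B\<^sup>2 / \<eta> * (\<Sum>c\<in>I. W c z * t c p) + (?z p)\<^sup>2 / (2 * B)))"
    proof -
      have "(\<Sum>c\<in>I. W c z * (\<delta> + (\<Sum>p<?m. K p * (\<eta> + Q * t c p + R p)))) = \<delta> + (\<Sum>p<?m. K p * (\<eta> + Q * (\<Sum>c\<in>I. W c z * t c p) + R p))" for K R Q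
      proof -
        have "(\<Sum>c\<in>I. W c z * (\<delta> + (\<Sum>p<?m. K p * (\<eta> + Q * t c p + R p))))
          = (\<Sum>c\<in>I. W c z * \<delta> + (\<Sum>p<?m. K p * (W c z * (\<eta> + R p) + Q * (W c z * t c p))))"
          by (simp add: distrib_left sum_distrib_left algebra_simps)
        also have "\<dots> = (\<Sum>c\<in>I. W c z) * \<delta> + (\<Sum>p<?m. K p * ((\<Sum>c\<in>I. W c z) * (\<eta> + R p) + Q * (\<Sum>c\<in>I. W c z * t c p)))"
          unfolding sum.distrib sum_distrib_right sum_distrib_left by (subst sum.swap) (simp only: sum_distrib_left[symmetric] sum.distrib)
        finally show ?thesis by (simp add: W1 algebra_simps)
      qed
      from this[of "\<lambda>p. L * norm (?b p)" "B\<^sup>2 / \<eta>" "\<lambda>p. (?z p)\<^sup>2 / (2 * B)"] show ?thesis .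
    qed
    also have "\<dots> \<le> \<delta> + (\<Sum>p<?m. L * norm (?b p) * (\<eta> + B\<^sup>2 / \<eta> * (1 / real M) + (?z p)\<^sup>2 / (2 * B)))"
    proof -
      have "(\<Sum>c\<in>I. W c z * t c p) \<le> 1 / real M" if "p < ?m" for p
        unfolding t_def using marg[OF that, of z "\<lambda>j. (real j / real M - x p z)\<^sup>2"] bernstein_variance[OF M1 x] by simp
      then show ?thesis
        using L \<eta> by (intro add_mono order_refl sum_mono mult_left_mono) auto
    qed
    also have "\<dots> = \<delta> + (L * (\<Sum>p<?m. norm (?b p))) * (\<eta> + B\<^sup>2 / \<eta> * (1 / real M)) + (\<Sum>p<?m. L * norm (?b p) * (?z p)\<^sup>2 / (2 * B))"
      by (simp add: sum_distrib_left sum_distrib_right distrib_left sum.distrib sum_divide_distrib)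
    also have "\<dots> \<le> \<delta> + \<kappa> + \<kappa> * (\<Sum>p<?m. (?z p)\<^sup>2)"
    proof -
      have "B\<^sup>2 / \<eta> * (1 / real M) \<le> \<kappa> / (2 * A)"
        using M M1 A \<eta> \<kappa> B by (simp add: field_simps)
      then have "A * (\<eta> + B\<^sup>2 / \<eta> * (1 / real M)) \<le> A * (\<kappa> / (2 * A) + \<kappa> / (2 * A))"
        using A by (intro mult_left_mono) (auto simp: \<eta>_def)
      also have "\<dots> = \<kappa>" using A by (simp add: field_simps)
      finally have "A * (\<eta> + B\<^sup>2 / \<eta> * (1 / real M)) \<le> \<kappa>" .
      moreover have "(L * (\<Sum>p<?m. norm (?b p))) * (\<eta> + B\<^sup>2 / \<eta> * (1 / real M)) \<le> A * (\<eta> + B\<^sup>2 / \<eta> * (1 / real M))"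
        using \<eta> by (intro mult_right_mono) (auto simp: A_def)
      moreover have "(\<Sum>p<?m. L * norm (?b p) * (?z p)\<^sup>2 / (2 * B)) \<le> \<kappa> * (\<Sum>p<?m. (?z p)\<^sup>2)"
        unfolding sum_distrib_left
      proof (rule sum_mono)
        fix p assume p: "p \<in> {..<?m}"
        have "norm (?b p) \<le> (\<Sum>p<?m. norm (?b p))" using p by (intro member_le_sum) auto
        then have "L * norm (?b p) \<le> A" using mult_left_mono[OF _ L] unfolding A_def by fastforce
        then have "L * norm (?b p) \<le> \<kappa> * (2 * B)" using A \<kappa> by (simp add: B_def)
        then have "L * norm (?b p) * (?z p)\<^sup>2 \<le> \<kappa> * (2 * B) * (?z p)\<^sup>2" by (intro mult_right_mono) auto
        then show "L * norm (?b p) * (?z p)\<^sup>2 / (2 * B) \<le> \<kappa> * (?z p)\<^sup>2" using B by (simp add: field_simps)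
      qed
      ultimately show ?thesis by linarith
    qed
    finally show ?thesis by (simp add: sum_list_sum_nth atLeast0LessThan)
  qed
  ultimately show ?thesis by blast
qed

end

section \<open>Extraction of the degree one part\<close>

context sign_frame
begin

lemma sq_sum_list_le: "(\<Sum>b\<leftarrow>xs. (f b :: real))\<^sup>2 \<le> real (length xs) * (\<Sum>b\<leftarrow>xs. (f b)\<^sup>2)"
proof -
  have "(\<Sum>p<length xs. f (xs ! p) * 1)\<^sup>2 \<le> (\<Sum>p<length xs. (f (xs ! p))\<^sup>2) * (\<Sum>p<length xs. 1\<^sup>2)"
    by (rule Cauchy_Schwarz_ineq_sum)
  then show ?thesis by (simp add: sum_list_sum_nth atLeast0LessThan mult.commute)
qed

lemma avg_sum_list: "avg vs (\<lambda>z. \<Sum>b\<leftarrow>xs. (f b z :: real)) = (\<Sum>b\<leftarrow>xs. avg vs (f b))"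
  by (induction xs) (simp_all add: avg_add)

text \<open>A map preserving inner products on random arguments up to \<open>\<delta>\<close> is linear on average. The same
  linear map serves for all rotations of the random argument, since in the limit the signs become Gaussian.\<close>

theorem gaussian_linearization:
  fixes F :: "'v \<Rightarrow> 'w::real_inner"
  assumes Lip: "\<And>x y. x \<in> V \<Longrightarrow> y \<in> V \<Longrightarrow> norm (F x - F y) \<le> L * norm (x - y) + \<delta>"
    and L: "0 \<le> L" and \<delta>: "0 < \<delta>" "\<delta> \<le> 1"
    and corr: "\<And>N \<rho> \<sigma>. N \<ge> 1 \<Longrightarrow> \<rho>\<^sup>2 + \<sigma>\<^sup>2 = 1 \<Longrightarrow>
      \<bar>avg (S N) (\<lambda>x. avg (S N) (\<lambda>y. inner (F (\<rho> *\<^sub>R y + \<sigma> *\<^sub>R x)) (F y))) - \<rho>\<bar> \<le> \<delta>"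
    and bound: "\<And>N \<rho> \<sigma>. N \<ge> 1 \<Longrightarrow> \<rho>\<^sup>2 + \<sigma>\<^sup>2 = 1 \<Longrightarrow>
      avg (S N) (\<lambda>x. avg (S N) (\<lambda>y. (norm (F (\<rho> *\<^sub>R y + \<sigma> *\<^sub>R x)))\<^sup>2)) \<le> 2"
  shows "\<exists>\<Lambda>. linear \<Lambda> \<and> (\<forall>u u'. linear u \<longrightarrow> (\<forall>z\<in>V. u z \<in> V) \<longrightarrow>
     (\<forall>v\<in>V. u' v \<in> V \<and> (\<forall>z. inner v (u z) = inner (u' v) z)) \<longrightarrow>
     (\<forall>v\<in>V. \<forall>w\<in>V. inner (u' v) (u' w) = inner v w) \<longrightarrow>
     (\<forall>\<^sub>F N in sequentially. avg (S N) (\<lambda>y. (norm (F (u y) - \<Lambda> (u y)))\<^sup>2) \<le> 480 * \<delta>))"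
proof -
  \<comment> \<open>\<open>X\<close> collects the fourth moments of the frame coordinates, which
    arise from squaring the quadratic error of \<open>trig_approx\<close>. Dividing \<delta> by 1 +
    X makes their contribution \<kappa>^2 X at most \<delta>^2.\<close>
  define X where "X = 6 * real (length bs) * (\<Sum>b\<leftarrow>bs. (s\<^sup>2 * (norm b)\<^sup>2)\<^sup>2)"
  have X: "0 \<le> X" unfolding X_def by (intro mult_nonneg_nonneg sum_list_nonneg) auto
  define \<kappa> where "\<kappa> = \<delta> / (1 + X)"
  have \<kappa>: "0 < \<kappa>" "\<kappa> \<le> \<delta>" using \<delta> X by (auto simp: \<kappa>_def field_simps)
  have "\<kappa>\<^sup>2 * X = \<delta>\<^sup>2 * (X / (1 + X)\<^sup>2)" by (simp add: \<kappa>_def power_divide)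
  also have "\<dots> \<le> \<delta>\<^sup>2 * 1"
  proof (intro mult_left_mono)
    have "X \<le> (1 + X)\<^sup>2" using X by (simp add: power2_eq_square algebra_simps)
    then show "X / (1 + X)\<^sup>2 \<le> 1" using X by (simp add: divide_le_eq_1)
  qed simp
  finally have \<kappa>X: "\<kappa>\<^sup>2 * X \<le> \<delta>\<^sup>2" by simp
  obtain f where "trig f" and fF: "\<And>z. z \<in> V \<Longrightarrow> norm (f z - F z) \<le> \<delta> + \<kappa> + \<kappa> * (\<Sum>b\<leftarrow>bs. (inner b z)\<^sup>2)"
    using trig_approx[OF Lip L \<kappa>(1)] by blast
  then obtain n v \<theta> c where v: "\<And>i. i < n \<Longrightarrow> v i \<in> V" and f: "f = tp n v \<theta> c"
    unfolding trig_def by blast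
  \<comment> \<open>Stated for every list with the second moments of \<open>S N\<close>, because it
    is applied to the sample itself, to the noisy sample and to rotated samples. The constant is 2 *
    2^2 + 1.\<close>
  have err: "avg vs (\<lambda>z. (norm (f z - F z))\<^sup>2) \<le> 9 * \<delta>\<^sup>2"
    if vs: "set vs \<subseteq> V" "\<And>b. b \<in> V \<Longrightarrow> (\<Sum>w\<leftarrow>vs. (inner b w)\<^sup>2) = s\<^sup>2 * (norm b)\<^sup>2" for vs
  proof -
    have "avg vs (\<lambda>z. (norm (f z - F z))\<^sup>2)
      \<le> avg vs (\<lambda>z. 2 * (\<delta> + \<kappa>)\<^sup>2 + (2 * \<kappa>\<^sup>2 * real (length bs)) * (\<Sum>b\<leftarrow>bs. (inner b z)^4))"
    proof (rule avg_mono_span[OF sub vs(1)])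
      fix z assume z: "z \<in> V"
      let ?Q = "\<Sum>b\<leftarrow>bs. (inner b z)\<^sup>2"
      have "(norm (f z - F z))\<^sup>2 \<le> (\<delta> + \<kappa> + \<kappa> * ?Q)\<^sup>2" by (intro power_mono fF z) simp
      also have "\<dots> \<le> 2 * (\<delta> + \<kappa>)\<^sup>2 + 2 * (\<kappa> * ?Q)\<^sup>2"
        using sum_squares_bound[of "\<delta> + \<kappa>" "\<kappa> * ?Q"] by (simp add: power2_sum)
      also have "\<dots> = 2 * (\<delta> + \<kappa>)\<^sup>2 + 2 * \<kappa>\<^sup>2 * ?Q\<^sup>2" by (simp add: power_mult_distrib)
      also have "\<dots> \<le> 2 * (\<delta> + \<kappa>)\<^sup>2 + 2 * \<kappa>\<^sup>2 * (real (length bs) * (\<Sum>b\<leftarrow>bs. ((inner b z)\<^sup>2)\<^sup>2))"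
        by (intro add_left_mono mult_left_mono sq_sum_list_le) auto
      finally show "(norm (f z - F z))\<^sup>2 \<le> 2 * (\<delta> + \<kappa>)\<^sup>2 + (2 * \<kappa>\<^sup>2 * real (length bs)) * (\<Sum>b\<leftarrow>bs. (inner b z)^4)"
        by (simp add: mult.assoc flip: power_mult)
    qed
    also have "\<dots> = 2 * (\<delta> + \<kappa>)\<^sup>2 + (2 * \<kappa>\<^sup>2 * real (length bs)) * (\<Sum>b\<leftarrow>bs. avg vs (\<lambda>z. (inner b z)^4))"
      by (simp only: avg_add avg_const avg_cmult avg_sum_list)
    also have "\<dots> \<le> 2 * (\<delta> + \<kappa>)\<^sup>2 + (2 * \<kappa>\<^sup>2 * real (length bs)) * (\<Sum>b\<leftarrow>bs. 3 * (s\<^sup>2 * (norm b)\<^sup>2)\<^sup>2)"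
    proof (intro add_left_mono mult_left_mono sum_list_mono)
      fix b assume "b \<in> set bs"
      then have "b \<in> V" using bs by auto
      then show "avg vs (\<lambda>z. (inner b z)^4) \<le> 3 * (s\<^sup>2 * (norm b)\<^sup>2)\<^sup>2"
        using avg_inner_fourth[of vs b] by (simp add: vs(2))
    qed auto
    also have "\<dots> = 2 * (\<delta> + \<kappa>)\<^sup>2 + \<kappa>\<^sup>2 * X"
      by (simp add: X_def sum_list_const_mult)
    also have "\<dots> \<le> 2 * (2 * \<delta>)\<^sup>2 + \<delta>\<^sup>2"
      using \<kappa> \<kappa>X \<delta> by (intro add_mono mult_left_mono power_mono) auto
    finally show ?thesis by simp
  qed
  have sm: "(\<Sum>w\<leftarrow>S N. (inner b w)\<^sup>2) = s\<^sup>2 * (norm b)\<^sup>2" if "N \<ge> 1" "b \<in> V" for N b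
    using second_moment[OF that that(2)] by (simp add: power2_norm_eq_inner) (simp add: power2_eq_square)
  \<comment> \<open>Replacing \<open>F\<close> by \<open>f\<close> changes correlations by at most
    20 \<delta>: the inequality of arithmetic and geometric means with weight \<delta> turns the
    mean square errors 9 \<delta>^2 into terms of order \<delta>.\<close>
  have fcorr: "\<bar>avg (S N) (\<lambda>x. avg (S N) (\<lambda>y. inner (f (\<rho> *\<^sub>R y + \<sigma> *\<^sub>R x)) (f y))) - \<rho>\<bar> \<le> 21 * \<delta>"
    if N: "N \<ge> 1" and \<rho>\<sigma>: "\<rho>\<^sup>2 + \<sigma>\<^sup>2 = 1" for N \<rho> \<sigma>
  proof -
    let ?E = "\<lambda>G. avg (S N) (\<lambda>x. avg (S N) (\<lambda>y. G (\<rho> *\<^sub>R y + \<sigma> *\<^sub>R x) y)) :: real"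
    \<comment> \<open>For independent x and y, the point \<rho> y + \<sigma> x is one signed sum
      over the concatenated list; \<rho>^2 + \<sigma>^2 = 1 gives this list the second moments of
      \<open>S N\<close>.\<close>
    let ?vs = "map (scaleR \<sigma>) (S N) @ map (scaleR \<rho>) (S N)"
    have lin: "linear (scaleR a :: 'v \<Rightarrow> 'v)" for a by (simp add: linear_iff algebra_simps)
    have vs: "avg (S N) (\<lambda>x. avg (S N) (\<lambda>y. G (\<rho> *\<^sub>R y + \<sigma> *\<^sub>R x))) = avg ?vs G" for G :: "'v \<Rightarrow> real"
      unfolding avg_append by (simp add: avg_map lin add.commute)
    have "(\<Sum>w\<leftarrow>?vs. (inner b w)\<^sup>2) = \<sigma>\<^sup>2 * (\<Sum>w\<leftarrow>S N. (inner b w)\<^sup>2) + \<rho>\<^sup>2 * (\<Sum>w\<leftarrow>S N. (inner b w)\<^sup>2)" for b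
      by (simp add: comp_def power_mult_distrib sum_list_const_mult)
    then have "(\<Sum>w\<leftarrow>?vs. (inner b w)\<^sup>2) = s\<^sup>2 * (norm b)\<^sup>2" if "b \<in> V" for b
      using \<rho>\<sigma> sm[OF N that] by (simp add: distrib_right[symmetric] add.commute)
    moreover have "set ?vs \<subseteq> V" using S_V[of N] sub by (auto intro: subspace_scale)
    ultimately have "avg ?vs (\<lambda>z. (norm (f z - F z))\<^sup>2) \<le> 9 * \<delta>\<^sup>2" by (intro err)
    then have e1: "?E (\<lambda>a y. (norm (f a - F a))\<^sup>2) \<le> 9 * \<delta>\<^sup>2" unfolding vs[of "\<lambda>a. (norm (f a - F a))\<^sup>2"] .
    have e2: "?E (\<lambda>a y. (norm (f y - F y))\<^sup>2) \<le> 9 * \<delta>\<^sup>2" using err[OF S_V[of N] sm[OF N]] by simp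
    have b1: "?E (\<lambda>a y. (norm (F a))\<^sup>2) \<le> 2" using bound[OF N \<rho>\<sigma>] .
    have b2: "?E (\<lambda>a y. (norm (F y))\<^sup>2) \<le> 2" using bound[OF N, of 1 0] by simp
    have pt: "\<bar>inner (f a) (f y) - inner (F a) (F y)\<bar>
      \<le> (1/2 + 1 / (2 * \<delta>)) * (norm (f a - F a))\<^sup>2 + (1/2 + 1 / (2 * \<delta>)) * (norm (f y - F y))\<^sup>2
        + \<delta> / 2 * (norm (F a))\<^sup>2 + \<delta> / 2 * (norm (F y))\<^sup>2" for a y
    proof -
      have amgm: "p * q \<le> p\<^sup>2 / (2 * t) + t / 2 * q\<^sup>2" if "t > 0" for p q t :: real
      proof -
        have "0 \<le> (p - t * q)\<^sup>2" by simp
        then show ?thesis using that by (simp add: field_simps power2_eq_square)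
      qed
      have "inner (f a) (f y) - inner (F a) (F y)
        = inner (f a - F a) (f y - F y) + inner (f a - F a) (F y) + inner (F a) (f y - F y)"
        by (simp add: inner_simps)
      then have "\<bar>inner (f a) (f y) - inner (F a) (F y)\<bar>
        \<le> norm (f a - F a) * norm (f y - F y) + norm (f a - F a) * norm (F y) + norm (f y - F y) * norm (F a)"
        using Cauchy_Schwarz_ineq2[of "f a - F a" "f y - F y"] Cauchy_Schwarz_ineq2[of "f a - F a" "F y"]
          Cauchy_Schwarz_ineq2[of "F a" "f y - F y"] by (simp add: mult.commute)
      also have "\<dots> \<le> ((norm (f a - F a))\<^sup>2 / (2 * 1) + 1 / 2 * (norm (f y - F y))\<^sup>2)
         + ((norm (f a - F a))\<^sup>2 / (2 * \<delta>) + \<delta> / 2 * (norm (F y))\<^sup>2)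
         + ((norm (f y - F y))\<^sup>2 / (2 * \<delta>) + \<delta> / 2 * (norm (F a))\<^sup>2)"
        using \<delta> by (intro add_mono amgm) auto
      finally show ?thesis by (simp add: algebra_simps)
    qed
    have "\<bar>?E (\<lambda>a y. inner (f a) (f y)) - ?E (\<lambda>a y. inner (F a) (F y))\<bar>
      = \<bar>?E (\<lambda>a y. inner (f a) (f y) - inner (F a) (F y))\<bar>" by (simp add: avg_diff)
    also have "\<dots> \<le> ?E (\<lambda>a y. \<bar>inner (f a) (f y) - inner (F a) (F y)\<bar>)"
      by (intro order_trans[OF avg_abs] avg_mono avg_abs)
    also have "\<dots> \<le> ?E (\<lambda>a y. (1/2 + 1 / (2 * \<delta>)) * (norm (f a - F a))\<^sup>2 + (1/2 + 1 / (2 * \<delta>)) * (norm (f y - F y))\<^sup>2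
        + \<delta> / 2 * (norm (F a))\<^sup>2 + \<delta> / 2 * (norm (F y))\<^sup>2)"
      by (intro avg_mono pt)
    also have "\<dots> = (1/2 + 1 / (2 * \<delta>)) * ?E (\<lambda>a y. (norm (f a - F a))\<^sup>2) + (1/2 + 1 / (2 * \<delta>)) * ?E (\<lambda>a y. (norm (f y - F y))\<^sup>2)
        + \<delta> / 2 * ?E (\<lambda>a y. (norm (F a))\<^sup>2) + \<delta> / 2 * ?E (\<lambda>a y. (norm (F y))\<^sup>2)"
      by (simp only: avg_add avg_cmult)
    also have "\<dots> \<le> (1/2 + 1 / (2 * \<delta>)) * (9 * \<delta>\<^sup>2) + (1/2 + 1 / (2 * \<delta>)) * (9 * \<delta>\<^sup>2) + \<delta> / 2 * 2 + \<delta> / 2 * 2"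
      using \<delta> by (intro add_mono mult_left_mono e1 e2 b1 b2) auto
    also have "\<dots> = 9 * \<delta>\<^sup>2 + 11 * \<delta>" using \<delta> by (simp add: field_simps power2_eq_square)
    also have "\<dots> \<le> 20 * \<delta>" using \<delta> by (simp add: power2_eq_square)
    finally show ?thesis using corr[OF N \<rho>\<sigma>] by linarith
  qed
  have kern: "\<bar>kern n v \<theta> c \<rho> - \<rho>\<bar> \<le> 21 * \<delta>" if "\<rho>\<^sup>2 + \<sigma>\<^sup>2 = 1" for \<rho> \<sigma>
  proof (rule tendsto_upperbound)
    show "(\<lambda>N. \<bar>avg (S N) (\<lambda>x. avg (S N) (\<lambda>y. inner (f (\<rho> *\<^sub>R y + \<sigma> *\<^sub>R x)) (f y))) - \<rho>\<bar>) \<longlonglongrightarrow> \<bar>kern n v \<theta> c \<rho> - \<rho>\<bar>"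
      unfolding f by (intro tendsto_intros noise_limit v that)
    show "\<forall>\<^sub>F N in sequentially. \<bar>avg (S N) (\<lambda>x. avg (S N) (\<lambda>y. inner (f (\<rho> *\<^sub>R y + \<sigma> *\<^sub>R x)) (f y))) - \<rho>\<bar> \<le> 21 * \<delta>"
      by (rule eventually_sequentiallyI[of 1]) (rule fcorr[OF _ that])
  qed simp
  \<comment> \<open>The three correlations 0, 3/5 and 1 are realized with \<sigma> equal to 1, 4/5
    and 0.\<close>
  have deg: "kern n v \<theta> c 1 - chaos n v \<theta> c 1 \<le> 10 * (21 * \<delta>)"
    using kern[of 0 1] kern[of "3/5" "4/5"] kern[of 1 0]
    by (intro degree_one_dominates v) (simp_all add: power2_eq_square)
  show ?thesis
  proof (intro exI[of _ "lin n v \<theta> c"] conjI linear_lin allI impI)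
    fix u u'
    assume u: "linear u" and uV: "\<forall>z\<in>V. u z \<in> V"
      and u': "\<forall>v\<in>V. u' v \<in> V \<and> (\<forall>z. inner v (u z) = inner (u' v) z)"
      and iso: "\<forall>v\<in>V. \<forall>w\<in>V. inner (u' v) (u' w) = inner v w"
    \<comment> \<open>Rotation invariance enters here: composing with u replaces each frequency by
      its image under the adjoint, which leaves the Gram matrix and thus \<open>kern\<close> and
      \<open>chaos\<close> unchanged. The linear part of the rotated polynomial is the old linear
      part composed with u.\<close>
    define v' where "v' i = u' (v i)" for i
    have v': "v' i \<in> V" if "i < n" for i using v[OF that] u' by (auto simp: v'_def)
    have g: "gw (v' i) = gw (v i)" if "i < n" for i
      using iso v[OF that] by (simp add: gw_def v'_def power2_norm_eq_inner)
    have ip: "inner (v' i) (v' j) = inner (v i) (v j)" if "i < n" "j < n" for i j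
      using iso v that by (simp add: v'_def)
    have "kern n v' \<theta> c 1 = kern n v \<theta> c 1" "chaos n v' \<theta> c 1 = chaos n v \<theta> c 1"
      unfolding kern_def chaos_def by (intro sum.cong refl; simp add: g ip)+
    then have deg': "kern n v' \<theta> c 1 - chaos n v' \<theta> c 1 \<le> 210 * \<delta>" using deg by simp
    have fu: "f (u z) = tp n v' \<theta> c z" "lin n v \<theta> c (u z) = lin n v' \<theta> c z" for z
      unfolding f tp_def lin_def by (intro sum.cong refl; use u' v g in \<open>simp add: v'_def\<close>)+
    have "(\<lambda>N. avg (S N) (\<lambda>y. (norm (f (u y) - lin n v \<theta> c (u y)))\<^sup>2)) \<longlonglongrightarrow> kern n v' \<theta> c 1 - chaos n v' \<theta> c 1"
      unfolding fu by (rule degree_one_distance[OF v'])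
    moreover have "kern n v' \<theta> c 1 - chaos n v' \<theta> c 1 < 211 * \<delta>" using deg' \<delta> by linarith
    ultimately have "\<forall>\<^sub>F N in sequentially. avg (S N) (\<lambda>y. (norm (f (u y) - lin n v \<theta> c (u y)))\<^sup>2) < 211 * \<delta>"
      by (rule order_tendstoD)
    then show "\<forall>\<^sub>F N in sequentially. avg (S N) (\<lambda>y. (norm (F (u y) - lin n v \<theta> c (u y)))\<^sup>2) \<le> 480 * \<delta>"
      using eventually_ge_at_top[of 1]
    proof eventually_elim
      case (elim N)
      have "(\<Sum>w\<leftarrow>map u (S N). (inner b w)\<^sup>2) = s\<^sup>2 * (norm b)\<^sup>2" if b: "b \<in> V" for b
      proof -
        have "(\<Sum>w\<leftarrow>map u (S N). (inner b w)\<^sup>2) = (\<Sum>w\<leftarrow>S N. (inner (u' b) w)\<^sup>2)"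
          using u' b by (simp add: comp_def)
        then show ?thesis using sm[OF elim(2), of "u' b"] u' iso b by (simp add: power2_norm_eq_inner)
      qed
      moreover have "set (map u (S N)) \<subseteq> V" using S_V[of N] uV by auto
      ultimately have e: "avg (S N) (\<lambda>y. (norm (f (u y) - F (u y)))\<^sup>2) \<le> 9 * \<delta>\<^sup>2"
        using err[of "map u (S N)"] by (simp add: avg_map[OF u])
      have "(norm (F (u y) - lin n v \<theta> c (u y)))\<^sup>2 \<le> 2 * (norm (f (u y) - F (u y)))\<^sup>2 + 2 * (norm (f (u y) - lin n v \<theta> c (u y)))\<^sup>2" for y
      proof -
        have "norm (F (u y) - lin n v \<theta> c (u y)) \<le> norm (f (u y) - F (u y)) + norm (f (u y) - lin n v \<theta> c (u y))"
          using norm_triangle_ineq4[of "f (u y) - lin n v \<theta> c (u y)" "f (u y) - F (u y)"] by simp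
        then have "(norm (F (u y) - lin n v \<theta> c (u y)))\<^sup>2 \<le> (norm (f (u y) - F (u y)) + norm (f (u y) - lin n v \<theta> c (u y)))\<^sup>2"
          by (intro power_mono) auto
        then show ?thesis
          using sum_squares_bound[of "norm (f (u y) - F (u y))" "norm (f (u y) - lin n v \<theta> c (u y))"]
          by (simp add: power2_sum)
      qed
      then have "avg (S N) (\<lambda>y. (norm (F (u y) - lin n v \<theta> c (u y)))\<^sup>2)
        \<le> avg (S N) (\<lambda>y. 2 * (norm (f (u y) - F (u y)))\<^sup>2 + 2 * (norm (f (u y) - lin n v \<theta> c (u y)))\<^sup>2)"
        by (intro avg_mono)
      also have "\<dots> = 2 * avg (S N) (\<lambda>y. (norm (f (u y) - F (u y)))\<^sup>2) + 2 * avg (S N) (\<lambda>y. (norm (f (u y) - lin n v \<theta> c (u y)))\<^sup>2)"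
        by (simp only: avg_add avg_cmult)
      also have "\<dots> \<le> 2 * (9 * \<delta>\<^sup>2) + 2 * (211 * \<delta>)" using e elim by linarith
      also have "\<dots> \<le> 480 * \<delta>" using \<delta> by (simp add: power2_eq_square)
      finally show ?case .
    qed
  qed
qed

end

section \<open>Linearization of approximate homomorphisms\<close>

definition mbasis :: "nat \<Rightarrow> fmat list" where
  "mbasis k = concat (map (\<lambda>i. concat (map (\<lambda>j. [eu i j, cs \<i> (eu i j)]) [0..<k])) [0..<k])"

lemma sum_mbasis:
  fixes f :: "fmat \<Rightarrow> real"
  shows "(\<Sum>b\<leftarrow>mbasis k. f b) = (\<Sum>i<k. \<Sum>j<k. f (eu i j) + f (cs \<i> (eu i j)))"
proof -
  have *: "(\<Sum>b\<leftarrow>concat (map g [0..<m]). f b) = (\<Sum>i<m. \<Sum>b\<leftarrow>g i. f b)" for g :: "nat \<Rightarrow> fmat list" and m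
    by (induction m) simp_all
  show ?thesis by (simp add: mbasis_def *)
qed

lemma subspace_sq: "subspace (sq k)"
  by (simp add: subspace_def)

lemma inner_eu: "inner v (eu i j) = Re (ent v i j)" "inner v (cs \<i> (eu i j)) = Im (ent v i j)"
  by (subst inner_commute, simp add: inner_fmat_def cip_cs_left cip_eu)+

lemma parseval_sq: "v \<in> sq k \<Longrightarrow> inner v w = (\<Sum>b\<leftarrow>mbasis k. inner v b * inner w b)"
  by (simp add: sum_mbasis inner_eu) (simp add: inner_fmat_def cip_rect[of v k k])

lemma set_mbasis: "b \<in> set (mbasis k) \<Longrightarrow> b \<in> sq k \<and> norm b = 1"
  by (auto simp: mbasis_def)

lemma sum_mbasis_norm_left:
  assumes "v \<in> rect r k"
  shows "(\<Sum>b\<leftarrow>mbasis k. (norm (v * b))\<^sup>2) = 2 * real k * (norm v)\<^sup>2"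
proof -
  have "(norm (v * eu i j))\<^sup>2 = (\<Sum>p<r. (cmod (ent v p i))\<^sup>2)" if "i < k" "j < k" for i j
  proof -
    have "v * eu i j \<in> rect r k" using assms that by auto
    moreover have "(\<Sum>q<k. (cmod (if q = j then ent v p i else 0))\<^sup>2) = (cmod (ent v p i))\<^sup>2" for p
      using that by (simp add: if_distrib[of "\<lambda>x. (cmod x)\<^sup>2"] cong: if_cong)
    ultimately show ?thesis by (simp add: norm_sq_rect[of _ r k] ent_mult_eu)
  qed
  then have "(\<Sum>b\<leftarrow>mbasis k. (norm (v * b))\<^sup>2) = (\<Sum>i<k. \<Sum>j<k. 2 * (\<Sum>p<r. (cmod (ent v p i))\<^sup>2))"
    by (simp add: sum_mbasis)
  also have "\<dots> = 2 * real k * (norm v)\<^sup>2"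
    by (simp add: norm_sq_rect[OF assms] sum_distrib_left) (subst sum.swap, simp add: algebra_simps)
  finally show ?thesis .
qed

lemma sum_mbasis_adj: "(\<Sum>b\<leftarrow>mbasis k. (norm (b * v))\<^sup>2) = (\<Sum>b\<leftarrow>mbasis k. (norm (adj v * b))\<^sup>2)"
proof -
  have "norm (cs \<i> (eu i j) * v) = norm (eu i j * v)" "norm (adj v * cs \<i> (eu i j)) = norm (adj v * eu i j)" for i j
    by simp_all
  moreover have "norm (eu i j * v) = norm (adj v * eu j i)" for i j
    by (metis adj_eu adj_mult norm_adj)
  ultimately show ?thesis
    by (simp only: sum_mbasis) (rule sum.swap)
qed

lemma norm_add_sq: "(norm (a + b))\<^sup>2 = (norm a)\<^sup>2 + (norm b)\<^sup>2 + 2 * inner a (b :: 'a::real_inner)"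
  by (simp add: power2_norm_eq_inner inner_simps inner_commute)

text \<open>Condition on the sign of \<open>v\<close>. The terms odd in the sign cancel, <z z*, v
  v*> equals |v* z|^2, and the mixed term z v* + v z* has norm at most 2 |z v*|. What remains is
  quadratic in z and is averaged by \<open>avg_linear_sq\<close>.\<close>

lemma avg_mult_adj:
  "avg vs (\<lambda>z. (norm (z * adj z))\<^sup>2)
     \<le> (\<Sum>v\<leftarrow>vs. (norm (v * adj v))\<^sup>2) + (\<Sum>v\<leftarrow>vs. \<Sum>w\<leftarrow>vs. 2 * (norm (adj v * w))\<^sup>2 + 4 * (norm (w * adj v))\<^sup>2)"
proof (induction vs)
  case (Cons v vs)
  let ?f = "\<lambda>v w. 2 * (norm (adj v * w))\<^sup>2 + 4 * (norm (w * adj v))\<^sup>2"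
  have pt: "(norm ((z + v) * adj (z + v)))\<^sup>2 + (norm ((z - v) * adj (z - v)))\<^sup>2
    \<le> 2 * (norm (z * adj z))\<^sup>2 + 2 * (norm (v * adj v))\<^sup>2 + 2 * ?f v z" for z
  proof -
    let ?A = "z * adj z + v * adj v" and ?B = "z * adj v + v * adj z"
    have e: "(z + v) * adj (z + v) = ?A + ?B" "(z - v) * adj (z - v) = ?A - ?B"
      by (simp_all add: adj_add adj_diff algebra_simps)
    have 1: "(norm (?A + ?B))\<^sup>2 + (norm (?A - ?B))\<^sup>2 = 2 * (norm ?A)\<^sup>2 + 2 * (norm ?B)\<^sup>2"
      by (simp add: power2_norm_eq_inner inner_simps inner_commute)
    have "inner (z * adj z) (v * adj v) = inner (adj v * z) (adj v * z)"
      by (simp only: inner_mult_right[of z "adj z"] inner_mult_left[of "adj v" z] adj_adj mult.assoc)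
    then have 2: "(norm ?A)\<^sup>2 = (norm (z * adj z))\<^sup>2 + (norm (v * adj v))\<^sup>2 + 2 * (norm (adj v * z))\<^sup>2"
      using norm_add_sq[of "z * adj z" "v * adj v"] by (simp add: power2_norm_eq_inner)
    have "norm (v * adj z) = norm (z * adj v)" by (metis adj_adj adj_mult norm_adj)
    then have "norm ?B \<le> 2 * norm (z * adj v)" using norm_triangle_ineq[of "z * adj v" "v * adj z"] by simp
    then have "(norm ?B)\<^sup>2 \<le> (2 * norm (z * adj v))\<^sup>2" by (intro power_mono) auto
    then show ?thesis unfolding e 1 2 by (simp add: power_mult_distrib)
  qed
  have lin: "linear (\<lambda>z. adj v * z)" "linear (\<lambda>z. z * adj v)" by (auto intro!: linearI simp: algebra_simps)
  have "avg (v # vs) (\<lambda>z. (norm (z * adj z))\<^sup>2)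
    = (1/2) * avg vs (\<lambda>z. (norm ((z + v) * adj (z + v)))\<^sup>2 + (norm ((z - v) * adj (z - v)))\<^sup>2)"
    by (simp add: avg_add)
  also have "\<dots> \<le> (1/2) * avg vs (\<lambda>z. 2 * (norm (z * adj z))\<^sup>2 + 2 * (norm (v * adj v))\<^sup>2 + 2 * ?f v z)"
    by (intro mult_left_mono avg_mono pt) auto
  also have "\<dots> = avg vs (\<lambda>z. (norm (z * adj z))\<^sup>2) + (norm (v * adj v))\<^sup>2
      + (2 * avg vs (\<lambda>z. (norm (adj v * z))\<^sup>2) + 4 * avg vs (\<lambda>z. (norm (z * adj v))\<^sup>2))"
    by (simp only: avg_add avg_cmult avg_const) simp
  also have "\<dots> = avg vs (\<lambda>z. (norm (z * adj z))\<^sup>2) + (norm (v * adj v))\<^sup>2 + (\<Sum>w\<leftarrow>vs. ?f v w)"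
    unfolding avg_linear_sq[OF lin(1)] avg_linear_sq[OF lin(2)]
    by (simp add: sum_list_addf sum_list_const_mult)
  also have "\<dots> \<le> (\<Sum>v\<leftarrow>vs. (norm (v * adj v))\<^sup>2) + (\<Sum>v\<leftarrow>vs. \<Sum>w\<leftarrow>vs. ?f v w)
      + (norm (v * adj v))\<^sup>2 + (\<Sum>w\<leftarrow>vs. ?f v w)" using Cons by simp
  also have "\<dots> \<le> (\<Sum>x\<leftarrow>v # vs. (norm (x * adj x))\<^sup>2) + (\<Sum>x\<leftarrow>v # vs. \<Sum>w\<leftarrow>v # vs. ?f x w)"
  proof -
    have "(\<Sum>v\<leftarrow>vs. \<Sum>w\<leftarrow>vs. ?f v w) \<le> (\<Sum>x\<leftarrow>vs. ?f x v + (\<Sum>w\<leftarrow>vs. ?f x w))"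
      by (intro sum_list_mono) simp
    moreover have "0 \<le> ?f v v" by simp
    ultimately show ?thesis by (simp only: list.map sum_list.Cons)
  qed
  finally show ?case .
qed simp

lemma sum_list_divide: "(\<Sum>x\<leftarrow>xs. f x / c) = (\<Sum>x\<leftarrow>xs. f x) / (c::real)"
  by (induction xs) (simp_all add: add_divide_distrib)

text \<open>The signed sum has the second moments of a complex Gaussian matrix: each of the 2 k^2
  real coordinates has variance 1 / (2 k), so its normalized Hilbert-Schmidt norm is 1 in mean
  square. The bound on single terms controls the diagonal part of the fourth moment.\<close>

definition isotropic :: "nat \<Rightarrow> fmat list \<Rightarrow> bool" where
  "isotropic k vs \<longleftrightarrow> set vs \<subseteq> sq k \<and> (\<forall>v\<in>set vs. norm v \<le> 1) \<and>
     (\<forall>b\<in>sq k. (\<Sum>w\<leftarrow>vs. (inner b w)\<^sup>2) = (norm b)\<^sup>2 / (2 * real k))"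

lemma sum_list_swap: "(\<Sum>x\<leftarrow>xs. \<Sum>y\<leftarrow>ys. (f x y :: real)) = (\<Sum>y\<leftarrow>ys. \<Sum>x\<leftarrow>xs. f x y)"
  by (induction xs) (simp_all add: sum_list_addf)

lemma norm_sq_mbasis: "v \<in> sq k \<Longrightarrow> (norm v)\<^sup>2 = (\<Sum>b\<leftarrow>mbasis k. (inner v b)\<^sup>2)"
  using parseval_sq[of v k v] by (simp add: power2_norm_eq_inner) (simp add: power2_eq_square)

text \<open>In the fourth moment the mixed terms give 2 + 4 = 6 times the total k of the squared
  norms, and the diagonal terms give at most one more k.\<close>

lemma isotropic_moments:
  assumes iso: "isotropic k vs" and k: "k > 0"
  shows "avg vs (\<lambda>z. (norm z)\<^sup>2) = real k" "avg vs (\<lambda>z. (norm (z * adj z))\<^sup>2) \<le> 7 * real k"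
proof -
  have vs: "set vs \<subseteq> sq k" "\<And>v. v \<in> set vs \<Longrightarrow> norm v \<le> 1"
    and I: "\<And>b. b \<in> sq k \<Longrightarrow> (\<Sum>w\<leftarrow>vs. (inner b w)\<^sup>2) = (norm b)\<^sup>2 / (2 * real k)"
    using iso by (auto simp: isotropic_def)
  have len: "(\<Sum>b\<leftarrow>mbasis k. (norm b)\<^sup>2) = 2 * (real k)\<^sup>2"
    by (simp add: sum_mbasis power2_eq_square)
  have "(\<Sum>w\<leftarrow>vs. (norm w)\<^sup>2) = (\<Sum>w\<leftarrow>vs. \<Sum>b\<leftarrow>mbasis k. (inner b w)\<^sup>2)"
    using vs by (intro arg_cong[of _ _ sum_list] map_cong refl) (auto simp: norm_sq_mbasis inner_commute)
  also have "\<dots> = (\<Sum>b\<leftarrow>mbasis k. (norm b)\<^sup>2 / (2 * real k))"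
    unfolding sum_list_swap[of _ "mbasis k"] using set_mbasis
    by (intro arg_cong[of _ _ sum_list] map_cong refl) (auto simp: I)
  also have "\<dots> = (\<Sum>b\<leftarrow>mbasis k. (norm b)\<^sup>2) * (1 / (2 * real k))"
    by (simp add: sum_list_divide)
  also have "\<dots> = real k" using k unfolding len by (simp add: power2_eq_square)
  finally have tot: "(\<Sum>w\<leftarrow>vs. (norm w)\<^sup>2) = real k" .
  show "avg vs (\<lambda>z. (norm z)\<^sup>2) = real k"
    using avg_linear_sq[of "\<lambda>z::fmat. z" vs] tot by (simp add: linear_iff)
  \<comment> \<open>Expanding |v* w|^2 over the basis moves \<open>v\<close> to the other side, so
    that the sum over w is an instance of isotropy for each \<open>v * b\<close>.\<close>
  have left: "(\<Sum>w\<leftarrow>vs. (norm (adj v * w))\<^sup>2) = (norm v)\<^sup>2" if v: "v \<in> sq k" for v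
  proof -
    have "(\<Sum>w\<leftarrow>vs. (norm (adj v * w))\<^sup>2) = (\<Sum>w\<leftarrow>vs. \<Sum>b\<leftarrow>mbasis k. (inner (v * b) w)\<^sup>2)"
    proof (intro arg_cong[of _ _ sum_list] map_cong refl)
      fix w assume "w \<in> set vs"
      then have "adj v * w \<in> sq k" using vs v by auto
      moreover have "inner (adj v * w) b = inner (v * b) w" for b
        by (metis adj_adj inner_commute inner_mult_left)
      ultimately show "(norm (adj v * w))\<^sup>2 = (\<Sum>b\<leftarrow>mbasis k. (inner (v * b) w)\<^sup>2)"
        by (simp only: norm_sq_mbasis)
    qed
    also have "\<dots> = (\<Sum>b\<leftarrow>mbasis k. (norm (v * b))\<^sup>2 / (2 * real k))"
      unfolding sum_list_swap[of _ "mbasis k"] using set_mbasis v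
      by (intro arg_cong[of _ _ sum_list] map_cong refl I) auto
    also have "\<dots> = (\<Sum>b\<leftarrow>mbasis k. (norm (v * b))\<^sup>2) * (1 / (2 * real k))"
      by (simp add: sum_list_divide)
    also have "\<dots> = (norm v)\<^sup>2" using k by (simp add: sum_mbasis_norm_left[OF v])
    finally show ?thesis .
  qed
  have right: "(\<Sum>w\<leftarrow>vs. (norm (w * adj v))\<^sup>2) = (norm v)\<^sup>2" if v: "v \<in> sq k" for v
  proof -
    have "(\<Sum>w\<leftarrow>vs. (norm (w * adj v))\<^sup>2) = (\<Sum>w\<leftarrow>vs. \<Sum>b\<leftarrow>mbasis k. (inner (b * v) w)\<^sup>2)"
    proof (intro arg_cong[of _ _ sum_list] map_cong refl)
      fix w assume "w \<in> set vs"
      then have "w * adj v \<in> sq k" using vs v by auto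
      moreover have "inner (w * adj v) b = inner (b * v) w" for b
        by (metis adj_adj inner_commute inner_mult_right)
      ultimately show "(norm (w * adj v))\<^sup>2 = (\<Sum>b\<leftarrow>mbasis k. (inner (b * v) w)\<^sup>2)"
        by (simp only: norm_sq_mbasis)
    qed
    also have "\<dots> = (\<Sum>b\<leftarrow>mbasis k. (norm (b * v))\<^sup>2 / (2 * real k))"
      unfolding sum_list_swap[of _ "mbasis k"] using set_mbasis v
      by (intro arg_cong[of _ _ sum_list] map_cong refl I) auto
    also have "\<dots> = (\<Sum>b\<leftarrow>mbasis k. (norm (b * v))\<^sup>2) * (1 / (2 * real k))"
      by (simp add: sum_list_divide)
    also have "\<dots> = (norm v)\<^sup>2" using k v by (simp add: sum_mbasis_adj sum_mbasis_norm_left[of "adj v" k])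
    finally show ?thesis .
  qed
  have "(\<Sum>v\<leftarrow>vs. \<Sum>w\<leftarrow>vs. 2 * (norm (adj v * w))\<^sup>2 + 4 * (norm (w * adj v))\<^sup>2) = (\<Sum>v\<leftarrow>vs. 6 * (norm v)\<^sup>2)"
    using vs left right
    by (intro arg_cong[of _ _ sum_list] map_cong refl) (auto simp: sum_list_addf sum_list_const_mult)
  also have "\<dots> = 6 * real k" by (simp add: sum_list_const_mult tot)
  finally have 1: "(\<Sum>v\<leftarrow>vs. \<Sum>w\<leftarrow>vs. 2 * (norm (adj v * w))\<^sup>2 + 4 * (norm (w * adj v))\<^sup>2) = 6 * real k" .
  have "(\<Sum>v\<leftarrow>vs. (norm (v * adj v))\<^sup>2) \<le> (\<Sum>v\<leftarrow>vs. (norm v)\<^sup>2)"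
  proof (intro sum_list_mono)
    fix v assume v: "v \<in> set vs"
    have "norm (v * adj v) \<le> norm v * 1"
      using norm_mult_fmat[of v "adj v"] vs(2)[OF v] by (metis mult_left_mono norm_adj norm_ge_zero order_trans)
    then show "(norm (v * adj v))\<^sup>2 \<le> (norm v)\<^sup>2" by (intro power_mono) auto
  qed
  then show "avg vs (\<lambda>z. (norm (z * adj z))\<^sup>2) \<le> 7 * real k"
    using avg_mult_adj[of vs] 1 tot by linarith
qed

lemma sign_frame_sq: "sign_frame (sq k) (mbasis k)"
  by unfold_locales (auto simp: subspace_sq dest: set_mbasis intro: parseval_sq)

definition msmp :: "nat \<Rightarrow> nat \<Rightarrow> fmat list" where
  "msmp k N = smp (1 / sqrt (2 * real k)) (mbasis k) N"

text \<open>The list underlying \<rho> y + \<sigma> x for independent samples x and y. The scale 1 /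
  sqrt(2 k) in \<open>msmp\<close> is the one that gives the required variance.\<close>

lemma isotropic_msmp:
  assumes "k > 0" "N \<ge> 1" "\<rho>\<^sup>2 + \<sigma>\<^sup>2 = 1"
  shows "isotropic k (map (scaleR \<sigma>) (msmp k N) @ map (scaleR \<rho>) (msmp k N))"
proof -
  interpret sign_frame "sq k" "mbasis k" "1 / sqrt (2 * real k)" by (rule sign_frame_sq)
  have sm: "(\<Sum>w\<leftarrow>msmp k N. (inner b w)\<^sup>2) = (norm b)\<^sup>2 / (2 * real k)" if "b \<in> sq k" for b
    using second_moment[OF assms(2) that that] assms(1)
    by (simp add: msmp_def power2_norm_eq_inner) (simp add: power2_eq_square)
  have n: "v \<in> sq k \<and> norm v \<le> 1" if "v \<in> set (msmp k N)" for v
  proof -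
    obtain b where b: "b \<in> set (mbasis k)" "v = (1 / sqrt (2 * real k) / sqrt (real N)) *\<^sub>R b"
      using \<open>v \<in> set (msmp k N)\<close> by (auto simp: msmp_def smp_def split: if_splits)
    have "1 \<le> sqrt (2 * real k)" "1 \<le> sqrt (real N)" using assms by simp_all
    then have "1 / sqrt (2 * real k) / sqrt (real N) \<le> 1" by (simp add: divide_le_eq_1 mult_ge1_I field_simps)
    then show ?thesis using set_mbasis[OF b(1)] b by simp
  qed
  have "\<sigma>\<^sup>2 \<le> 1\<^sup>2" "\<rho>\<^sup>2 \<le> 1\<^sup>2" using assms(3) zero_le_power2[of \<sigma>] zero_le_power2[of \<rho>] by (simp_all, linarith+)
  then have s: "\<bar>\<sigma>\<bar> \<le> 1" "\<bar>\<rho>\<bar> \<le> 1"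
    using abs_le_square_iff[of \<sigma> 1] abs_le_square_iff[of \<rho> 1] by simp_all
  have "(\<Sum>w\<leftarrow>map (scaleR \<sigma>) (msmp k N) @ map (scaleR \<rho>) (msmp k N). (inner b w)\<^sup>2) = (norm b)\<^sup>2 / (2 * real k)" if "b \<in> sq k" for b
  proof -
    have "(\<Sum>w\<leftarrow>map (scaleR \<sigma>) (msmp k N) @ map (scaleR \<rho>) (msmp k N). (inner b w)\<^sup>2)
       = (\<sigma>\<^sup>2 + \<rho>\<^sup>2) * (\<Sum>w\<leftarrow>msmp k N. (inner b w)\<^sup>2)"
      by (simp add: comp_def power_mult_distrib sum_list_const_mult algebra_simps)
    then show ?thesis using assms(3) sm[OF that] by (simp add: add.commute)
  qed
  moreover have "norm (\<sigma> *\<^sub>R v) \<le> 1 \<and> norm (\<rho> *\<^sub>R v) \<le> 1" if "v \<in> set (msmp k N)" for v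
    using n[OF that] s by (simp add: mult_le_one)
  ultimately show ?thesis using n by (auto simp: isotropic_def)
qed

text \<open>
  The hypotheses hold for the component maps of an asymptotic homomorphism. The truncation at
  operator norm \<open>R\<close> makes \<open>h\<close> applicable to random arguments; the resulting linear map
  intertwines left multiplication by \<open>u\<close> and by \<open>hu u\<close> on average over the matrix units.
\<close>

theorem linear_model:
  assumes k: "k > 0" and l: "l > 0" and R: "1 \<le> R" and \<delta>: "0 < \<delta>"
    and small: "\<delta> + 3 / R \<le> 1 / 100000"
    and hl: "\<And>a. a \<in> sq k \<Longrightarrow> opb R a \<Longrightarrow> h a \<in> sq l"
    and hinner: "\<And>a b. a \<in> sq k \<Longrightarrow> opb R a \<Longrightarrow> b \<in> sq k \<Longrightarrow> opb R b \<Longrightarrow>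
      \<bar>inner (h a) (h b) / l - inner a b / k\<bar> \<le> \<delta>"
    and hlip: "\<And>a b. a \<in> sq k \<Longrightarrow> opb R a \<Longrightarrow> b \<in> sq k \<Longrightarrow> opb R b \<Longrightarrow>
      norm (h a - h b) / sqrt l \<le> norm (a - b) / sqrt k + \<delta>"
    and hu: "\<And>u. u \<in> umat k \<Longrightarrow> hu u \<in> umat l"
    and hmult: "\<And>u a. u \<in> umat k \<Longrightarrow> a \<in> sq k \<Longrightarrow> opb R a \<Longrightarrow> norm (h (u * a) - hu u * h a) / sqrt l \<le> \<delta>"
    and hi: "\<And>a. a \<in> sq k \<Longrightarrow> opb R a \<Longrightarrow> norm (h (cs \<i> a) - cs \<i> (h a)) / sqrt l \<le> \<delta>"
  shows "\<exists>\<Lambda>. (\<forall>x y. \<Lambda> (x + y) = \<Lambda> x + \<Lambda> y) \<and> (\<forall>c x. \<Lambda> (cs c x) = cs c (\<Lambda> x)) \<and> (\<forall>x. \<Lambda> x \<in> sq l) \<and>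
    (\<forall>u\<in>umat k. (\<Sum>i<k. \<Sum>j<k. (norm (\<Lambda> (u * eu i j) - hu u * \<Lambda> (eu i j)))\<^sup>2) \<le> 3000 * (\<delta> + 3 / R) * real k) \<and>
    (\<Sum>i<k. \<Sum>j<k. (norm (\<Lambda> (eu i j)))\<^sup>2) \<ge> real k / 16"
proof -
  interpret sign_frame "sq k" "mbasis k" "1 / sqrt (2 * real k)" by (rule sign_frame_sq)
  have Sm: "S N = msmp k N" for N by (simp add: msmp_def)
  \<comment> \<open>The error of \<open>h\<close> plus the error of truncation. The latter is
    computed in \<open>corrb\<close> as 11/4 divided by \<open>R\<close> and rounded up.\<close>
  define d where "d = \<delta> + 3 / R"
  have d: "0 < d" "d \<le> 1 / 100000" "\<delta> \<le> d" using \<delta> R small by (auto simp: d_def intro: add_pos_pos)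
  have R0: "R > 0" using R by simp
  have sk: "sqrt (real k) > 0" "sqrt (real l) > 0" using k l by auto
  \<comment> \<open>Truncation makes \<open>h\<close> applicable to unbounded samples. The target is
    normalized by the factor in front, the source by the scale of the sample.\<close>
  define F where "F y = (1 / sqrt l) *\<^sub>R h (chi k R y)" for y
  have B: "chi k R y \<in> sq k" "opb R (chi k R y)" if "y \<in> sq k" for y
    using that R0 by (auto intro: chi_opb)
  have FR: "F y \<in> sq l" if "y \<in> sq k" for y using hl[OF B[OF that]] by (simp add: F_def)
  have Lip: "norm (F x - F y) \<le> 3 / sqrt k * norm (x - y) + d" if "x \<in> sq k" "y \<in> sq k" for x y
  proof -
    have "norm (F x - F y) = norm (h (chi k R x) - h (chi k R y)) / sqrt l"
      by (simp add: F_def flip: scaleR_diff_right)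
    also have "\<dots> \<le> norm (chi k R x - chi k R y) / sqrt k + \<delta>"
      by (intro hlip B that)
    also have "\<dots> \<le> 3 * norm (x - y) / sqrt k + \<delta>"
      by (intro add_right_mono divide_right_mono chi_lipschitz that R0) simp
    finally show ?thesis using d by simp
  qed
  have Finner: "\<bar>inner (F x) (F y) - inner (chi k R x) (chi k R y) / k\<bar> \<le> \<delta>" if "x \<in> sq k" "y \<in> sq k" for x y
    using hinner[OF B[OF that(1)] B[OF that(2)]] by (simp add: F_def)
  have chile: "norm (chi k R y) \<le> norm y" if "y \<in> sq k" for y
    using opb_right[OF res_props(4)[of "(1 / R) *\<^sub>R y" k], of y] that by (simp add: chi_def)
  have chinorm: "(norm (x - chi k R x))\<^sup>2 \<le> (norm (x * adj x))\<^sup>2 / (4 * R\<^sup>2)" if "x \<in> sq k" for x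
  proof -
    have "(norm (x - chi k R x))\<^sup>2 \<le> (norm (x * adj x) / (2 * R))\<^sup>2"
      by (intro power_mono chi_approx that R0) simp
    then show ?thesis by (simp add: power_divide power_mult_distrib)
  qed
  have two: "avg (S N) (\<lambda>x. avg (S N) (\<lambda>y. G (\<rho> *\<^sub>R y + \<sigma> *\<^sub>R x))) = avg (map (scaleR \<sigma>) (msmp k N) @ map (scaleR \<rho>) (msmp k N)) G"
    for G :: "fmat \<Rightarrow> real" and N \<rho> \<sigma>
  proof -
    have lin: "linear (scaleR a :: fmat \<Rightarrow> fmat)" for a by (simp add: linear_iff algebra_simps)
    show ?thesis unfolding avg_append by (simp add: avg_map lin add.commute Sm)
  qed
  have corrb: "\<bar>avg (S N) (\<lambda>x. avg (S N) (\<lambda>y. inner (F (\<rho> *\<^sub>R y + \<sigma> *\<^sub>R x)) (F y))) - \<rho>\<bar> \<le> d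
     \<and> avg (S N) (\<lambda>x. avg (S N) (\<lambda>y. (norm (F (\<rho> *\<^sub>R y + \<sigma> *\<^sub>R x)))\<^sup>2)) \<le> 2"
    if N: "N \<ge> 1" and \<rho>\<sigma>: "\<rho>\<^sup>2 + \<sigma>\<^sup>2 = 1" for N \<rho> \<sigma>
  proof -
    let ?vs = "map (scaleR \<sigma>) (msmp k N) @ map (scaleR \<rho>) (msmp k N)"
    let ?E = "\<lambda>G. avg (S N) (\<lambda>x. avg (S N) (\<lambda>y. G (\<rho> *\<^sub>R y + \<sigma> *\<^sub>R x) y)) :: real"
    note m = isotropic_moments[OF isotropic_msmp[OF k N \<rho>\<sigma>] k]
    have "isotropic k (map (scaleR 0) (msmp k N) @ map (scaleR 1) (msmp k N))"
      by (rule isotropic_msmp[OF k N]) simp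
    note m0 = isotropic_moments[OF this k]
    have e1: "?E (\<lambda>a y. (norm a)\<^sup>2) = k" using two[of N "\<lambda>z. (norm z)\<^sup>2" \<rho> \<sigma>] m(1) by simp
    have e2: "?E (\<lambda>a y. (norm (a * adj a))\<^sup>2) \<le> 7 * k" using two[of N "\<lambda>z. (norm (z * adj z))\<^sup>2" \<rho> \<sigma>] m(2) by simp
    have e3: "avg (S N) (\<lambda>y. (norm y)\<^sup>2) = k" using two[of N "\<lambda>z. (norm z)\<^sup>2" 1 0] m0(1) by simp
    have e4: "avg (S N) (\<lambda>y. (norm (y * adj y))\<^sup>2) \<le> 7 * k" using two[of N "\<lambda>z. (norm (z * adj z))\<^sup>2" 1 0] m0(2) by simp
    have zV: "\<rho> *\<^sub>R y + \<sigma> *\<^sub>R x \<in> sq k" if "x \<in> sq k" "y \<in> sq k" for x y using that by auto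
    have cross: "avg (S N) (\<lambda>x. avg (S N) (\<lambda>y. inner (\<rho> *\<^sub>R y + \<sigma> *\<^sub>R x) y)) = \<rho> * k"
    proof -
      have "avg (S N) (\<lambda>y. inner (\<rho> *\<^sub>R y + \<sigma> *\<^sub>R x) y) = \<rho> * k + \<sigma> * avg (S N) (\<lambda>y. inner x y)" for x
        using e3 by (simp add: inner_add_left avg_add avg_cmult power2_norm_eq_inner)
      then show ?thesis by (simp add: avg_inner_zero)
    qed
    have pt: "\<bar>inner (F a) (F y) - inner a y / k\<bar>
      \<le> \<delta> + (1 / (2 * R * k)) * ((norm a)\<^sup>2 + (norm y)\<^sup>2) + (1 / (8 * R * k)) * ((norm (a * adj a))\<^sup>2 + (norm (y * adj y))\<^sup>2)"
      if "a \<in> sq k" "y \<in> sq k" for a y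
    proof -
      have amgm: "p * q \<le> 1 / (2 * R) * q\<^sup>2 + R / 2 * p\<^sup>2" for p q
      proof -
        have "0 \<le> (q - R * p)\<^sup>2" by simp
        then show ?thesis using R0 by (simp add: field_simps power2_eq_square)
      qed
      have "inner a y - inner (chi k R a) (chi k R y) = inner (a - chi k R a) (chi k R y) + inner a (y - chi k R y)"
        by (simp add: inner_simps)
      then have "\<bar>inner a y - inner (chi k R a) (chi k R y)\<bar> \<le> norm (a - chi k R a) * norm (chi k R y) + norm (y - chi k R y) * norm a"
        using Cauchy_Schwarz_ineq2[of "a - chi k R a" "chi k R y"] Cauchy_Schwarz_ineq2[of a "y - chi k R y"]
        by (simp add: mult.commute)
      also have "\<dots> \<le> norm (a - chi k R a) * norm y + norm (y - chi k R y) * norm a"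
        by (intro add_right_mono mult_left_mono chile that) simp
      also have "\<dots> \<le> (1 / (2 * R) * (norm y)\<^sup>2 + R / 2 * (norm (a - chi k R a))\<^sup>2) + (1 / (2 * R) * (norm a)\<^sup>2 + R / 2 * (norm (y - chi k R y))\<^sup>2)"
        by (intro add_mono amgm)
      also have "\<dots> \<le> (1 / (2 * R) * (norm y)\<^sup>2 + R / 2 * ((norm (a * adj a))\<^sup>2 / (4 * R\<^sup>2))) + (1 / (2 * R) * (norm a)\<^sup>2 + R / 2 * ((norm (y * adj y))\<^sup>2 / (4 * R\<^sup>2)))"
        using R0 by (intro add_mono mult_left_mono chinorm that order_refl) auto
      also have "\<dots> = (1 / (2 * R)) * ((norm a)\<^sup>2 + (norm y)\<^sup>2) + (1 / (8 * R)) * ((norm (a * adj a))\<^sup>2 + (norm (y * adj y))\<^sup>2)"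
        using R0 by (simp add: field_simps power2_eq_square)
      finally have "\<bar>inner a y - inner (chi k R a) (chi k R y)\<bar> / k \<le> \<dots> / k"
        by (rule divide_right_mono) simp
      moreover have "\<bar>inner a y / k - inner (chi k R a) (chi k R y) / k\<bar> = \<bar>inner a y - inner (chi k R a) (chi k R y)\<bar> / k"
        by (simp add: abs_divide diff_divide_distrib[symmetric])
      moreover have "((1 / (2 * R)) * P + (1 / (8 * R)) * Q) / k = (1 / (2 * R * k)) * P + (1 / (8 * R * k)) * Q" for P Q
        by (simp add: add_divide_distrib)
      ultimately show ?thesis using Finner[OF that] by (simp only:)
    qed
    have "\<bar>?E (\<lambda>a y. inner (F a) (F y)) - \<rho>\<bar> = \<bar>?E (\<lambda>a y. inner (F a) (F y) - inner a y / k)\<bar>"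
    proof -
      have "?E (\<lambda>a y. inner a y / k) = \<rho>"
        using cross avg_cmult[of "S N" "1 / real k"] k by simp
      then show ?thesis by (simp add: avg_diff)
    qed
    also have "\<dots> \<le> ?E (\<lambda>a y. \<bar>inner (F a) (F y) - inner a y / k\<bar>)"
      by (intro order_trans[OF avg_abs] avg_mono avg_abs)
    also have "\<dots> \<le> ?E (\<lambda>a y. \<delta> + (1 / (2 * R * k)) * ((norm a)\<^sup>2 + (norm y)\<^sup>2) + (1 / (8 * R * k)) * ((norm (a * adj a))\<^sup>2 + (norm (y * adj y))\<^sup>2))"
      by (intro avg_mono_span[OF sub S_V] pt zV)
    also have "\<dots> = \<delta> + (1 / (2 * R * k)) * (?E (\<lambda>a y. (norm a)\<^sup>2) + avg (S N) (\<lambda>y. (norm y)\<^sup>2))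
       + (1 / (8 * R * k)) * (?E (\<lambda>a y. (norm (a * adj a))\<^sup>2) + avg (S N) (\<lambda>y. (norm (y * adj y))\<^sup>2))"
      by (simp only: avg_add avg_cmult avg_const)
    also have "\<dots> \<le> \<delta> + (1 / (2 * R * k)) * (k + k) + (1 / (8 * R * k)) * (7 * k + 7 * k)"
      using e1 e2 e3 e4 R0 by (intro add_mono mult_left_mono) auto
    also have "\<dots> = \<delta> + (11 / 4) / R" using k R0 by (simp add: field_simps)
    also have "\<dots> \<le> d" using R0 by (simp add: d_def field_simps)
    finally have 1: "\<bar>?E (\<lambda>a y. inner (F a) (F y)) - \<rho>\<bar> \<le> d" .
    have "(norm (F a))\<^sup>2 \<le> (1 / k) * (norm a)\<^sup>2 + \<delta>" if a: "a \<in> sq k" for a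
    proof -
      have "(norm (F a))\<^sup>2 \<le> (norm (chi k R a))\<^sup>2 / k + \<delta>"
        using Finner[OF a a] by (simp add: power2_norm_eq_inner)
      also have "\<dots> \<le> (norm a)\<^sup>2 / k + \<delta>"
        by (intro add_right_mono divide_right_mono power_mono chile a) auto
      finally show ?thesis by simp
    qed
    then have "?E (\<lambda>a y. (norm (F a))\<^sup>2) \<le> ?E (\<lambda>a y. (1 / k) * (norm a)\<^sup>2 + \<delta>)"
      by (intro avg_mono_span[OF sub S_V]) (use zV in auto)
    also have "\<dots> = (1 / k) * ?E (\<lambda>a y. (norm a)\<^sup>2) + \<delta>" by (simp only: avg_add avg_cmult avg_const)
    also have "\<dots> \<le> 2" using e1 k d by simp
    finally show ?thesis using 1 by simp
  qed
  obtain \<Lambda>0 where "linear \<Lambda>0" and \<Lambda>0: "\<And>u u'. linear u \<Longrightarrow> (\<forall>z\<in>sq k. u z \<in> sq k) \<Longrightarrow>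
     (\<forall>v\<in>sq k. u' v \<in> sq k \<and> (\<forall>z. inner v (u z) = inner (u' v) z)) \<Longrightarrow>
     (\<forall>v\<in>sq k. \<forall>w\<in>sq k. inner (u' v) (u' w) = inner v w) \<Longrightarrow>
     (\<forall>\<^sub>F N in sequentially. avg (S N) (\<lambda>y. (norm (F (u y) - \<Lambda>0 (u y)))\<^sup>2) \<le> 480 * d)"
    using gaussian_linearization[OF Lip _ d(1) _ conjunct1[OF corrb] conjunct2[OF corrb]] sk d by force
  \<comment> \<open>The values of \<Lambda>0 need not lie in \<open>sq l\<close>; compression
    repairs this and cannot increase the distance to \<open>F\<close>, whose values do.\<close>
  define \<Lambda>1 where "\<Lambda>1 x = unitm l * \<Lambda>0 x * unitm l" for x
  have lin1: "linear \<Lambda>1" using \<open>linear \<Lambda>0\<close>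
    by (auto simp: \<Lambda>1_def linear_iff algebra_simps)
  have \<Lambda>1l: "\<Lambda>1 x \<in> sq l" for x
    unfolding \<Lambda>1_def using unitm_left_rect[OF supp, of l "\<Lambda>0 x"] unitm_right_rect by blast
  have ev: "\<forall>\<^sub>F N in sequentially. avg (S N) (\<lambda>y. (norm (F (u * y) - \<Lambda>1 (u * y)))\<^sup>2) \<le> 480 * d" if u: "u \<in> umat k" for u
  proof -
    have ur: "u \<in> sq k" "adj u \<in> sq k" "adj (adj u) * adj u = unitm k" using u by (auto simp: umat_def)
    have ip: "u * (adj u * w) = w" if "w \<in> sq k" for w
      using umat_cancel_left[OF umat_adj[OF u] that] by simp
    have "\<forall>\<^sub>F N in sequentially. avg (S N) (\<lambda>y. (norm (F (u * y) - \<Lambda>0 (u * y)))\<^sup>2) \<le> 480 * d"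
      by (rule \<Lambda>0[of "\<lambda>y. u * y" "\<lambda>y. adj u * y"])
        (use ur in \<open>auto simp: linear_iff algebra_simps ip inner_mult_left\<close>)
    then show ?thesis
    proof eventually_elim
      case (elim N)
      have "avg (S N) (\<lambda>y. (norm (F (u * y) - \<Lambda>1 (u * y)))\<^sup>2) \<le> avg (S N) (\<lambda>y. (norm (F (u * y) - \<Lambda>0 (u * y)))\<^sup>2)"
      proof (rule avg_mono_span[OF sub S_V])
        fix y assume "y \<in> sq k"
        then have "u * y \<in> sq k" using ur by auto
        then have "F (u * y) - \<Lambda>1 (u * y) = unitm l * (F (u * y) - \<Lambda>0 (u * y)) * unitm l"
          using FR by (simp add: \<Lambda>1_def algebra_simps)
        also have "norm \<dots> \<le> 1 * (1 * norm (F (u * y) - \<Lambda>0 (u * y)))"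
          by (intro order_trans[OF opb_right[OF opb_unitm]] mult_left_mono opb_left opb_unitm) auto
        finally show "(norm (F (u * y) - \<Lambda>1 (u * y)))\<^sup>2 \<le> (norm (F (u * y) - \<Lambda>0 (u * y)))\<^sup>2"
          by (intro power_mono) auto
      qed
      then show ?case using elim by linarith
    qed
  qed
  have ex: "\<exists>N\<ge>1. avg (S N) (\<lambda>y. (norm (F (u * y) - \<Lambda>1 (u * y)))\<^sup>2) \<le> 480 * d \<and> avg (S N) (\<lambda>y. (norm (F y - \<Lambda>1 y))\<^sup>2) \<le> 480 * d"
    if u: "u \<in> umat k" for u
  proof -
    have "avg (S N) (\<lambda>y. (norm (F (unitm k * y) - \<Lambda>1 (unitm k * y)))\<^sup>2) = avg (S N) (\<lambda>y. (norm (F y - \<Lambda>1 y))\<^sup>2)" for N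
      by (rule avg_cong_span[OF sub S_V]) simp
    then have "\<forall>\<^sub>F N in sequentially. avg (S N) (\<lambda>y. (norm (F y - \<Lambda>1 y))\<^sup>2) \<le> 480 * d" using ev[OF umat_unitm] by simp
    then have "\<forall>\<^sub>F N in sequentially. 1 \<le> N \<and> avg (S N) (\<lambda>y. (norm (F (u * y) - \<Lambda>1 (u * y)))\<^sup>2) \<le> 480 * d \<and> avg (S N) (\<lambda>y. (norm (F y - \<Lambda>1 y))\<^sup>2) \<le> 480 * d"
      using ev[OF u] eventually_ge_at_top[of 1] by eventually_elim auto
    then show ?thesis using eventually_happens'[OF sequentially_bot] by blast
  qed
  \<comment> \<open>For a linear map the average over the sample is exactly a sum over the basis,
    for every N. Estimates that hold only eventually in N therefore turn into exact statements about
    matrix units.\<close>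
  have quad: "avg (S N) (\<lambda>y. (norm (g y))\<^sup>2) = (\<Sum>b\<leftarrow>mbasis k. (norm (g b))\<^sup>2) / (2 * k)" if "linear g" "N \<ge> 1" for g :: "fmat \<Rightarrow> fmat" and N
  proof -
    have "(norm (g ((1 / sqrt (2 * real k) / sqrt (real N)) *\<^sub>R b)))\<^sup>2 = (norm (g b))\<^sup>2 / (2 * k * N)" for b
      by (simp add: linear_cmul[OF that(1)] power_mult_distrib power_divide)
    then show ?thesis using that
      by (simp only: avg_linear_sq smp_sum_list sum_list_divide) simp
  qed
  have three: "(norm (a + b + c))\<^sup>2 \<le> 3 * (norm a)\<^sup>2 + 3 * (norm b)\<^sup>2 + 3 * (norm c)\<^sup>2" for a b c :: fmat
  proof -
    have "norm (a + b + c) \<le> norm a + norm b + norm c" by (intro norm_triangle_le add_mono order_refl norm_triangle_ineq)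
    then have "(norm (a + b + c))\<^sup>2 \<le> (norm a + norm b + norm c)\<^sup>2" by (intro power_mono) auto
    also have "\<dots> \<le> 3 * (norm a)\<^sup>2 + 3 * (norm b)\<^sup>2 + 3 * (norm c)\<^sup>2"
      using sum_squares_bound[of "norm a" "norm b"] sum_squares_bound[of "norm b" "norm c"] sum_squares_bound[of "norm a" "norm c"]
      by (simp add: power2_eq_square algebra_simps)
    finally show ?thesis .
  qed
  have lower1: "(\<Sum>b\<leftarrow>mbasis k. (norm (\<Lambda>1 b))\<^sup>2) / (2 * k) \<ge> 1 / 3"
  proof -
    obtain N where N: "N \<ge> 1" "avg (S N) (\<lambda>y. (norm (F y - \<Lambda>1 y))\<^sup>2) \<le> 480 * d" using ex[OF umat_unitm] by blast
    have "1 - d \<le> avg (S N) (\<lambda>y. (norm (F y))\<^sup>2)"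
      using corrb[OF N(1), of 1 0] by (simp add: power2_norm_eq_inner abs_le_iff)
    also have "\<dots> \<le> avg (S N) (\<lambda>y. 2 * (norm (F y - \<Lambda>1 y))\<^sup>2 + 2 * (norm (\<Lambda>1 y))\<^sup>2)"
    proof (rule avg_mono)
      fix y
      have "(norm (F y - \<Lambda>1 y + \<Lambda>1 y))\<^sup>2 \<le> (norm (F y - \<Lambda>1 y) + norm (\<Lambda>1 y))\<^sup>2"
        by (intro power_mono norm_triangle_ineq) auto
      then show "(norm (F y))\<^sup>2 \<le> 2 * (norm (F y - \<Lambda>1 y))\<^sup>2 + 2 * (norm (\<Lambda>1 y))\<^sup>2"
        using sum_squares_bound[of "norm (F y - \<Lambda>1 y)" "norm (\<Lambda>1 y)"] by (simp add: power2_sum)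
    qed
    also have "\<dots> = 2 * avg (S N) (\<lambda>y. (norm (F y - \<Lambda>1 y))\<^sup>2) + 2 * avg (S N) (\<lambda>y. (norm (\<Lambda>1 y))\<^sup>2)"
      by (simp only: avg_add avg_cmult)
    finally have "1 - d \<le> 2 * (480 * d) + 2 * avg (S N) (\<lambda>y. (norm (\<Lambda>1 y))\<^sup>2)" using N(2) by linarith
    then show ?thesis using d unfolding quad[OF lin1 N(1)] by linarith
  qed
  \<comment> \<open>Stated for a linear contraction g in order to cover both left multiplication by
    \<open>hu u\<close> and multiplication by \<i>. The constant comes from 3 * 480 + 3 * 480 +
    3.\<close>
  have uvar: "(\<Sum>b\<leftarrow>mbasis k. (norm (\<Lambda>1 (u * b) - g (\<Lambda>1 b)))\<^sup>2) / (2 * k) \<le> 2900 * d"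
    if u: "u \<in> umat k" and g: "linear g" "\<And>x. x \<in> sq l \<Longrightarrow> norm (g x) \<le> norm x"
      and Fg: "\<And>y. y \<in> sq k \<Longrightarrow> norm (F (u * y) - g (F y)) \<le> \<delta>" for u g
  proof -
    obtain N where N: "N \<ge> 1" "avg (S N) (\<lambda>y. (norm (F (u * y) - \<Lambda>1 (u * y)))\<^sup>2) \<le> 480 * d" "avg (S N) (\<lambda>y. (norm (F y - \<Lambda>1 y))\<^sup>2) \<le> 480 * d"
      using ex[OF u] by blast
    have lin: "linear (\<lambda>y. \<Lambda>1 (u * y) - g (\<Lambda>1 y))"
      using lin1 g(1) by (auto simp: linear_iff algebra_simps)
    have "avg (S N) (\<lambda>y. (norm (\<Lambda>1 (u * y) - g (\<Lambda>1 y)))\<^sup>2)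
      \<le> avg (S N) (\<lambda>y. 3 * (norm (F (u * y) - \<Lambda>1 (u * y)))\<^sup>2 + 3 * \<delta>\<^sup>2 + 3 * (norm (F y - \<Lambda>1 y))\<^sup>2)"
    proof (rule avg_mono_span[OF sub S_V])
      fix y assume y: "y \<in> sq k"
      have "\<Lambda>1 (u * y) - g (\<Lambda>1 y) = (\<Lambda>1 (u * y) - F (u * y)) + (F (u * y) - g (F y)) + g (F y - \<Lambda>1 y)"
        using g(1) by (simp add: linear_diff)
      then have "(norm (\<Lambda>1 (u * y) - g (\<Lambda>1 y)))\<^sup>2 \<le> 3 * (norm (\<Lambda>1 (u * y) - F (u * y)))\<^sup>2
         + 3 * (norm (F (u * y) - g (F y)))\<^sup>2 + 3 * (norm (g (F y - \<Lambda>1 y)))\<^sup>2" by (simp only: three)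
      also have "\<dots> \<le> 3 * (norm (F (u * y) - \<Lambda>1 (u * y)))\<^sup>2 + 3 * \<delta>\<^sup>2 + 3 * (norm (F y - \<Lambda>1 y))\<^sup>2"
        using Fg[OF y] g(2)[of "F y - \<Lambda>1 y"] FR[OF y] \<Lambda>1l
        by (intro add_mono mult_left_mono power_mono) (auto simp: norm_minus_commute)
      finally show "(norm (\<Lambda>1 (u * y) - g (\<Lambda>1 y)))\<^sup>2 \<le> \<dots>" .
    qed
    also have "\<dots> = 3 * avg (S N) (\<lambda>y. (norm (F (u * y) - \<Lambda>1 (u * y)))\<^sup>2) + 3 * \<delta>\<^sup>2 + 3 * avg (S N) (\<lambda>y. (norm (F y - \<Lambda>1 y))\<^sup>2)"
      by (simp only: avg_add avg_cmult avg_const)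
    also have "\<dots> \<le> 2880 * d + 3 * d"
    proof -
      have "\<delta> * \<delta> \<le> 1 * \<delta>" using d \<delta> by (intro mult_right_mono) auto
      then have "\<delta>\<^sup>2 \<le> d" using d by (simp add: power2_eq_square)
      then show ?thesis using N by linarith
    qed
    finally show ?thesis using d unfolding quad[OF lin N(1)] by linarith
  qed
  \<comment> \<open>The complex linear part of the real linear map \<Lambda>1.\<close>
  define \<Lambda> where "\<Lambda> x = (1/2) *\<^sub>R (\<Lambda>1 x - cs \<i> (\<Lambda>1 (cs \<i> x)))" for x
  have add: "\<Lambda> (x + y) = \<Lambda> x + \<Lambda> y" for x y
    by (simp add: \<Lambda>_def cs_add linear_add[OF lin1] algebra_simps)
  have i: "\<Lambda> (cs \<i> x) = cs \<i> (\<Lambda> x)" for x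
    by (simp add: \<Lambda>_def cs_scaleR cs_diff cs_minus linear_neg[OF lin1])
  have r: "\<Lambda> (r *\<^sub>R x) = r *\<^sub>R \<Lambda> x" for r x
    by (simp add: \<Lambda>_def cs_scaleR linear_cmul[OF lin1] algebra_simps)
  have cs: "\<Lambda> (cs c x) = cs c (\<Lambda> x)" for c x
  proof -
    have "cs c z = Re c *\<^sub>R z + Im c *\<^sub>R cs \<i> z" for z
      by (intro fmat_eqI) (simp add: complex_eq_iff)
    then show ?thesis by (simp add: add r i)
  qed
  have isum: "(\<Sum>b\<leftarrow>mbasis k. f (cs \<i> b)) = (\<Sum>b\<leftarrow>mbasis k. f b)" if "\<And>x. f (- x) = f x" for f :: "fmat \<Rightarrow> real"
  proof -
    have "cs (-1) x = - x" for x by (intro fmat_eqI) simp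
    then show ?thesis by (simp add: sum_mbasis that add.commute)
  qed
  have dbl: "(\<Sum>b\<leftarrow>mbasis k. (norm (g b))\<^sup>2) = 2 * (\<Sum>i<k. \<Sum>j<k. (norm (g (eu i j)))\<^sup>2)" if "\<And>x. g (cs \<i> x) = cs \<i> (g x)" for g :: "fmat \<Rightarrow> fmat"
    by (simp add: sum_mbasis that sum_distrib_left)
  have half: "(norm ((1/2) *\<^sub>R (a - b)))\<^sup>2 \<le> (norm a)\<^sup>2 / 2 + (norm b)\<^sup>2 / 2" for a b :: fmat
  proof -
    have "(norm (a - b))\<^sup>2 \<le> (norm a + norm b)\<^sup>2" by (intro power_mono norm_triangle_ineq4) auto
    then show ?thesis using sum_squares_bound[of "norm a" "norm b"]
      by (simp add: power_mult_distrib power2_sum power_divide)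
  qed
  have main: "(\<Sum>i<k. \<Sum>j<k. (norm (\<Lambda> (u * eu i j) - hu u * \<Lambda> (eu i j)))\<^sup>2) \<le> 3000 * d * real k" if u: "u \<in> umat k" for u
  proof -
    let ?D = "\<lambda>b. \<Lambda>1 (u * b) - hu u * \<Lambda>1 b"
    have "(\<Sum>b\<leftarrow>mbasis k. (norm (?D b))\<^sup>2) / (2 * k) \<le> 2900 * d"
    proof (rule uvar[OF u, of "\<lambda>x. hu u * x"])
      show "linear (\<lambda>x. hu u * x)" by (auto simp: linear_iff algebra_simps)
      show "norm (hu u * x) \<le> norm x" for x using opb_left[OF umat_opb[OF hu[OF u]], of x] by simp
      show "norm (F (u * y) - hu u * F y) \<le> \<delta>" if y: "y \<in> sq k" for y
        using hmult[OF u B[OF y]] by (simp add: F_def chi_unitary[OF u y] flip: scaleR_diff_right)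
    qed
    then have D: "(\<Sum>b\<leftarrow>mbasis k. (norm (?D b))\<^sup>2) \<le> 5800 * d * k" using k by (simp add: field_simps)
    have "\<Lambda> (u * b) - hu u * \<Lambda> b = (1/2) *\<^sub>R (?D b - cs \<i> (?D (cs \<i> b)))" for b
      by (simp add: \<Lambda>_def cs_diff algebra_simps)
    then have "(\<Sum>b\<leftarrow>mbasis k. (norm (\<Lambda> (u * b) - hu u * \<Lambda> b))\<^sup>2) \<le> (\<Sum>b\<leftarrow>mbasis k. (norm (?D b))\<^sup>2 / 2 + (norm (?D (cs \<i> b)))\<^sup>2 / 2)"
      by (simp only:) (intro sum_list_mono order_trans[OF half], simp)
    also have "\<dots> = (\<Sum>b\<leftarrow>mbasis k. (norm (?D b))\<^sup>2) / 2 + (\<Sum>b\<leftarrow>mbasis k. (norm (?D (cs \<i> b)))\<^sup>2) / 2"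
      by (simp only: sum_list_addf sum_list_divide)
    also have "(\<Sum>b\<leftarrow>mbasis k. (norm (?D (cs \<i> b)))\<^sup>2) = (\<Sum>b\<leftarrow>mbasis k. (norm (?D b))\<^sup>2)"
    proof (rule isum)
      have "?D (- x) = - ?D x" for x by (simp add: linear_neg[OF lin1])
      then show "(norm (?D (- x)))\<^sup>2 = (norm (?D x))\<^sup>2" for x by (simp only: norm_minus_cancel)
    qed
    finally have "(\<Sum>b\<leftarrow>mbasis k. (norm (\<Lambda> (u * b) - hu u * \<Lambda> b))\<^sup>2) \<le> 5800 * d * k" using D by linarith
    then have "2 * (\<Sum>i<k. \<Sum>j<k. (norm (\<Lambda> (u * eu i j) - hu u * \<Lambda> (eu i j)))\<^sup>2) \<le> 5800 * d * k"
      by (subst (asm) dbl) (simp_all add: i cs_diff)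
    moreover have "0 \<le> d * k" using d by simp
    ultimately show ?thesis by linarith
  qed
  have lower: "(\<Sum>i<k. \<Sum>j<k. (norm (\<Lambda> (eu i j)))\<^sup>2) \<ge> real k / 16"
  proof -
    \<comment> \<open>The complex linear part could vanish if \<Lambda>1 were antilinear. The
      estimate \<open>uvar\<close> for u = \<i> 1 excludes this, since \<Lambda>1 b - \<Lambda> b is
      \<i> / 2 times the defect \<open>?D b\<close>.\<close>
    let ?D = "\<lambda>b. \<Lambda>1 (cs \<i> (unitm k) * b) - cs \<i> (\<Lambda>1 b)"
    have "(\<Sum>b\<leftarrow>mbasis k. (norm (?D b))\<^sup>2) / (2 * k) \<le> 2900 * d"
    proof (rule uvar[of "cs \<i> (unitm k)" "cs \<i>"])
      show "cs \<i> (unitm k) \<in> umat k" by (intro umat_cs) auto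
      show "linear (cs \<i>)" by (auto simp: linear_iff cs_add cs_scaleR)
      show "norm (cs \<i> x) \<le> norm x" for x by simp
      show "norm (F (cs \<i> (unitm k) * y) - cs \<i> (F y)) \<le> \<delta>" if y: "y \<in> sq k" for y
      proof -
        have "chi k R (cs \<i> y) = cs \<i> (chi k R y)"
          using chi_unitary[of "cs \<i> (unitm k)" k y R] y B[OF y] by (simp add: umat_cs)
        then show ?thesis using hi[OF B[OF y]] y by (simp add: F_def cs_scaleR flip: scaleR_diff_right)
      qed
    qed
    then have D: "(\<Sum>b\<leftarrow>mbasis k. (norm (?D b))\<^sup>2) \<le> 5800 * d * k" using k by (simp add: field_simps)
    have "(\<Sum>b\<leftarrow>mbasis k. (norm (\<Lambda>1 b))\<^sup>2) \<le> (\<Sum>b\<leftarrow>mbasis k. 2 * (norm (\<Lambda> b))\<^sup>2 + (1/2) * (norm (?D b))\<^sup>2)"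
    proof (intro sum_list_mono)
      fix b assume "b \<in> set (mbasis k)"
      then have ub: "cs \<i> (unitm k) * b = cs \<i> b" using set_mbasis by auto
      have "\<Lambda>1 b = \<Lambda> b + cs (\<i> / 2) (?D b)"
        unfolding ub by (intro fmat_eqI) (simp add: \<Lambda>_def scaleR_conv_of_real field_simps)
      then have "norm (\<Lambda>1 b) \<le> norm (\<Lambda> b) + norm (?D b) / 2"
        using norm_triangle_ineq[of "\<Lambda> b" "cs (\<i> / 2) (?D b)"] by (simp add: norm_divide)
      then have "(norm (\<Lambda>1 b))\<^sup>2 \<le> (norm (\<Lambda> b) + norm (?D b) / 2)\<^sup>2" by (intro power_mono) auto
      also have "\<dots> \<le> 2 * (norm (\<Lambda> b))\<^sup>2 + 2 * (norm (?D b) / 2)\<^sup>2"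
        using sum_squares_bound[of "norm (\<Lambda> b)" "norm (?D b) / 2"] by (simp add: power2_sum)
      finally show "(norm (\<Lambda>1 b))\<^sup>2 \<le> 2 * (norm (\<Lambda> b))\<^sup>2 + (1/2) * (norm (?D b))\<^sup>2" by (simp add: power_divide)
    qed
    also have "\<dots> = 2 * (\<Sum>b\<leftarrow>mbasis k. (norm (\<Lambda> b))\<^sup>2) + (1/2) * (\<Sum>b\<leftarrow>mbasis k. (norm (?D b))\<^sup>2)"
      by (simp only: sum_list_addf sum_list_const_mult)
    also have "\<dots> \<le> 4 * (\<Sum>i<k. \<Sum>j<k. (norm (\<Lambda> (eu i j)))\<^sup>2) + 2900 * d * k"
      using D by (subst dbl) (simp_all add: i)
    finally have "(\<Sum>b\<leftarrow>mbasis k. (norm (\<Lambda>1 b))\<^sup>2) \<le> \<dots>" .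
    moreover have "(\<Sum>b\<leftarrow>mbasis k. (norm (\<Lambda>1 b))\<^sup>2) \<ge> 2 * k / 3" using lower1 k by (simp add: field_simps)
    moreover have "2900 * d * k \<le> 2900 / 100000 * k" using d by (intro mult_right_mono) auto
    ultimately show ?thesis by linarith
  qed
  have "\<Lambda> x \<in> sq l" for x unfolding \<Lambda>_def using \<Lambda>1l by auto
  then show ?thesis using add cs main lower unfolding d_def by (intro exI[of _ \<Lambda>]) auto
qed

section \<open>A unitary design\<close>

definition gidx :: "nat \<Rightarrow> (nat set \<times> nat) set" where
  "gidx k = Pow {..<k} \<times> {..<k}"

text \<open>A signed cyclic permutation matrix: \<open>snd x\<close> is the shift and
  \<open>fst x\<close> the set of rows with sign -1. Averaging conjugates over the signs removes the
  off-diagonal entries, averaging over the shifts equalizes the diagonal ones.\<close>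

definition gd :: "nat \<Rightarrow> nat set \<times> nat \<Rightarrow> fmat" where
  "gd k x = mk k k (\<lambda>i j. if j = (i + snd x) mod k then (if i \<in> fst x then - 1 else 1) else 0)"

lemma finite_gidx [simp]: "finite (gidx k)" by (simp add: gidx_def)
lemma card_gidx_pos: "k > 0 \<Longrightarrow> 0 < real (card (gidx k))"
  by (simp add: gidx_def card_cartesian_product card_Pow)
lemma gd_rect [simp, intro]: "gd k x \<in> sq k" by (simp add: gd_def)

lemma ent_gd: "ent (gd k x) i j = (if i < k \<and> j < k \<and> j = (i + snd x) mod k then (if i \<in> fst x then - 1 else 1) else 0)"
  by (auto simp: gd_def)

lemma bij_shift: "bij_betw (\<lambda>p. (i + p) mod k) {..<k} {..<(k::nat)}"
proof -
  have aux: "p = q" if "p \<le> q" "q < k" "(i + p) mod k = (i + q) mod k" for p q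
  proof -
    have "k dvd (i + q) - (i + p)" using that by (subst mod_eq_dvd_iff_nat[symmetric]) auto
    then have "k dvd q - p" by simp
    moreover have "q - p < k" using that by simp
    ultimately have "q - p = 0" using nat_dvd_not_less by blast
    then show ?thesis using that by simp
  qed
  have "inj_on (\<lambda>p. (i + p) mod k) {..<k}"
    by (rule inj_onI) (metis aux lessThan_iff nle_le)
  moreover have "(\<lambda>p. (i + p) mod k) ` {..<k} \<subseteq> {..<k}" by auto
  ultimately show ?thesis by (simp add: bij_betw_def endo_inj_surj)
qed

lemma ent_gd_conj:
  assumes "i < k" "j < k" "A \<in> sq k"
  shows "ent (gd k x * A * adj (gd k x)) i j
    = (if i \<in> fst x then - 1 else 1) * (if j \<in> fst x then - 1 else 1) * ent A ((i + snd x) mod k) ((j + snd x) mod k)"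
proof -
  have l: "ent (gd k x * B) i q = (if i \<in> fst x then - 1 else 1) * ent B ((i + snd x) mod k) q" if "i < k" for B i q
  proof -
    have "(i + snd x) mod k < k" using that by simp
    then show ?thesis using that
      by (subst ent_mult[OF disjI1, OF gd_rect]) (simp add: ent_gd if_distrib[of "\<lambda>t. t * _"] sum.delta cong: if_cong)
  qed
  have "ent (gd k x * A * adj (gd k x)) i j = (if i \<in> fst x then - 1 else 1) * ent (A * adj (gd k x)) ((i + snd x) mod k) j"
    using l[OF assms(1), of "A * adj (gd k x)"] by (simp add: mult.assoc)
  also have "ent (A * adj (gd k x)) ((i + snd x) mod k) j = cnj (ent (gd k x * adj A) j ((i + snd x) mod k))"
    by (metis adj_adj adj_mult ent_adj)
  finally show ?thesis using l[OF assms(2), of "adj A"] by simp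
qed

lemma gd_umat [simp, intro]: "gd k x \<in> umat k"
proof -
  have "gd k x * unitm k * adj (gd k x) = unitm k"
  proof (rule rect_eqI[of _ k k])
    fix i j assume ij: "i < k" "j < k"
    have "(i + snd x) mod k = (j + snd x) mod k \<Longrightarrow> i = j"
      using inj_onD[OF bij_betw_imp_inj_on[OF bij_shift[of "snd x" k]], of i j] ij by (simp add: add.commute)
    then show "ent (gd k x * unitm k * adj (gd k x)) i j = ent (unitm k) i j"
      unfolding ent_gd_conj[OF ij unitm_rect] using ij by auto
  qed auto
  moreover have "adj (gd k x) * gd k x = unitm k"
  proof (rule rect_eqI[of _ k k])
    fix i j assume ij: "i < k" "j < k"
    let ?f = "\<lambda>q. if i = q \<and> j = q then 1 else (0::complex)"
    have "ent (adj (gd k x) * gd k x) i j = (\<Sum>p<k. ?f ((snd x + p) mod k))"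
      using ij by (subst ent_mult[of _ k k _ k]) (auto intro!: sum.cong simp: ent_gd add.commute)
    also have "\<dots> = (\<Sum>q<k. ?f q)" by (rule sum.reindex_bij_betw[OF bij_shift])
    also have "\<dots> = ent (unitm k) i j" using ij by (cases "i = j") (auto simp: sum.delta)
    finally show "ent (adj (gd k x) * gd k x) i j = ent (unitm k) i j" .
  qed auto
  ultimately show ?thesis by (simp add: umat_def)
qed

text \<open>Toggling the membership of \<open>i\<close> is an involution of the power set that
  changes the sign of every summand.\<close>

lemma sum_signs:
  assumes "i \<in> S" "i \<noteq> j" "finite S"
  shows "(\<Sum>T\<in>Pow S. (if i \<in> T then - 1 else 1) * (if j \<in> T then - 1 else (1::complex))) = 0" (is "sum ?f _ = 0")
proof -
  let ?t = "\<lambda>T. if i \<in> T then T - {i} else insert i T"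
  have "sum ?f (Pow S) = (\<Sum>T\<in>Pow S. - ?f T)"
    by (rule sum.reindex_bij_witness[of _ ?t ?t]) (use assms in auto)
  then have "sum ?f (Pow S) = - sum ?f (Pow S)" by (simp add: sum_negf)
  then show ?thesis by simp
qed

text \<open>The averaging identity of an irreducible system of unitaries: the mean of the conjugates
  of \<open>A\<close> is its normalized trace times the identity.\<close>

lemma design:
  assumes A: "A \<in> sq k" and k: "k > 0"
  shows "(\<Sum>x\<in>gidx k. gd k x * A * adj (gd k x)) = cs (of_nat (card (gidx k)) * (\<Sum>i<k. ent A i i) / of_nat k) (unitm k)"
proof (rule rect_eqI[of _ k k])
  fix i j assume ij: "i < k" "j < k"
  let ?s = "\<lambda>T. (if i \<in> T then - 1 else 1) * (if j \<in> T then - 1 else (1::complex))"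
  have "ent (\<Sum>x\<in>gidx k. gd k x * A * adj (gd k x)) i j
    = (\<Sum>T\<in>Pow {..<k}. \<Sum>p<k. ?s T * ent A ((i + p) mod k) ((j + p) mod k))"
    unfolding ent_sum gidx_def
    by (subst sum.cartesian_product) (auto intro!: sum.cong simp: ent_gd_conj[OF ij A])
  also have "\<dots> = (\<Sum>T\<in>Pow {..<k}. ?s T) * (\<Sum>p<k. ent A ((i + p) mod k) ((j + p) mod k))"
    by (simp add: sum_product)
  also have "\<dots> = ent (cs (of_nat (card (gidx k)) * (\<Sum>i<k. ent A i i) / of_nat k) (unitm k)) i j"
  proof (cases "i = j")
    case True
    have "(\<Sum>p<k. ent A ((i + p) mod k) ((i + p) mod k)) = (\<Sum>q<k. ent A q q)"
      by (rule sum.reindex_bij_betw[OF bij_shift])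
    moreover have "(\<Sum>T\<in>Pow {..<k}. ?s T) = of_nat (card (Pow {..<k}))"
      using True by (simp add: if_distrib cong: if_cong) 
    ultimately show ?thesis using True ij k by (simp add: gidx_def card_cartesian_product)
  next
    case False
    then show ?thesis using sum_signs[of i "{..<k}" j] ij by simp
  qed
  finally show "ent (\<Sum>x\<in>gidx k. gd k x * A * adj (gd k x)) i j = \<dots>" .
qed (use A in auto)

section \<open>Selecting an approximate intertwiner\<close>

lemma sum_norm_eu:
  assumes "D \<in> rect r l"
  shows "(\<Sum>s<l. (norm (D * eu s i))\<^sup>2) = (norm D)\<^sup>2"
proof -
  have "(norm (D * eu s i))\<^sup>2 = (\<Sum>p<r. (cmod (ent D p s))\<^sup>2)" if "s < l" for s
  proof -
    have "D * eu s i \<in> rect r (Suc i)" using assms that by auto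
    moreover have "(\<Sum>q<Suc i. (cmod (if q = i then ent D p s else 0))\<^sup>2) = (cmod (ent D p s))\<^sup>2" for p
      by (simp add: if_distrib[of "\<lambda>x. (cmod x)\<^sup>2"] cong: if_cong)
    ultimately show ?thesis by (simp add: norm_sq_rect[of _ r "Suc i"] ent_mult_eu del: sum.lessThan_Suc)
  qed
  then show ?thesis by (simp add: norm_sq_rect[OF assms]) (rule sum.swap)
qed

lemma norm_sum_eu:
  assumes "\<And>i. i < k \<Longrightarrow> D i \<in> sq l" "s < l"
  shows "(norm (\<Sum>i<k. D i * eu s i))\<^sup>2 = (\<Sum>i<k. (norm (D i * eu s i))\<^sup>2)"
proof -
  have "inner (D i * eu s i) (D j * eu s j) = (if i = j then (norm (D i * eu s i))\<^sup>2 else 0)" for i j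
  proof (cases "i = j")
    case False
    then show ?thesis by (simp add: inner_mult_right[of _ "eu s i"] mult.assoc eu_eu)
  qed (simp add: power2_norm_eq_inner)
  then show ?thesis
    by (simp add: power2_norm_eq_inner[of "sum _ _"] inner_sum_left inner_sum_right)
qed

text \<open>Column i of \<open>X j s\<close> is column s of \<Lambda>(e_ij). This reshuffling turns
  u e_ij = \<Sum> u_pi e_pj into right multiplication of \<open>X j s\<close> by u, and summing
  squared norms over j and s restores the sums over all matrix units. A choice of (j, s) in the mean
  then keeps the defects small relative to |X|^2. The selected \<open>X\<close> depends on u, as the
  defect for u takes part in the selection.\<close>

lemma select_intertwiner:
  assumes k: "k > 0" and l: "l > 0"
    and add: "\<And>x y. \<Lambda> (x + y) = \<Lambda> x + \<Lambda> y" and cs: "\<And>c x. \<Lambda> (cs c x) = cs c (\<Lambda> x)"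
    and sq: "\<And>x. \<Lambda> x \<in> sq l" and hu: "\<And>u. u \<in> umat k \<Longrightarrow> hu u \<in> umat l"
    and up: "\<And>u. u \<in> umat k \<Longrightarrow> (\<Sum>i<k. \<Sum>j<k. (norm (\<Lambda> (u * eu i j) - hu u * \<Lambda> (eu i j)))\<^sup>2) \<le> \<epsilon> * real k"
    and low: "(\<Sum>i<k. \<Sum>j<k. (norm (\<Lambda> (eu i j)))\<^sup>2) \<ge> real k / 16"
    and u: "u \<in> umat k"
  shows "\<exists>X\<in>rect l k. (norm X)\<^sup>2 = real k
    \<and> (\<Sum>x\<in>gidx k. (norm (X * gd k x - hu (gd k x) * X))\<^sup>2) \<le> 32 * \<epsilon> * real k * real (card (gidx k))
    \<and> (norm (X * u - hu u * X))\<^sup>2 \<le> 32 * \<epsilon> * real k"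
proof -
  define X where "X j s = (\<Sum>i<k. \<Lambda> (eu i j) * eu s i)" for j s
  have zero: "\<Lambda> 0 = 0" using cs[of 0 0] by simp
  have sum: "\<Lambda> (\<Sum>i\<in>I. f i) = (\<Sum>i\<in>I. \<Lambda> (f i))" for f :: "nat \<Rightarrow> fmat" and I
    by (induction I rule: infinite_finite_induct) (simp_all add: zero add)
  have Xr: "X j s \<in> rect l k" if "s < l" for j s
    unfolding X_def using sq that by (intro rect_sum) auto
  have Xg: "X j s * v - hu v * X j s = (\<Sum>i<k. (\<Lambda> (v * eu i j) - hu v * \<Lambda> (eu i j)) * eu s i)"
    if v: "v \<in> umat k" and j: "j < k" for v j s
  proof -
    have ve: "v * eu i j = (\<Sum>p<k. cs (ent v p i) (eu p j))" for i
    proof (rule fmat_eqI)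
      fix a b
      show "ent (v * eu i j) a b = ent (\<Sum>p<k. cs (ent v p i) (eu p j)) a b"
        using rectD[OF umat_rect[OF v], of a i]
        by (auto simp: ent_mult_eu ent_sum if_distrib[of "\<lambda>x. _ * x"] not_less cong: if_cong)
    qed
    have ev: "eu s i * v = (\<Sum>q<k. cs (ent v i q) (eu s q))" for i
    proof (rule fmat_eqI)
      fix a b
      show "ent (eu s i * v) a b = ent (\<Sum>q<k. cs (ent v i q) (eu s q)) a b"
        using rectD[OF umat_rect[OF v], of i b]
        by (auto simp: ent_eu_mult ent_sum if_distrib[of "\<lambda>x. _ * x"] not_less cong: if_cong)
    qed
    have "X j s * v = (\<Sum>i<k. \<Sum>q<k. cs (ent v i q) (\<Lambda> (eu i j) * eu s q))"
      by (simp add: X_def sum_distrib_right mult.assoc ev sum_distrib_left)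
    also have "\<dots> = (\<Sum>q<k. \<Sum>i<k. cs (ent v i q) (\<Lambda> (eu i j) * eu s q))" by (rule sum.swap)
    also have "\<dots> = (\<Sum>q<k. \<Lambda> (v * eu q j) * eu s q)"
      by (simp add: ve sum cs sum_distrib_right)
    finally show ?thesis
      by (simp add: X_def sum_distrib_left sum_subtractf algebra_simps)
  qed
  have tot: "(\<Sum>x\<in>{..<k}\<times>{..<l}. (norm (\<Sum>i<k. D i (fst x) * eu (snd x) i))\<^sup>2) = (\<Sum>i<k. \<Sum>j<k. (norm (D i j))\<^sup>2)"
    if D: "\<And>i j. D i j \<in> sq l" for D :: "nat \<Rightarrow> nat \<Rightarrow> fmat"
  proof -
    have "(\<Sum>x\<in>{..<k}\<times>{..<l}. (norm (\<Sum>i<k. D i (fst x) * eu (snd x) i))\<^sup>2)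
      = (\<Sum>j<k. \<Sum>s<l. \<Sum>i<k. (norm (D i j * eu s i))\<^sup>2)"
      by (subst sum.cartesian_product) (auto intro!: sum.cong norm_sum_eu[OF D])
    also have "\<dots> = (\<Sum>j<k. \<Sum>i<k. \<Sum>s<l. (norm (D i j * eu s i))\<^sup>2)" by (intro sum.cong refl sum.swap)
    also have "\<dots> = (\<Sum>j<k. \<Sum>i<k. (norm (D i j))\<^sup>2)" by (simp add: sum_norm_eu[OF D])
    finally show ?thesis by (simp only:) (rule sum.swap)
  qed
  let ?P = "{..<k}\<times>{..<l}"
  define T where "T v x = (norm (X (fst x) (snd x) * v - hu v * X (fst x) (snd x)))\<^sup>2" for v x
  have T0: "0 \<le> T v x" for v x by (simp add: T_def)
  have Tsum: "(\<Sum>x\<in>?P. T v x) \<le> \<epsilon> * k" if v: "v \<in> umat k" for v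
  proof -
    have "(\<Sum>x\<in>?P. T v x) = (\<Sum>x\<in>?P. (norm (\<Sum>i<k. (\<Lambda> (v * eu i (fst x)) - hu v * \<Lambda> (eu i (fst x))) * eu (snd x) i))\<^sup>2)"
      unfolding T_def by (intro sum.cong refl) (auto simp: Xg[OF v])
    also have "\<dots> = (\<Sum>i<k. \<Sum>j<k. (norm (\<Lambda> (v * eu i j) - hu v * \<Lambda> (eu i j)))\<^sup>2)"
      by (rule tot) (use sq umat_rect[OF hu[OF v]] in auto)
    finally show ?thesis using up[OF v] by simp
  qed
  have Xsum: "(\<Sum>x\<in>?P. (norm (X (fst x) (snd x)))\<^sup>2) \<ge> real k / 16"
    unfolding X_def using tot[of "\<lambda>i j. \<Lambda> (eu i j)"] sq low by simp
  let ?c = "real (card (gidx k))"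
  have c: "?c > 0" using card_gidx_pos[OF k] .
  \<comment> \<open>The mean defect over the design plus the defect for u; each contributes at most
    \<epsilon> k in total.\<close>
  define L where "L x = (\<Sum>g\<in>gidx k. T (gd k g) x) / ?c + T u x" for x
  have "(\<Sum>x\<in>?P. L x) = (\<Sum>g\<in>gidx k. \<Sum>x\<in>?P. T (gd k g) x) / ?c + (\<Sum>x\<in>?P. T u x)"
    unfolding L_def sum.distrib sum_divide_distrib[symmetric] by (subst sum.swap) simp
  also have "\<dots> \<le> (\<Sum>g\<in>gidx k. \<epsilon> * k) / ?c + \<epsilon> * k"
    by (intro add_mono divide_right_mono sum_mono Tsum u) auto
  also have "\<dots> = 2 * \<epsilon> * k" using c by (auto simp: card_gt_0_iff)
  finally have Lsum: "(\<Sum>x\<in>?P. L x) \<le> 2 * \<epsilon> * k" .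
  have "0 \<le> (\<Sum>x\<in>?P. T u x)" by (intro sum_nonneg T0)
  from order_trans[OF this Tsum[OF u]] have eps: "0 \<le> \<epsilon>" using k by (simp add: zero_le_mult_iff)
  \<comment> \<open>The defects sum to at most 2 \<epsilon> k and the squared norms to at least k /
    16, which is the origin of the factor 32. Some \<open>X j s\<close> is nonzero, so that failure
    everywhere would give a strict inequality between the sums.\<close>
  have "\<exists>x\<in>?P. X (fst x) (snd x) \<noteq> 0 \<and> L x \<le> 32 * \<epsilon> * (norm (X (fst x) (snd x)))\<^sup>2"
  proof (rule ccontr)
    assume neg: "\<not> ?thesis"
    have L0: "0 \<le> L x" for x unfolding L_def using T0 c by (intro add_nonneg_nonneg divide_nonneg_nonneg sum_nonneg) auto
    have "(\<Sum>x\<in>?P. 32 * \<epsilon> * (norm (X (fst x) (snd x)))\<^sup>2) < (\<Sum>x\<in>?P. L x)"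
    proof (rule sum_strict_mono_ex1)
      show "\<forall>x\<in>?P. 32 * \<epsilon> * (norm (X (fst x) (snd x)))\<^sup>2 \<le> L x"
      proof
        fix x assume x: "x \<in> ?P"
        show "32 * \<epsilon> * (norm (X (fst x) (snd x)))\<^sup>2 \<le> L x"
        proof (cases "X (fst x) (snd x) = 0")
          case False
          then show ?thesis using neg x by (meson less_imp_le not_le)
        qed (simp add: L0)
      qed
      have "\<exists>x\<in>?P. X (fst x) (snd x) \<noteq> 0"
      proof (rule ccontr)
        assume "\<not> ?thesis"
        then have "(\<Sum>x\<in>?P. (norm (X (fst x) (snd x)))\<^sup>2) = 0" by (intro sum.neutral) auto
        then show False using Xsum k by simp
      qed
      then show "\<exists>x\<in>?P. 32 * \<epsilon> * (norm (X (fst x) (snd x)))\<^sup>2 < L x" using neg by (auto simp: not_le)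
    qed auto
    also have "\<dots> \<le> 2 * \<epsilon> * k" by (rule Lsum)
    also have "\<dots> \<le> 32 * \<epsilon> * (\<Sum>x\<in>?P. (norm (X (fst x) (snd x)))\<^sup>2)"
      using mult_left_mono[OF Xsum, of "32 * \<epsilon>"] eps by simp
    finally show False by (simp add: sum_distrib_left)
  qed
  then obtain j s where js: "j < k" "s < l" "X j s \<noteq> 0" "L (j, s) \<le> 32 * \<epsilon> * (norm (X j s))\<^sup>2" by auto
  define r where "r = sqrt k / norm (X j s)"
  have r2: "r\<^sup>2 * (norm (X j s))\<^sup>2 = k" using js by (simp add: r_def power_divide)
  define Y where "Y = r *\<^sub>R X j s"
  have YT: "(norm (Y * v - hu v * Y))\<^sup>2 = r\<^sup>2 * T v (j, s)" for v
    by (simp add: Y_def T_def power_mult_distrib flip: scaleR_diff_right)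
  have rL: "r\<^sup>2 * L (j, s) \<le> 32 * \<epsilon> * k"
  proof -
    have "r\<^sup>2 * L (j, s) \<le> r\<^sup>2 * (32 * \<epsilon> * (norm (X j s))\<^sup>2)" by (intro mult_left_mono js(4)) simp
    also have "\<dots> = 32 * \<epsilon> * (r\<^sup>2 * (norm (X j s))\<^sup>2)" by simp
    finally show ?thesis by (simp only: r2)
  qed
  have s0: "0 \<le> (\<Sum>g\<in>gidx k. T (gd k g) (j, s))" by (intro sum_nonneg T0)
  have "r\<^sup>2 * ((\<Sum>g\<in>gidx k. T (gd k g) (j, s)) / ?c) \<le> r\<^sup>2 * L (j, s)" "r\<^sup>2 * T u (j, s) \<le> r\<^sup>2 * L (j, s)"
    using T0[of u "(j, s)"] s0 c unfolding L_def by (intro mult_left_mono; simp)+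
  then have "r\<^sup>2 * ((\<Sum>g\<in>gidx k. T (gd k g) (j, s)) / ?c) \<le> 32 * \<epsilon> * k" and 2: "r\<^sup>2 * T u (j, s) \<le> 32 * \<epsilon> * k"
    using rL by linarith+
  then have "(\<Sum>x\<in>gidx k. (norm (Y * gd k x - hu (gd k x) * Y))\<^sup>2) \<le> 32 * \<epsilon> * k * ?c"
    using c by (simp add: YT sum_distrib_left[symmetric] field_simps)
  moreover have "(norm Y)\<^sup>2 = k" using r2 by (simp add: Y_def power_mult_distrib)
  moreover have "Y \<in> rect l k" using Xr[OF js(2)] by (simp add: Y_def)
  ultimately show ?thesis using 2 YT[of u] by (intro bexI[of _ Y]) auto
qed

section \<open>From intertwiners to unitaries\<close>

lemma square_le: "(a + b)\<^sup>2 \<le> 2 * a\<^sup>2 + 2 * (b::real)\<^sup>2"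
  using sum_squares_bound[of a b] by (simp add: power2_sum)

lemma cs_trace: "A \<in> sq k \<Longrightarrow> (\<Sum>i<k. ent (adj X * X) i i) = of_real ((norm X)\<^sup>2)" if "X \<in> rect l k"
proof -
  have "ent (adj X * X) i i = (\<Sum>p<l. of_real ((cmod (ent X p i))\<^sup>2))" for i
    using that by (subst ent_mult[of _ k l _ k]) (auto intro!: sum.cong simp: complex_norm_square mult.commute simp del: of_real_power)
  then have "(\<Sum>i<k. ent (adj X * X) i i) = (\<Sum>p<l. \<Sum>i<k. of_real ((cmod (ent X p i))\<^sup>2))"
    by (simp only:) (rule sum.swap)
  then show ?thesis by (simp add: norm_sq_rect[OF that])
qed

text \<open>For g in the design, X g* is close to v* X, so g P g* is close to P = X* X; averaging
  over the design yields the normalized trace of P, which is 1. Testing against all contractions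
  \<open>S\<close> amounts to a trace norm estimate.\<close>

lemma intertwiner_almost_isometric:
  assumes k: "k > 0" and X: "X \<in> rect l k" "(norm X)\<^sup>2 = real k" and \<eta>: "0 < \<eta>" "\<eta> \<le> 1"
    and v: "\<And>x. x \<in> gidx k \<Longrightarrow> v x \<in> umat l"
    and XG: "(\<Sum>x\<in>gidx k. (norm (X * gd k x - v x * X))\<^sup>2) \<le> \<eta> * real k * real (card (gidx k))"
    and S: "S \<in> sq k" "opb 1 S"
  shows "inner S (adj X * X - unitm k) \<le> 3 * sqrt \<eta> * real k"
proof -
  define P where "P = adj X * X"
  have P: "P \<in> sq k" using X by (auto simp: P_def)
  let ?c = "real (card (gidx k))"
  have c: "?c > 0" by (rule card_gidx_pos[OF k])
  define \<Delta> where "\<Delta> x = X * adj (gd k x) - adj (v x) * X" for x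
  have n\<Delta>: "norm (\<Delta> x) = norm (X * gd k x - v x * X)" if x: "x \<in> gidx k" for x
  proof -
    have vx: "v x \<in> umat l" "v x \<in> sq l" "v x * adj (v x) = unitm l" using v[OF x] by (auto simp: umat_def)
    have g: "gd k x \<in> umat k" "adj (gd k x) * gd k x = unitm k" using gd_umat[of k x] by (auto simp: umat_def)
    have "\<Delta> x \<in> rect l k" using X vx by (auto simp: \<Delta>_def)
    then have "norm (\<Delta> x) = norm (v x * \<Delta> x * gd k x)"
      using umat_norm_left[OF vx(1), of "\<Delta> x" k] umat_norm_right[OF g(1), of "v x * \<Delta> x" l] vx by simp
    also have "v x * \<Delta> x * gd k x = v x * (X * (adj (gd k x) * gd k x)) - (v x * adj (v x)) * (X * gd k x)"
      by (simp add: \<Delta>_def algebra_simps)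
    also have "\<dots> = v x * X - X * gd k x"
    proof -
      have "X * gd k x \<in> rect l k" using X(1) by simp
      then show ?thesis unfolding g(2) vx(3) using X(1) by (simp add: unitm_left[of _ l k])
    qed
    finally show ?thesis by (simp add: norm_minus_commute)
  qed
  have pt: "\<bar>inner S (P - gd k x * P * adj (gd k x))\<bar> \<le> sqrt \<eta> * k + (1 / sqrt \<eta> + 1) * (norm (\<Delta> x))\<^sup>2"
    if x: "x \<in> gidx k" for x
  proof -
    have vx: "v x \<in> sq l" "v x * adj (v x) = unitm l" using v[OF x] by (auto simp: umat_def)
    define Y where "Y = adj (v x) * X"
    have YY: "adj Y * Y = P"
      using vx X(1) by (simp add: Y_def P_def adj_mult mult.assoc flip: mult.assoc[of "v x"])
    have Yn: "norm Y \<le> sqrt k"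
      using opb_left[OF umat_opb[OF umat_adj[OF v[OF x]]], of X] X(2) by (simp add: Y_def real_le_rsqrt) (metis X(2) abs_norm_cancel real_sqrt_abs)
    have "gd k x * P * adj (gd k x) = adj (X * adj (gd k x)) * (X * adj (gd k x))"
      by (simp add: P_def adj_mult mult.assoc)
    also have "X * adj (gd k x) = Y + \<Delta> x" by (simp add: Y_def \<Delta>_def)
    finally have "P - gd k x * P * adj (gd k x) = - (adj Y * \<Delta> x + adj (\<Delta> x) * Y + adj (\<Delta> x) * \<Delta> x)"
      by (simp add: adj_add algebra_simps YY)
    then have "inner S (P - gd k x * P * adj (gd k x))
       = - (inner S (adj Y * \<Delta> x) + inner S (adj (\<Delta> x) * Y) + inner S (adj (\<Delta> x) * \<Delta> x))"
      by (simp add: inner_simps)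
    moreover have "inner S (adj Z * W) = inner (Z * S) W" for Z W by (metis inner_mult_left)
    ultimately have "inner S (P - gd k x * P * adj (gd k x))
       = - (inner (Y * S) (\<Delta> x) + inner (\<Delta> x * S) Y + inner (\<Delta> x * S) (\<Delta> x))" by (simp only:)
    then have "\<bar>inner S (P - gd k x * P * adj (gd k x))\<bar>
      \<le> \<bar>inner (Y * S) (\<Delta> x)\<bar> + \<bar>inner (\<Delta> x * S) Y\<bar> + \<bar>inner (\<Delta> x * S) (\<Delta> x)\<bar>" by linarith
    also have "\<dots> \<le> norm (Y * S) * norm (\<Delta> x) + norm (\<Delta> x * S) * norm Y + norm (\<Delta> x * S) * norm (\<Delta> x)"
      by (intro add_mono Cauchy_Schwarz_ineq2)
    also have "\<dots> \<le> norm Y * norm (\<Delta> x) + norm (\<Delta> x) * norm Y + norm (\<Delta> x) * norm (\<Delta> x)"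
      using opb_right[OF S(2)] by (intro add_mono mult_right_mono) auto
    also have "\<dots> \<le> sqrt k * norm (\<Delta> x) + norm (\<Delta> x) * sqrt k + norm (\<Delta> x) * norm (\<Delta> x)"
      using Yn by (intro add_mono mult_right_mono mult_left_mono) auto
    also have "\<dots> = 2 * (sqrt k * norm (\<Delta> x)) + (norm (\<Delta> x))\<^sup>2" by (simp add: power2_eq_square)
    \<comment> \<open>The inequality of arithmetic and geometric means with weight sqrt \<eta>: the
      defects have mean square at most \<eta> k, so both resulting terms are of order sqrt \<eta>
      times k.\<close>
    also have "2 * (sqrt k * norm (\<Delta> x)) \<le> sqrt \<eta> * k + (norm (\<Delta> x))\<^sup>2 / sqrt \<eta>"
    proof -
      have "0 \<le> (sqrt \<eta> * sqrt k - norm (\<Delta> x))\<^sup>2" by simp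
      then have "2 * (sqrt k * norm (\<Delta> x)) * sqrt \<eta> \<le> \<eta> * k + (norm (\<Delta> x))\<^sup>2"
        using \<eta> by (simp add: power2_diff power_mult_distrib algebra_simps)
      then have "2 * (sqrt k * norm (\<Delta> x)) \<le> (\<eta> * k + (norm (\<Delta> x))\<^sup>2) / sqrt \<eta>"
        using \<eta> by (simp add: pos_le_divide_eq)
      also have "\<dots> = sqrt \<eta> * k + (norm (\<Delta> x))\<^sup>2 / sqrt \<eta>"
      proof -
        have "\<eta> * k / sqrt \<eta> = \<eta> / sqrt \<eta> * k" by simp
        then show ?thesis using \<eta> by (simp only: real_div_sqrt add_divide_distrib less_imp_le)
      qed
      finally show ?thesis .
    qed
    finally show ?thesis by (simp add: algebra_simps)
  qed
  have "(\<Sum>x\<in>gidx k. gd k x * P * adj (gd k x)) = ?c *\<^sub>R unitm k"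
    using design[OF P k] cs_trace[OF X(1)] P X(2) k by (simp add: P_def scaleR_eq_cs)
  then have "?c *\<^sub>R (P - unitm k) = (\<Sum>x\<in>gidx k. P - gd k x * P * adj (gd k x))"
    by (simp add: sum_subtractf scaleR_right_diff_distrib flip: scaleR_conv_of_real)
      (simp add: sum_constant_scaleR)
  then have "inner S (?c *\<^sub>R (P - unitm k)) = inner S (\<Sum>x\<in>gidx k. P - gd k x * P * adj (gd k x))"
    by (simp only:)
  then have "?c * inner S (P - unitm k) = (\<Sum>x\<in>gidx k. inner S (P - gd k x * P * adj (gd k x)))"
    by (simp only: inner_scaleR_right inner_sum_right)
  also have "\<dots> \<le> (\<Sum>x\<in>gidx k. sqrt \<eta> * k + (1 / sqrt \<eta> + 1) * (norm (\<Delta> x))\<^sup>2)"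
    using pt by (intro sum_mono) (auto simp: abs_le_iff)
  also have "\<dots> = ?c * (sqrt \<eta> * k) + (1 / sqrt \<eta> + 1) * (\<Sum>x\<in>gidx k. (norm (X * gd k x - v x * X))\<^sup>2)"
    by (simp add: sum.distrib sum_distrib_left n\<Delta>)
  also have "\<dots> \<le> ?c * (sqrt \<eta> * k) + (1 / sqrt \<eta> + 1) * (\<eta> * k * ?c)"
    using \<eta> by (intro add_left_mono mult_left_mono XG) auto
  also have "\<dots> = ?c * (sqrt \<eta> * k + (\<eta> / sqrt \<eta> + \<eta>) * k)" by (simp add: algebra_simps)
  finally have "inner S (P - unitm k) \<le> sqrt \<eta> * k + (\<eta> / sqrt \<eta> + \<eta>) * k"
    using c by (simp add: mult_le_cancel_left_pos)
  also have "\<eta> / sqrt \<eta> = sqrt \<eta>" using \<eta> real_div_sqrt[of \<eta>] by simp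
  also have "sqrt \<eta> * k + (sqrt \<eta> + \<eta>) * k \<le> 3 * sqrt \<eta> * k"
  proof -
    have "sqrt \<eta> * sqrt \<eta> \<le> 1 * sqrt \<eta>" using \<eta> by (intro mult_right_mono) auto
    then have "\<eta> \<le> sqrt \<eta>" using \<eta> by simp
    then have "\<eta> * k \<le> sqrt \<eta> * k" by (intro mult_right_mono) auto
    then show ?thesis by (simp add: algebra_simps)
  qed
  finally show ?thesis by (simp add: P_def)
qed

section \<open>Passage to unitaries of the larger size\<close>

lemma unitm_diff_norm: "k \<le> m \<Longrightarrow> (norm (unitm m - unitm k))\<^sup>2 = real m - real k"
proof -
  assume "k \<le> m"
  then have "inner (unitm m) (unitm k) = real k"
    using norm_sq_unitm[of k] by (metis adj_unitm inner_mult_left min.absorb2 min_def power2_norm_eq_inner unitm_unitm)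
  then show ?thesis by (simp add: power2_norm_eq_inner inner_simps inner_commute norm_sq_unitm[unfolded power2_norm_eq_inner])
qed

text \<open>Read in size m, \<open>X\<close> has a polar decomposition whose test matrix
  \<open>S\<close> converts the trace norm estimate into a bound on |X - w|^2. On the coordinates
  from k to m, \<open>X\<close> vanishes and any contraction costs at most m - k.\<close>

lemma intertwiner_unitary:
  assumes k: "k > 0" and X: "X \<in> rect l k" "(norm X)\<^sup>2 = real k" and \<eta>: "0 < \<eta>" "\<eta> \<le> 1"
    and v: "\<And>x. x \<in> gidx k \<Longrightarrow> v x \<in> umat l"
    and XG: "(\<Sum>x\<in>gidx k. (norm (X * gd k x - v x * X))\<^sup>2) \<le> \<eta> * real k * real (card (gidx k))"
  defines "m \<equiv> max k l"
  shows "\<exists>w\<in>umat m. (norm (X - w))\<^sup>2 \<le> 3 * sqrt \<eta> * real k + (real m - real k)"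
proof -
  have km: "k \<le> m" "l \<le> m" by (auto simp: m_def)
  have Xm: "X \<in> sq m" using X km by (blast intro: rect_mono)
  obtain w S where w: "w \<in> umat m" and S: "S \<in> sq m" "opb 1 S"
    and wS: "(norm (X - w))\<^sup>2 \<le> inner S (adj X * X - unitm m)"
    using near_unitary[OF Xm] by blast
  let ?S = "unitm k * S * unitm k" and ?Q = "unitm m - unitm k"
  have S': "?S \<in> sq k" using unitm_left_rect[OF S(1), of k] unitm_right_rect by blast
  have "opb (1 * 1 * 1) ?S" by (intro opb_mult opb_unitm S)
  then have 1: "inner ?S (adj X * X - unitm k) \<le> 3 * sqrt \<eta> * k"
    by (intro intertwiner_almost_isometric[OF k X \<eta> v XG] S') auto
  have XX: "adj X * X - unitm k \<in> sq k" using X(1) by auto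
  have e1: "inner ?S (adj X * X - unitm k) = inner S (adj X * X - unitm k)"
    using XX by (simp add: inner_mult_right[of "unitm k * S"] inner_mult_left[of "unitm k"])
  have QQ: "?Q * ?Q = ?Q" using km by (simp add: algebra_simps unitm_unitm min_def)
  have "inner S ?Q = inner (S * ?Q) ?Q"
    by (simp add: inner_mult_right adj_diff QQ)
  also have "\<dots> \<le> norm (S * ?Q) * norm ?Q" by (rule norm_cauchy_schwarz)
  also have "\<dots> \<le> (1 * norm ?Q) * norm ?Q" by (intro mult_right_mono opb_left S) auto
  also have "\<dots> = real m - real k" using unitm_diff_norm[OF km(1)] by (simp add: power2_eq_square)
  finally have 2: "inner S ?Q \<le> real m - real k" .
  have "- inner S ?Q \<le> \<bar>inner (S * ?Q) ?Q\<bar>" by (simp add: inner_mult_right adj_diff QQ)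
  also have "\<dots> \<le> norm (S * ?Q) * norm ?Q" by (rule Cauchy_Schwarz_ineq2)
  also have "\<dots> \<le> (1 * norm ?Q) * norm ?Q" by (intro mult_right_mono opb_left S) auto
  also have "\<dots> = real m - real k" using unitm_diff_norm[OF km(1)] by (simp add: power2_eq_square)
  finally have 3: "- inner S ?Q \<le> real m - real k" .
  have "inner S (adj X * X - unitm m) = inner S (adj X * X - unitm k) - inner S ?Q" by (simp add: inner_simps)
  then show ?thesis using wS 1 e1 3 w by (intro bexI[of _ w]) linarith+
qed

text \<open>If l < k, the last k - l rows of \<open>X\<close> vanish, whereas those rows of the
  unitary \<open>w\<close> contribute k - l to |X - w|^2.\<close>

lemma intertwiner_dimension:
  assumes k: "k > 0" and X: "X \<in> rect l k" "(norm X)\<^sup>2 = real k" and \<eta>: "0 < \<eta>" "\<eta> \<le> 1"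
    and v: "\<And>x. x \<in> gidx k \<Longrightarrow> v x \<in> umat l"
    and XG: "(\<Sum>x\<in>gidx k. (norm (X * gd k x - v x * X))\<^sup>2) \<le> \<eta> * real k * real (card (gidx k))"
  shows "real k \<le> real l + 3 * sqrt \<eta> * real k"
proof (cases "l < k")
  case True
  then have m: "max k l = k" by simp
  obtain w where w: "w \<in> umat k" "(norm (X - w))\<^sup>2 \<le> 3 * sqrt \<eta> * k"
    using intertwiner_unitary[OF k X \<eta> v XG] unfolding m by auto
  let ?Q = "unitm k - unitm l"
  have "?Q * (X - w) = - (?Q * w)"
    using X(1) rect_mono[OF X(1), of k k] True by (simp add: algebra_simps)
  then have "norm (?Q * w) = norm (?Q * (X - w))" by simp
  moreover have "norm (?Q * w) = norm ?Q"
    by (rule umat_norm_right[OF w(1), of _ k]) (use True in \<open>intro rect_diff unitm_rect rect_mono[OF unitm_rect]; simp\<close>)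
  moreover have "norm (?Q * (X - w)) \<le> norm (X - w)"
  proof -
    have "?Q = unitm k * ?Q * unitm k" using True by (simp add: algebra_simps unitm_unitm min_def)
    have "(norm (?Q * A))\<^sup>2 \<le> (norm A)\<^sup>2" for A
    proof -
      have QQ: "?Q * ?Q = ?Q" using True by (simp add: algebra_simps unitm_unitm min_def)
      have "(norm (?Q * A))\<^sup>2 = inner A (?Q * A)"
        by (simp add: power2_norm_eq_inner inner_mult_left adj_diff QQ flip: mult.assoc)
      also have "\<dots> \<le> norm A * norm (?Q * A)" by (rule norm_cauchy_schwarz)
      finally have "norm (?Q * A) \<le> norm A"
        by (metis mult_right_le_imp_le norm_ge_zero not_less order_le_less power2_eq_square)
      then show ?thesis by (intro power_mono) auto
    qed
    then show ?thesis using power2_le_imp_le norm_ge_zero by blast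
  qed
  ultimately have "norm ?Q \<le> norm (X - w)" by simp
  then have "(norm ?Q)\<^sup>2 \<le> (norm (X - w))\<^sup>2" by (intro power_mono) auto
  then show ?thesis using unitm_diff_norm[of l k] True w(2) by simp
next
  case False
  moreover have "0 \<le> 3 * sqrt \<eta> * real k" using \<eta> by simp
  ultimately show ?thesis by linarith
qed

text \<open>An identity block, not a zero block, on the coordinates from k to m, so that unitaries
  remain unitary.\<close>

definition pad :: "nat \<Rightarrow> nat \<Rightarrow> fmat \<Rightarrow> fmat" where
  "pad m k u = u + (unitm m - unitm k)"

lemma pad_umat:
  assumes u: "u \<in> umat k" and km: "k \<le> m"
  shows "pad m k u \<in> umat m"
proof -
  have r: "u \<in> sq k" "adj u \<in> sq k" "u \<in> sq m" "adj u \<in> sq m" "unitm k \<in> sq m"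
    and uu: "adj u * u = unitm k" "u * adj u = unitm k"
    using u km by (auto simp: umat_def intro: rect_mono)
  then show ?thesis using km
    by (simp add: umat_def pad_def adj_add adj_diff algebra_simps unitm_unitm min_def)
qed

text \<open>The identity blocks are invisible to \<open>X\<close>, because its columns end at k and
  its rows at l. Only the replacement of \<open>X\<close> by \<open>w\<close> on the two sides
  costs, twice |X - w|.\<close>

lemma pad_intertwine:
  assumes X: "X \<in> rect l k" and w: "w \<in> umat m" and u: "u \<in> umat k" and v: "v \<in> umat l"
    and m: "k \<le> m" "l \<le> m"
  shows "(norm (w * pad m k u - pad m l v * w))\<^sup>2 \<le> 8 * (norm (X - w))\<^sup>2 + 2 * (norm (X * u - v * X))\<^sup>2"
proof -
  have X': "X \<in> rect m m" "X \<in> rect m k" "X \<in> rect l m" using X m by (auto intro: rect_mono)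
  have 0: "X * (unitm m - unitm k) = 0" "(unitm m - unitm l) * X = 0"
    using X X' by (simp_all add: algebra_simps)
  have "w * pad m k u - pad m l v * w = ((w - X) * pad m k u + pad m l v * (X - w)) + (X * u - v * X)"
    using 0 by (simp add: pad_def algebra_simps)
  note e = this
  have "norm ((w - X) * pad m k u) \<le> norm (X - w)"
    using opb_right[OF umat_opb[OF pad_umat[OF u m(1)]], of "w - X"] by (simp add: norm_minus_commute)
  moreover have "norm (pad m l v * (X - w)) \<le> norm (X - w)"
    using opb_left[OF umat_opb[OF pad_umat[OF v m(2)]], of "X - w"] by simp
  ultimately have "norm (w * pad m k u - pad m l v * w) \<le> (norm (X - w) + norm (X - w)) + norm (X * u - v * X)"
    unfolding e by (intro norm_triangle_le add_mono order_refl)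
  then have "(norm (w * pad m k u - pad m l v * w))\<^sup>2 \<le> (2 * norm (X - w) + norm (X * u - v * X))\<^sup>2"
    by (intro power_mono) auto
  also have "\<dots> \<le> 2 * (2 * norm (X - w))\<^sup>2 + 2 * (norm (X * u - v * X))\<^sup>2" by (rule square_le)
  finally show ?thesis by (simp add: power_mult_distrib)
qed

text \<open>Compressed to the corner of size k, the conjugates of \<open>z'\<close> by the design
  are close to \<open>z'\<close>, and their mean is the scalar \<mu>, its normalized trace. The rows
  and columns outside the corner cost multiples of m - k: 12 for \<open>z\<close> and 3 for the
  scalar.\<close>

lemma commutes_with_design_scalar:
  assumes k: "k > 0" "k \<le> m" and z: "z \<in> umat m"
    and D: "(\<Sum>x\<in>gidx k. (norm (z * pad m k (gd k x) - pad m k (gd k x) * z))\<^sup>2) \<le> D * real (card (gidx k))"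
  shows "\<exists>\<mu>. cmod \<mu> \<le> 1 \<and> (norm (z - cs \<mu> (unitm m)))\<^sup>2 \<le> 3 * D + 15 * (real m - real k)"
proof -
  let ?c = "real (card (gidx k))" and ?Q = "unitm m - unitm k"
  have c: "?c > 0" by (rule card_gidx_pos[OF k(1)])
  have zr: "z \<in> sq m" using z by (rule umat_rect)
  define z' where "z' = unitm k * z * unitm k"
  have z': "z' \<in> sq k" unfolding z'_def using unitm_left_rect[OF zr] unitm_right_rect by blast
  have "opb (1 * 1 * 1) z'" unfolding z'_def by (intro opb_mult opb_unitm umat_opb[OF z])
  then have zo: "norm z' \<le> sqrt k"
    using opb_left[of 1 z' "unitm k"] z' norm_sq_unitm[of k] by (simp add: real_le_rsqrt)
      (metis norm_ge_zero norm_sq_unitm real_sqrt_unique)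
  have QS: "?Q \<in> sq m" using k by (intro rect_diff unitm_rect rect_mono[OF unitm_rect]) auto
  have Qo: "opb 1 ?Q"
    unfolding opb_def
  proof (intro conjI allI)
    fix A
    have QQ: "?Q * ?Q = ?Q" using k by (simp add: algebra_simps unitm_unitm min_def)
    have "(norm (?Q * A))\<^sup>2 = inner A (?Q * A)"
      by (simp add: power2_norm_eq_inner inner_mult_left adj_diff QQ flip: mult.assoc)
    also have "\<dots> \<le> norm A * norm (?Q * A)" by (rule norm_cauchy_schwarz)
    finally have "norm (?Q * A) * norm (?Q * A) \<le> norm A * norm (?Q * A)" by (simp add: power2_eq_square)
    then show "norm (?Q * A) \<le> 1 * norm A"
      by (cases "norm (?Q * A) = 0") (auto simp: mult_le_cancel_right)
  qed simp
  define \<mu> where "\<mu> = (\<Sum>i<k. ent z' i i) / of_nat k"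
  have "(\<Sum>i<k. ent z' i i) = cip (unitm k) z'"
  proof -
    have "(\<Sum>j<k. cnj (ent (unitm k) i j) * ent z' i j) = ent z' i i" if "i < k" for i
      using that by (simp add: if_distrib[of cnj] if_distrib[of "\<lambda>t. t * _"] cong: if_cong)
    then show ?thesis by (simp add: cip_rect[of _ k k])
  qed
  moreover have "cmod (cip (unitm k) z') \<le> sqrt k * sqrt k"
  proof -
    have "norm (unitm k) = sqrt k" using norm_sq_unitm[of k] by (metis norm_ge_zero real_sqrt_unique)
    then show ?thesis using cmod_cip_le[of "unitm k" z'] zo by (metis mult_left_mono norm_ge_zero order_trans)
  qed
  ultimately have \<mu>: "cmod \<mu> \<le> 1" using k(1) by (simp add: \<mu>_def norm_divide)
  have pt: "norm (z' - gd k x * z' * adj (gd k x)) \<le> norm (z * pad m k (gd k x) - pad m k (gd k x) * z)" for x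
  proof -
    let ?g = "gd k x" and ?p = "pad m k (gd k x)"
    have g: "?g \<in> sq k" "?g * adj ?g = unitm k" and gu: "?g \<in> umat k" using gd_umat[of k x] by (auto simp: umat_def)
    have gm: "?g \<in> sq m" using g k by (auto intro: rect_mono)
    have 1: "?p * unitm k = ?g" "unitm k * ?p = ?g"
      using k g by (simp_all add: pad_def algebra_simps unitm_unitm min_def)
    have 2: "unitm k * (z * ?p - ?p * z) * unitm k = z' * ?g - ?g * z'"
    proof -
      have "unitm k * (z * ?p - ?p * z) * unitm k = unitm k * z * (?p * unitm k) - (unitm k * ?p) * z * unitm k"
        by (simp add: algebra_simps)
      also have "\<dots> = unitm k * z * (unitm k * ?g) - (?g * unitm k) * z * unitm k" unfolding 1 using g by simp
      also have "\<dots> = z' * ?g - ?g * z'" by (simp only: z'_def mult.assoc)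
      finally show ?thesis .
    qed
    have "z' - ?g * z' * adj ?g = (z' * ?g - ?g * z') * adj ?g"
      using g z' by (simp add: algebra_simps)
    then have "norm (z' - ?g * z' * adj ?g) = norm (z' * ?g - ?g * z')"
      using umat_norm_right[OF umat_adj[OF gu], of "z' * ?g - ?g * z'" k] z' g by simp
    also have "\<dots> \<le> 1 * (1 * norm (z * ?p - ?p * z))"
      unfolding 2[symmetric] by (intro order_trans[OF opb_right[OF opb_unitm]] mult_left_mono opb_left opb_unitm) auto
    finally show ?thesis by simp
  qed
  have "(\<Sum>x\<in>gidx k. gd k x * z' * adj (gd k x)) = ?c *\<^sub>R cs \<mu> (unitm k)"
    using design[OF z' k(1)] by (simp add: \<mu>_def scaleR_eq_cs)
  then have "?c *\<^sub>R (z' - cs \<mu> (unitm k)) = (\<Sum>x\<in>gidx k. z' - gd k x * z' * adj (gd k x))"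
    by (simp add: sum_subtractf scaleR_right_diff_distrib sum_constant_scaleR)
  then have "?c * norm (z' - cs \<mu> (unitm k)) = norm (\<Sum>x\<in>gidx k. z' - gd k x * z' * adj (gd k x))"
    using c by (metis abs_of_pos norm_scaleR)
  also have "\<dots> \<le> (\<Sum>x\<in>gidx k. norm (z * pad m k (gd k x) - pad m k (gd k x) * z) * 1)"
    by (intro sum_norm_le) (simp add: pt)
  finally have "(?c * norm (z' - cs \<mu> (unitm k)))\<^sup>2 \<le> (\<Sum>x\<in>gidx k. norm (z * pad m k (gd k x) - pad m k (gd k x) * z) * 1)\<^sup>2"
    using c by (intro power_mono) auto
  also have "\<dots> \<le> (\<Sum>x\<in>gidx k. (norm (z * pad m k (gd k x) - pad m k (gd k x) * z))\<^sup>2) * (\<Sum>x\<in>gidx k. 1\<^sup>2)"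
    by (rule Cauchy_Schwarz_ineq_sum)
  also have "\<dots> \<le> (D * ?c) * ?c" using D by (intro mult_mono) (auto intro: order_trans[OF sum_nonneg D])
  finally have "?c\<^sup>2 * (norm (z' - cs \<mu> (unitm k)))\<^sup>2 \<le> ?c\<^sup>2 * D"
    by (simp add: power_mult_distrib power2_eq_square algebra_simps)
  then have 1: "(norm (z' - cs \<mu> (unitm k)))\<^sup>2 \<le> D" by (rule mult_left_le_imp_le[OF _ zero_less_power[OF c]])
  have 2: "(norm ?Q)\<^sup>2 = real m - real k" by (rule unitm_diff_norm[OF k(2)])
  have "z - z' = ?Q * z + unitm k * z * ?Q"
    using zr by (simp add: z'_def algebra_simps)
  then have "norm (z - z') \<le> norm (?Q * z) + norm (unitm k * z * ?Q)" by (metis norm_triangle_ineq)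
  also have "norm (?Q * z) = norm ?Q" by (rule umat_norm_right[OF z QS])
  also have "norm (unitm k * z * ?Q) \<le> 1 * (1 * norm ?Q)"
    unfolding mult.assoc by (intro order_trans[OF opb_left[OF opb_unitm]] mult_left_mono opb_left umat_opb[OF z]) auto
  finally have "(norm (z - z'))\<^sup>2 \<le> (2 * norm ?Q)\<^sup>2" by (intro power_mono) auto
  then have 3: "(norm (z - z'))\<^sup>2 \<le> 4 * (real m - real k)" using 2 by (simp add: power_mult_distrib)
  have "(norm (cs \<mu> ?Q))\<^sup>2 \<le> (1 * norm ?Q)\<^sup>2" unfolding norm_cs using \<mu> by (intro power_mono mult_right_mono) auto
  then have 4: "(norm (cs \<mu> ?Q))\<^sup>2 \<le> real m - real k" using 2 by simp
  have "z - cs \<mu> (unitm m) = (z - z') + (z' - cs \<mu> (unitm k)) + - cs \<mu> ?Q" by (simp add: cs_diff)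
  then have "norm (z - cs \<mu> (unitm m)) \<le> norm (z - z') + norm (z' - cs \<mu> (unitm k)) + norm (cs \<mu> ?Q)"
    by (metis norm_minus_cancel norm_triangle_le add_mono_thms_linordered_semiring(3) norm_triangle_ineq add_right_mono)
  then have "(norm (z - cs \<mu> (unitm m)))\<^sup>2 \<le> (norm (z - z') + norm (z' - cs \<mu> (unitm k)) + norm (cs \<mu> ?Q))\<^sup>2"
    by (intro power_mono) auto
  also have "\<dots> \<le> 3 * (norm (z - z'))\<^sup>2 + 3 * (norm (z' - cs \<mu> (unitm k)))\<^sup>2 + 3 * (norm (cs \<mu> ?Q))\<^sup>2"
    using sum_squares_bound[of "norm (z - z')" "norm (z' - cs \<mu> (unitm k))"]
      sum_squares_bound[of "norm (z - z')" "norm (cs \<mu> ?Q)"] sum_squares_bound[of "norm (z' - cs \<mu> (unitm k))" "norm (cs \<mu> ?Q)"]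
    by (simp add: power2_eq_square algebra_simps)
  also have "\<dots> \<le> 3 * D + 15 * (real m - real k)"
  proof -
    have "3 * a + 3 * b + 3 * c \<le> 3 * D + 15 * q" if "b \<le> D" "a \<le> 4 * q" "c \<le> q" for a b c q :: real
      using that by linarith
    from this[OF 1 3 4] show ?thesis .
  qed
  finally show ?thesis using \<mu> by blast
qed

text \<open>The corner of \<open>w\<close> is unitary up to the k - l rows removed, so
  \<open>near_unitary\<close> moves it by at most sqrt(k - l); the removed rows and columns account
  for the other two terms.\<close>

lemma cut_unitary:
  assumes w: "w \<in> umat k" and lk: "l \<le> k"
  shows "\<exists>w'\<in>umat l. norm (w - w') \<le> 3 * sqrt (real k - real l)"
proof -
  let ?Q = "unitm k - unitm l"
  have wr: "w \<in> sq k" "adj w \<in> sq k" "adj w * w = unitm k" using w by (auto simp: umat_def)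
  have QS: "?Q \<in> sq k" using lk by (intro rect_diff unitm_rect rect_mono[OF unitm_rect]) auto
  have nQ: "norm ?Q = sqrt (real k - real l)"
    using unitm_diff_norm[OF lk] by (metis norm_ge_zero real_sqrt_unique)
  define A where "A = unitm l * w * unitm l"
  have A: "A \<in> sq l" unfolding A_def using unitm_left_rect[OF wr(1)] unitm_right_rect by blast
  obtain w' where w': "w' \<in> umat l" "norm (A - w') \<le> norm (adj A * A - unitm l)" using near_unitary[OF A] by blast
  have ll: "unitm l * unitm l = unitm l" "unitm l * unitm k = unitm l" "unitm k * unitm l = unitm l"
    using lk by (simp_all add: unitm_unitm min_def)
  have "adj A * A - unitm l = - (unitm l * adj w * ?Q * w * unitm l)"
  proof -
    have "adj A * A = unitm l * adj w * unitm l * w * unitm l"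
      by (simp add: A_def adj_mult mult.assoc ll flip: mult.assoc[of "unitm l" "unitm l"])
    moreover have "unitm l * adj w * unitm k * w * unitm l = unitm l * (adj w * unitm k * w) * unitm l"
      by (simp add: mult.assoc)
    moreover have "\<dots> = unitm l" using wr by (simp add: ll)
    ultimately show ?thesis by (simp add: algebra_simps)
  qed
  also have "norm \<dots> \<le> 1 * norm (unitm l * adj w * ?Q * w)" unfolding norm_minus_cancel by (rule opb_right[OF opb_unitm])
  also have "\<dots> \<le> 1 * (1 * norm (unitm l * adj w * ?Q))" by (intro mult_left_mono opb_right umat_opb[OF w]) auto
  also have "\<dots> \<le> 1 * (1 * (1 * norm (adj w * ?Q)))" unfolding mult.assoc by (intro mult_left_mono opb_left opb_unitm) auto
  also have "\<dots> \<le> 1 * (1 * (1 * (1 * norm ?Q)))" by (intro mult_left_mono opb_left umat_opb[OF umat_adj[OF w]]) auto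
  finally have 1: "norm (A - w') \<le> sqrt (real k - real l)" using w'(2) nQ by simp
  have "w - A = ?Q * w + unitm l * w * ?Q" using wr by (simp add: A_def algebra_simps)
  then have "norm (w - A) \<le> norm (?Q * w) + norm (unitm l * w * ?Q)" by (metis norm_triangle_ineq)
  also have "norm (?Q * w) = norm ?Q" by (rule umat_norm_right[OF w QS])
  also have "norm (unitm l * w * ?Q) \<le> 1 * (1 * norm ?Q)"
    unfolding mult.assoc by (intro order_trans[OF opb_left[OF opb_unitm]] mult_left_mono opb_left umat_opb[OF w]) auto
  finally have "norm (w - w') \<le> 3 * sqrt (real k - real l)"
    using 1 nQ norm_triangle_ineq[of "w - A" "A - w'"] by simp
  then show ?thesis using w' by blast
qed

text \<open>The intertwiner given by \<open>sel\<close> varies with u, but all of them nearly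
  intertwine the same design. Two such unitaries therefore differ by a nearly scalar factor, and
  scalars cancel in a conjugation.\<close>

theorem unitary_rigidity:
  assumes k: "k > 0" and hu: "\<And>u. u \<in> umat k \<Longrightarrow> hu u \<in> umat l" and \<eta>: "0 < \<eta>" "\<eta> \<le> 1"
    and sel: "\<And>u. u \<in> umat k \<Longrightarrow> \<exists>X\<in>rect l k. (norm X)\<^sup>2 = real k
      \<and> (\<Sum>x\<in>gidx k. (norm (X * gd k x - hu (gd k x) * X))\<^sup>2) \<le> \<eta> * real k * real (card (gidx k))
      \<and> (norm (X * u - hu u * X))\<^sup>2 \<le> \<eta> * real k"
  shows "\<exists>w\<in>umat l. \<forall>u\<in>umat k. norm (hu u - w * u * adj w) \<le> sqrt (2600 * sqrt \<eta> * real k + 1000 * \<bar>real k - real l\<bar>) + 7 * sqrt \<bar>real k - real l\<bar>"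
proof -
  define m d where "m = max k l" and "d = \<bar>real k - real l\<bar>"
  have m: "k \<le> m" "l \<le> m" and d: "real m - real k \<le> d" "real m - real l \<le> d" "0 \<le> d" by (auto simp: m_def d_def)
  have \<eta>s: "\<eta> \<le> sqrt \<eta>"
  proof -
    have "sqrt \<eta> * sqrt \<eta> \<le> 1 * sqrt \<eta>" using \<eta> by (intro mult_right_mono) auto
    then show ?thesis using \<eta> by simp
  qed
  define e where "e = sqrt \<eta> * real k"
  have e: "0 \<le> e" "\<eta> * real k \<le> e" using \<eta> \<eta>s by (auto simp: e_def intro: mult_right_mono)
  let ?c = "real (card (gidx k))"
  have c: "?c > 0" by (rule card_gidx_pos[OF k])
  \<comment> \<open>\<open>pad_intertwine\<close> gives 8 (3 e + d) for the replacement of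
    \<open>X\<close> by a unitary and 2 e for the defect of \<open>X\<close>.\<close>
  define K where "K = 26 * e + 8 * d"
  have unitary: "\<exists>w\<in>umat m. (\<Sum>x\<in>gidx k. (norm (w * pad m k (gd k x) - pad m l (hu (gd k x)) * w))\<^sup>2) \<le> K * ?c
      \<and> (norm (w * pad m k u - pad m l (hu u) * w))\<^sup>2 \<le> K" if u: "u \<in> umat k" for u
  proof -
    obtain X where X: "X \<in> rect l k" "(norm X)\<^sup>2 = real k"
      "(\<Sum>x\<in>gidx k. (norm (X * gd k x - hu (gd k x) * X))\<^sup>2) \<le> \<eta> * real k * ?c"
      "(norm (X * u - hu u * X))\<^sup>2 \<le> \<eta> * real k" using sel[OF u] by blast
    obtain w where w: "w \<in> umat m" "(norm (X - w))\<^sup>2 \<le> 3 * sqrt \<eta> * k + (real m - real k)"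
      using intertwiner_unitary[OF k X(1,2) \<eta> _ X(3)] hu unfolding m_def by auto
    have wX: "8 * (norm (X - w))\<^sup>2 \<le> 24 * e + 8 * d" using w(2) d by (simp add: e_def)
    have "(\<Sum>x\<in>gidx k. (norm (w * pad m k (gd k x) - pad m l (hu (gd k x)) * w))\<^sup>2)
      \<le> (\<Sum>x\<in>gidx k. (24 * e + 8 * d) + 2 * (norm (X * gd k x - hu (gd k x) * X))\<^sup>2)"
      using wX by (intro sum_mono order_trans[OF pad_intertwine[OF X(1) w(1) _ _ m]] add_right_mono hu) auto
    also have "\<dots> = (24 * e + 8 * d) * ?c + 2 * (\<Sum>x\<in>gidx k. (norm (X * gd k x - hu (gd k x) * X))\<^sup>2)"
      by (simp add: sum.distrib sum_distrib_left)
    also have "\<dots> \<le> (24 * e + 8 * d) * ?c + 2 * (e * ?c)"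
      using X(3) mult_right_mono[OF e(2), of ?c] by simp
    also have "\<dots> = K * ?c" by (simp add: K_def algebra_simps)
    finally have 1: "(\<Sum>x\<in>gidx k. (norm (w * pad m k (gd k x) - pad m l (hu (gd k x)) * w))\<^sup>2) \<le> K * ?c" .
    have "(norm (w * pad m k u - pad m l (hu u) * w))\<^sup>2 \<le> K"
      using pad_intertwine[OF X(1) w(1) u hu[OF u] m] wX X(4) e by (simp add: K_def)
    then show ?thesis using 1 w by blast
  qed
  \<comment> \<open>Obtained for u = 1, and only its estimate on the design is kept; the comparison
    with the unitary belonging to another u is made by \<open>z\<close>.\<close>
  obtain w0 where w0: "w0 \<in> umat m" "(\<Sum>x\<in>gidx k. (norm (w0 * pad m k (gd k x) - pad m l (hu (gd k x)) * w0))\<^sup>2) \<le> K * ?c"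
    using unitary[OF umat_unitm] by blast
  have main: "(norm (pad m l (hu u) - w0 * pad m k u * adj w0))\<^sup>2 \<le> 2600 * e + 1000 * d" if u: "u \<in> umat k" for u
  proof -
    obtain w1 where w1: "w1 \<in> umat m" "(\<Sum>x\<in>gidx k. (norm (w1 * pad m k (gd k x) - pad m l (hu (gd k x)) * w1))\<^sup>2) \<le> K * ?c"
      "(norm (w1 * pad m k u - pad m l (hu u) * w1))\<^sup>2 \<le> K" using unitary[OF u] by blast
    define z where "z = adj w1 * w0"
    have z: "z \<in> umat m" using w0 w1 by (auto simp: z_def intro: umat_mult umat_adj)
    have r: "w0 \<in> sq m" "w1 \<in> sq m" "adj w1 \<in> sq m" "z \<in> sq m" "adj z \<in> sq m" "w1 * adj w1 = unitm m" "z * adj z = unitm m" "adj w1 * w1 = unitm m"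
      using w0 w1 z by (auto simp: umat_def)
    have pt: "(norm (z * p - p * z))\<^sup>2 \<le> 2 * (norm (w0 * p - q * w0))\<^sup>2 + 2 * (norm (w1 * p - q * w1))\<^sup>2"
      if pq: "p \<in> sq m" "q \<in> sq m" for p q
    proof -
      have "z * p - p * z = adj w1 * (w0 * p - q * w0) + (adj w1 * q - p * adj w1) * w0"
        by (simp add: z_def algebra_simps)
      then have "norm (z * p - p * z) \<le> norm (adj w1 * (w0 * p - q * w0)) + norm ((adj w1 * q - p * adj w1) * w0)"
        by (metis norm_triangle_ineq)
      also have "norm (adj w1 * (w0 * p - q * w0)) = norm (w0 * p - q * w0)"
        by (rule umat_norm_left[OF umat_adj[OF w1(1)], of _ m]) (use r pq in auto)
      also have "norm ((adj w1 * q - p * adj w1) * w0) = norm (adj w1 * q - p * adj w1)"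
        by (rule umat_norm_right[OF w0(1), of _ m]) (use r pq in auto)
      also have "norm (adj w1 * q - p * adj w1) = norm (w1 * p - q * w1)"
      proof -
        have s: "adj w1 * q - p * adj w1 \<in> sq m" using r pq by auto
        have "norm (adj w1 * q - p * adj w1) = norm (w1 * (adj w1 * q - p * adj w1) * w1)"
          using umat_norm_right[OF w1(1), of "w1 * (adj w1 * q - p * adj w1)" m] umat_norm_left[OF w1(1) s] s r by simp
        also have "w1 * (adj w1 * q - p * adj w1) * w1 = (w1 * adj w1) * (q * w1) - w1 * (p * (adj w1 * w1))"
          by (simp add: algebra_simps)
        also have "\<dots> = q * w1 - w1 * p"
        proof -
          have "q * w1 \<in> sq m" using pq r by auto
          then show ?thesis using pq by (simp add: r)
        qed
        finally show ?thesis by (simp add: norm_minus_commute)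
      qed
      finally have "(norm (z * p - p * z))\<^sup>2 \<le> (norm (w0 * p - q * w0) + norm (w1 * p - q * w1))\<^sup>2"
        by (intro power_mono) auto
      then show ?thesis using square_le order_trans by blast
    qed
    have gm: "pad m k (gd k x) \<in> sq m" "pad m l (hu (gd k x)) \<in> sq m" for x
      by (rule umat_rect[OF pad_umat[OF gd_umat m(1)]], rule umat_rect[OF pad_umat[OF hu[OF gd_umat] m(2)]])
    have "(\<Sum>x\<in>gidx k. (norm (z * pad m k (gd k x) - pad m k (gd k x) * z))\<^sup>2)
      \<le> (\<Sum>x\<in>gidx k. 2 * (norm (w0 * pad m k (gd k x) - pad m l (hu (gd k x)) * w0))\<^sup>2
          + 2 * (norm (w1 * pad m k (gd k x) - pad m l (hu (gd k x)) * w1))\<^sup>2)"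
      by (intro sum_mono pt gm)
    also have "\<dots> \<le> 2 * (K * ?c) + 2 * (K * ?c)"
      unfolding sum.distrib sum_distrib_left[symmetric] using w0(2) w1(2) by linarith
    finally have "(\<Sum>x\<in>gidx k. (norm (z * pad m k (gd k x) - pad m k (gd k x) * z))\<^sup>2) \<le> (4 * K) * ?c" by simp
    from commutes_with_design_scalar[OF k m(1) z this] obtain \<mu> where
      \<mu>: "(norm (z - cs \<mu> (unitm m)))\<^sup>2 \<le> 3 * (4 * K) + 15 * (real m - real k)" by blast
    let ?p = "pad m k u" and ?q = "pad m l (hu u)"
    have p: "?p \<in> sq m" "?p \<in> umat m" and q: "?q \<in> sq m"
      using pad_umat[OF u m(1)] pad_umat[OF hu[OF u] m(2)] by (auto intro: umat_rect)
    have zp: "norm (z * ?p - ?p * z) \<le> 2 * norm (z - cs \<mu> (unitm m))"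
    proof -
      have "z * ?p - ?p * z = (z - cs \<mu> (unitm m)) * ?p - ?p * (z - cs \<mu> (unitm m))"
        using p by (simp add: algebra_simps)
      then have "norm (z * ?p - ?p * z) \<le> norm ((z - cs \<mu> (unitm m)) * ?p) + norm (?p * (z - cs \<mu> (unitm m)))"
        by (metis norm_triangle_ineq4)
      also have "\<dots> \<le> 1 * norm (z - cs \<mu> (unitm m)) + 1 * norm (z - cs \<mu> (unitm m))"
        by (intro add_mono opb_left[OF umat_opb[OF p(2)]] opb_right[OF umat_opb[OF p(2)]])
      finally show ?thesis by simp
    qed
    have w0z: "w0 = w1 * z" using r by (simp add: z_def flip: mult.assoc)
    have "?q - w0 * ?p * adj w0 = - ((w1 * ?p - ?q * w1) * adj w1) - w1 * ((z * ?p - ?p * z) * adj z) * adj w1"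
    proof -
      have "w0 * ?p * adj w0 = w1 * (z * ?p * adj z) * adj w1" by (simp add: w0z adj_mult mult.assoc)
      moreover have "(z * ?p - ?p * z) * adj z = z * ?p * adj z - ?p" using p by (simp add: left_diff_distrib mult.assoc r)
      moreover have "(w1 * ?p - ?q * w1) * adj w1 = w1 * ?p * adj w1 - ?q" using q by (simp add: left_diff_distrib mult.assoc r)
      ultimately show ?thesis by (simp add: left_diff_distrib right_diff_distrib mult.assoc)
    qed
    then have "norm (?q - w0 * ?p * adj w0) \<le> norm ((w1 * ?p - ?q * w1) * adj w1) + norm (w1 * ((z * ?p - ?p * z) * adj z) * adj w1)"
      by (metis norm_minus_cancel norm_triangle_ineq4)
    also have "\<dots> \<le> norm (w1 * ?p - ?q * w1) + 2 * norm (z - cs \<mu> (unitm m))"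
      using opb_right[OF umat_opb[OF umat_adj[OF w1(1)]], of "w1 * ?p - ?q * w1"]
        opb_right[OF umat_opb[OF umat_adj[OF w1(1)]], of "w1 * ((z * ?p - ?p * z) * adj z)"]
        opb_left[OF umat_opb[OF w1(1)], of "(z * ?p - ?p * z) * adj z"]
        opb_right[OF umat_opb[OF umat_adj[OF z]], of "z * ?p - ?p * z"] zp by linarith
    finally have "(norm (?q - w0 * ?p * adj w0))\<^sup>2 \<le> (norm (w1 * ?p - ?q * w1) + 2 * norm (z - cs \<mu> (unitm m)))\<^sup>2"
      by (intro power_mono) auto
    also have "\<dots> \<le> 2 * (norm (w1 * ?p - ?q * w1))\<^sup>2 + 2 * (2 * norm (z - cs \<mu> (unitm m)))\<^sup>2" by (rule square_le)
    \<comment> \<open>In total 98 K + 120 d, that is 2548 e + 904 d, rounded up.\<close>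
    also have "\<dots> \<le> 2 * K + 8 * (3 * (4 * K) + 15 * (real m - real k))" using w1(3) \<mu> by (simp add: power_mult_distrib)
    also have "\<dots> \<le> 2600 * e + 1000 * d" using d e by (simp add: K_def)
    finally show ?thesis .
  qed
  have main': "norm (pad m l (hu u) - w0 * pad m k u * adj w0) \<le> sqrt (2600 * e + 1000 * d)" if "u \<in> umat k" for u
    using main[OF that] by (rule real_le_rsqrt)
  show ?thesis
  proof (cases "k \<le> l")
    case True
    then have ml: "m = l" by (simp add: m_def)
    have "norm (hu u - w0 * u * adj w0) \<le> sqrt (2600 * e + 1000 * d) + 7 * sqrt d" if u: "u \<in> umat k" for u
    proof -
      have "hu u - w0 * u * adj w0 = (pad m l (hu u) - w0 * pad m k u * adj w0) + w0 * (unitm m - unitm k) * adj w0"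
        by (simp add: pad_def ml algebra_simps)
      then have "norm (hu u - w0 * u * adj w0) \<le> sqrt (2600 * e + 1000 * d) + norm (w0 * (unitm m - unitm k) * adj w0)"
        by (simp only:) (intro norm_triangle_le add_right_mono main' u)
      also have "norm (w0 * (unitm m - unitm k) * adj w0) \<le> 1 * (1 * norm (unitm m - unitm k))"
        by (intro order_trans[OF opb_right[OF umat_opb[OF umat_adj[OF w0(1)]]]] mult_left_mono opb_left[OF umat_opb[OF w0(1)]]) auto
      also have "norm (unitm m - unitm k) \<le> sqrt d"
        using unitm_diff_norm[OF m(1)] d by (intro real_le_rsqrt) simp
      finally have "norm (hu u - w0 * u * adj w0) \<le> sqrt (2600 * e + 1000 * d) + 1 * (1 * sqrt d)" by simp
      moreover have "0 \<le> sqrt d" using d by simp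
      ultimately show ?thesis by linarith
    qed
    then show ?thesis using w0(1) unfolding ml e_def d_def by (intro bexI[of _ w0]) (auto simp: mult.assoc)
  next
    case False
    then have mk: "m = k" and lk: "l \<le> k" by (auto simp: m_def)
    \<comment> \<open>Here \<open>w0\<close> is larger than the target and is cut down to size l.
      The cut occurs on both sides of u, at 3 sqrt d each, and removing the identity block costs
      another sqrt d: together 7.\<close>
    obtain w where w: "w \<in> umat l" "norm (w0 - w) \<le> 3 * sqrt (real k - real l)" using cut_unitary[OF w0(1)[unfolded mk] lk] by blast
    have dk: "real k - real l = d" using lk by (simp add: d_def)
    have "norm (hu u - w * u * adj w) \<le> sqrt (2600 * e + 1000 * d) + 7 * sqrt d" if u: "u \<in> umat k" for u
    proof -
      have "hu u - w * u * adj w = (pad m l (hu u) - w0 * pad m k u * adj w0) - (unitm k - unitm l)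
         + ((w0 - w) * u * adj w0 + w * u * adj (w0 - w))"
        by (simp add: pad_def mk algebra_simps adj_diff)
      then have "norm (hu u - w * u * adj w) \<le> (norm (pad m l (hu u) - w0 * pad m k u * adj w0) + norm (unitm k - unitm l))
         + (norm ((w0 - w) * u * adj w0) + norm (w * u * adj (w0 - w)))"
        by (simp only:) (intro norm_triangle_le add_mono norm_triangle_ineq4 norm_triangle_ineq)
      moreover have "norm (unitm k - unitm l) \<le> sqrt d" using unitm_diff_norm[OF lk] dk by (intro real_le_rsqrt) simp
      moreover have "norm ((w0 - w) * u * adj w0) \<le> 1 * (1 * norm (w0 - w))"
        by (intro order_trans[OF opb_right[OF umat_opb[OF umat_adj[OF w0(1)]]]] mult_left_mono opb_right[OF umat_opb[OF u]]) auto
      moreover have "norm (w * u * adj (w0 - w)) \<le> 1 * (1 * norm (w0 - w))"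
        using opb_left[OF umat_opb[OF w(1)], of "u * adj (w0 - w)"] opb_left[OF umat_opb[OF u], of "adj (w0 - w)"]
        by (simp add: mult.assoc)
      ultimately show ?thesis using main'[OF u] w(2) unfolding dk by linarith
    qed
    then show ?thesis using w(1) unfolding e_def d_def by (intro bexI[of _ w]) (auto simp: mult.assoc)
  qed
qed

section \<open>Asymptotic homomorphisms\<close>

definition ball_op :: "nat \<Rightarrow> real \<Rightarrow> fmat set" where
  "ball_op d R = {a \<in> sq d. opb R a}"

definition bseq :: "(nat \<Rightarrow> nat) \<Rightarrow> (nat \<Rightarrow> fmat) \<Rightarrow> bool" where
  "bseq d a \<longleftrightarrow> (\<exists>C. \<forall>n. a n \<in> ball_op (d n) C)"

text \<open>Equality of classes in \<open>M_HS d\<close>, read in \<open>fmat\<close>; see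
  \<open>hs_class_eq_iff\<close>.\<close>

definition aeq :: "(nat \<Rightarrow> nat) \<Rightarrow> (nat \<Rightarrow> fmat) \<Rightarrow> (nat \<Rightarrow> fmat) \<Rightarrow> bool" where
  "aeq d x y \<longleftrightarrow> (\<lambda>n. norm (x n - y n) / sqrt (d n)) \<longlonglongrightarrow> 0"

lemma ball_opD: "a \<in> ball_op d R \<Longrightarrow> a \<in> sq d" "a \<in> ball_op d R \<Longrightarrow> opb R a"
  by (auto simp: ball_op_def)
lemma ball_op_mono: "a \<in> ball_op d R \<Longrightarrow> R \<le> R' \<Longrightarrow> a \<in> ball_op d R'"
  by (auto simp: ball_op_def intro: opb_mono)
lemma ball_op_add: "a \<in> ball_op d R \<Longrightarrow> b \<in> ball_op d R' \<Longrightarrow> a + b \<in> ball_op d (R + R')"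
  by (auto simp: ball_op_def intro: opb_add)
lemma ball_op_diff: "a \<in> ball_op d R \<Longrightarrow> b \<in> ball_op d R' \<Longrightarrow> a - b \<in> ball_op d (R + R')"
  by (auto simp: ball_op_def intro: opb_diff)
lemma ball_op_mult: "a \<in> ball_op d R \<Longrightarrow> b \<in> ball_op d R' \<Longrightarrow> a * b \<in> ball_op d (R * R')"
  by (auto simp: ball_op_def intro: opb_mult)
lemma ball_op_adj: "a \<in> ball_op d R \<Longrightarrow> adj a \<in> ball_op d R"
  by (auto simp: ball_op_def intro: opb_adj)
lemma ball_op_cs: "a \<in> ball_op d R \<Longrightarrow> cs c a \<in> ball_op d (cmod c * R)"
  by (auto simp: ball_op_def intro: opb_cs)
lemma ball_op_umat: "u \<in> umat d \<Longrightarrow> u \<in> ball_op d 1"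
  by (auto simp: ball_op_def umat_rect umat_opb)
lemma ball_op_zero: "0 \<le> R \<Longrightarrow> 0 \<in> ball_op d R"
  by (auto simp: ball_op_def)
lemma norm_ball_op: "a \<in> ball_op d R \<Longrightarrow> norm a \<le> R * sqrt d"
  by (auto simp: ball_op_def intro: opb_norm_le)

lemma bseqI: "(\<And>n. a n \<in> ball_op (d n) C) \<Longrightarrow> bseq d a" by (auto simp: bseq_def)
lemma bseqE: assumes "bseq d a" obtains C where "0 \<le> C" "\<And>n. a n \<in> ball_op (d n) C"
  using assms unfolding bseq_def by (metis ball_opD(2) opb_nonneg)
lemma bseq_add: "bseq d a \<Longrightarrow> bseq d b \<Longrightarrow> bseq d (\<lambda>n. a n + b n)"
  unfolding bseq_def by (meson ball_op_add)
lemma bseq_diff: "bseq d a \<Longrightarrow> bseq d b \<Longrightarrow> bseq d (\<lambda>n. a n - b n)"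
  unfolding bseq_def by (meson ball_op_diff)
lemma bseq_mult: "bseq d a \<Longrightarrow> bseq d b \<Longrightarrow> bseq d (\<lambda>n. a n * b n)"
  unfolding bseq_def by (meson ball_op_mult)
lemma bseq_adj: "bseq d a \<Longrightarrow> bseq d (\<lambda>n. adj (a n))"
  unfolding bseq_def by (meson ball_op_adj)
lemma bseq_cs: "bseq d a \<Longrightarrow> bseq d (\<lambda>n. cs c (a n))"
  unfolding bseq_def by (meson ball_op_cs)
lemma bseq_umat: "(\<And>n. u n \<in> umat (d n)) \<Longrightarrow> bseq d u"
  by (auto intro!: bseqI[of _ _ 1] ball_op_umat)
lemma bseq_unitm: "bseq d (\<lambda>n. unitm (d n))" by (rule bseq_umat) auto

lemma aeq_refl [simp]: "aeq d x x" by (simp add: aeq_def)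
lemma aeq_sym: "aeq d x y \<Longrightarrow> aeq d y x" by (simp add: aeq_def norm_minus_commute)
lemma aeq_squeeze:
  assumes "aeq d x y" "\<And>n. norm (z n) \<le> C * norm (x n - y n)"
  shows "(\<lambda>n. norm (z n) / sqrt (d n)) \<longlonglongrightarrow> 0"
proof (rule Lim_null_comparison)
  show "(\<lambda>n. C * (norm (x n - y n) / sqrt (d n))) \<longlonglongrightarrow> 0"
    using tendsto_mult_left[OF assms(1)[unfolded aeq_def], of C] by simp
  show "\<forall>\<^sub>F n in sequentially. norm (norm (z n) / sqrt (d n)) \<le> C * (norm (x n - y n) / sqrt (d n))"
    using assms(2) by (intro always_eventually allI) (simp add: divide_right_mono)
qed
lemma aeq_sum:
  assumes "aeq d x y" "aeq d x' y'" "\<And>n. norm (z n - z' n) \<le> C * norm (x n - y n) + C' * norm (x' n - y' n)"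
  shows "aeq d z z'"
  unfolding aeq_def
proof (rule Lim_null_comparison)
  show "(\<lambda>n. C * (norm (x n - y n) / sqrt (d n)) + C' * (norm (x' n - y' n) / sqrt (d n))) \<longlonglongrightarrow> 0"
    using tendsto_add[OF tendsto_mult_left[OF assms(1)[unfolded aeq_def], of C] tendsto_mult_left[OF assms(2)[unfolded aeq_def], of C']] by simp
  have "(C * norm (x n - y n) + C' * norm (x' n - y' n)) / sqrt (d n) = C * (norm (x n - y n) / sqrt (d n)) + C' * (norm (x' n - y' n) / sqrt (d n))" for n
    by (simp add: add_divide_distrib)
  then show "\<forall>\<^sub>F n in sequentially. norm (norm (z n - z' n) / sqrt (d n)) \<le> C * (norm (x n - y n) / sqrt (d n)) + C' * (norm (x' n - y' n) / sqrt (d n))"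
    using assms(3) by (intro always_eventually allI) (metis abs_of_nonneg divide_nonneg_nonneg divide_right_mono norm_ge_zero of_nat_0_le_iff real_norm_def real_sqrt_ge_0_iff)
qed
lemma aeq_trans: "aeq d x y \<Longrightarrow> aeq d y z \<Longrightarrow> aeq d x z"
  by (rule aeq_sum[of d x y y z _ _ 1 1]) (auto intro: norm_triangle_sub norm_diff_triangle_le)
lemma aeq_add: "aeq d x y \<Longrightarrow> aeq d x' y' \<Longrightarrow> aeq d (\<lambda>n. x n + x' n) (\<lambda>n. y n + y' n)"
  by (rule aeq_sum[of d x y x' y' _ _ 1 1]) (simp_all add: norm_diff_triangle_ineq)
lemma aeq_cs:
  assumes "aeq d x y" shows "aeq d (\<lambda>n. cs c (x n)) (\<lambda>n. cs c (y n))"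
  unfolding aeq_def cs_diff(2)[symmetric] by (rule aeq_squeeze[OF assms, of _ "cmod c"]) simp
lemma aeq_adj: "aeq d x y \<Longrightarrow> aeq d (\<lambda>n. adj (x n)) (\<lambda>n. adj (y n))"
  by (simp add: aeq_def flip: adj_diff)
lemma aeq_mult:
  assumes "aeq d x y" "aeq d x' y'" "bseq d x'" "bseq d y"
  shows "aeq d (\<lambda>n. x n * x' n) (\<lambda>n. y n * y' n)"
proof -
  obtain C where C: "\<And>n. x' n \<in> ball_op (d n) C" using bseqE[OF assms(3)] by blast
  obtain D where D: "\<And>n. y n \<in> ball_op (d n) D" using bseqE[OF assms(4)] by blast
  show ?thesis
  proof (rule aeq_sum[OF assms(1,2)])
    fix n
    have "x n * x' n - y n * y' n = (x n - y n) * x' n + y n * (x' n - y' n)" by (simp add: algebra_simps)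
    then show "norm (x n * x' n - y n * y' n) \<le> C * norm (x n - y n) + D * norm (x' n - y' n)"
      using opb_right[OF ball_opD(2)[OF C]] opb_left[OF ball_opD(2)[OF D]]
      by (simp only:) (intro norm_triangle_le add_mono)
  qed
qed

text \<open>For each n a counterexample is chosen whenever there is one. The property of this single
  sequence is then the uniform statement.\<close>

lemma eventually_uniform:
  assumes "\<And>x. (\<And>n. x n \<in> S n) \<Longrightarrow> eventually (\<lambda>n. Q n (x n)) sequentially"
    and ne: "\<And>n. S n \<noteq> {}"
  shows "eventually (\<lambda>n. \<forall>x\<in>S n. Q n x) sequentially"
proof -
  define x where "x n = (SOME y. y \<in> S n \<and> (Q n y \<longrightarrow> (\<forall>z\<in>S n. Q n z)))" for n
  have "x n \<in> S n \<and> (Q n (x n) \<longrightarrow> (\<forall>z\<in>S n. Q n z))" for n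
    unfolding x_def by (rule someI_ex) (use ne[of n] in blast)
  then show ?thesis using assms(1)[of x] by (auto elim: eventually_mono)
qed

lemma aeq_eventually: "aeq d x y \<Longrightarrow> 0 < \<epsilon> \<Longrightarrow> \<forall>\<^sub>F n in sequentially. norm (x n - y n) / sqrt (d n) \<le> \<epsilon>"
  unfolding aeq_def by (drule order_tendstoD(2)[of _ 0]) (auto elim: eventually_mono)

text \<open>The normalized trace as a pairing with the local unit, so that the adjoint rules for
  \<open>cip\<close> give its cyclicity and Cauchy-Schwarz gives \<open>ntr_le\<close>.\<close>

definition ntr :: "nat \<Rightarrow> fmat \<Rightarrow> complex" where
  "ntr d a = cip (unitm d) a / of_nat d"

lemma ntr_diff: "ntr d (a - b) = ntr d a - ntr d b"
  by (simp add: ntr_def cip_diff_right diff_divide_distrib)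
lemma ntr_add: "ntr d (a + b) = ntr d a + ntr d b"
  by (simp add: ntr_def cip_add_right add_divide_distrib)
lemma ntr_cs: "ntr d (cs c a) = c * ntr d a"
  by (simp add: ntr_def cip_cs_right)
lemma norm_unitm: "norm (unitm d) = sqrt d"
  using norm_sq_unitm[of d] by (metis norm_ge_zero real_sqrt_unique)
lemma ntr_unitm: "d > 0 \<Longrightarrow> ntr d (unitm d) = 1"
  by (simp add: ntr_def cip_norm norm_unitm)
lemma ntr_le: "cmod (ntr d a) \<le> norm a / sqrt d"
proof -
  have "cmod (ntr d a) \<le> sqrt d * norm a / d"
    using cmod_cip_le[of "unitm d" a] by (simp add: ntr_def norm_divide norm_unitm divide_right_mono)
  also have "\<dots> = norm a / sqrt d"
    by (cases "d = 0") (simp_all add: field_simps flip: real_sqrt_mult)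
  finally show ?thesis .
qed
lemma ntr_commute: "a \<in> sq d \<Longrightarrow> b \<in> sq d \<Longrightarrow> ntr d (a * b) = ntr d (b * a)"
proof -
  assume "a \<in> sq d" "b \<in> sq d"
  then have "cip (unitm d) (a * b) = cip (adj a) b" "cip (unitm d) (b * a) = cip (adj a) b"
    using cip_mult_left[of "adj a" "unitm d" b] cip_mult_right[of "unitm d" "adj a" b] by simp_all
  then show ?thesis by (simp add: ntr_def)
qed
lemma ntr_inner: "a \<in> sq d \<Longrightarrow> Re (ntr d (adj a * b)) = inner a b / d"
  using cip_mult_left[of a "unitm d" b] by (simp add: ntr_def inner_fmat_def)

text \<open>The component maps of a unital *-homomorphism of product form. All laws speak of bounded
  sequences; \<open>hnull\<close> says that the induced map on classes is well defined.\<close>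

locale asymp_hom =
  fixes k l :: "nat \<Rightarrow> nat" and h :: "nat \<Rightarrow> fmat \<Rightarrow> fmat"
  assumes kpos: "\<And>n. k n > 0" and lpos: "\<And>n. l n > 0"
    and maps: "\<And>n a. a \<in> sq (k n) \<Longrightarrow> h n a \<in> sq (l n)"
    and bdd: "\<And>a. bseq k a \<Longrightarrow> bseq l (\<lambda>n. h n (a n))"
    and hadd: "\<And>a b. bseq k a \<Longrightarrow> bseq k b \<Longrightarrow> aeq l (\<lambda>n. h n (a n + b n)) (\<lambda>n. h n (a n) + h n (b n))"
    and hmult: "\<And>a b. bseq k a \<Longrightarrow> bseq k b \<Longrightarrow> aeq l (\<lambda>n. h n (a n * b n)) (\<lambda>n. h n (a n) * h n (b n))"
    and hadj: "\<And>a. bseq k a \<Longrightarrow> aeq l (\<lambda>n. h n (adj (a n))) (\<lambda>n. adj (h n (a n)))"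
    and hcs: "\<And>a c. bseq k a \<Longrightarrow> aeq l (\<lambda>n. h n (cs c (a n))) (\<lambda>n. cs c (h n (a n)))"
    and hone: "aeq l (\<lambda>n. h n (unitm (k n))) (\<lambda>n. unitm (l n))"
    and hnull: "\<And>a b. bseq k a \<Longrightarrow> bseq k b \<Longrightarrow> aeq k a b \<Longrightarrow> aeq l (\<lambda>n. h n (a n)) (\<lambda>n. h n (b n))"
begin

lemma hdiff:
  assumes "bseq k a" "bseq k b"
  shows "aeq l (\<lambda>n. h n (a n - b n)) (\<lambda>n. h n (a n) - h n (b n))"
proof -
  have "aeq l (\<lambda>n. h n (a n + cs (-1) (b n))) (\<lambda>n. h n (a n) + cs (-1) (h n (b n)))"
    by (rule aeq_trans[OF hadd[OF assms(1) bseq_cs[OF assms(2)]] aeq_add[OF aeq_refl hcs[OF assms(2)]]])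
  moreover have "cs (-1) x = - x" for x by (intro fmat_eqI) simp
  ultimately show ?thesis by simp
qed

lemma uniform1:
  assumes "\<And>a. bseq k a \<Longrightarrow> aeq l (\<lambda>n. F n (a n)) (\<lambda>n. G n (a n))" "0 \<le> R" "0 < \<epsilon>"
  shows "\<forall>\<^sub>F n in sequentially. \<forall>a\<in>ball_op (k n) R. norm (F n a - G n a) / sqrt (l n) \<le> \<epsilon>"
proof (rule eventually_uniform)
  fix a assume "\<And>n. a n \<in> ball_op (k n) R"
  then have "bseq k a" by (rule bseqI)
  then show "\<forall>\<^sub>F n in sequentially. norm (F n (a n) - G n (a n)) / sqrt (l n) \<le> \<epsilon>"
    by (intro aeq_eventually assms)
qed (use ball_op_zero[OF assms(2)] in auto)

lemma uniform2:
  assumes "\<And>a b. bseq k a \<Longrightarrow> bseq k b \<Longrightarrow> aeq l (\<lambda>n. F n (a n) (b n)) (\<lambda>n. G n (a n) (b n))" "0 \<le> R" "0 < \<epsilon>"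
  shows "\<forall>\<^sub>F n in sequentially. \<forall>a\<in>ball_op (k n) R. \<forall>b\<in>ball_op (k n) R. norm (F n a b - G n a b) / sqrt (l n) \<le> \<epsilon>"
proof -
  have "\<forall>\<^sub>F n in sequentially. \<forall>x\<in>ball_op (k n) R \<times> ball_op (k n) R. norm (F n (fst x) (snd x) - G n (fst x) (snd x)) / sqrt (l n) \<le> \<epsilon>"
  proof (rule eventually_uniform)
    fix x :: "nat \<Rightarrow> fmat \<times> fmat" assume "\<And>n. x n \<in> ball_op (k n) R \<times> ball_op (k n) R"
    then have "bseq k (\<lambda>n. fst (x n))" "bseq k (\<lambda>n. snd (x n))" by (auto intro!: bseqI[of _ _ R] simp: mem_Times_iff)
    then show "\<forall>\<^sub>F n in sequentially. norm (F n (fst (x n)) (snd (x n)) - G n (fst (x n)) (snd (x n))) / sqrt (l n) \<le> \<epsilon>"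
      by (intro aeq_eventually assms)
  qed (use ball_op_zero[OF assms(2)] in auto)
  then show ?thesis by eventually_elim auto
qed

text \<open>\<open>eventually_uniform\<close> does not apply, since no bound is given in advance. If
  none worked, a single bounded sequence could be assembled that violates ever larger bounds,
  against \<open>bdd\<close>.\<close>

lemma uniform_bound:
  assumes R: "0 \<le> R"
  shows "\<exists>C\<ge>1. \<forall>\<^sub>F n in sequentially. \<forall>a\<in>ball_op (k n) R. opb C (h n a)"
proof (rule ccontr)
  assume "\<not> ?thesis"
  then have neg: "\<exists>\<^sub>F n in sequentially. \<exists>a\<in>ball_op (k n) R. \<not> opb C (h n a)" if "C \<ge> 1" for C
    using that by (auto simp: frequently_def not_not)
  \<comment> \<open>The violated bounds up to n. The restriction to j <= n makes the set finite, so
    \<open>x n\<close> can be taken to violate the largest of them.\<close>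
  define J where "J n = {j. j \<le> n \<and> (\<exists>a\<in>ball_op (k n) R. \<not> opb (real j) (h n a))}" for n
  have fin: "finite (J n)" for n by (rule finite_subset[of _ "{..n}"]) (auto simp: J_def)
  define x where "x n = (if J n = {} then 0 else SOME a. a \<in> ball_op (k n) R \<and> \<not> opb (real (Max (J n))) (h n a))" for n
  have x: "x n \<in> ball_op (k n) R \<and> \<not> opb (real (Max (J n))) (h n (x n))" if "J n \<noteq> {}" for n
  proof -
    have "Max (J n) \<in> J n" using Max_in[OF fin that] .
    then have "\<exists>a. a \<in> ball_op (k n) R \<and> \<not> opb (real (Max (J n))) (h n a)" by (auto simp: J_def)
    from someI_ex[OF this] show ?thesis using that by (simp add: x_def)
  qed
  have "x n \<in> ball_op (k n) R" for n using x[of n] ball_op_zero[OF R] by (cases "J n = {}") (auto simp: x_def)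
  then have "bseq k x" by (rule bseqI)
  from bdd[OF this] obtain C where C: "\<And>n. h n (x n) \<in> ball_op (l n) C" using bseqE by blast
  obtain j :: nat where j: "real j \<ge> max C 1" using real_arch_simple by blast
  have "\<exists>\<^sub>F n in sequentially. (\<exists>a\<in>ball_op (k n) R. \<not> opb (real j) (h n a)) \<and> j \<le> n"
    by (rule frequently_eventually_frequently[OF neg eventually_ge_at_top]) (use j in auto)
  then obtain n where n: "\<exists>a\<in>ball_op (k n) R. \<not> opb (real j) (h n a)" "j \<le> n"
    using frequently_ex by blast
  then have "j \<in> J n" by (auto simp: J_def)
  then have "j \<le> Max (J n)" "J n \<noteq> {}" using fin by auto
  then have "C \<le> real (Max (J n))" using j by linarith
  then have "opb (real (Max (J n))) (h n (x n))" using ball_opD(2)[OF C] by (rule opb_mono[rotated])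
  then show False using x[OF \<open>J n \<noteq> {}\<close>] by blast
qed

text \<open>Asymptotic uniform continuity. Counterexamples for the radii 1 / (j + 1) are found at
  strictly increasing indices and joined into one pair of sequences, equal to zero at all other
  indices; they are asymptotically equal, against \<open>hnull\<close>.\<close>

lemma uniform_null:
  assumes R: "0 \<le> R" and \<epsilon>: "0 < \<epsilon>"
  shows "\<exists>\<delta>>0. \<forall>\<^sub>F n in sequentially. \<forall>a\<in>ball_op (k n) R. \<forall>b\<in>ball_op (k n) R.
    norm (a - b) / sqrt (k n) \<le> \<delta> \<longrightarrow> norm (h n a - h n b) / sqrt (l n) \<le> \<epsilon>"
proof (rule ccontr)
  assume neg: "\<not> ?thesis"
  define bad where "bad j n x \<longleftrightarrow> x \<in> ball_op (k n) R \<times> ball_op (k n) R \<and> norm (fst x - snd x) / sqrt (k n) \<le> 1 / real (Suc j)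
     \<and> \<not> norm (h n (fst x) - h n (snd x)) / sqrt (l n) \<le> \<epsilon>" for j n and x :: "fmat \<times> fmat"
  have bad: "\<exists>\<^sub>F n in sequentially. \<exists>x. bad j n x" for j
  proof -
    have "\<not> (\<forall>\<^sub>F n in sequentially. \<forall>a\<in>ball_op (k n) R. \<forall>b\<in>ball_op (k n) R.
       norm (a - b) / sqrt (k n) \<le> 1 / real (Suc j) \<longrightarrow> norm (h n a - h n b) / sqrt (l n) \<le> \<epsilon>)"
    proof -
      have "0 < 1 / real (Suc j)" by simp
      then show ?thesis using neg by blast
    qed
    then have "\<exists>\<^sub>F n in sequentially. \<not> (\<forall>a\<in>ball_op (k n) R. \<forall>b\<in>ball_op (k n) R.
       norm (a - b) / sqrt (k n) \<le> 1 / real (Suc j) \<longrightarrow> norm (h n a - h n b) / sqrt (l n) \<le> \<epsilon>)"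
      by (simp add: frequently_def)
    then show ?thesis by (rule frequently_elim1) (auto simp: bad_def)
  qed
  have "\<exists>r. \<forall>j. (\<exists>x. bad j (r j) x) \<and> r j < r (Suc j)"
  proof (rule dependent_nat_choice)
    show "\<exists>n. \<exists>x. bad 0 n x" using frequently_ex[OF bad] .
    fix n j
    have "\<exists>\<^sub>F m in sequentially. (\<exists>x. bad (Suc j) m x) \<and> n < m"
      by (rule frequently_eventually_frequently[OF bad eventually_gt_at_top])
    then show "\<exists>m. (\<exists>x. bad (Suc j) m x) \<and> n < m" using frequently_ex by blast
  qed
  then obtain r where r: "\<And>j. \<exists>x. bad j (r j) x" "\<And>j. r j < r (Suc j)" by blast
  have sm: "strict_mono r" using r(2) by (simp add: strict_mono_Suc_iff)
  have inj: "inj r" using sm by (rule strict_mono_imp_inj_on)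
  \<comment> \<open>The inverse of the injective index map recovers j from n.\<close>
  define x where "x n = (if n \<in> range r then SOME y. bad (inv_into UNIV r n) n y else (0, 0))" for n
  have xr: "bad j (r j) (x (r j))" for j
    using someI_ex[OF r(1)[of j]] by (simp add: x_def inv_f_f[OF inj])
  have xR: "x n \<in> ball_op (k n) R \<times> ball_op (k n) R" for n
  proof (cases "n \<in> range r")
    case True
    then show ?thesis using xr unfolding bad_def by blast
  qed (simp add: x_def ball_op_zero[OF R])
  then have b: "bseq k (\<lambda>n. fst (x n))" "bseq k (\<lambda>n. snd (x n))" by (auto intro!: bseqI[of _ _ R] simp: mem_Times_iff)
  have "aeq k (\<lambda>n. fst (x n)) (\<lambda>n. snd (x n))"
    unfolding aeq_def LIMSEQ_iff
  proof (intro allI impI)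
    fix e :: real assume e: "0 < e"
    obtain j0 where j0: "1 / real (Suc j0) < e" using nat_approx_posE[OF e] by blast
    show "\<exists>N. \<forall>n\<ge>N. norm (norm (fst (x n) - snd (x n)) / sqrt (k n) - 0) < e"
    proof (intro exI[of _ "r j0"] allI impI)
      fix n assume n: "r j0 \<le> n"
      show "norm (norm (fst (x n) - snd (x n)) / sqrt (k n) - 0) < e"
      proof (cases "n \<in> range r")
        case True
        then obtain j where j: "n = r j" by blast
        then have "j0 \<le> j" using n strict_mono_less_eq[OF sm] by simp
        then have "1 / real (Suc j) \<le> 1 / real (Suc j0)" by (simp add: field_simps)
        then show ?thesis using xr[of j] j0 unfolding bad_def j by simp
      qed (simp add: x_def e)
    qed
  qed
  from aeq_eventually[OF hnull[OF b this] \<epsilon>] obtain N where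
    N: "\<And>n. n \<ge> N \<Longrightarrow> norm (h n (fst (x n)) - h n (snd (x n))) / sqrt (l n) \<le> \<epsilon>"
    by (auto simp: eventually_sequentially)
  have "r N \<ge> N" using sm by (rule strict_mono_imp_increasing)
  then show False using N[of "r N"] xr[of N] by (simp add: bad_def)
qed

lemma hzero: "aeq l (\<lambda>n. h n 0) (\<lambda>n. 0)"
  using hcs[OF bseq_unitm, of 0] by simp

end

section \<open>Asymptotic preservation of the trace and of inner products\<close>

context asymp_hom
begin

lemma uniform_add:
  assumes "0 \<le> R" "0 < \<epsilon>"
  shows "\<forall>\<^sub>F n in sequentially. \<forall>a\<in>ball_op (k n) R. \<forall>b\<in>ball_op (k n) R. norm (h n (a + b) - (h n a + h n b)) / sqrt (l n) \<le> \<epsilon>"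
  by (rule uniform2[where F = "\<lambda>n a b. h n (a + b)" and G = "\<lambda>n a b. (h n a + h n b)", OF _ assms]) (rule hadd)

lemma uniform_diff:
  assumes "0 \<le> R" "0 < \<epsilon>"
  shows "\<forall>\<^sub>F n in sequentially. \<forall>a\<in>ball_op (k n) R. \<forall>b\<in>ball_op (k n) R. norm (h n (a - b) - (h n a - h n b)) / sqrt (l n) \<le> \<epsilon>"
  by (rule uniform2[where F = "\<lambda>n a b. h n (a - b)" and G = "\<lambda>n a b. (h n a - h n b)", OF _ assms]) (rule hdiff)

lemma uniform_mult:
  assumes "0 \<le> R" "0 < \<epsilon>"
  shows "\<forall>\<^sub>F n in sequentially. \<forall>a\<in>ball_op (k n) R. \<forall>b\<in>ball_op (k n) R. norm (h n (a * b) - h n a * h n b) / sqrt (l n) \<le> \<epsilon>"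
  by (rule uniform2[where F = "\<lambda>n a b. h n (a * b)" and G = "\<lambda>n a b. h n a * h n b", OF _ assms]) (rule hmult)

lemma uniform_adj_mult:
  assumes "0 \<le> R" "0 < \<epsilon>"
  shows "\<forall>\<^sub>F n in sequentially. \<forall>a\<in>ball_op (k n) R. \<forall>b\<in>ball_op (k n) R. norm (h n (adj a * b) - adj (h n a) * h n b) / sqrt (l n) \<le> \<epsilon>"
  by (rule uniform2[where F = "\<lambda>n a b. h n (adj a * b)" and G = "\<lambda>n a b. adj (h n a) * h n b", OF _ assms]) (rule aeq_trans[OF hmult aeq_mult[OF hadj aeq_refl]], (intro bseq_adj bdd | assumption)+)

lemma ntr_aeq: "aeq d x y \<Longrightarrow> (\<lambda>n. ntr (d n) (x n) - ntr (d n) (y n)) \<longlonglongrightarrow> 0"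
proof (rule Lim_null_comparison)
  assume "aeq d x y"
  then show "(\<lambda>n. norm (x n - y n) / sqrt (d n)) \<longlonglongrightarrow> 0" by (simp add: aeq_def)
  show "\<forall>\<^sub>F n in sequentially. norm (ntr (d n) (x n) - ntr (d n) (y n)) \<le> norm (x n - y n) / sqrt (d n)"
    using ntr_le by (intro always_eventually allI) (simp flip: ntr_diff)
qed

lemma trace_step_seq:
  assumes a: "bseq k a" and g: "\<And>n. g n \<in> umat (k n)"
  shows "(\<lambda>n. ntr (l n) (h n (cs (1/2) (a n + g n * a n * adj (g n)))) - ntr (l n) (h n (a n))) \<longlonglongrightarrow> 0"
proof -
  have G: "bseq k g" "bseq k (\<lambda>n. adj (g n))" using g by (auto intro: bseq_umat bseq_adj)
  define b where "b n = g n * a n * adj (g n)" for n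
  have b: "bseq k b" unfolding b_def by (intro bseq_mult G a)
  have sq: "h n (a n) \<in> sq (l n)" "h n (g n) \<in> sq (l n)" "h n (adj (g n)) \<in> sq (l n)" for n
    using bseqE[OF a] bseqE[OF G(1)] bseqE[OF G(2)] by (metis ball_opD(1) maps)+
  have "aeq l (\<lambda>n. h n (b n)) (\<lambda>n. h n (g n) * h n (a n) * h n (adj (g n)))"
    unfolding b_def
    by (rule aeq_trans[OF hmult aeq_mult[OF hmult aeq_refl]]) (intro bseq_mult bdd G a)+
  from ntr_aeq[OF this]
  have 1: "(\<lambda>n. ntr (l n) (h n (b n)) - ntr (l n) (h n (g n) * h n (a n) * h n (adj (g n)))) \<longlonglongrightarrow> 0" .
  have "aeq l (\<lambda>n. h n (adj (g n)) * h n (g n)) (\<lambda>n. unitm (l n))"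
  proof -
    have "adj (g n) * g n = unitm (k n)" for n using g by (simp add: umat_def)
    then show ?thesis using aeq_trans[OF aeq_sym[OF hmult[OF G(2,1)]]] hone by simp
  qed
  then have "aeq l (\<lambda>n. h n (adj (g n)) * h n (g n) * h n (a n)) (\<lambda>n. unitm (l n) * h n (a n))"
    by (rule aeq_mult[OF _ aeq_refl bdd[OF a] bseq_unitm])
  then have *: "(\<lambda>n. ntr (l n) (h n (adj (g n)) * h n (g n) * h n (a n)) - ntr (l n) (h n (a n))) \<longlonglongrightarrow> 0"
    using ntr_aeq[of l] sq by fastforce
  have 2: "(\<lambda>n. ntr (l n) (h n (g n) * h n (a n) * h n (adj (g n))) - ntr (l n) (h n (a n))) \<longlonglongrightarrow> 0"
  proof -
    have "ntr (l n) (h n (g n) * h n (a n) * h n (adj (g n))) = ntr (l n) (h n (adj (g n)) * (h n (g n) * h n (a n)))" for n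
      by (rule ntr_commute) (use sq in auto)
    then show ?thesis using * by (simp add: mult.assoc)
  qed
  have "aeq l (\<lambda>n. h n (cs (1/2) (a n + b n))) (\<lambda>n. cs (1/2) (h n (a n) + h n (b n)))"
    by (rule aeq_trans[OF hcs aeq_cs[OF hadd]]) (intro bseq_add a b)+
  from ntr_aeq[OF this]
  have 3: "(\<lambda>n. ntr (l n) (h n (cs (1/2) (a n + b n))) - (ntr (l n) (h n (a n)) + ntr (l n) (h n (b n))) / 2) \<longlonglongrightarrow> 0"
    by (simp add: ntr_cs ntr_add)
  have T: "(\<lambda>n. (ntr (l n) (h n (cs (1/2) (a n + b n))) - (ntr (l n) (h n (a n)) + ntr (l n) (h n (b n))) / 2)
     + ((ntr (l n) (h n (b n)) - ntr (l n) (h n (g n) * h n (a n) * h n (adj (g n))))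
        + (ntr (l n) (h n (g n) * h n (a n) * h n (adj (g n))) - ntr (l n) (h n (a n)))) / 2) \<longlonglongrightarrow> 0 + (0 + 0) / 2"
    by (intro tendsto_intros 1 2 3) simp
  have E: "(x - (y + z) / 2) + ((z - t) + (t - y)) / 2 = x - y" for x y z t :: complex by (simp add: field_simps)
  show ?thesis using T unfolding E b_def[symmetric] by simp
qed

lemma trace_step:
  assumes R: "0 \<le> R" and \<epsilon>: "0 < \<epsilon>"
  shows "\<forall>\<^sub>F n in sequentially. \<forall>a\<in>ball_op (k n) R. \<forall>g\<in>umat (k n).
    cmod (ntr (l n) (h n (cs (1/2) (a + g * a * adj g))) - ntr (l n) (h n a)) \<le> \<epsilon>"
proof -
  have "\<forall>\<^sub>F n in sequentially. \<forall>x\<in>ball_op (k n) R \<times> umat (k n).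
    cmod (ntr (l n) (h n (cs (1/2) (fst x + snd x * fst x * adj (snd x)))) - ntr (l n) (h n (fst x))) \<le> \<epsilon>"
  proof (rule eventually_uniform)
    fix x :: "nat \<Rightarrow> fmat \<times> fmat" assume x: "\<And>n. x n \<in> ball_op (k n) R \<times> umat (k n)"
    then have "bseq k (\<lambda>n. fst (x n))" "\<And>n. snd (x n) \<in> umat (k n)" by (auto intro!: bseqI[of _ _ R] simp: mem_Times_iff)
    from tendsto_norm[OF trace_step_seq[OF this]]
    have "\<forall>\<^sub>F n in sequentially. cmod (ntr (l n) (h n (cs (1/2) (fst (x n) + snd (x n) * fst (x n) * adj (snd (x n))))) - ntr (l n) (h n (fst (x n)))) < \<epsilon>"
      using \<epsilon> by (intro order_tendstoD(2)[of _ 0]) auto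
    then show "\<forall>\<^sub>F n in sequentially. cmod (ntr (l n) (h n (cs (1/2) (fst (x n) + snd (x n) * fst (x n) * adj (snd (x n))))) - ntr (l n) (h n (fst (x n)))) \<le> \<epsilon>"
      by eventually_elim simp
  next
    show "ball_op (k n) R \<times> umat (k n) \<noteq> {}" for n using ball_op_zero[OF R] umat_unitm by blast
  qed
  then show ?thesis by eventually_elim auto
qed

end

lemma cip_unitm: "cip (unitm k) a = (\<Sum>i<k. ent a i i)"
proof -
  have "(\<Sum>j<k. cnj (ent (unitm k) i j) * ent a i j) = ent a i i" if "i < k" for i
    using that by (simp add: if_distrib[of cnj] if_distrib[of "\<lambda>t. t * _"] cong: if_cong)
  then show ?thesis by (simp add: cip_rect[of _ k k])
qed

text \<open>The mean of the inner products of a with g a g* over the design vanishes by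
  \<open>design\<close>, so some of them is nonpositive. For this g the parallelogram expansion
  halves the squared norm of the average of a and g a g*.\<close>

lemma traceless_halving:
  assumes a: "a \<in> ball_op k R" "ntr k a = 0" and k: "k > 0"
  shows "\<exists>g\<in>umat k. (norm (cs (1/2) (a + g * a * adj g)))\<^sup>2 \<le> (norm a)\<^sup>2 / 2
    \<and> cs (1/2) (a + g * a * adj g) \<in> ball_op k R \<and> ntr k (cs (1/2) (a + g * a * adj g)) = 0"
proof -
  have A: "a \<in> sq k" using a by (simp add: ball_op_def)
  have "(\<Sum>x\<in>gidx k. inner a (gd k x * a * adj (gd k x))) = 0"
    using design[OF A k] a(2) k by (simp add: inner_sum_right[symmetric] ntr_def cip_unitm)
  moreover have "gidx k \<noteq> {}" using card_gidx_pos[OF k] by auto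
  ultimately obtain x where x: "inner a (gd k x * a * adj (gd k x)) \<le> 0"
    using sum_pos[of "gidx k" "\<lambda>x. inner a (gd k x * a * adj (gd k x))"] finite_gidx[of k]
    by (auto simp: not_le[symmetric])
  let ?g = "gd k x"
  have g: "?g \<in> umat k" "?g \<in> sq k" "adj ?g \<in> sq k" "adj ?g * ?g = unitm k" using gd_umat[of k x] by (auto simp: umat_def)
  let ?b = "?g * a * adj ?g"
  have nb: "norm ?b = norm a"
    using umat_norm_right[OF umat_adj[OF g(1)], of "?g * a" k] umat_norm_left[OF g(1) A] A by simp
  have "(norm (cs (1/2) (a + ?b)))\<^sup>2 = (norm (a + ?b))\<^sup>2 / 4" by (simp add: power_mult_distrib power_divide norm_divide)
  also have "\<dots> \<le> (norm a)\<^sup>2 / 2" using x unfolding norm_add_sq nb by simp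
  finally have 1: "(norm (cs (1/2) (a + ?b)))\<^sup>2 \<le> (norm a)\<^sup>2 / 2" .
  have "?b \<in> ball_op k (1 * R * 1)"
    by (intro ball_op_mult a ball_op_umat g umat_adj)
  then have "cs (1/2) (a + ?b) \<in> ball_op k (cmod (1/2) * (R + 1 * R * 1))" by (intro ball_op_cs ball_op_add a)
  then have 2: "cs (1/2) (a + ?b) \<in> ball_op k R" by (simp add: norm_divide)
  have "ntr k ?b = ntr k (adj ?g * (?g * a))" by (rule ntr_commute) (use g A in auto)
  also have "\<dots> = 0" using umat_cancel_left[OF g(1) A] a by simp
  finally show ?thesis using 1 2 a g by (intro bexI[of _ ?g]) (simp_all add: ntr_cs ntr_add)
qed

context asymp_hom
begin

text \<open>The number of halvings is fixed before n, so that finitely many eventual estimates have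
  to hold together; the tolerance is split in two at each step.\<close>

lemma trace_iterate:
  assumes R: "0 \<le> R"
  shows "0 < \<epsilon> \<Longrightarrow> \<forall>\<^sub>F n in sequentially. \<forall>a\<in>ball_op (k n) R. ntr (k n) a = 0 \<longrightarrow>
    (\<exists>b\<in>ball_op (k n) R. ntr (k n) b = 0 \<and> (norm b)\<^sup>2 \<le> (norm a)\<^sup>2 / 2 ^ j \<and> cmod (ntr (l n) (h n b) - ntr (l n) (h n a)) \<le> \<epsilon>)"
proof (induction j arbitrary: \<epsilon>)
  case 0
  then show ?case by (intro always_eventually allI ballI impI) (auto intro!: bexI)
next
  case (Suc j)
  have "0 < \<epsilon> / 2" using Suc.prems by simp
  from Suc.IH[OF this] trace_step[OF R this] show ?case
  proof eventually_elim
    case (elim n)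
    show ?case
    proof (intro ballI impI)
      fix a assume a: "a \<in> ball_op (k n) R" "ntr (k n) a = 0"
      obtain b where b: "b \<in> ball_op (k n) R" "ntr (k n) b = 0" "(norm b)\<^sup>2 \<le> (norm a)\<^sup>2 / 2 ^ j"
        "cmod (ntr (l n) (h n b) - ntr (l n) (h n a)) \<le> \<epsilon> / 2" using elim(1) a by blast
      obtain g where g: "g \<in> umat (k n)" "(norm (cs (1/2) (b + g * b * adj g)))\<^sup>2 \<le> (norm b)\<^sup>2 / 2"
        "cs (1/2) (b + g * b * adj g) \<in> ball_op (k n) R" "ntr (k n) (cs (1/2) (b + g * b * adj g)) = 0"
        using traceless_halving[OF b(1,2) kpos] by blast
      have "cmod (ntr (l n) (h n (cs (1/2) (b + g * b * adj g))) - ntr (l n) (h n b)) \<le> \<epsilon> / 2"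
        using elim(2) b g by blast
      then have "cmod (ntr (l n) (h n (cs (1/2) (b + g * b * adj g))) - ntr (l n) (h n a)) \<le> \<epsilon> / 2 + \<epsilon> / 2"
        using b(4) by (metis add_mono norm_diff_triangle_le)
      moreover have "(norm (cs (1/2) (b + g * b * adj g)))\<^sup>2 \<le> (norm a)\<^sup>2 / 2 ^ Suc j"
        using g(2) b(3) by simp
      ultimately show "\<exists>b\<in>ball_op (k n) R. ntr (k n) b = 0 \<and> (norm b)\<^sup>2 \<le> (norm a)\<^sup>2 / 2 ^ Suc j \<and> cmod (ntr (l n) (h n b) - ntr (l n) (h n a)) \<le> \<epsilon>"
        using g(3,4) by (intro bexI[OF _ g(3)]) auto
    qed
  qed
qed

text \<open>After j halvings the squared normalized norm is at most R^2 / 2^j. For large j the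
  matrix is so small that \<open>uniform_null\<close> makes its image, and hence the trace of its
  image, small.\<close>

lemma trace_zero:
  assumes R: "0 \<le> R" and \<epsilon>: "0 < \<epsilon>"
  shows "\<forall>\<^sub>F n in sequentially. \<forall>a\<in>ball_op (k n) R. ntr (k n) a = 0 \<longrightarrow> cmod (ntr (l n) (h n a)) \<le> \<epsilon>"
proof -
  have e3: "0 < \<epsilon> / 3" using \<epsilon> by simp
  obtain \<delta> where \<delta>: "\<delta> > 0" "\<forall>\<^sub>F n in sequentially. \<forall>a\<in>ball_op (k n) R. \<forall>b\<in>ball_op (k n) R.
    norm (a - b) / sqrt (k n) \<le> \<delta> \<longrightarrow> norm (h n a - h n b) / sqrt (l n) \<le> \<epsilon> / 3"
    using uniform_null[OF R e3] by blast
  obtain j where j: "R\<^sup>2 / \<delta>\<^sup>2 < 2 ^ j" using real_arch_pow[of 2 "R\<^sup>2 / \<delta>\<^sup>2"] by auto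
  show ?thesis using trace_iterate[OF R e3, of j] \<delta>(2) aeq_eventually[OF hzero e3]
  proof eventually_elim
    case (elim n)
    show ?case
    proof (intro ballI impI)
      fix a assume a: "a \<in> ball_op (k n) R" "ntr (k n) a = 0"
      obtain b where b: "b \<in> ball_op (k n) R" "(norm b)\<^sup>2 \<le> (norm a)\<^sup>2 / 2 ^ j"
        "cmod (ntr (l n) (h n b) - ntr (l n) (h n a)) \<le> \<epsilon> / 3" using elim(1) a by blast
      have "(norm a)\<^sup>2 \<le> (R * sqrt (k n))\<^sup>2" by (intro power_mono norm_ball_op a) auto
      then have "(norm b)\<^sup>2 \<le> R\<^sup>2 * k n / 2 ^ j"
        using b(2) by (simp add: power_mult_distrib) (meson divide_right_mono order_trans zero_le_numeral zero_le_power)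
      also have "\<dots> \<le> \<delta>\<^sup>2 * k n"
      proof -
        have "R\<^sup>2 / 2 ^ j \<le> \<delta>\<^sup>2" using j \<delta>(1) by (simp add: field_simps)
        from mult_right_mono[OF this, of "real (k n)"] show ?thesis by simp
      qed
      finally have "(norm b)\<^sup>2 \<le> (\<delta> * sqrt (k n))\<^sup>2" by (simp add: power_mult_distrib)
      then have "norm b \<le> \<delta> * sqrt (k n)" by (rule power2_le_imp_le) (use \<delta>(1) in simp)
      then have "norm (b - 0) / sqrt (k n) \<le> \<delta>" using kpos[of n] by (simp add: field_simps)
      then have "norm (h n b - h n 0) / sqrt (l n) \<le> \<epsilon> / 3"
        using elim(2) b(1) ball_op_zero[OF R] by blast
      moreover have "norm (h n b) \<le> norm (h n b - h n 0) + norm (h n 0 - 0)"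
        using norm_triangle_ineq[of "h n b - h n 0" "h n 0"] by simp
      then have "norm (h n b) / sqrt (l n) \<le> norm (h n b - h n 0) / sqrt (l n) + norm (h n 0 - 0) / sqrt (l n)"
        by (simp add: divide_right_mono flip: add_divide_distrib)
      ultimately have "norm (h n b) / sqrt (l n) \<le> \<epsilon> / 3 + \<epsilon> / 3" using elim(3) by linarith
      then have "cmod (ntr (l n) (h n b)) \<le> \<epsilon> / 3 + \<epsilon> / 3" using ntr_le[of "l n" "h n b"] by linarith
      then show "cmod (ntr (l n) (h n a)) \<le> \<epsilon>"
        using b(3) norm_triangle_ineq2[of "ntr (l n) (h n a)" "ntr (l n) (h n b)"] by (simp add: norm_minus_commute)
    qed
  qed
qed

text \<open>\<open>hcs\<close> concerns a fixed scalar. A finite net of the disc makes it uniform,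
  and \<open>uniform_null\<close> carries the estimate from the net to all scalars.\<close>

lemma scalars:
  assumes R: "0 \<le> R" and \<epsilon>: "0 < \<epsilon>"
  shows "\<forall>\<^sub>F n in sequentially. \<forall>c. cmod c \<le> R \<longrightarrow> norm (h n (cs c (unitm (k n))) - cs c (unitm (l n))) / sqrt (l n) \<le> \<epsilon>"
proof -
  have e3: "0 < \<epsilon> / 3" using \<epsilon> by simp
  obtain \<delta> where \<delta>: "\<delta> > 0" "\<forall>\<^sub>F n in sequentially. \<forall>a\<in>ball_op (k n) R. \<forall>b\<in>ball_op (k n) R.
    norm (a - b) / sqrt (k n) \<le> \<delta> \<longrightarrow> norm (h n a - h n b) / sqrt (l n) \<le> \<epsilon> / 3"
    using uniform_null[OF R e3] by blast
  have "compact (cball (0::complex) R)" by simp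
  then obtain K :: "complex set" where K: "finite K" "K \<subseteq> cball 0 R" "cball 0 R \<subseteq> (\<Union>c\<in>K. ball c (min \<delta> (\<epsilon> / 3)))"
  proof (rule compactE_image[of "cball (0::complex) R" "cball 0 R" "\<lambda>c. ball c (min \<delta> (\<epsilon> / 3))"])
    show "cball 0 R \<subseteq> (\<Union>c\<in>cball 0 R. ball c (min \<delta> (\<epsilon> / 3)))"
      by (intro subsetI UN_I) (assumption, use \<delta>(1) e3 in simp)
    fix C' assume *: "C' \<subseteq> cball (0::complex) R" "finite C'" "cball 0 R \<subseteq> (\<Union>c\<in>C'. ball c (min \<delta> (\<epsilon> / 3)))"
    show thesis by (rule that[OF *(2,1,3)])
  qed simp_all
  have "\<forall>\<^sub>F n in sequentially. \<forall>c\<in>K. norm (h n (cs c (unitm (k n))) - cs c (unitm (l n))) / sqrt (l n) \<le> \<epsilon> / 3"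
    by (intro eventually_ball_finite K ballI aeq_eventually[OF aeq_trans[OF hcs aeq_cs[OF hone]] e3] bseq_unitm)
  then show ?thesis using \<delta>(2)
  proof eventually_elim
    case (elim n)
    have sk: "sqrt (k n) > 0" "sqrt (l n) > 0" using kpos lpos by auto
    have B: "cs c (unitm (k n)) \<in> ball_op (k n) R" if "cmod c \<le> R" for c
      using ball_op_mono[OF ball_op_cs[OF ball_op_umat[OF umat_unitm]], of c R] that by simp
    show ?case
    proof (intro allI impI)
      fix c assume c: "cmod c \<le> R"
      then obtain c' where c': "c' \<in> K" "dist c' c < min \<delta> (\<epsilon> / 3)" using K(3) by (force simp: dist_norm)
      have c'R: "cmod c' \<le> R" using K(2) c'(1) by auto
      have "norm (cs c (unitm d) - cs c' (unitm d)) = dist c' c * sqrt d" for d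
        by (simp add: norm_unitm dist_norm norm_minus_commute flip: cs_diff)
      note dd = this
      have "norm (h n (cs c (unitm (k n))) - h n (cs c' (unitm (k n)))) / sqrt (l n) \<le> \<epsilon> / 3"
        using elim(2) B[OF c] B[OF c'R] dd[of "k n"] c'(2) sk by auto
      moreover have "norm (h n (cs c' (unitm (k n))) - cs c' (unitm (l n))) / sqrt (l n) \<le> \<epsilon> / 3" using elim(1) c'(1) by blast
      moreover have "norm (cs c' (unitm (l n)) - cs c (unitm (l n))) / sqrt (l n) \<le> \<epsilon> / 3"
        using dd[of "l n"] c'(2) sk by (simp add: norm_minus_commute)
      moreover have "norm (h n (cs c (unitm (k n))) - cs c (unitm (l n)))
        \<le> norm (h n (cs c (unitm (k n))) - h n (cs c' (unitm (k n)))) + norm (h n (cs c' (unitm (k n))) - cs c' (unitm (l n)))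
         + norm (cs c' (unitm (l n)) - cs c (unitm (l n)))"
      proof -
        have t: "norm (x - w) \<le> norm (x - y) + norm (y - z) + norm (z - w)" for x y z w :: fmat
          using norm_triangle_ineq[of "x - y" "y - z"] norm_triangle_ineq[of "x - z" "z - w"] by simp
        show ?thesis by (rule t)
      qed
      ultimately show "norm (h n (cs c (unitm (k n))) - cs c (unitm (l n))) / sqrt (l n) \<le> \<epsilon>"
        using sk by (simp add: field_simps)
    qed
  qed
qed

text \<open>Split a into its traceless part and the scalar given by its trace;
  \<open>trace_zero\<close> and \<open>scalars\<close> treat the two parts.\<close>

lemma trace_preserving:
  assumes R: "0 \<le> R" and \<epsilon>: "0 < \<epsilon>"
  shows "\<forall>\<^sub>F n in sequentially. \<forall>a\<in>ball_op (k n) R. cmod (ntr (l n) (h n a) - ntr (k n) a) \<le> \<epsilon>"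
proof -
  have e3: "0 < \<epsilon> / 3" and R2: "0 \<le> 2 * R" using \<epsilon> R by auto
  show ?thesis using trace_zero[OF R2 e3] scalars[OF R e3] uniform_add[OF R2 e3]
  proof eventually_elim
    case (elim n)
    show ?case
    proof
      fix a assume a: "a \<in> ball_op (k n) R"
      define c where "c = ntr (k n) a"
      have "norm a / sqrt (k n) \<le> R" using norm_ball_op[OF a] kpos[of n] by (simp add: field_simps)
      then have c: "cmod c \<le> R" using ntr_le[of "k n" a] by (simp add: c_def)
      have C: "cs c (unitm (k n)) \<in> ball_op (k n) R"
        using ball_op_mono[OF ball_op_cs[OF ball_op_umat[OF umat_unitm]], of c R] c by simp
      define a0 where "a0 = a - cs c (unitm (k n))"
      have as: "a0 + cs c (unitm (k n)) = a" by (simp add: a0_def)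
      have a0: "a0 \<in> ball_op (k n) (2 * R)" using ball_op_diff[OF a C] by (simp add: a0_def)
      have "ntr (k n) a0 = 0" using kpos[of n] by (simp add: a0_def ntr_diff ntr_cs ntr_unitm c_def)
      then have 1: "cmod (ntr (l n) (h n a0)) \<le> \<epsilon> / 3" using elim(1) a0 by blast
      have 2: "cmod (ntr (l n) (h n (cs c (unitm (k n)))) - c) \<le> \<epsilon> / 3"
      proof -
        have eq: "ntr (l n) (h n (cs c (unitm (k n))) - cs c (unitm (l n))) = ntr (l n) (h n (cs c (unitm (k n)))) - c"
          using lpos[of n] by (simp add: ntr_diff ntr_cs ntr_unitm)
        show ?thesis unfolding eq[symmetric] using ntr_le[of "l n" "h n (cs c (unitm (k n))) - cs c (unitm (l n))"] elim(2)[rule_format, OF c] by linarith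
      qed
      have "norm (h n (a0 + cs c (unitm (k n))) - (h n a0 + h n (cs c (unitm (k n))))) / sqrt (l n) \<le> \<epsilon> / 3"
        using elim(3) a0 ball_op_mono[OF C, of "2 * R"] R by simp
      then have "cmod (ntr (l n) (h n a - (h n a0 + h n (cs c (unitm (k n)))))) \<le> \<epsilon> / 3"
        using ntr_le[of "l n" "h n a - (h n a0 + h n (cs c (unitm (k n))))"] unfolding as by linarith
      then have 3: "cmod (ntr (l n) (h n a) - (ntr (l n) (h n a0) + ntr (l n) (h n (cs c (unitm (k n)))))) \<le> \<epsilon> / 3"
        by (simp add: ntr_diff ntr_add)
      have "ntr (l n) (h n a) - c = (ntr (l n) (h n a) - (ntr (l n) (h n a0) + ntr (l n) (h n (cs c (unitm (k n))))))
         + (ntr (l n) (h n a0) + (ntr (l n) (h n (cs c (unitm (k n)))) - c))" by simp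
      also have "cmod \<dots> \<le> \<epsilon> / 3 + (\<epsilon> / 3 + \<epsilon> / 3)"
        by (intro norm_triangle_le add_mono 1 2 3)
      finally show "cmod (ntr (l n) (h n a) - ntr (k n) a) \<le> \<epsilon>" by (simp add: c_def)
    qed
  qed
qed

lemma inner_preserving:
  assumes R: "0 \<le> R" and \<epsilon>: "0 < \<epsilon>"
  shows "\<forall>\<^sub>F n in sequentially. \<forall>a\<in>ball_op (k n) R. \<forall>b\<in>ball_op (k n) R. \<bar>inner (h n a) (h n b) / l n - inner a b / k n\<bar> \<le> \<epsilon>"
proof -
  have e2: "0 < \<epsilon> / 2" and R2: "0 \<le> R * R" using \<epsilon> R by auto
  from uniform_adj_mult[OF R e2] trace_preserving[OF R2 e2] show ?thesis
  proof eventually_elim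
    case (elim n)
    show ?case
    proof (intro ballI)
      fix a b assume a: "a \<in> ball_op (k n) R" and b: "b \<in> ball_op (k n) R"
      have s: "a \<in> sq (k n)" "b \<in> sq (k n)" "h n a \<in> sq (l n)" "h n b \<in> sq (l n)"
        using ball_opD(1)[OF a] ball_opD(1)[OF b] by (auto intro: maps)
      have ab: "adj a * b \<in> ball_op (k n) (R * R)" by (intro ball_op_mult ball_op_adj a b)
      have "cmod (ntr (l n) (h n (adj a * b) - adj (h n a) * h n b)) \<le> \<epsilon> / 2"
        using elim(1) a b ntr_le order_trans by blast
      moreover have "cmod (ntr (l n) (h n (adj a * b)) - ntr (k n) (adj a * b)) \<le> \<epsilon> / 2" using elim(2) ab by blast
      ultimately have "cmod (ntr (l n) (adj (h n a) * h n b) - ntr (k n) (adj a * b)) \<le> \<epsilon> / 2 + \<epsilon> / 2"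
        unfolding ntr_diff by (metis add_mono norm_diff_triangle_le norm_minus_commute)
      then have "\<bar>Re (ntr (l n) (adj (h n a) * h n b) - ntr (k n) (adj a * b))\<bar> \<le> \<epsilon>"
        using abs_Re_le_cmod order_trans by fastforce
      then show "\<bar>inner (h n a) (h n b) / l n - inner a b / k n\<bar> \<le> \<epsilon>"
        using s by (simp add: ntr_inner)
    qed
  qed
qed

lemma lipschitz:
  assumes R: "0 \<le> R" and \<epsilon>: "0 < \<epsilon>"
  shows "\<forall>\<^sub>F n in sequentially. \<forall>a\<in>ball_op (k n) R. \<forall>b\<in>ball_op (k n) R.
     norm (h n a - h n b) / sqrt (l n) \<le> norm (a - b) / sqrt (k n) + \<epsilon>"
proof -
  have e2: "0 < \<epsilon> / 2" "0 < (\<epsilon> / 2)\<^sup>2" and R2: "0 \<le> 2 * R" using \<epsilon> R by auto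
  show ?thesis using inner_preserving[OF R2 e2(2)] uniform_diff[OF R e2(1)]
  proof eventually_elim
    case (elim n)
    show ?case
    proof (intro ballI)
      fix a b assume a: "a \<in> ball_op (k n) R" and b: "b \<in> ball_op (k n) R"
      have d: "a - b \<in> ball_op (k n) (2 * R)" using ball_op_diff[OF a b] by simp
      then have "\<bar>inner (h n (a - b)) (h n (a - b)) / l n - inner (a - b) (a - b) / k n\<bar> \<le> (\<epsilon> / 2)\<^sup>2" using elim(1) by blast
      then have "inner (h n (a - b)) (h n (a - b)) / l n \<le> inner (a - b) (a - b) / k n + (\<epsilon> / 2)\<^sup>2" by linarith
      then have "(norm (h n (a - b)) / sqrt (l n))\<^sup>2 \<le> (norm (a - b) / sqrt (k n))\<^sup>2 + (\<epsilon> / 2)\<^sup>2"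
        by (simp add: power_divide[of _ "sqrt _"] power2_norm_eq_inner)
      also have "\<dots> \<le> (norm (a - b) / sqrt (k n) + \<epsilon> / 2)\<^sup>2"
        using \<epsilon> by (simp add: power2_sum)
      finally have "norm (h n (a - b)) / sqrt (l n) \<le> norm (a - b) / sqrt (k n) + \<epsilon> / 2"
        by (rule power2_le_imp_le) (use \<epsilon> in simp)
      moreover have "norm (h n (a - b) - (h n a - h n b)) / sqrt (l n) \<le> \<epsilon> / 2" using elim(2) a b by blast
      moreover have "norm (h n a - h n b) / sqrt (l n) \<le> norm (h n (a - b)) / sqrt (l n) + norm (h n (a - b) - (h n a - h n b)) / sqrt (l n)"
        unfolding add_divide_distrib[symmetric]
        by (intro divide_right_mono) (use norm_triangle_ineq4[of "h n (a - b)" "h n (a - b) - (h n a - h n b)"] in auto)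
      ultimately show "norm (h n a - h n b) / sqrt (l n) \<le> norm (a - b) / sqrt (k n) + \<epsilon>" by linarith
    qed
  qed
qed

text \<open>A map that is nearly isometric on balls is injective on classes. Thereby the laws of an
  inverse can be checked after applying \<open>h\<close>.\<close>

lemma injective:
  assumes a: "bseq k a" and b: "bseq k b" and hab: "aeq l (\<lambda>n. h n (a n)) (\<lambda>n. h n (b n))"
  shows "aeq k a b"
proof -
  obtain R where R: "0 \<le> R" "\<And>n. a n - b n \<in> ball_op (k n) R" using bseqE[OF bseq_diff[OF a b]] by blast
  have "aeq l (\<lambda>n. h n (a n) - h n (b n)) (\<lambda>n. 0)" using hab by (simp add: aeq_def)
  then have z: "aeq l (\<lambda>n. h n (a n - b n)) (\<lambda>n. 0)" by (rule aeq_trans[OF hdiff[OF a b]])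
  show ?thesis
    unfolding aeq_def LIMSEQ_iff
  proof (intro allI impI)
    fix e :: real assume e: "0 < e"
    then have e2: "0 < e\<^sup>2 / 4" "0 < e / 2" by auto
    have "\<forall>\<^sub>F n in sequentially. norm (norm (a n - b n) / sqrt (k n) - 0) < e"
      using inner_preserving[OF R(1) e2(1)] aeq_eventually[OF z e2(2)]
    proof eventually_elim
      case (elim n)
      have "\<bar>inner (h n (a n - b n)) (h n (a n - b n)) / l n - inner (a n - b n) (a n - b n) / k n\<bar> \<le> e\<^sup>2 / 4"
        using elim(1) R(2) by blast
      then have "inner (a n - b n) (a n - b n) / k n \<le> inner (h n (a n - b n)) (h n (a n - b n)) / l n + e\<^sup>2 / 4" by linarith
      then have "(norm (a n - b n) / sqrt (k n))\<^sup>2 \<le> (norm (h n (a n - b n)) / sqrt (l n))\<^sup>2 + e\<^sup>2 / 4"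
        by (simp add: power_divide power2_norm_eq_inner)
      also have "\<dots> \<le> (e / 2)\<^sup>2 + e\<^sup>2 / 4"
        using elim(2) by (intro add_right_mono power_mono) auto
      also have "\<dots> < e\<^sup>2" using e by (simp add: power_divide)
      finally have "norm (a n - b n) / sqrt (k n) < e" by (rule power2_less_imp_less) (use e in simp)
      then show ?case by simp
    qed
    then show "\<exists>N. \<forall>n\<ge>N. norm (norm (a n - b n) / sqrt (k n) - 0) < e" by (simp add: eventually_sequentially)
  qed
qed

lemma unitaries:
  assumes \<epsilon>: "0 < \<epsilon>"
  shows "\<forall>\<^sub>F n in sequentially. \<forall>u\<in>umat (k n). \<exists>w\<in>umat (l n). norm (h n u - w) / sqrt (l n) \<le> \<epsilon>"
proof (rule eventually_uniform)
  fix u assume u: "\<And>n. u n \<in> umat (k n)"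
  have U: "bseq k u" using u by (rule bseq_umat)
  have uu: "adj (u n) * u n = unitm (k n)" for n using u by (simp add: umat_def)
  have "aeq l (\<lambda>n. adj (h n (u n)) * h n (u n)) (\<lambda>n. unitm (l n))"
  proof (rule aeq_trans[OF aeq_sym])
    show "aeq l (\<lambda>n. h n (adj (u n) * u n)) (\<lambda>n. adj (h n (u n)) * h n (u n))"
      by (rule aeq_trans[OF hmult aeq_mult[OF hadj aeq_refl]]) (intro bseq_adj bdd U)+
    show "aeq l (\<lambda>n. h n (adj (u n) * u n)) (\<lambda>n. unitm (l n))" using hone by (simp add: uu)
  qed
  from aeq_eventually[OF this \<epsilon>] show "\<forall>\<^sub>F n in sequentially. \<exists>w\<in>umat (l n). norm (h n (u n) - w) / sqrt (l n) \<le> \<epsilon>"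
  proof eventually_elim
    case (elim n)
    have "h n (u n) \<in> sq (l n)" using u by (intro maps umat_rect)
    from near_unitary[OF this] obtain w where "w \<in> umat (l n)" "norm (h n (u n) - w) \<le> norm (adj (h n (u n)) * h n (u n) - unitm (l n))" by blast
    then show ?case using elim by (meson divide_right_mono of_nat_0_le_iff order_trans real_sqrt_ge_0_iff)
  qed
qed (use umat_unitm in blast)

end

section \<open>Local linear models and the dimension estimate\<close>

context asymp_hom
begin

text \<open>For a single large n all hypotheses of \<open>linear_model\<close> hold at once. The map
  \<open>hu\<close> replaces the images of unitaries by nearby exact unitaries.\<close>

lemma local_model:
  assumes \<eta>: "0 < \<eta>" "\<eta> \<le> 1"
  shows "\<forall>\<^sub>F n in sequentially. \<exists>hu. (\<forall>u\<in>umat (k n). hu u \<in> umat (l n) \<and> norm (h n u - hu u) / sqrt (l n) \<le> \<eta>) \<and>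
    (\<forall>u\<in>umat (k n). \<exists>X\<in>rect (l n) (k n). (norm X)\<^sup>2 = real (k n)
      \<and> (\<Sum>x\<in>gidx (k n). (norm (X * gd (k n) x - hu (gd (k n) x) * X))\<^sup>2) \<le> \<eta> * real (k n) * real (card (gidx (k n)))
      \<and> (norm (X * u - hu u * X))\<^sup>2 \<le> \<eta> * real (k n))"
proof -
  \<comment> \<open>The first bound is the smallness required by \<open>linear_model\<close>; 96000
    is the product of its factor 3000 and the factor 32 of
    \<open>select_intertwiner\<close>.\<close>
  define t where "t = min (1 / 100000) (\<eta> / 96000)"
  have t: "0 < t" "t \<le> 1 / 100000" "96000 * t \<le> \<eta>" using \<eta> by (auto simp: t_def)
  \<comment> \<open>Chosen so that \<delta> + 3 / R equals \<open>t\<close>.\<close>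
  define R \<delta> where "R = 6 / t" and "\<delta> = t / 2"
  have R: "1 \<le> R" "0 \<le> R" and \<delta>: "0 < \<delta>" "0 < \<delta> / 2" and small: "\<delta> + 3 / R = t" using t by (auto simp: R_def \<delta>_def field_simps)
  obtain C where C: "1 \<le> C" "\<forall>\<^sub>F n in sequentially. \<forall>a\<in>ball_op (k n) R. opb C (h n a)" using uniform_bound[OF R(2)] by blast
  \<comment> \<open>Replacing \<open>h n u\<close> by \<open>hu u\<close> in a product with
    \<open>h n a\<close>, of operator bound \<open>C\<close>, may cost at most half of
    \<delta>.\<close>
  define \<rho> where "\<rho> = min \<eta> (\<delta> / (2 * C))"
  have \<rho>: "0 < \<rho>" "\<rho> \<le> \<eta>" using \<eta> \<delta> C by (auto simp: \<rho>_def)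
  have \<rho>C: "C * \<rho> \<le> \<delta> / 2"
  proof -
    have "C * \<rho> \<le> C * (\<delta> / (2 * C))" using C by (intro mult_left_mono) (auto simp: \<rho>_def)
    then show ?thesis using C by simp
  qed
  have I: "\<forall>\<^sub>F n in sequentially. \<forall>a\<in>ball_op (k n) R. norm (h n (cs \<i> a) - cs \<i> (h n a)) / sqrt (l n) \<le> \<delta>"
    by (rule uniform1[where F = "\<lambda>n a. h n (cs \<i> a)" and G = "\<lambda>n a. cs \<i> (h n a)", OF _ R(2) \<delta>(1)]) (rule hcs)
  show ?thesis
    using C(2) inner_preserving[OF R(2) \<delta>(1)] lipschitz[OF R(2) \<delta>(1)]
      uniform_mult[OF R(2) \<delta>(2)]
      unitaries[OF \<rho>(1)] I
  proof eventually_elim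
    case (elim n)
    have B: "a \<in> ball_op (k n) R" if "a \<in> sq (k n)" "opb R a" for a using that by (simp add: ball_op_def)
    obtain hu where hu: "\<And>u. u \<in> umat (k n) \<Longrightarrow> hu u \<in> umat (l n) \<and> norm (h n u - hu u) / sqrt (l n) \<le> \<rho>"
      using elim(5) by metis
    have mult: "norm (h n (u * a) - hu u * h n a) / sqrt (l n) \<le> \<delta>" if u: "u \<in> umat (k n)" and a: "a \<in> sq (k n)" "opb R a" for u a
    proof -
      have uR: "u \<in> ball_op (k n) R" using ball_op_mono[OF ball_op_umat[OF u] R(1)] .
      have "norm ((h n u - hu u) * h n a) / sqrt (l n) \<le> C * norm (h n u - hu u) / sqrt (l n)"
        using elim(1) B[OF a] by (intro divide_right_mono opb_right) auto
      also have "\<dots> \<le> C * \<rho>" using hu[OF u] C(1) by (metis mult_left_mono order_trans times_divide_eq_right zero_le_one)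
      finally have 1: "norm ((h n u - hu u) * h n a) / sqrt (l n) \<le> \<delta> / 2" using \<rho>C by linarith
      have 2: "norm (h n (u * a) - h n u * h n a) / sqrt (l n) \<le> \<delta> / 2" using elim(4) uR B[OF a] by blast
      have "h n (u * a) - hu u * h n a = (h n (u * a) - h n u * h n a) + (h n u - hu u) * h n a" by (simp add: algebra_simps)
      then have "norm (h n (u * a) - hu u * h n a) / sqrt (l n)
          \<le> norm (h n (u * a) - h n u * h n a) / sqrt (l n) + norm ((h n u - hu u) * h n a) / sqrt (l n)"
        unfolding add_divide_distrib[symmetric] by (intro divide_right_mono) (simp_all only: norm_triangle_ineq real_sqrt_ge_0_iff of_nat_0_le_iff)
      then show ?thesis using 1 2 by linarith
    qed
    have hu': "\<And>u. u \<in> umat (k n) \<Longrightarrow> hu u \<in> umat (l n)" using hu by blast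
    have ex: "\<exists>\<Lambda>. (\<forall>x y. \<Lambda> (x + y) = \<Lambda> x + \<Lambda> y) \<and> (\<forall>c x. \<Lambda> (cs c x) = cs c (\<Lambda> x)) \<and> (\<forall>x. \<Lambda> x \<in> sq (l n)) \<and>
      (\<forall>u\<in>umat (k n). (\<Sum>i<k n. \<Sum>j<k n. (norm (\<Lambda> (u * eu i j) - hu u * \<Lambda> (eu i j)))\<^sup>2) \<le> 3000 * (\<delta> + 3 / R) * real (k n)) \<and>
      (\<Sum>i<k n. \<Sum>j<k n. (norm (\<Lambda> (eu i j)))\<^sup>2) \<ge> real (k n) / 16"
    proof (rule linear_model[OF kpos lpos R(1) \<delta>(1), where h = "h n"])
      show "\<delta> + 3 / R \<le> 1 / 100000" using small t by simp
      show "norm (h n (u * a) - hu u * h n a) / sqrt (l n) \<le> \<delta>" if "u \<in> umat (k n)" "a \<in> sq (k n)" "opb R a" for u a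
        using mult that .
      show "norm (h n a - h n b) / sqrt (l n) \<le> norm (a - b) / sqrt (k n) + \<delta>"
        if "a \<in> sq (k n)" "opb R a" "b \<in> sq (k n)" "opb R b" for a b using elim(3) B that by blast
      show "\<bar>inner (h n a) (h n b) / l n - inner a b / k n\<bar> \<le> \<delta>"
        if "a \<in> sq (k n)" "opb R a" "b \<in> sq (k n)" "opb R b" for a b using elim(2) B that by blast
      show "norm (h n (cs \<i> a) - cs \<i> (h n a)) / sqrt (l n) \<le> \<delta>" if "a \<in> sq (k n)" "opb R a" for a
        using elim(6) B that by blast
    qed (auto intro: hu' maps)
    then obtain \<Lambda> where \<Lambda>: "\<And>x y. \<Lambda> (x + y) = \<Lambda> x + \<Lambda> y" "\<And>c x. \<Lambda> (cs c x) = cs c (\<Lambda> x)" "\<And>x. \<Lambda> x \<in> sq (l n)"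
      "\<And>u. u \<in> umat (k n) \<Longrightarrow> (\<Sum>i<k n. \<Sum>j<k n. (norm (\<Lambda> (u * eu i j) - hu u * \<Lambda> (eu i j)))\<^sup>2) \<le> 3000 * t * real (k n)"
      "(\<Sum>i<k n. \<Sum>j<k n. (norm (\<Lambda> (eu i j)))\<^sup>2) \<ge> real (k n) / 16"
      unfolding small by blast
    have 32: "32 * (3000 * t) \<le> \<eta>" using t by simp
    have "\<exists>X\<in>rect (l n) (k n). (norm X)\<^sup>2 = real (k n)
      \<and> (\<Sum>x\<in>gidx (k n). (norm (X * gd (k n) x - hu (gd (k n) x) * X))\<^sup>2) \<le> \<eta> * real (k n) * real (card (gidx (k n)))
      \<and> (norm (X * u - hu u * X))\<^sup>2 \<le> \<eta> * real (k n)" if u: "u \<in> umat (k n)" for u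
    proof -
      obtain X where X: "X \<in> rect (l n) (k n)" "(norm X)\<^sup>2 = real (k n)"
        "(\<Sum>x\<in>gidx (k n). (norm (X * gd (k n) x - hu (gd (k n) x) * X))\<^sup>2) \<le> 32 * (3000 * t) * real (k n) * real (card (gidx (k n)))"
        "(norm (X * u - hu u * X))\<^sup>2 \<le> 32 * (3000 * t) * real (k n)"
        using select_intertwiner[where \<Lambda> = \<Lambda>, OF kpos lpos \<Lambda>(1,2,3) hu' \<Lambda>(4,5) u] by blast
      have "32 * (3000 * t) * real (k n) * c \<le> \<eta> * real (k n) * c" if "0 \<le> c" for c
        using 32 that by (intro mult_right_mono) auto
      from this[of "real (card (gidx (k n)))"] this[of 1] show ?thesis using X by (intro bexI[OF _ X(1)]) auto
    qed
    then show ?case using hu \<rho>(2) by (intro exI[of _ hu]) (meson order_trans)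
  qed
qed

lemma dimension:
  assumes \<eta>: "0 < \<eta>" "\<eta> \<le> 1"
  shows "\<forall>\<^sub>F n in sequentially. real (k n) \<le> real (l n) + 3 * sqrt \<eta> * real (k n)"
  using local_model[OF \<eta>]
proof eventually_elim
  case (elim n)
  then obtain hu where hu: "\<And>u. u \<in> umat (k n) \<Longrightarrow> hu u \<in> umat (l n)"
    and X: "\<And>u. u \<in> umat (k n) \<Longrightarrow> \<exists>X\<in>rect (l n) (k n). (norm X)\<^sup>2 = real (k n)
      \<and> (\<Sum>x\<in>gidx (k n). (norm (X * gd (k n) x - hu (gd (k n) x) * X))\<^sup>2) \<le> \<eta> * real (k n) * real (card (gidx (k n)))"
    by meson
  obtain X where "X \<in> rect (l n) (k n)" "(norm X)\<^sup>2 = real (k n)"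
      "(\<Sum>x\<in>gidx (k n). (norm (X * gd (k n) x - hu (gd (k n) x) * X))\<^sup>2) \<le> \<eta> * real (k n) * real (card (gidx (k n)))"
    using X[OF umat_unitm] by blast
  then show ?case by (intro intertwiner_dimension[OF kpos _ _ \<eta>, where v = "\<lambda>x. hu (gd (k n) x)"] hu gd_umat) auto
qed

end

text \<open>One sequence for all tolerances: each \<open>w n\<close> is nearly optimal among the
  elements of \<open>S n\<close>. The slack 1 / (n + 1) is added because the infimum of the
  admissible tolerances need not be attained.\<close>

lemma eventually_diagonal:
  fixes Q :: "nat \<Rightarrow> 'a \<Rightarrow> real \<Rightarrow> bool"
  assumes ev: "\<And>\<epsilon>. 0 < \<epsilon> \<Longrightarrow> \<forall>\<^sub>F n in sequentially. \<exists>w\<in>S n. Q n w \<epsilon>"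
    and mono: "\<And>n w \<delta> \<epsilon>. Q n w \<delta> \<Longrightarrow> \<delta> \<le> \<epsilon> \<Longrightarrow> Q n w \<epsilon>" and ne: "\<And>n. S n \<noteq> {}"
  shows "\<exists>w. (\<forall>n. w n \<in> S n) \<and> (\<forall>\<epsilon>>0. \<forall>\<^sub>F n in sequentially. Q n (w n) \<epsilon>)"
proof -
  define E where "E n = {e. 0 < e \<and> (\<exists>w\<in>S n. Q n w e)}" for n
  have bel: "bdd_below (E n)" for n by (rule bdd_belowI[of _ 0]) (auto simp: E_def)
  have "\<exists>w\<in>S n. E n \<noteq> {} \<longrightarrow> Q n w (Inf (E n) + 1 / real (Suc n))" for n
  proof (cases "E n = {}")
    case True
    then show ?thesis using ne by auto
  next
    case False
    then obtain e where "e \<in> E n" "e < Inf (E n) + 1 / real (Suc n)"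
      using cInf_lessD[of "E n" "Inf (E n) + 1 / real (Suc n)"] by auto
    then show ?thesis using mono[of n _ e "Inf (E n) + 1 / real (Suc n)"] by (auto simp: E_def)
  qed
  then obtain w where w: "\<And>n. w n \<in> S n" "\<And>n. E n \<noteq> {} \<Longrightarrow> Q n (w n) (Inf (E n) + 1 / real (Suc n))" by metis
  have "\<forall>\<^sub>F n in sequentially. Q n (w n) \<epsilon>" if \<epsilon>: "0 < \<epsilon>" for \<epsilon>
  proof -
    have e2: "0 < \<epsilon> / 2" using \<epsilon> by simp
    have "(\<lambda>n. 1 / real (Suc n)) \<longlonglongrightarrow> 0" using LIMSEQ_inverse_real_of_nat by (simp add: inverse_eq_divide)
    then have "\<forall>\<^sub>F n in sequentially. 1 / real (Suc n) < \<epsilon> / 2" using e2 by (rule order_tendstoD)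
    with ev[OF e2] show ?thesis
    proof eventually_elim
      case (elim n)
      then have E: "\<epsilon> / 2 \<in> E n" using e2 by (auto simp: E_def)
      then have "Inf (E n) \<le> \<epsilon> / 2" using bel by (intro cInf_lower)
      then have "Inf (E n) + 1 / real (Suc n) \<le> \<epsilon>" using elim(2) by linarith
      moreover have "Q n (w n) (Inf (E n) + 1 / real (Suc n))" using w(2) E by blast
      ultimately show ?case using mono by blast
    qed
  qed
  then show ?thesis using w(1) by blast
qed

section \<open>The inverse isomorphism and the comparison of dimensions\<close>

lemma ex_opb_nat: "\<exists>m::nat. opb (real m) (A :: fmat)"
proof -
  have "opb (norm A) A" by (simp add: opb_def norm_mult_fmat)
  then show ?thesis using opb_mono real_arch_simple[of "norm A"] by blast
qed

locale asymp_iso = asymp_hom +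
  assumes surj: "\<And>b. bseq l b \<Longrightarrow> \<exists>a. bseq k a \<and> aeq l (\<lambda>n. h n (a n)) b"
begin

text \<open>For any lift a, the images of a* a and of 1 agree asymptotically, so
  \<open>injective\<close> makes a* a close to 1, and a can be moved to a unitary by
  \<open>near_unitary\<close>.\<close>

lemma lift_unitary:
  assumes b: "\<And>n. b n \<in> umat (l n)"
  shows "\<exists>a. (\<forall>n. a n \<in> umat (k n)) \<and> aeq l (\<lambda>n. h n (a n)) b"
proof -
  have B: "bseq l b" using b by (rule bseq_umat)
  obtain a where a: "bseq k a" "aeq l (\<lambda>n. h n (a n)) b" using surj[OF B] by blast
  have "aeq l (\<lambda>n. h n (adj (a n) * a n)) (\<lambda>n. adj (b n) * b n)"
    by (rule aeq_trans[OF hmult[OF bseq_adj[OF a(1)] a(1)] aeq_mult[OF aeq_trans[OF hadj[OF a(1)] aeq_adj[OF a(2)]] a(2) bdd[OF a(1)] bseq_adj[OF B]]])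
  moreover have "adj (b n) * b n = unitm (l n)" for n using b by (simp add: umat_def)
  ultimately have "aeq l (\<lambda>n. h n (adj (a n) * a n)) (\<lambda>n. h n (unitm (k n)))" using aeq_trans[OF _ aeq_sym[OF hone]] by simp
  then have au: "aeq k (\<lambda>n. adj (a n) * a n) (\<lambda>n. unitm (k n))" by (rule injective[rotated 2]) (intro bseq_mult bseq_adj a bseq_unitm)+
  have sq: "a n \<in> sq (k n)" for n using bseqE[OF a(1)] ball_opD(1) by metis
  obtain u where u: "\<And>n. u n \<in> umat (k n)" "\<And>n. norm (a n - u n) \<le> norm (adj (a n) * a n - unitm (k n))"
    using near_unitary[OF sq] by metis
  have "aeq k a u" by (rule aeq_sum[OF au aeq_refl, where C = 1 and C' = 0]) (use u in auto)
  then have "aeq l (\<lambda>n. h n (a n)) (\<lambda>n. h n (u n))" using hnull[OF a(1) bseq_umat[of u k]] u(1) by blast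
  then show ?thesis using u(1) aeq_trans[OF aeq_sym a(2)] by blast
qed

text \<open>\<open>surj\<close> gives no control of the operator norm of a lift. Writing b as a
  multiple of a sum of two unitaries and lifting these keeps the same radius.\<close>

lemma lift_ball:
  assumes b: "\<And>n. b n \<in> ball_op (l n) R" and R: "0 < R"
  shows "\<exists>a. (\<forall>n. a n \<in> ball_op (k n) R) \<and> aeq l (\<lambda>n. h n (a n)) b"
proof -
  have "\<exists>u\<in>umat (l n). \<exists>v\<in>umat (l n). b n = cs (R / 2) (u + v)" for n
    using average_two_unitaries[of "b n" "l n" R] b[of n] R by (simp add: ball_op_def scaleR_eq_cs)
  then obtain u v where uv: "\<And>n. u n \<in> umat (l n)" "\<And>n. v n \<in> umat (l n)" "\<And>n. b n = cs (R / 2) (u n + v n)" by metis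
  obtain u' where u': "\<And>n. u' n \<in> umat (k n)" "aeq l (\<lambda>n. h n (u' n)) u" using lift_unitary[of u] uv(1) by blast
  obtain v' where v': "\<And>n. v' n \<in> umat (k n)" "aeq l (\<lambda>n. h n (v' n)) v" using lift_unitary[of v] uv(2) by blast
  have B: "bseq k u'" "bseq k v'" using u' v' by (auto intro: bseq_umat)
  define a where "a n = cs (R / 2) (u' n + v' n)" for n
  have "a n \<in> ball_op (k n) (cmod (R / 2) * (1 + 1))" for n
    unfolding a_def by (intro ball_op_cs ball_op_add ball_op_umat u' v')
  then have "a n \<in> ball_op (k n) R" for n using R by (simp add: norm_divide)
  moreover have "aeq l (\<lambda>n. h n (a n)) b" unfolding a_def uv(3)
    by (rule aeq_trans[OF hcs[OF bseq_add[OF B]] aeq_cs[OF aeq_trans[OF hadd[OF B] aeq_add[OF u'(2) v'(2)]]]])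
  ultimately show ?thesis by blast
qed

lemma uniform_surj:
  assumes R: "0 < R" and \<epsilon>: "0 < \<epsilon>"
  shows "\<forall>\<^sub>F n in sequentially. \<forall>b\<in>ball_op (l n) R. \<exists>a\<in>ball_op (k n) R. norm (h n a - b) / sqrt (l n) \<le> \<epsilon>"
proof (rule eventually_uniform)
  fix b assume "\<And>n. b n \<in> ball_op (l n) R"
  from lift_ball[OF this R] obtain a where a: "\<And>n. a n \<in> ball_op (k n) R" "aeq l (\<lambda>n. h n (a n)) b" by blast
  from aeq_eventually[OF a(2) \<epsilon>] show "\<forall>\<^sub>F n in sequentially. \<exists>a\<in>ball_op (k n) R. norm (h n a - b n) / sqrt (l n) \<le> \<epsilon>"
    by eventually_elim (use a(1) in blast)
qed (use ball_op_zero[OF less_imp_le[OF R]] in blast)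

text \<open>Near preimages exist uniformly on balls by \<open>uniform_surj\<close>, and each law for
  h' follows by applying h and cancelling with \<open>injective\<close>. The maps h' n must be
  defined on all matrices, respect bounds, and have errors vanishing on every ball;
  \<open>eventually_diagonal\<close> supplies one choice meeting all of this.\<close>

lemma ex_inverse: "\<exists>h'. asymp_hom l k h'"
proof -
  \<comment> \<open>A positive integer radius for each matrix. Only finitely many values occur on a
    ball, so finitely many uses of \<open>uniform_surj\<close> suffice for one tolerance.\<close>
  define r where "r b = real (Suc (LEAST m. opb (real m) b))" for b :: fmat
  have rb: "b \<in> ball_op (l n) (r b)" if "b \<in> sq (l n)" for b n
    using LeastI_ex[OF ex_opb_nat[of b]] that unfolding r_def ball_op_def by (auto intro: opb_mono)
  have rN: "r b \<le> real (Suc N)" if "opb C b" "C \<le> real N" for b C N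
    using Least_le[of "\<lambda>m. opb (real m) b" N] opb_mono[OF that] by (simp add: r_def)
  define S where "S n = {g. \<forall>b. g b \<in> ball_op (k n) (r b)}" for n
  \<comment> \<open>A single parameter couples the error with the radius 1 / \<epsilon>, which makes
    the condition monotone and lets the balls grow as the tolerance shrinks.\<close>
  define Q where "Q n g \<epsilon> \<longleftrightarrow> 0 < \<epsilon> \<and> (\<forall>b\<in>ball_op (l n) (1 / \<epsilon>). norm (h n (g b) - b) / sqrt (l n) \<le> \<epsilon>)" for n g \<epsilon>
  have "\<exists>h'. (\<forall>n. h' n \<in> S n) \<and> (\<forall>\<epsilon>>0. \<forall>\<^sub>F n in sequentially. Q n (h' n) \<epsilon>)"
  proof (rule eventually_diagonal)
    fix \<epsilon> :: real assume \<epsilon>: "0 < \<epsilon>"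
    obtain N :: nat where N: "1 / \<epsilon> \<le> real N" using real_arch_simple by blast
    have "\<forall>\<^sub>F n in sequentially. \<forall>j\<in>{..N}. \<forall>b\<in>ball_op (l n) (real (Suc j)). \<exists>a\<in>ball_op (k n) (real (Suc j)). norm (h n a - b) / sqrt (l n) \<le> \<epsilon>"
      by (intro eventually_ball_finite ballI uniform_surj \<epsilon>) auto
    then show "\<forall>\<^sub>F n in sequentially. \<exists>g\<in>S n. Q n g \<epsilon>"
    proof eventually_elim
      case (elim n)
      have "\<exists>a. a \<in> ball_op (k n) (r b) \<and> (b \<in> ball_op (l n) (1 / \<epsilon>) \<longrightarrow> norm (h n a - b) / sqrt (l n) \<le> \<epsilon>)" for b
      proof (cases "b \<in> ball_op (l n) (1 / \<epsilon>)")
        case True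
        then have "(LEAST m. opb (real m) b) \<le> N" using rN[OF _ N, of b] by (simp add: r_def ball_op_def)
        moreover have "b \<in> ball_op (l n) (r b)" using rb[of b n] True by (simp add: ball_op_def)
        ultimately show ?thesis using elim unfolding r_def by blast
      next
        case False
        have "0 \<in> ball_op (k n) (r b)" by (rule ball_op_zero) (simp add: r_def)
        then show ?thesis using False by blast
      qed
      then obtain g where "\<And>b. g b \<in> ball_op (k n) (r b)" "\<And>b. b \<in> ball_op (l n) (1 / \<epsilon>) \<Longrightarrow> norm (h n (g b) - b) / sqrt (l n) \<le> \<epsilon>" by metis
      then show ?case using \<epsilon> by (intro bexI[of _ g]) (auto simp: S_def Q_def)
    qed
  next
    show "S n \<noteq> {}" for n
    proof -
      have "(\<lambda>_. 0) \<in> S n" by (auto simp: S_def r_def intro!: ball_op_zero)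
      then show ?thesis by blast
    qed
    fix n g \<delta> \<epsilon> assume Q: "Q n g \<delta>" and le: "\<delta> \<le> (\<epsilon>::real)"
    have "1 / \<epsilon> \<le> 1 / \<delta>" using Q le by (simp add: Q_def frac_le)
    then show "Q n g \<epsilon>" using Q le ball_op_mono unfolding Q_def by (meson less_le_trans order_trans)
  qed
  then obtain h' where h'S: "\<And>n. h' n \<in> S n" and h'Q: "\<And>\<epsilon>. 0 < \<epsilon> \<Longrightarrow> \<forall>\<^sub>F n in sequentially. Q n (h' n) \<epsilon>" by blast
  have h': "h' n b \<in> ball_op (k n) (r b)" for n b using h'S[of n] by (simp add: S_def)
  have bd: "bseq k (\<lambda>n. h' n (b n))" if b: "bseq l b" for b
  proof -
    obtain C where C: "\<And>n. b n \<in> ball_op (l n) C" using bseqE[OF b] by blast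
    obtain N :: nat where N: "C \<le> real N" using real_arch_simple by blast
    have "h' n (b n) \<in> ball_op (k n) (real (Suc N))" for n
      using ball_op_mono[OF h' rN[OF _ N]] ball_opD(2)[OF C] .
    then show ?thesis by (rule bseqI)
  qed
  have inv: "aeq l (\<lambda>n. h n (h' n (b n))) b" if b: "bseq l b" for b
  proof -
    obtain C where C: "0 \<le> C" "\<And>n. b n \<in> ball_op (l n) C" using bseqE[OF b] by blast
    show ?thesis
      unfolding aeq_def LIMSEQ_iff
    proof (intro allI impI)
      fix e :: real assume e: "0 < e"
      define \<epsilon> where "\<epsilon> = min (e / 2) (1 / (C + 1))"
      have \<epsilon>: "0 < \<epsilon>" "\<epsilon> \<le> e / 2" "C \<le> 1 / \<epsilon>"
      proof -
        show "0 < \<epsilon>" "\<epsilon> \<le> e / 2" using e C(1) by (auto simp: \<epsilon>_def)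
        have "\<epsilon> * (C + 1) \<le> 1" using C(1) by (auto simp: \<epsilon>_def min_def field_simps)
        then show "C \<le> 1 / \<epsilon>" using \<open>0 < \<epsilon>\<close> by (simp add: field_simps)
      qed
      have "\<forall>\<^sub>F n in sequentially. norm (norm (h n (h' n (b n)) - b n) / sqrt (l n) - 0) < e"
        using h'Q[OF \<epsilon>(1)]
      proof eventually_elim
        case (elim n)
        then have "norm (h n (h' n (b n)) - b n) / sqrt (l n) \<le> \<epsilon>" using ball_op_mono[OF C(2) \<epsilon>(3)] by (auto simp: Q_def)
        then show ?case using \<epsilon>(2) e by simp
      qed
      then show "\<exists>N. \<forall>n\<ge>N. norm (norm (h n (h' n (b n)) - b n) / sqrt (l n) - 0) < e" by (simp add: eventually_sequentially)
    qed
  qed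
  have "asymp_hom l k h'"
  proof
    show "h' n a \<in> sq (k n)" if "a \<in> sq (l n)" for n a using ball_opD(1)[OF h'] .
    show "bseq k (\<lambda>n. h' n (a n))" if "bseq l a" for a using bd[OF that] .
    show "aeq k (\<lambda>n. h' n (a n + b n)) (\<lambda>n. h' n (a n) + h' n (b n))" if a: "bseq l a" and b: "bseq l b" for a b
    proof (rule injective)
      show "aeq l (\<lambda>n. h n (h' n (a n + b n))) (\<lambda>n. h n (h' n (a n) + h' n (b n)))"
        by (rule aeq_trans[OF inv[OF bseq_add[OF a b]] aeq_sym[OF aeq_trans[OF hadd[OF bd[OF a] bd[OF b]] aeq_add[OF inv[OF a] inv[OF b]]]]])
    qed (intro bd bseq_add a b)+
    show "aeq k (\<lambda>n. h' n (a n * b n)) (\<lambda>n. h' n (a n) * h' n (b n))" if a: "bseq l a" and b: "bseq l b" for a b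
    proof (rule injective)
      show "aeq l (\<lambda>n. h n (h' n (a n * b n))) (\<lambda>n. h n (h' n (a n) * h' n (b n)))"
        by (rule aeq_trans[OF inv[OF bseq_mult[OF a b]] aeq_sym[OF aeq_trans[OF hmult[OF bd[OF a] bd[OF b]] aeq_mult[OF inv[OF a] inv[OF b] bdd[OF bd[OF b]] a]]]])
    qed (intro bd bseq_mult a b)+
    show "aeq k (\<lambda>n. h' n (adj (a n))) (\<lambda>n. adj (h' n (a n)))" if a: "bseq l a" for a
    proof (rule injective)
      show "aeq l (\<lambda>n. h n (h' n (adj (a n)))) (\<lambda>n. h n (adj (h' n (a n))))"
        by (rule aeq_trans[OF inv[OF bseq_adj[OF a]] aeq_sym[OF aeq_trans[OF hadj[OF bd[OF a]] aeq_adj[OF inv[OF a]]]]])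
    qed (intro bd bseq_adj a)+
    show "aeq k (\<lambda>n. h' n (cs c (a n))) (\<lambda>n. cs c (h' n (a n)))" if a: "bseq l a" for a c
    proof (rule injective)
      show "aeq l (\<lambda>n. h n (h' n (cs c (a n)))) (\<lambda>n. h n (cs c (h' n (a n))))"
        by (rule aeq_trans[OF inv[OF bseq_cs[OF a]] aeq_sym[OF aeq_trans[OF hcs[OF bd[OF a]] aeq_cs[OF inv[OF a]]]]])
    qed (intro bd bseq_cs a)+
    show "aeq k (\<lambda>n. h' n (unitm (l n))) (\<lambda>n. unitm (k n))"
      by (rule injective[OF bd[OF bseq_unitm] bseq_unitm aeq_trans[OF inv[OF bseq_unitm] aeq_sym[OF hone]]])
    show "aeq k (\<lambda>n. h' n (a n)) (\<lambda>n. h' n (b n))" if a: "bseq l a" and b: "bseq l b" and ab: "aeq l a b" for a b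
      by (rule injective[OF bd[OF a] bd[OF b] aeq_trans[OF inv[OF a] aeq_trans[OF ab aeq_sym[OF inv[OF b]]]]])
  qed (rule lpos kpos)+
  then show ?thesis by blast
qed

lemma dimension_close:
  assumes \<epsilon>: "0 < \<epsilon>" "\<epsilon> \<le> 1"
  shows "\<forall>\<^sub>F n in sequentially. \<bar>real (k n) - real (l n)\<bar> \<le> \<epsilon> * real (l n)"
proof -
  \<comment> \<open>The choice \<eta> = (s / 3)^2 turns the relative error in
    \<open>dimension\<close> into s. Half of \<epsilon> suffices, as k is at most 2 l by the first
    estimate.\<close>
  define s where "s = \<epsilon> / 2"
  have s: "0 < s" "s \<le> 1 / 2" and \<eta>: "0 < (s / 3)\<^sup>2" "(s / 3)\<^sup>2 \<le> 1" and sq: "3 * sqrt ((s / 3)\<^sup>2) = s"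
    using \<epsilon> by (auto simp: s_def power_le_one)
  obtain h' where "asymp_hom l k h'" using ex_inverse by blast
  then interpret inv: asymp_hom l k h' .
  show ?thesis using dimension[OF \<eta>, unfolded sq] inv.dimension[OF \<eta>, unfolded sq]
  proof eventually_elim
    case (elim n)
    have "s * real (k n) \<le> 1 / 2 * real (k n)" using s by (intro mult_right_mono) auto
    then have "real (k n) \<le> 2 * real (l n)" using elim(1) by linarith
    then have "s * real (k n) \<le> s * (2 * real (l n))" using s by (intro mult_left_mono) auto
    moreover have "0 \<le> s * real (l n)" using s by simp
    ultimately have "real (k n) - real (l n) \<le> 2 * (s * real (l n))" "real (l n) - real (k n) \<le> 2 * (s * real (l n))"
      using elim by linarith+
    then show ?case by (simp add: s_def)
  qed
qed

lemma ratio: "(\<lambda>n. real (k n) / real (l n)) \<longlonglongrightarrow> 1"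
  unfolding LIMSEQ_iff
proof (intro allI impI)
  fix e :: real assume e: "0 < e"
  have "0 < min (e / 2) 1" "min (e / 2) 1 \<le> 1" using e by auto
  from dimension_close[OF this] have "\<forall>\<^sub>F n in sequentially. norm (real (k n) / real (l n) - 1) < e"
  proof eventually_elim
    case (elim n)
    have ln: "0 < real (l n)" using lpos by simp
    have "norm (real (k n) / real (l n) - 1) = \<bar>real (k n) - real (l n)\<bar> / real (l n)"
    proof -
      have "real (k n) / real (l n) - 1 = (real (k n) - real (l n)) / real (l n)" using ln by (simp add: diff_divide_distrib)
      then show ?thesis by simp
    qed
    also have "\<dots> \<le> min (e / 2) 1" using elim by (simp only: pos_divide_le_eq[OF ln])
    also have "\<dots> < e" using e by auto
    finally show ?case .
  qed
  then show "\<exists>N. \<forall>n\<ge>N. norm (real (k n) / real (l n) - 1) < e" by (simp add: eventually_sequentially)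
qed

section \<open>The implementing unitaries\<close>

lemma unitary_close:
  assumes \<epsilon>: "0 < \<epsilon>"
  shows "\<forall>\<^sub>F n in sequentially. \<exists>w\<in>umat (l n). \<forall>u\<in>umat (k n). norm (h n u - w * u * adj w) / sqrt (l n) \<le> \<epsilon>"
proof -
  define e where "e = min \<epsilon> 1"
  have e: "0 < e" "e \<le> 1" "e \<le> \<epsilon>" using \<epsilon> by (auto simp: e_def)
  \<comment> \<open>The local model is taken with \<eta> = q^2, so that both sqrt \<eta> and the
    relative error in dimension are q. The denominator is generous: the terms under the first root
    sum up to at most 6200 q l.\<close>
  define q where "q = e\<^sup>2 / 200000"
  have e2: "e\<^sup>2 \<le> e" using e by (simp add: power2_eq_square mult_left_le)
  have q: "0 < q" "q \<le> 1" using e e2 by (auto simp: q_def)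
  have qq: "q\<^sup>2 \<le> q" using q by (simp add: power2_eq_square mult_left_le)
  have q2: "0 < q\<^sup>2" "q\<^sup>2 \<le> 1" "q\<^sup>2 \<le> e / 4" using q qq e e2 by (auto simp: q_def intro: order_trans)
  show ?thesis using local_model[OF q2(1,2)] dimension_close[OF q]
  proof eventually_elim
    case (elim n)
    define L where "L = sqrt (l n)"
    have L: "0 < L" "L\<^sup>2 = real (l n)" using lpos[of n] by (auto simp: L_def)
    define M where "M = e * L"
    have M: "0 \<le> M" using e L by (simp add: M_def)
    have M\<epsilon>: "M \<le> \<epsilon> * L" using e L unfolding M_def by (intro mult_right_mono) auto
    obtain hu where hu: "\<And>u. u \<in> umat (k n) \<Longrightarrow> hu u \<in> umat (l n)" "\<And>u. u \<in> umat (k n) \<Longrightarrow> norm (h n u - hu u) / L \<le> q\<^sup>2"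
      and sel: "\<And>u. u \<in> umat (k n) \<Longrightarrow> \<exists>X\<in>rect (l n) (k n). (norm X)\<^sup>2 = real (k n)
      \<and> (\<Sum>x\<in>gidx (k n). (norm (X * gd (k n) x - hu (gd (k n) x) * X))\<^sup>2) \<le> q\<^sup>2 * real (k n) * real (card (gidx (k n)))
      \<and> (norm (X * u - hu u * X))\<^sup>2 \<le> q\<^sup>2 * real (k n)"
      using elim(1) unfolding L_def by auto
    obtain w where w: "w \<in> umat (l n)" "\<And>u. u \<in> umat (k n) \<Longrightarrow> norm (hu u - w * u * adj w)
        \<le> sqrt (2600 * sqrt (q\<^sup>2) * real (k n) + 1000 * \<bar>real (k n) - real (l n)\<bar>) + 7 * sqrt \<bar>real (k n) - real (l n)\<bar>"
      using unitary_rigidity[OF kpos hu(1) q2(1,2) sel] by blast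
    have k2: "real (k n) \<le> 2 * real (l n)"
    proof -
      have "q * real (l n) \<le> 1 * real (l n)" using q by (intro mult_right_mono) auto
      then show ?thesis using elim(2) by linarith
    qed
    have d: "\<bar>real (k n) - real (l n)\<bar> \<le> q * L\<^sup>2" using elim(2) L by simp
    have "2600 * sqrt (q\<^sup>2) * real (k n) \<le> 2600 * q * (2 * L\<^sup>2)" using q k2 L by (simp add: mult_left_mono)
    then have "2600 * sqrt (q\<^sup>2) * real (k n) + 1000 * \<bar>real (k n) - real (l n)\<bar> \<le> 6200 * (q * L\<^sup>2)" using d by simp
    also have "\<dots> \<le> (M / 4)\<^sup>2" by (simp add: q_def M_def power_mult_distrib power_divide)
    finally have s1: "sqrt (2600 * sqrt (q\<^sup>2) * real (k n) + 1000 * \<bar>real (k n) - real (l n)\<bar>) \<le> M / 4"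
      using M by (intro real_le_lsqrt) auto
    have "\<bar>real (k n) - real (l n)\<bar> \<le> (M / 28)\<^sup>2"
      using d by (rule order_trans) (simp add: q_def M_def power_mult_distrib power_divide)
    then have s2: "sqrt \<bar>real (k n) - real (l n)\<bar> \<le> M / 28" using M by (intro real_le_lsqrt) auto
    have "norm (h n u - w * u * adj w) / sqrt (l n) \<le> \<epsilon>" if u: "u \<in> umat (k n)" for u
    proof -
      have "norm (h n u - hu u) \<le> q\<^sup>2 * L" using hu(2)[OF u] L by (simp add: pos_divide_le_eq)
      also have "\<dots> \<le> e / 4 * L" using q2(3) L by (intro mult_right_mono) auto
      finally have 1: "norm (h n u - hu u) \<le> M / 4" by (simp add: M_def)
      have "norm (h n u - w * u * adj w) \<le> norm (h n u - hu u) + norm (hu u - w * u * adj w)"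
        using norm_triangle_ineq[of "h n u - hu u" "hu u - w * u * adj w"] by simp
      also have "\<dots> \<le> M / 4 + (M / 4 + 7 * (M / 28))" using w(2)[OF u] s1 s2 1 by linarith
      also have "\<dots> \<le> \<epsilon> * L" using M M\<epsilon> by linarith
      finally show ?thesis using L by (simp add: pos_divide_le_eq flip: L_def)
    qed
    then show ?case using w(1) by blast
  qed
qed

text \<open>The estimate for unitaries is uniform in u and thus applies to every sequence of
  unitaries. Asymptotic linearity carries it to bounded sequences through
  \<open>average_two_unitaries\<close>.\<close>

theorem implemented_by_unitaries:
  "\<exists>w. (\<forall>n. w n \<in> umat (l n)) \<and> (\<forall>a. bseq k a \<longrightarrow> aeq l (\<lambda>n. h n (a n)) (\<lambda>n. w n * a n * adj (w n)))"
proof -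
  have "\<exists>w. (\<forall>n. w n \<in> umat (l n)) \<and> (\<forall>\<epsilon>>0. \<forall>\<^sub>F n in sequentially. \<forall>u\<in>umat (k n). norm (h n u - w n * u * adj (w n)) / sqrt (l n) \<le> \<epsilon>)"
    by (rule eventually_diagonal) (use unitary_close umat_unitm in \<open>auto intro: order_trans\<close>)
  then obtain w where w: "\<And>n. w n \<in> umat (l n)"
    "\<And>\<epsilon>. 0 < \<epsilon> \<Longrightarrow> \<forall>\<^sub>F n in sequentially. \<forall>u\<in>umat (k n). norm (h n u - w n * u * adj (w n)) / sqrt (l n) \<le> \<epsilon>" by blast
  have U: "aeq l (\<lambda>n. h n (u n)) (\<lambda>n. w n * u n * adj (w n))" if u: "\<And>n. u n \<in> umat (k n)" for u
    unfolding aeq_def LIMSEQ_iff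
  proof (intro allI impI)
    fix e :: real assume e: "0 < e"
    then obtain e' where e': "0 < e'" "e' < e" using dense by blast
    from w(2)[OF e'(1)] have "\<forall>\<^sub>F n in sequentially. norm (norm (h n (u n) - w n * u n * adj (w n)) / sqrt (l n) - 0) < e"
    proof eventually_elim
      case (elim n)
      then have "norm (h n (u n) - w n * u n * adj (w n)) / sqrt (l n) \<le> e'" using u by blast
      then show ?case using e' by simp
    qed
    then show "\<exists>N. \<forall>n\<ge>N. norm (norm (h n (u n) - w n * u n * adj (w n)) / sqrt (l n) - 0) < e" by (simp add: eventually_sequentially)
  qed
  have "aeq l (\<lambda>n. h n (a n)) (\<lambda>n. w n * a n * adj (w n))" if a: "bseq k a" for a
  proof -
    obtain C0 where C0: "0 \<le> C0" "\<And>n. a n \<in> ball_op (k n) C0" using bseqE[OF a] by blast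
    \<comment> \<open>The increment makes the bound positive, as
      \<open>average_two_unitaries\<close> requires.\<close>
    define C where "C = C0 + 1"
    have C: "0 < C" "\<And>n. a n \<in> ball_op (k n) C" using C0 ball_op_mono[OF C0(2), of C] by (auto simp: C_def)
    have "\<exists>u\<in>umat (k n). \<exists>v\<in>umat (k n). a n = cs (C / 2) (u + v)" for n
      using average_two_unitaries[of "a n" "k n" C] C by (simp add: ball_op_def scaleR_eq_cs)
    then obtain u v where uv: "\<And>n. u n \<in> umat (k n)" "\<And>n. v n \<in> umat (k n)" "\<And>n. a n = cs (C / 2) (u n + v n)" by metis
    have B: "bseq k u" "bseq k v" using uv by (auto intro: bseq_umat)
    have "aeq l (\<lambda>n. h n (a n)) (\<lambda>n. cs (C / 2) (w n * u n * adj (w n) + w n * v n * adj (w n)))"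
      unfolding uv(3)
      by (rule aeq_trans[OF hcs[OF bseq_add[OF B]] aeq_cs[OF aeq_trans[OF hadd[OF B] aeq_add[OF U[OF uv(1)] U[OF uv(2)]]]]])
    moreover have "cs (C / 2) (w n * u n * adj (w n) + w n * v n * adj (w n)) = w n * a n * adj (w n)" for n
      by (simp add: uv(3) algebra_simps)
    ultimately show ?thesis by simp
  qed
  then show ?thesis using w(1) by blast
qed

end

section \<open>Transfer to complex matrices\<close>

definition to_fm :: "complex mat \<Rightarrow> fmat" where
  "to_fm A = mk (dim_row A) (dim_col A) (\<lambda>i j. A $$ (i, j))"

text \<open>The size \<open>d\<close> is an argument because an element of \<open>fmat\<close> does
  not record one.\<close>

definition of_fm :: "nat \<Rightarrow> fmat \<Rightarrow> complex mat" where
  "of_fm d B = Matrix.mat d d (\<lambda>(i, j). ent B i j)"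

lemma ent_to_fm: "A \<in> carrier_mat d d \<Longrightarrow> ent (to_fm A) i j = (if i < d \<and> j < d then A $$ (i, j) else 0)"
  by (auto simp: to_fm_def)
lemma to_fm_sq: "A \<in> carrier_mat d d \<Longrightarrow> to_fm A \<in> sq d"
  unfolding to_fm_def by (metis carrier_matD mk_rect)
lemma of_fm_carrier [simp]: "of_fm d B \<in> carrier_mat d d" "dim_row (of_fm d B) = d" "dim_col (of_fm d B) = d"
  by (simp_all add: of_fm_def)
lemma of_to_fm: "A \<in> carrier_mat d d \<Longrightarrow> of_fm d (to_fm A) = A"
  by (intro eq_matI) (auto simp: of_fm_def ent_to_fm[of A d])
lemma to_of_fm: "B \<in> sq d \<Longrightarrow> to_fm (of_fm d B) = B"
  by (intro rect_eqI[of _ d d]) (auto simp: to_fm_sq ent_to_fm[of _ d] of_fm_def)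
lemma mat_adjoint_carrier: "A \<in> carrier_mat d d \<Longrightarrow> mat_adjoint A \<in> carrier_mat d d"
  unfolding mat_adjoint_def by auto
lemma index_mat_adjoint: "A \<in> carrier_mat d d \<Longrightarrow> i < d \<Longrightarrow> j < d \<Longrightarrow> mat_adjoint A $$ (i, j) = cnj (A $$ (j, i))"
  unfolding mat_adjoint_def by (simp add: mat_of_rows_index cols_length)

lemma to_fm_add: "A \<in> carrier_mat d d \<Longrightarrow> B \<in> carrier_mat d d \<Longrightarrow> to_fm (A + B) = to_fm A + to_fm B"
  by (intro rect_eqI[of _ d d]) (auto simp: to_fm_sq ent_to_fm[of _ d])
lemma to_fm_diff: "A \<in> carrier_mat d d \<Longrightarrow> B \<in> carrier_mat d d \<Longrightarrow> to_fm (A - B) = to_fm A - to_fm B"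
  by (intro rect_eqI[of _ d d]) (auto simp: to_fm_sq ent_to_fm[of _ d] minus_carrier_mat)
lemma to_fm_mult:
  assumes "A \<in> carrier_mat d d" "B \<in> carrier_mat d d" shows "to_fm (A * B) = to_fm A * to_fm B"
proof (rule rect_eqI[of _ d d])
  fix i j assume ij: "i < d" "j < d"
  have "ent (to_fm A * to_fm B) i j = (\<Sum>p<d. A $$ (i, p) * B $$ (p, j))"
    using ij assms by (simp add: ent_mult[of _ d d _ d] to_fm_sq ent_to_fm[of _ d])
  then show "ent (to_fm (A * B)) i j = ent (to_fm A * to_fm B) i j"
    using ij assms by (simp add: ent_to_fm[of _ d] scalar_prod_def lessThan_atLeast0)
qed (use assms in \<open>auto intro!: to_fm_sq\<close>)
lemma to_fm_smult: "A \<in> carrier_mat d d \<Longrightarrow> to_fm (c \<cdot>\<^sub>m A) = cs c (to_fm A)"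
  by (intro rect_eqI[of _ d d]) (auto simp: to_fm_sq ent_to_fm[of _ d])
lemma to_fm_adjoint: "A \<in> carrier_mat d d \<Longrightarrow> to_fm (mat_adjoint A) = adj (to_fm A)"
  by (intro rect_eqI[of _ d d]) (auto simp: to_fm_sq mat_adjoint_carrier ent_to_fm[of _ d] index_mat_adjoint)
lemma to_fm_one: "to_fm (1\<^sub>m d) = unitm d"
  by (intro rect_eqI[of _ d d]) (auto simp: to_fm_sq ent_to_fm[of _ d])
lemma to_fm_inj: "A \<in> carrier_mat d d \<Longrightarrow> B \<in> carrier_mat d d \<Longrightarrow> to_fm A = to_fm B \<Longrightarrow> A = B"
  by (metis of_to_fm)

lemma to_fm_pad_zero: "A \<in> carrier_mat d d \<Longrightarrow> to_fm (pad_zero A m) = to_fm A"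
  by (intro rect_eqI[of _ "d + m" "d + m"])
    (auto simp: pad_zero_def to_fm_sq ent_to_fm[of _ "d + m"] ent_to_fm[of A d] intro: rect_mono[OF to_fm_sq])
lemma pad_zero_carrier: "A \<in> carrier_mat d d \<Longrightarrow> pad_zero A m \<in> carrier_mat (d + m) (d + m)"
  unfolding pad_zero_def by auto

lemma hs_norm_to_fm:
  assumes A: "A \<in> carrier_mat d d" shows "hs_norm d A = norm (to_fm A) / sqrt d"
proof -
  have "Re (mat_trace (mat_adjoint A * A)) = Re (\<Sum>i<d. ent (adj (to_fm A) * to_fm A) i i)"
    using A mat_adjoint_carrier[OF A]
    by (simp add: mat_trace_def ent_to_fm[of _ d] flip: to_fm_adjoint to_fm_mult[of _ d])
  also have "(\<Sum>i<d. ent (adj (to_fm A) * to_fm A) i i) = cip (to_fm A) (to_fm A)"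
  proof -
    have "(\<Sum>i<d. ent (adj (to_fm A) * to_fm A) i i) = (\<Sum>i<d. \<Sum>j<d. cnj (ent (to_fm A) j i) * ent (to_fm A) j i)"
      using to_fm_sq[OF A] by (simp add: ent_mult[of _ d d _ d])
    also have "\<dots> = cip (to_fm A) (to_fm A)"
      using to_fm_sq[OF A] by (subst sum.swap) (simp add: cip_rect[of _ d d])
    finally show ?thesis .
  qed
  finally show ?thesis by (simp add: hs_norm_def cip_norm real_sqrt_divide del: of_real_power)
qed

definition col_fm :: "nat \<Rightarrow> complex Matrix.vec \<Rightarrow> fmat" where
  "col_fm d v = mk d 1 (\<lambda>i j. vec_index v i)"

lemma col_fm_rect: "col_fm d v \<in> rect d 1" by (simp add: col_fm_def)

lemma norm_col_fm:
  assumes "v \<in> carrier_vec d" shows "cvec_norm v = norm (col_fm d v)"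
proof -
  have nsq: "(norm (col_fm d v))\<^sup>2 = (\<Sum>i<d. (cmod (vec_index v i))\<^sup>2)"
    unfolding norm_sq_rect[OF col_fm_rect] by (simp add: col_fm_def)
  have "Re (v \<bullet>c v) = (norm (col_fm d v))\<^sup>2"
    using assms unfolding nsq by (simp add: scalar_prod_def lessThan_atLeast0 cmod_power2 sum.distrib flip: power2_eq_square)
  then show ?thesis by (simp add: cvec_norm_def)
qed

lemma to_fm_mult_col:
  assumes "A \<in> carrier_mat d d" "v \<in> carrier_vec d"
  shows "to_fm A * col_fm d v = col_fm d (A *\<^sub>v v)"
proof (rule rect_eqI[of _ d 1])
  fix i j :: nat assume "i < d" "j < 1"
  then show "ent (to_fm A * col_fm d v) i j = ent (col_fm d (A *\<^sub>v v)) i j"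
    using assms ent_mult[of "to_fm A" d d "col_fm d v" 1 i j] to_fm_sq[OF assms(1)]
    by (simp add: ent_to_fm[of _ d] col_fm_def scalar_prod_def lessThan_atLeast0 cong: sum.cong_simp)
qed (use assms col_fm_rect in \<open>auto intro!: rect_mult_left to_fm_sq simp del: One_nat_def\<close>)

lemma op_norm_le:
  assumes A: "A \<in> carrier_mat d d" and C: "opb C (to_fm A)"
  shows "v \<in> carrier_vec d \<Longrightarrow> cvec_norm v \<le> 1 \<Longrightarrow> cvec_norm (A *\<^sub>v v) \<le> C" and "op_norm A \<le> C"
proof -
  show 1: "cvec_norm (A *\<^sub>v v) \<le> C" if v: "v \<in> carrier_vec d" "cvec_norm v \<le> 1" for v
  proof -
    have "cvec_norm (A *\<^sub>v v) = norm (to_fm A * col_fm d v)"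
      using A v by (simp add: norm_col_fm[of _ d] to_fm_mult_col)
    also have "\<dots> \<le> C * norm (col_fm d v)" using C by (rule opb_left)
    also have "\<dots> \<le> C * 1" using v norm_col_fm[OF v(1)] opb_nonneg[OF C] by (intro mult_left_mono) auto
    finally show ?thesis by simp
  qed
  have "cvec_norm (0\<^sub>v d) \<le> 1" by (simp add: cvec_norm_def)
  then have "{v \<in> carrier_vec (dim_col A). cvec_norm v \<le> 1} \<noteq> {}" using A by (auto intro!: exI[of _ "0\<^sub>v d"])
  then show "op_norm A \<le> C" unfolding op_norm_def by (rule cSUP_least) (use A 1 in auto)
qed

text \<open>The supremum bounds the action on single columns; squares of column norms add up to the
  squared Frobenius norm.\<close>

lemma opb_op_norm:
  assumes A: "A \<in> carrier_mat d d"
  shows "opb (op_norm A) (to_fm A)"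
proof -
  let ?S = "{v \<in> carrier_vec (dim_col A). cvec_norm v \<le> 1}"
  \<comment> \<open>The Frobenius norm shows that the supremum is taken over a bounded set, as
    needed for upper bounds by a real supremum.\<close>
  have "opb (norm (to_fm A)) (to_fm A)" by (simp add: opb_def norm_mult_fmat)
  from op_norm_le(1)[OF A this] have "bdd_above ((\<lambda>v. cvec_norm (A *\<^sub>v v)) ` ?S)"
    using A by (intro bdd_aboveI[of _ "norm (to_fm A)"]) auto
  then have up: "cvec_norm (A *\<^sub>v v) \<le> op_norm A" if "v \<in> carrier_vec d" "cvec_norm v \<le> 1" for v
    unfolding op_norm_def by (intro cSUP_upper) (use A that in auto)
  have "cvec_norm (A *\<^sub>v 0\<^sub>v d) \<ge> 0" using A norm_col_fm[of "A *\<^sub>v 0\<^sub>v d" d] by auto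
  moreover have "cvec_norm (A *\<^sub>v 0\<^sub>v d) \<le> op_norm A" by (rule up) (simp_all add: cvec_norm_def)
  ultimately have nn: "0 \<le> op_norm A" by linarith
  have col: "norm (to_fm A * x) \<le> op_norm A * norm x" if x: "x \<in> rect d 1" for x
  proof (cases "x = 0")
    case False
    define y where "y = (1 / norm x) *\<^sub>R x"
    define v where "v = Matrix.vec d (\<lambda>i. ent y i 0)"
    have v: "v \<in> carrier_vec d" "col_fm d v = y"
      using x by (auto simp: v_def y_def col_fm_def intro!: rect_eqI[of _ d 1])
    have "norm (to_fm A * y) \<le> op_norm A"
      using up[OF v(1)] norm_col_fm[OF v(1)] norm_col_fm[of "A *\<^sub>v v" d] to_fm_mult_col[OF A v(1)] A v False
      by (simp add: y_def)
    then show ?thesis using False by (simp add: y_def field_simps)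
  qed simp
  have "norm (to_fm A * B) \<le> op_norm A * norm B" for B
  proof -
    obtain N where N: "B \<in> sq N" using rect_ex by blast
    \<comment> \<open>Only the first d rows of \<open>B\<close> meet \<open>A\<close>; after
      truncation the columns have length d.\<close>
    define B' where "B' = unitm d * B"
    have B': "B' \<in> rect d N" using unitm_left_rect[OF N] by (simp add: B'_def)
    have AB: "to_fm A * B = to_fm A * B'" using to_fm_sq[OF A] by (simp add: B'_def flip: mult.assoc)
    have AB': "to_fm A * B' \<in> rect d N" using to_fm_sq[OF A] B' by simp
    define c where "c X j = mk d 1 (\<lambda>i _. ent X i j)" for X j
    have c: "(norm X)\<^sup>2 = (\<Sum>j<N. (norm (c X j))\<^sup>2)" if "X \<in> rect d N" for X
      unfolding norm_sq_rect[OF that] c_def norm_sq_rect[OF mk_rect] by (subst sum.swap) simp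
    have "c (to_fm A * B') j = to_fm A * c B' j" for j
      using to_fm_sq[OF A] by (intro rect_eqI[of _ d 1]) (auto simp: c_def ent_mult[of _ d d])
    then have "(norm (to_fm A * B'))\<^sup>2 = (\<Sum>j<N. (norm (to_fm A * c B' j))\<^sup>2)" using c[OF AB'] by simp
    also have "\<dots> \<le> (\<Sum>j<N. (op_norm A * norm (c B' j))\<^sup>2)"
      by (intro sum_mono power_mono col) (auto simp: c_def)
    also have "\<dots> = (op_norm A * norm B')\<^sup>2" by (simp add: power_mult_distrib c[OF B'] sum_distrib_left)
    finally have "norm (to_fm A * B') \<le> op_norm A * norm B'" by (rule power2_le_imp_le) (simp add: nn)
    also have "\<dots> \<le> op_norm A * norm B"
      using opb_left[OF opb_unitm, of d B] nn by (intro mult_left_mono) (auto simp: B'_def)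
    finally show ?thesis by (simp add: AB)
  qed
  then show ?thesis using nn by (simp add: opb_def)
qed

section \<open>Bounded sequences and their classes\<close>

definition fs :: "(nat \<Rightarrow> complex mat) \<Rightarrow> nat \<Rightarrow> fmat" where "fs a n = to_fm (a n)"

lemma bdd_seqs_iff: "a \<in> bdd_seqs k \<longleftrightarrow> (\<forall>n. a n \<in> carrier_mat (k n) (k n)) \<and> bseq k (fs a)"
proof -
  have "(\<exists>C. \<forall>n. op_norm (a n) \<le> C) \<longleftrightarrow> bseq k (fs a)" if c: "\<And>n. a n \<in> carrier_mat (k n) (k n)"
  proof
    assume "\<exists>C. \<forall>n. op_norm (a n) \<le> C"
    then obtain C where C: "\<And>n. op_norm (a n) \<le> C" by blast
    have "fs a n \<in> ball_op (k n) C" for n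
      using C[of n] opb_mono[OF opb_op_norm[OF c]] to_fm_sq[OF c] by (simp add: ball_op_def fs_def)
    then show "bseq k (fs a)" by (rule bseqI)
  next
    assume "bseq k (fs a)"
    then obtain C where C: "\<And>n. fs a n \<in> ball_op (k n) C" using bseqE by blast
    have "op_norm (a n) \<le> C" for n using op_norm_le(2)[OF c[of n], of C] C[of n] by (simp add: ball_op_def fs_def)
    then show "\<exists>C. \<forall>n. op_norm (a n) \<le> C" by blast
  qed
  then show ?thesis by (auto simp: bdd_seqs_def)
qed

lemma bdd_seqsD: "a \<in> bdd_seqs k \<Longrightarrow> a n \<in> carrier_mat (k n) (k n)" "a \<in> bdd_seqs k \<Longrightarrow> bseq k (fs a)"
  by (auto simp: bdd_seqs_iff)

lemma bdd_seqs_of_fm: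
  assumes "bseq k x"
  shows "(\<lambda>n. of_fm (k n) (x n)) \<in> bdd_seqs k" "fs (\<lambda>n. of_fm (k n) (x n)) = x"
proof -
  show fs: "fs (\<lambda>n. of_fm (k n) (x n)) = x"
    using assms by (intro ext) (auto simp: fs_def bseq_def ball_op_def intro: to_of_fm)
  show "(\<lambda>n. of_fm (k n) (x n)) \<in> bdd_seqs k" using assms by (simp add: bdd_seqs_iff fs)
qed

lemma bdd_seqs_closed:
  assumes "a \<in> bdd_seqs k" "b \<in> bdd_seqs k"
  shows "(\<lambda>n. a n + b n) \<in> bdd_seqs k" "fs (\<lambda>n. a n + b n) = (\<lambda>n. fs a n + fs b n)"
    "(\<lambda>n. a n - b n) \<in> bdd_seqs k" "fs (\<lambda>n. a n - b n) = (\<lambda>n. fs a n - fs b n)"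
    "(\<lambda>n. a n * b n) \<in> bdd_seqs k" "fs (\<lambda>n. a n * b n) = (\<lambda>n. fs a n * fs b n)"
    "(\<lambda>n. c \<cdot>\<^sub>m a n) \<in> bdd_seqs k" "fs (\<lambda>n. c \<cdot>\<^sub>m a n) = (\<lambda>n. cs c (fs a n))"
    "(\<lambda>n. mat_adjoint (a n)) \<in> bdd_seqs k" "fs (\<lambda>n. mat_adjoint (a n)) = (\<lambda>n. adj (fs a n))"
proof -
  note D = bdd_seqsD(1)[OF assms(1)] bdd_seqsD(1)[OF assms(2)]
  show fs: "fs (\<lambda>n. a n + b n) = (\<lambda>n. fs a n + fs b n)" "fs (\<lambda>n. a n - b n) = (\<lambda>n. fs a n - fs b n)"
    "fs (\<lambda>n. a n * b n) = (\<lambda>n. fs a n * fs b n)" "fs (\<lambda>n. c \<cdot>\<^sub>m a n) = (\<lambda>n. cs c (fs a n))"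
    "fs (\<lambda>n. mat_adjoint (a n)) = (\<lambda>n. adj (fs a n))"
    by (intro ext; simp add: fs_def to_fm_add[OF D] to_fm_diff[OF D] to_fm_mult[OF D] to_fm_smult[OF D(1)] to_fm_adjoint[OF D(1)])+
  note B = bdd_seqsD(2)[OF assms(1)] bdd_seqsD(2)[OF assms(2)]
  show "(\<lambda>n. a n + b n) \<in> bdd_seqs k" "(\<lambda>n. a n - b n) \<in> bdd_seqs k" "(\<lambda>n. a n * b n) \<in> bdd_seqs k"
    "(\<lambda>n. c \<cdot>\<^sub>m a n) \<in> bdd_seqs k" "(\<lambda>n. mat_adjoint (a n)) \<in> bdd_seqs k"
    unfolding bdd_seqs_iff fs using D B
    by (auto intro: bseq_add bseq_diff bseq_mult bseq_cs bseq_adj mat_adjoint_carrier minus_carrier_mat mult_carrier_mat)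
qed

lemma bdd_seqs_one: "(\<lambda>n. 1\<^sub>m (k n)) \<in> bdd_seqs k" "fs (\<lambda>n. 1\<^sub>m (k n)) = (\<lambda>n. unitm (k n))"
proof -
  show fs: "fs (\<lambda>n. 1\<^sub>m (k n)) = (\<lambda>n. unitm (k n))" by (simp add: fs_def to_fm_one fun_eq_iff)
  show "(\<lambda>n. 1\<^sub>m (k n)) \<in> bdd_seqs k" unfolding bdd_seqs_iff fs by (simp add: bseq_unitm)
qed

lemma hs_null_iff: "a \<in> hs_null k \<longleftrightarrow> a \<in> bdd_seqs k \<and> aeq k (fs a) (\<lambda>_. 0)"
  by (auto simp: hs_null_def aeq_def fs_def hs_norm_to_fm[OF bdd_seqsD(1)])

lemma hs_class_eq_set:
  assumes a: "a \<in> bdd_seqs k"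
  shows "hs_class k a = {c \<in> bdd_seqs k. aeq k (fs c) (fs a)}"
proof -
  have "hs_class k a = {c. \<exists>z\<in>hs_null k. c = (\<lambda>n. z n + a n)}"
    by (auto simp: hs_class_def a_r_coset_def r_coset_def bdd_seq_algebra_def)
  also have "\<dots> = {c \<in> bdd_seqs k. aeq k (fs c) (fs a)}"
  proof (intro equalityI subsetI CollectI)
    fix c assume "c \<in> {c. \<exists>z\<in>hs_null k. c = (\<lambda>n. z n + a n)}"
    then obtain z where z: "z \<in> hs_null k" "c = (\<lambda>n. z n + a n)" by blast
    then have zb: "z \<in> bdd_seqs k" "aeq k (fs z) (\<lambda>_. 0)" by (auto simp: hs_null_iff)
    then show "c \<in> bdd_seqs k \<and> aeq k (fs c) (fs a)"
      using bdd_seqs_closed(1,2)[OF zb(1) a] z(2) by (simp add: aeq_def)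
  next
    fix c assume "c \<in> {c \<in> bdd_seqs k. aeq k (fs c) (fs a)}"
    then have c: "c \<in> bdd_seqs k" "aeq k (fs c) (fs a)" by auto
    have "(\<lambda>n. c n - a n) \<in> hs_null k" using bdd_seqs_closed(3,4)[OF c(1) a] c(2) by (simp add: hs_null_iff aeq_def)
    moreover have "c = (\<lambda>n. (c n - a n) + a n)"
    proof
      fix n
      have "c n - a n + a n = c n" using bdd_seqsD(1)[OF a, of n] bdd_seqsD(1)[OF c(1), of n] by (intro eq_matI) auto
      then show "c n = c n - a n + a n" by simp
    qed
    ultimately show "\<exists>z\<in>hs_null k. c = (\<lambda>n. z n + a n)"
      by (intro bexI[where x = "\<lambda>n. c n - a n"])
  qed
  finally show ?thesis .
qed

lemma hs_class_self: "a \<in> bdd_seqs k \<Longrightarrow> a \<in> hs_class k a"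
  by (simp add: hs_class_eq_set)

lemma hs_class_eq_iff:
  assumes "a \<in> bdd_seqs k" "b \<in> bdd_seqs k"
  shows "hs_class k a = hs_class k b \<longleftrightarrow> aeq k (fs a) (fs b)"
  using assms by (auto simp: hs_class_eq_set intro: aeq_sym aeq_trans)

lemma UN_const_eq: "a \<in> X \<Longrightarrow> (\<And>x. x \<in> X \<Longrightarrow> f x = Y) \<Longrightarrow> (\<Union>x\<in>X. f x) = Y" by auto

text \<open>In the unions over representatives all members coincide, as products, scalars and
  adjoints of bounded sequences respect \<open>aeq\<close>.\<close>

lemma M_HS_simps:
  assumes a: "a \<in> bdd_seqs k" and b: "b \<in> bdd_seqs k"
  shows "hs_class k a \<otimes>\<^bsub>M_HS k\<^esub> hs_class k b = hs_class k (\<lambda>n. a n * b n)"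
    and "hs_class k a \<oplus>\<^bsub>M_HS k\<^esub> hs_class k b = hs_class k (\<lambda>n. a n + b n)"
    and "c \<odot>\<^bsub>M_HS k\<^esub> hs_class k a = hs_class k (\<lambda>n. c \<cdot>\<^sub>m a n)"
    and "star (M_HS k) (hs_class k a) = hs_class k (\<lambda>n. mat_adjoint (a n))"
proof -
  have mem: "x \<in> bdd_seqs k \<and> aeq k (fs x) (fs y)" if "x \<in> hs_class k y" "y \<in> bdd_seqs k" for x y
    using that by (simp add: hs_class_eq_set)
  have "hs_class k (\<lambda>n. x n * y n) = hs_class k (\<lambda>n. a n * b n)" if "x \<in> hs_class k a" "y \<in> hs_class k b" for x y
  proof -
    note x = mem[OF that(1) a] and y = mem[OF that(2) b]
    show ?thesis using x y a b
      by (subst hs_class_eq_iff) (auto simp: bdd_seqs_closed(5,6)[of _ k] intro!: aeq_mult bdd_seqsD)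
  qed
  then have "(\<Union>x\<in>hs_class k a. \<Union>y\<in>hs_class k b. hs_class k (\<lambda>n. x n * y n)) = hs_class k (\<lambda>n. a n * b n)"
    by (intro UN_const_eq[OF hs_class_self[OF a]] UN_const_eq[OF hs_class_self[OF b]])
  then show "hs_class k a \<otimes>\<^bsub>M_HS k\<^esub> hs_class k b = hs_class k (\<lambda>n. a n * b n)"
    by (simp add: M_HS_def quot_star_algebra_def FactRing_def rcoset_mult_def hs_class_def bdd_seq_algebra_def)
  have "hs_class k (\<lambda>n. c \<cdot>\<^sub>m x n) = hs_class k (\<lambda>n. c \<cdot>\<^sub>m a n)" if "x \<in> hs_class k a" for x
    using mem[OF that a] a by (subst hs_class_eq_iff) (auto simp: bdd_seqs_closed(7,8)[of _ k] intro!: aeq_cs)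
  then have "(\<Union>x\<in>hs_class k a. hs_class k (\<lambda>n. c \<cdot>\<^sub>m x n)) = hs_class k (\<lambda>n. c \<cdot>\<^sub>m a n)"
    by (intro UN_const_eq[OF hs_class_self[OF a]])
  then show "c \<odot>\<^bsub>M_HS k\<^esub> hs_class k a = hs_class k (\<lambda>n. c \<cdot>\<^sub>m a n)"
    by (simp add: M_HS_def quot_star_algebra_def hs_class_def bdd_seq_algebra_def)
  have "hs_class k (\<lambda>n. mat_adjoint (x n)) = hs_class k (\<lambda>n. mat_adjoint (a n))" if "x \<in> hs_class k a" for x
    using mem[OF that a] a by (subst hs_class_eq_iff) (auto simp: bdd_seqs_closed(9,10)[of _ k] intro!: aeq_adj)
  then have "(\<Union>x\<in>hs_class k a. hs_class k (\<lambda>n. mat_adjoint (x n))) = hs_class k (\<lambda>n. mat_adjoint (a n))"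
    by (intro UN_const_eq[OF hs_class_self[OF a]])
  then show "star (M_HS k) (hs_class k a) = hs_class k (\<lambda>n. mat_adjoint (a n))"
    by (simp add: M_HS_def quot_star_algebra_def hs_class_def bdd_seq_algebra_def)
  \<comment> \<open>Addition of cosets is elementwise and not a union of cosets, so both inclusions
    are proved; an element z of the sum is split as (z - b) + b.\<close>
  have "(\<Union>x\<in>hs_class k a. \<Union>y\<in>hs_class k b. {\<lambda>n. x n + y n}) = hs_class k (\<lambda>n. a n + b n)"
  proof (intro equalityI subsetI)
    fix z assume "z \<in> (\<Union>x\<in>hs_class k a. \<Union>y\<in>hs_class k b. {\<lambda>n. x n + y n})"
    then obtain x y where xy: "x \<in> hs_class k a" "y \<in> hs_class k b" "z = (\<lambda>n. x n + y n)" by blast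
    show "z \<in> hs_class k (\<lambda>n. a n + b n)"
      using mem[OF xy(1) a] mem[OF xy(2) b] a b xy(3)
      by (auto simp: hs_class_eq_set bdd_seqs_closed(1,2)[of _ k] intro!: aeq_add)
  next
    fix z assume "z \<in> hs_class k (\<lambda>n. a n + b n)"
    then have z: "z \<in> bdd_seqs k" "aeq k (fs z) (\<lambda>n. fs a n + fs b n)"
      using mem[OF _ bdd_seqs_closed(1)[OF a b]] unfolding bdd_seqs_closed(2)[OF a b] by blast+
    have m: "(\<lambda>n. z n - b n) \<in> hs_class k a"
      using z(2) bdd_seqs_closed(3,4)[OF z(1) b] a by (simp add: hs_class_eq_set aeq_def algebra_simps)
    have zz: "z = (\<lambda>n. (z n - b n) + b n)"
    proof
      fix n
      have "z n - b n + b n = z n" using bdd_seqsD(1)[OF b, of n] bdd_seqsD(1)[OF z(1), of n] by (intro eq_matI) auto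
      then show "z n = z n - b n + b n" by simp
    qed
    have "z \<in> (\<Union>y\<in>hs_class k b. {\<lambda>n. (z n - b n) + y n})"
      by (rule UN_I[OF hs_class_self[OF b]], rule iffD2[OF singleton_iff zz])
    then show "z \<in> (\<Union>x\<in>hs_class k a. \<Union>y\<in>hs_class k b. {\<lambda>n. x n + y n})"
      by (rule UN_I[OF m])
  qed
  then show "hs_class k a \<oplus>\<^bsub>M_HS k\<^esub> hs_class k b = hs_class k (\<lambda>n. a n + b n)"
    by (simp add: M_HS_def quot_star_algebra_def FactRing_def set_add_def set_mult_def bdd_seq_algebra_def)
qed

lemma M_HS_one: "\<one>\<^bsub>M_HS k\<^esub> = hs_class k (\<lambda>n. 1\<^sub>m (k n))"
  by (simp add: M_HS_def quot_star_algebra_def FactRing_def hs_class_def bdd_seq_algebra_def)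

lemma M_HS_carrier: "carrier (M_HS k) = hs_class k ` bdd_seqs k"
  by (auto simp: M_HS_def quot_star_algebra_def FactRing_def A_RCOSETS_def RCOSETS_def hs_class_def a_r_coset_def bdd_seq_algebra_def)

lemma aeq_change:
  assumes "aeq d x y" and ev: "\<forall>\<^sub>F n in sequentially. real (d n) \<le> 4 * real (e n)" and pos: "\<And>n. 0 < d n" "\<And>n. 0 < e n"
  shows "aeq e x y"
  unfolding aeq_def
proof (rule Lim_null_comparison)
  show "(\<lambda>n. 2 * (norm (x n - y n) / sqrt (d n))) \<longlonglongrightarrow> 0"
    using tendsto_mult_left[OF assms(1)[unfolded aeq_def], of 2] by simp
  show "\<forall>\<^sub>F n in sequentially. norm (norm (x n - y n) / sqrt (e n)) \<le> 2 * (norm (x n - y n) / sqrt (d n))"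
    using ev
  proof eventually_elim
    case (elim n)
    have "sqrt (d n) \<le> sqrt (4 * real (e n))" using elim by (rule real_sqrt_le_mono)
    then have "sqrt (d n) \<le> 2 * sqrt (e n)" by (simp add: real_sqrt_mult)
    then have "1 / sqrt (e n) \<le> 2 / sqrt (d n)" using pos[of n] by (simp add: field_simps)
    from mult_left_mono[OF this, of "norm (x n - y n)"] show ?case by (simp add: mult.commute)
  qed
qed

text \<open>Equality of classes is \<open>aeq\<close> of representatives, so each law of \<phi> on
  classes is a law of the component maps, and surjectivity of \<phi> becomes
  \<open>surj\<close>.\<close>

lemma product_form_asymp_iso:
  assumes kpos: "\<And>n. k n > 0" and lpos: "\<And>n. l n > 0" and iso: "\<phi> \<in> unital_star_iso (M_HS k) (M_HS l)"
    and maps: "\<And>n A. A \<in> carrier_mat (k n) (k n) \<Longrightarrow> h n A \<in> carrier_mat (l n) (l n)"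
    and bdd: "\<And>a. a \<in> bdd_seqs k \<Longrightarrow> (\<lambda>n. h n (a n)) \<in> bdd_seqs l"
    and \<phi>: "\<And>a. a \<in> bdd_seqs k \<Longrightarrow> \<phi> (hs_class k a) = hs_class l (\<lambda>n. h n (a n))"
  shows "asymp_iso k l (\<lambda>n x. to_fm (h n (of_fm (k n) x)))"
proof -
  let ?H = "\<lambda>n x. to_fm (h n (of_fm (k n) x))"
  have hom: "\<phi> (x \<otimes>\<^bsub>M_HS k\<^esub> y) = \<phi> x \<otimes>\<^bsub>M_HS l\<^esub> \<phi> y" "\<phi> (x \<oplus>\<^bsub>M_HS k\<^esub> y) = \<phi> x \<oplus>\<^bsub>M_HS l\<^esub> \<phi> y"
    "\<phi> (c \<odot>\<^bsub>M_HS k\<^esub> x) = c \<odot>\<^bsub>M_HS l\<^esub> \<phi> x" "\<phi> (star (M_HS k) x) = star (M_HS l) (\<phi> x)"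
    if "x \<in> hs_class k ` bdd_seqs k" "y \<in> hs_class k ` bdd_seqs k" for x y c
    using iso that unfolding unital_star_iso_def ring_iso_def Ring.ring_hom_def M_HS_carrier by auto
  have one: "\<phi> \<one>\<^bsub>M_HS k\<^esub> = \<one>\<^bsub>M_HS l\<^esub>" and onto: "\<phi> ` (hs_class k ` bdd_seqs k) = hs_class l ` bdd_seqs l"
    using iso unfolding unital_star_iso_def ring_iso_def Ring.ring_hom_def M_HS_carrier bij_betw_def by auto
  have H: "fs (\<lambda>n. h n (a n)) n = ?H n (fs a n)" if "a \<in> bdd_seqs k" for a n
    using of_to_fm[OF bdd_seqsD(1)[OF that]] by (simp add: fs_def)
  have lift: "\<exists>a\<in>bdd_seqs k. fs a = x" if "bseq k x" for x using bdd_seqs_of_fm[OF that] by blast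
  have eqI: "aeq l (fs a) (fs b)" if "hs_class l a = hs_class l b" "a \<in> bdd_seqs l" "b \<in> bdd_seqs l" for a b
    using that hs_class_eq_iff by blast
  show ?thesis
  proof
    show "to_fm (h n (of_fm (k n) x)) \<in> sq (l n)" for n x by (intro to_fm_sq maps of_fm_carrier)
    fix x assume "bseq k x"
    then obtain a where a: "a \<in> bdd_seqs k" and x: "x = fs a" using lift by blast
    show "bseq l (\<lambda>n. ?H n (x n))" using bdd_seqsD(2)[OF bdd[OF a]] by (simp add: x H[OF a] bseq_def)
    show "aeq l (\<lambda>n. ?H n (adj (x n))) (\<lambda>n. adj (?H n (x n)))"
    proof -
      have "hs_class l (\<lambda>n. h n (mat_adjoint (a n))) = hs_class l (\<lambda>n. mat_adjoint (h n (a n)))"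
        using hom(4)[of "hs_class k a" "hs_class k a"] a by (simp add: M_HS_simps(4)[OF a a] \<phi> bdd_seqs_closed(9)[OF a a] M_HS_simps(4)[OF bdd[OF a] bdd[OF a]])
      from eqI[OF this bdd[OF bdd_seqs_closed(9)[OF a a]] bdd_seqs_closed(9)[OF bdd[OF a] bdd[OF a]]]
      show ?thesis unfolding H[OF bdd_seqs_closed(9)[OF a a], abs_def] bdd_seqs_closed(10)[OF bdd[OF a] bdd[OF a]]
        by (simp add: x H[OF a] H[OF bdd_seqs_closed(9)[OF a a]] bdd_seqs_closed(10)[OF a a] aeq_def)
    qed
    show "aeq l (\<lambda>n. ?H n (cs c (x n))) (\<lambda>n. cs c (?H n (x n)))" for c
    proof -
      have "hs_class l (\<lambda>n. h n (c \<cdot>\<^sub>m a n)) = hs_class l (\<lambda>n. c \<cdot>\<^sub>m h n (a n))"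
        using hom(3)[of "hs_class k a" "hs_class k a" c] a by (simp add: M_HS_simps(3)[OF a a] \<phi> bdd_seqs_closed(7)[OF a a] M_HS_simps(3)[OF bdd[OF a] bdd[OF a]])
      from eqI[OF this bdd[OF bdd_seqs_closed(7)[OF a a]] bdd_seqs_closed(7)[OF bdd[OF a] bdd[OF a]]]
      show ?thesis unfolding bdd_seqs_closed(8)[OF bdd[OF a] bdd[OF a]]
        by (simp add: x H[OF a] H[OF bdd_seqs_closed(7)[OF a a]] bdd_seqs_closed(8)[OF a a] aeq_def)
    qed
    fix y assume "bseq k y"
    then obtain b where b: "b \<in> bdd_seqs k" and y: "y = fs b" using lift by blast
    show "aeq l (\<lambda>n. ?H n (x n + y n)) (\<lambda>n. ?H n (x n) + ?H n (y n))"
    proof -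
      have "hs_class l (\<lambda>n. h n (a n + b n)) = hs_class l (\<lambda>n. h n (a n) + h n (b n))"
        using hom(2)[of "hs_class k a" "hs_class k b"] a b by (simp add: M_HS_simps(2)[OF a b] \<phi> bdd_seqs_closed(1)[OF a b] M_HS_simps(2)[OF bdd[OF a] bdd[OF b]])
      from eqI[OF this bdd[OF bdd_seqs_closed(1)[OF a b]] bdd_seqs_closed(1)[OF bdd[OF a] bdd[OF b]]]
      show ?thesis unfolding bdd_seqs_closed(2)[OF bdd[OF a] bdd[OF b]]
        by (simp add: x y H[OF a] H[OF b] H[OF bdd_seqs_closed(1)[OF a b]] bdd_seqs_closed(2)[OF a b] aeq_def)
    qed
    show "aeq l (\<lambda>n. ?H n (x n * y n)) (\<lambda>n. ?H n (x n) * ?H n (y n))"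
    proof -
      have "hs_class l (\<lambda>n. h n (a n * b n)) = hs_class l (\<lambda>n. h n (a n) * h n (b n))"
        using hom(1)[of "hs_class k a" "hs_class k b"] a b by (simp add: M_HS_simps(1)[OF a b] \<phi> bdd_seqs_closed(5)[OF a b] M_HS_simps(1)[OF bdd[OF a] bdd[OF b]])
      from eqI[OF this bdd[OF bdd_seqs_closed(5)[OF a b]] bdd_seqs_closed(5)[OF bdd[OF a] bdd[OF b]]]
      show ?thesis unfolding bdd_seqs_closed(6)[OF bdd[OF a] bdd[OF b]]
        by (simp add: x y H[OF a] H[OF b] H[OF bdd_seqs_closed(5)[OF a b]] bdd_seqs_closed(6)[OF a b] aeq_def)
    qed
    show "aeq l (\<lambda>n. ?H n (x n)) (\<lambda>n. ?H n (y n))" if "aeq k x y"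
    proof -
      have "hs_class k a = hs_class k b" using that hs_class_eq_iff[OF a b] by (simp add: x y)
      then have "hs_class l (\<lambda>n. h n (a n)) = hs_class l (\<lambda>n. h n (b n))" using \<phi>[OF a] \<phi>[OF b] by simp
      from eqI[OF this bdd[OF a] bdd[OF b]] show ?thesis by (simp add: x y H[OF a] H[OF b] aeq_def)
    qed
  next
    have "hs_class l (\<lambda>n. h n (1\<^sub>m (k n))) = hs_class l (\<lambda>n. 1\<^sub>m (l n))"
      using one \<phi>[OF bdd_seqs_one(1)] by (simp add: M_HS_one)
    from eqI[OF this bdd[OF bdd_seqs_one(1)] bdd_seqs_one(1)]
    show "aeq l (\<lambda>n. ?H n (unitm (k n))) (\<lambda>n. unitm (l n))"
      by (simp add: H[OF bdd_seqs_one(1)] bdd_seqs_one(2) aeq_def)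
  next
    fix y assume "bseq l y"
    from bdd_seqs_of_fm[OF this] obtain b where b: "b \<in> bdd_seqs l" "fs b = y" by blast
    then have "hs_class l b \<in> \<phi> ` (hs_class k ` bdd_seqs k)" using onto by blast
    then obtain a where a: "a \<in> bdd_seqs k" "\<phi> (hs_class k a) = hs_class l b" by auto
    then have "hs_class l (\<lambda>n. h n (a n)) = hs_class l b" using \<phi> by simp
    from eqI[OF this bdd[OF a(1)] b(1)] show "\<exists>x. bseq k x \<and> aeq l (\<lambda>n. ?H n (x n)) y"
      using bdd_seqsD(2)[OF a(1)] b(2) by (intro exI[of _ "fs a"]) (simp add: H[OF a(1)] aeq_def)
  qed (rule kpos lpos)+
qed

text \<open>Truncation from size k to size l affects at most |k - l| rows and columns. With operator
  bound C each side costs C sqrt |k - l|, which is negligible against sqrt l.\<close>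

lemma aeq_truncate:
  assumes a: "bseq k a" and lpos: "\<And>n. l n > 0" and ratio: "(\<lambda>n. real (k n) / real (l n)) \<longlonglongrightarrow> 1"
  shows "aeq l a (\<lambda>n. unitm (l n) * a n * unitm (l n))"
proof -
  obtain C where C: "0 \<le> C" "\<And>n. a n \<in> ball_op (k n) C" using bseqE[OF a] by blast
  show ?thesis
    unfolding aeq_def
  proof (rule Lim_null_comparison)
    have "(\<lambda>n. 2 * C * sqrt \<bar>real (k n) / real (l n) - 1\<bar>) \<longlonglongrightarrow> 2 * C * sqrt \<bar>1 - 1\<bar>"
      by (intro tendsto_intros ratio)
    then show "(\<lambda>n. 2 * C * sqrt \<bar>real (k n) / real (l n) - 1\<bar>) \<longlonglongrightarrow> 0" by simp
    show "\<forall>\<^sub>F n in sequentially. norm (norm (a n - unitm (l n) * a n * unitm (l n)) / sqrt (l n)) \<le> 2 * C * sqrt \<bar>real (k n) / real (l n) - 1\<bar>"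
    proof (intro always_eventually allI)
      fix n
      define D where "D = unitm (k n) - unitm (l n)"
      have A: "a n \<in> sq (k n)" "opb C (a n)" using ball_opD[OF C(2)] by auto
      have D: "norm D = sqrt \<bar>real (k n) - real (l n)\<bar>"
      proof (rule real_sqrt_unique[symmetric])
        show "(norm D)\<^sup>2 = \<bar>real (k n) - real (l n)\<bar>"
          using unitm_diff_norm[of "k n" "l n"] unitm_diff_norm[of "l n" "k n"]
          by (cases "k n \<le> l n") (simp_all add: D_def norm_minus_commute)
      qed simp
      have "a n - unitm (l n) * a n * unitm (l n) = D * a n + unitm (l n) * (a n * D)"
        using A(1) by (simp add: D_def left_diff_distrib right_diff_distrib mult.assoc)
      also have "norm \<dots> \<le> C * norm D + 1 * (C * norm D)"
        by (intro norm_triangle_le add_mono opb_right A order_trans[OF opb_left[OF opb_unitm]] mult_left_mono) (simp_all add: opb_left A)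
      finally show "norm (norm (a n - unitm (l n) * a n * unitm (l n)) / sqrt (l n)) \<le> 2 * C * sqrt \<bar>real (k n) / real (l n) - 1\<bar>"
      proof -
        assume *: "norm (a n - unitm (l n) * a n * unitm (l n)) \<le> C * norm D + 1 * (C * norm D)"
        have "\<bar>real (k n) / real (l n) - 1\<bar> = \<bar>real (k n) - real (l n)\<bar> / real (l n)"
        proof -
          have "real (k n) / real (l n) - 1 = (real (k n) - real (l n)) / real (l n)" using lpos[of n] by (simp add: diff_divide_distrib)
          then show ?thesis by simp
        qed
        then have "2 * C * sqrt \<bar>real (k n) / real (l n) - 1\<bar> = (C * norm D + 1 * (C * norm D)) / sqrt (l n)"
          by (simp add: D real_sqrt_divide)
        then show ?thesis using divide_right_mono[OF *, of "sqrt (l n)"] by simp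
      qed
    qed
  qed
qed

text \<open>Padding by zeros is invisible in \<open>fmat\<close>, and normalizing by max(k, l) or by
  l makes no difference for null sequences when the ratio tends to 1.\<close>

lemma updown_rel_iff:
  assumes kpos: "\<And>n. k n > 0" and lpos: "\<And>n. l n > 0" and ratio: "(\<lambda>n. real (k n) / real (l n)) \<longlonglongrightarrow> 1"
    and a: "a \<in> bdd_seqs k" and b: "b \<in> bdd_seqs l"
  shows "(\<lambda>n. hs_norm (max (k n) (l n)) (pad_zero (a n) (max (k n) (l n) - k n) - pad_zero (b n) (max (k n) (l n) - l n))) \<longlonglongrightarrow> 0
    \<longleftrightarrow> aeq l (fs a) (fs b)"
proof -
  let ?m = "\<lambda>n. max (k n) (l n)"
  have "hs_norm (?m n) (pad_zero (a n) (?m n - k n) - pad_zero (b n) (?m n - l n)) = norm (fs a n - fs b n) / sqrt (?m n)" for n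
  proof -
    note A = bdd_seqsD(1)[OF a, of n] and B = bdd_seqsD(1)[OF b, of n]
    have P: "pad_zero (a n) (?m n - k n) \<in> carrier_mat (?m n) (?m n)" "pad_zero (b n) (?m n - l n) \<in> carrier_mat (?m n) (?m n)"
      using pad_zero_carrier[OF A, of "?m n - k n"] pad_zero_carrier[OF B, of "?m n - l n"] by simp_all
    show ?thesis
      unfolding hs_norm_to_fm[OF minus_carrier_mat[OF P(2)]] to_fm_diff[OF P] to_fm_pad_zero[OF A] to_fm_pad_zero[OF B]
      by (simp add: fs_def)
  qed
  then have 1: "?thesis \<longleftrightarrow> (aeq ?m (fs a) (fs b) \<longleftrightarrow> aeq l (fs a) (fs b))" by (simp add: aeq_def)
  have ev: "\<forall>\<^sub>F n in sequentially. real (?m n) \<le> 4 * real (l n)"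
  proof -
    have "\<forall>\<^sub>F n in sequentially. real (k n) / real (l n) < 4" using ratio by (rule order_tendstoD) simp
    then show ?thesis
    proof eventually_elim
      case (elim n)
      then show ?case using lpos[of n] by (simp add: field_simps max_def)
    qed
  qed
  have mpos: "0 < ?m n" for n using kpos[of n] by (simp add: less_max_iff_disj)
  show ?thesis unfolding 1
    using aeq_change[OF _ ev mpos lpos] aeq_change[of l "fs a" "fs b" ?m, OF _ always_eventually lpos mpos] by fastforce
qed

text \<open>To use the definite description, existence is shown by truncating the representative to
  size l, and uniqueness by transitivity of \<open>aeq\<close>.\<close>

lemma updownD:
  assumes kpos: "\<And>n. k n > 0" and lpos: "\<And>n. l n > 0" and ratio: "(\<lambda>n. real (k n) / real (l n)) \<longlonglongrightarrow> 1"
    and a: "a \<in> bdd_seqs k" and b: "b \<in> bdd_seqs l" and eq: "hs_class l b = updown k l (hs_class k a)"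
  shows "aeq l (fs a) (fs b)"
proof -
  have ev: "\<forall>\<^sub>F n in sequentially. real (k n) \<le> 4 * real (l n)"
  proof -
    have "\<forall>\<^sub>F n in sequentially. real (k n) / real (l n) < 4" using ratio by (rule order_tendstoD) simp
    then show ?thesis
    proof eventually_elim
      case (elim n)
      then show ?case using lpos[of n] by (simp add: field_simps)
    qed
  qed
  define P where "P Y \<longleftrightarrow> (\<exists>a'\<in>bdd_seqs k. \<exists>b\<in>bdd_seqs l. hs_class k a = hs_class k a' \<and> Y = hs_class l b \<and>
     (\<lambda>n. hs_norm (max (k n) (l n)) (pad_zero (a' n) (max (k n) (l n) - k n) - pad_zero (b n) (max (k n) (l n) - l n))) \<longlonglongrightarrow> 0)" for Y
  have P: "P Y \<longleftrightarrow> (\<exists>b\<in>bdd_seqs l. Y = hs_class l b \<and> aeq l (fs a) (fs b))" for Y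
  proof
    assume "P Y"
    then obtain a' b' where *: "a' \<in> bdd_seqs k" "b' \<in> bdd_seqs l" "hs_class k a = hs_class k a'" "Y = hs_class l b'" "aeq l (fs a') (fs b')"
      using updown_rel_iff[OF kpos lpos ratio] unfolding P_def by blast
    then have "aeq k (fs a) (fs a')" using hs_class_eq_iff[OF a *(1)] by blast
    from aeq_change[OF this ev kpos lpos] show "\<exists>b\<in>bdd_seqs l. Y = hs_class l b \<and> aeq l (fs a) (fs b)" using * aeq_trans by blast
  next
    assume "\<exists>b\<in>bdd_seqs l. Y = hs_class l b \<and> aeq l (fs a) (fs b)"
    then show "P Y" using updown_rel_iff[OF kpos lpos ratio a] a unfolding P_def by blast
  qed
  define x where "x n = unitm (l n) * fs a n * unitm (l n)" for n
  have "x n \<in> ball_op (l n) C" if "fs a n \<in> ball_op (k n) C" for n C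
  proof -
    have "fs a n * unitm (l n) \<in> rect (k n) (l n)" using ball_opD(1)[OF that] by (rule unitm_right_rect)
    then have "unitm (l n) * (fs a n * unitm (l n)) \<in> sq (l n)" by (rule unitm_left_rect)
    moreover have "opb (1 * C * 1) (unitm (l n) * fs a n * unitm (l n))" by (intro opb_mult opb_unitm ball_opD(2)[OF that])
    ultimately show ?thesis by (simp add: ball_op_def x_def mult.assoc)
  qed
  then have x: "bseq l x" using bdd_seqsD(2)[OF a] unfolding bseq_def by blast
  have "aeq l (fs a) x" unfolding x_def by (rule aeq_truncate[OF bdd_seqsD(2)[OF a] lpos ratio])
  then obtain b0 where b0: "b0 \<in> bdd_seqs l" "aeq l (fs a) (fs b0)" using bdd_seqs_of_fm[OF x] by metis
  have "P (THE Y. P Y)"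
  proof (rule theI)
    show "P (hs_class l b0)" using b0 P by blast
    show "Y = hs_class l b0" if Y: "P Y" for Y
    proof -
      obtain b' where b': "b' \<in> bdd_seqs l" "Y = hs_class l b'" "aeq l (fs a) (fs b')" using Y P by blast
      then show ?thesis using hs_class_eq_iff[OF b'(1) b0(1)] aeq_trans[OF aeq_sym[OF b'(3)] b0(2)] by simp
    qed
  qed
  moreover have "updown k l (hs_class k a) = (THE Y. P Y)" unfolding updown_def P_def ..
  ultimately have "P (hs_class l b)" using eq by simp
  then obtain b' where b': "b' \<in> bdd_seqs l" "hs_class l b = hs_class l b'" "aeq l (fs a) (fs b')" using P by blast
  then show ?thesis using hs_class_eq_iff[OF b b'(1)] aeq_trans aeq_sym by blast
qed

theorem proposition5p2:
  fixes k l :: "nat \<Rightarrow> nat"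
    and \<phi> :: "(nat \<Rightarrow> complex mat) set \<Rightarrow> (nat \<Rightarrow> complex mat) set"
  assumes "\<And>n. k n > 0" and "\<And>n. l n > 0"
    and "filterlim k at_top sequentially" and "filterlim l at_top sequentially"
    and "\<phi> \<in> unital_star_iso (M_HS k) (M_HS l)"
    and "product_form k l \<phi>"
  shows "(\<lambda>n. real (k n) / real (l n)) \<longlonglongrightarrow> 1 \<and>
    (\<exists>w. (\<forall>n. w n \<in> unitary_mats (l n)) \<and>
      (\<forall>a\<in>bdd_seqs k. \<forall>b\<in>bdd_seqs l.
        hs_class l b = updown k l (hs_class k a) \<longrightarrow>
        \<phi> (hs_class k a) = hs_class l (\<lambda>n. mat_adjoint (w n) * b n * w n)))"
proof -
  obtain h where maps: "\<And>n. h n \<in> carrier_mat (k n) (k n) \<rightarrow> carrier_mat (l n) (l n)"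
    and h: "\<And>a. a \<in> bdd_seqs k \<Longrightarrow> (\<lambda>n. h n (a n)) \<in> bdd_seqs l \<and> \<phi> (hs_class k a) = hs_class l (\<lambda>n. h n (a n))"
    using assms(6) unfolding product_form_def by blast
  interpret asymp_iso k l "\<lambda>n x. to_fm (h n (of_fm (k n) x))"
    by (rule product_form_asymp_iso[OF assms(1,2,5)]) (use maps h in auto)
  obtain w where w: "\<And>n. w n \<in> umat (l n)"
    "\<And>a. bseq k a \<Longrightarrow> aeq l (\<lambda>n. to_fm (h n (of_fm (k n) (a n)))) (\<lambda>n. w n * a n * adj (w n))"
    using implemented_by_unitaries by blast
  \<comment> \<open>The adjoint, since the claim conjugates as w* b w, whereas
    \<open>implemented_by_unitaries\<close> provides w a w*.\<close>
  define W where "W n = of_fm (l n) (adj (w n))" for n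
  have Wf: "to_fm (W n) = adj (w n)" "W n \<in> carrier_mat (l n) (l n)" for n
    using umat_rect[OF umat_adj[OF w(1)]] by (auto simp: W_def intro: to_of_fm)
  have Wa: "mat_adjoint (W n) \<in> carrier_mat (l n) (l n)" "to_fm (mat_adjoint (W n)) = w n" for n
    using Wf[of n] by (auto simp: to_fm_adjoint intro: mat_adjoint_carrier)
  have "W n \<in> unitary_mats (l n)" for n
    using Wf[of n] Wa[of n] w(1)[of n] unfolding unitary_mats_def
    by (auto intro!: to_fm_inj[of _ "l n"] simp: to_fm_mult[of _ "l n"] to_fm_one umat_def)
  moreover have "\<phi> (hs_class k a) = hs_class l (\<lambda>n. mat_adjoint (W n) * b n * W n)"
    if a: "a \<in> bdd_seqs k" and b: "b \<in> bdd_seqs l" and eq: "hs_class l b = updown k l (hs_class k a)" for a b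
  proof -
    have ab: "aeq l (fs a) (fs b)" by (rule updownD[OF assms(1,2) ratio a b eq])
    have C: "(\<lambda>n. mat_adjoint (W n) * b n * W n) \<in> bdd_seqs l" and F: "fs (\<lambda>n. mat_adjoint (W n) * b n * W n) = (\<lambda>n. w n * fs b n * adj (w n))"
    proof -
      show F: "fs (\<lambda>n. mat_adjoint (W n) * b n * W n) = (\<lambda>n. w n * fs b n * adj (w n))"
        by (intro ext) (simp add: fs_def to_fm_mult[OF mult_carrier_mat[OF Wa(1) bdd_seqsD(1)[OF b]] Wf(2)] to_fm_mult[OF Wa(1) bdd_seqsD(1)[OF b]] Wf(1) Wa(2))
      show "(\<lambda>n. mat_adjoint (W n) * b n * W n) \<in> bdd_seqs l"
        unfolding bdd_seqs_iff F
        by (intro conjI allI mult_carrier_mat[OF mult_carrier_mat[OF Wa(1) bdd_seqsD(1)[OF b]] Wf(2)]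
          bseq_mult bdd_seqsD(2)[OF b] bseq_umat[OF w(1)] bseq_umat[OF umat_adj[OF w(1)]])
    qed
    have "aeq l (fs (\<lambda>n. h n (a n))) (\<lambda>n. w n * fs a n * adj (w n))"
      using w(2)[OF bdd_seqsD(2)[OF a]] of_to_fm[OF bdd_seqsD(1)[OF a]] by (simp add: fs_def aeq_def)
    moreover have "aeq l (\<lambda>n. w n * fs a n * adj (w n)) (\<lambda>n. w n * fs b n * adj (w n))"
    proof (rule aeq_sum[OF ab aeq_refl, where C = 1 and C' = 0])
      fix n
      have "norm (w n * fs a n * adj (w n) - w n * fs b n * adj (w n)) = norm (w n * ((fs a n - fs b n) * adj (w n)))"
        by (simp add: algebra_simps)
      also have "\<dots> \<le> 1 * (1 * norm (fs a n - fs b n))"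
        by (rule order_trans[OF opb_left[OF umat_opb[OF w(1)]] mult_left_mono[OF opb_right[OF umat_opb[OF umat_adj[OF w(1)]]]]]) simp
      finally show "norm (w n * fs a n * adj (w n) - w n * fs b n * adj (w n)) \<le> 1 * norm (fs a n - fs b n) + 0 * norm (0 - (0::fmat))" by simp
    qed
    ultimately show ?thesis
      using aeq_trans h[OF a] hs_class_eq_iff[OF _ C] unfolding F by simp
  qed
  ultimately show ?thesis using ratio by blast
qed


end
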